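(* In terms of the parameters $(r,m)$ on the (rational) Hilbert modular surface $Y_{-}(4)$, a tautological family of genus $2$ curves with $(2,2)$-reducible Jacobian is given by $$y^2 = x^6-(2m+3)x^4-(36r-4m-3)x^2+4(2m+9)r-2m-1 .$$
   Context: $Y_{-}(4)$ denotes the Hilbert modular surface of discriminant $4$, i.e. the coarse moduli space (over $\mathbb Q$) of principally polarized abelian surfaces $A$ with real multiplication $\iota:\mathcal O_4\to\mathrm{End}(A)$, where $\mathcal O_4=\{(x,y)\in\mathbb Z^2: x\equiv y\bmod 2\}$. It is birational to the moduli space $\widetilde{\mathcal L}_2$ of pairs $(C,E)$ of a genus $2$ curve $C$ and an elliptic curve $E$ related by an optimal map $C\to E$ of degree $2$ (optimal: not factoring through an unramified cover of $E$), and it is a double cover of the Humbert surface $\mathcal H_4\subset\mathcal A_2$ (by forgetting $\iota$). The Jacobian $J(C)$ is $(2,2)$-reducible (or $(2,2)$-split) if it is isogenous to a product of two elliptic curves with kernel isomorphic to $\mathbb Z/2\mathbb Z\oplus\mathbb Z/2\mathbb Z$, arising from a degree $2$ map from $C$ to an elliptic curve. Coordinates: $Y_{-}(4)$ is birational to the surface $$z^2 = -r(27s^2+36rs-s-16r^3+8r^2-r),$$ with $(r,s,z)\mapsto(r,s)$ the double cover of $\mathcal H_4$; the point with coordinates $(r,s)$ on $\mathcal H_4$ corresponds to the genus $2$ curve with Igusa--Clebsch invariants $(I_2:I_4:I_6:I_{10})$ (in the weighted projective space with weights $2,4,6,10$) equal to $I_2=8(3s+r)/r$, $I_4=-4(3r-1)$,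 $I_6=-4(6rs-8s+5r^2-2r)/r$, $I_{10}=4rs$. The rational parameters $(r,m)$ on $Y_{-}(4)$ are defined by $z=ms+r(4r-1)$, so that $$s=-\frac{r(8mr+36r-2m-1)}{27r+m^2},\qquad z=\frac{r(108r^2-4m^2r-36mr-27r+m^2+m)}{27r+m^2}.$$ "Tautological family" means a family of genus $2$ curves over (a dense open subset of) the moduli space such that the curve over a point has Jacobian (equivalently, Igusa--Clebsch invariants) represented by that point. Igusa--Clebsch invariants: for $y^2=f(x)=f_6\prod_{i=1}^6(x-\alpha_i)$, writing $(ij)=\alpha_i-\alpha_j$, $I_2=f_6^2\sum_{15}(12)^2(34)^2(56)^2$, $I_4=f_6^4\sum_{10}(12)^2(23)^2(31)^2(45)^2(56)^2(64)^2$, $I_6=f_6^6\sum_{60}(12)^2(23)^2(31)^2(45)^2(56)^2(64)^2(14)^2(25)^2(36)^2$, $I_{10}=f_6^{10}\prod_{i<j}(ij)^2$, each sum running over the distinct expressions (their number is the subscript) obtained by permuting indices. *)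

theory Defs
  imports
    "HOL-Algebra.Algebraic_Closure_Type"
    "HOL-Algebra.Generated_Fields"
    "HOL-Algebra.Embedded_Algebras"
    "HOL-Algebra.Elementary_Groups"
    "HOL-Algebra.Free_Abelian_Groups"
    "HOL-Computational_Algebra.Computational_Algebra"
    "HOL-Combinatorics.Permutations"
begin

section \<open>Igusa--Clebsch invariants\<close>

text \<open>
  An expression such as \<open>(12)\<^sup>2 (34)\<^sup>2 (56)\<^sup>2\<close> is encoded as the graph on \<open>{1..6}\<close> with one edge
  \<open>{i, j}\<close> for each factor \<open>(ij)\<^sup>2\<close>. The distinct expressions obtained by permuting indices are
  then the distinct graphs in its orbit under the symmetric group.
\<close>

definition expression_value :: "(nat \<Rightarrow> 'a::comm_ring_1) \<Rightarrow> nat set set \<Rightarrow> 'a" where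
  "expression_value \<alpha> H = (\<Prod>e\<in>H. (\<alpha> (Min e) - \<alpha> (Max e))\<^sup>2)"

definition permuted_expressions :: "nat set set \<Rightarrow> nat set set set" where
  "permuted_expressions G = (\<lambda>\<sigma>. (\<lambda>e. \<sigma> ` e) ` G) ` {\<sigma>. \<sigma> permutes {1..6}}"

definition orbit_sum :: "(nat \<Rightarrow> 'a::comm_ring_1) \<Rightarrow> nat set set \<Rightarrow> 'a" where
  "orbit_sum \<alpha> G = (\<Sum>H\<in>permuted_expressions G. expression_value \<alpha> H)"

text \<open>The invariants of \<open>y\<^sup>2 = c (x - \<alpha>\<^sub>1) \<cdots> (x - \<alpha>\<^sub>6)\<close>.\<close>

definition igusa_clebsch :: "'a::comm_ring_1 \<Rightarrow> (nat \<Rightarrow> 'a) \<Rightarrow> 'a \<times> 'a \<times> 'a \<times> 'a" where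
  "igusa_clebsch c \<alpha> =
     (c ^ 2 * orbit_sum \<alpha> {{1,2}, {3,4}, {5,6}},
      c ^ 4 * orbit_sum \<alpha> {{1,2}, {2,3}, {3,1}, {4,5}, {5,6}, {6,4}},
      c ^ 6 * orbit_sum \<alpha> {{1,2}, {2,3}, {3,1}, {4,5}, {5,6}, {6,4}, {1,4}, {2,5}, {3,6}},
      c ^ 10 * (\<Prod>i\<in>{1..6}. \<Prod>j\<in>{i<..6}. (\<alpha> i - \<alpha> j)\<^sup>2))"

text \<open>Equality of points of the weighted projective space with weights 2, 4, 6, 10.\<close>

fun weighted_proj_eq :: "'a::field \<times> 'a \<times> 'a \<times> 'a \<Rightarrow> 'a \<times> 'a \<times> 'a \<times> 'a \<Rightarrow> bool" where
  "weighted_proj_eq (a2, a4, a6, a10) (b2, b4, b6, b10) \<longleftrightarrow>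
     (a2, a4, a6, a10) \<noteq> (0, 0, 0, 0) \<and> (b2, b4, b6, b10) \<noteq> (0, 0, 0, 0) \<and>
     (\<exists>l. l \<noteq> 0 \<and> a2 = l ^ 2 * b2 \<and> a4 = l ^ 4 * b4 \<and> a6 = l ^ 6 * b6 \<and> a10 = l ^ 10 * b10)"

text \<open>
  Meant for algebraically closed fields of characteristic not 2, over which \<open>rsquarefree\<close> is
  separability. The choice of numbering \<open>\<alpha>\<close> of the roots is immaterial, the invariants being symmetric.
\<close>

definition genus2_sextic :: "'k::field poly \<Rightarrow> bool" where
  "genus2_sextic f \<longleftrightarrow> Polynomial.degree f = 6 \<and> rsquarefree f"

definition has_igusa_clebsch :: "'k::field poly \<Rightarrow> 'k \<times> 'k \<times> 'k \<times> 'k \<Rightarrow> bool" where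
  "has_igusa_clebsch f J \<longleftrightarrow>
     (\<exists>\<alpha>. f = Polynomial.smult (lead_coeff f) (\<Prod>i\<in>{1..6}. [:- \<alpha> i, 1:]) \<and>
          weighted_proj_eq (igusa_clebsch (lead_coeff f) \<alpha>) J)"


section \<open>The Hilbert modular surface of discriminant 4\<close>

definition humbert4_point :: "'k::field \<Rightarrow> 'k \<Rightarrow> 'k \<times> 'k \<times> 'k \<times> 'k" where
  "humbert4_point r s =
     (8 * (3 * s + r) / r,
      - 4 * (3 * r - 1),
      - 4 * (6 * r * s - 8 * s + 5 * r ^ 2 - 2 * r) / r,
      4 * r * s)"

definition hilbert4_surface :: "('k::field \<times> 'k \<times> 'k) set" where
  "hilbert4_surface =
     {(r, s, z). z ^ 2 = - r * (27 * s ^ 2 + 36 * r * s - s - 16 * r ^ 3 + 8 * r ^ 2 - r)}"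

definition hilbert4_s :: "'k::field \<Rightarrow> 'k \<Rightarrow> 'k" where
  "hilbert4_s r m = - (r * (8 * m * r + 36 * r - 2 * m - 1)) / (27 * r + m ^ 2)"

definition hilbert4_z :: "'k::field \<Rightarrow> 'k \<Rightarrow> 'k" where
  "hilbert4_z r m =
     r * (108 * r ^ 2 - 4 * m ^ 2 * r - 36 * m * r - 27 * r + m ^ 2 + m) / (27 * r + m ^ 2)"

text \<open>
  Away from \<open>27 r + m\<^sup>2 = 0\<close> and \<open>s = 0\<close>, the substitution \<open>z = m s + r (4 r - 1)\<close> identifies
  the points of the surface with the pairs \<open>(r, m)\<close>.
\<close>

lemma hilbert4_parametrization:
  fixes r s z m :: "'k::field"
  assumes "27 * r + m ^ 2 \<noteq> 0" "s \<noteq> 0"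
  shows "((r, s, z) \<in> hilbert4_surface \<and> z = m * s + r * (4 * r - 1)) \<longleftrightarrow>
         (s = hilbert4_s r m \<and> z = hilbert4_z r m)"
proof -
  let ?d = "27 * r + m ^ 2"
  have id: "(m * s + r * (4 * r - 1)) ^ 2
      + r * (27 * s ^ 2 + 36 * r * s - s - 16 * r ^ 3 + 8 * r ^ 2 - r)
      = s * (s * ?d + r * (8 * m * r + 36 * r - 2 * m - 1))"
    by (simp add: algebra_simps power2_eq_square power3_eq_cube)
  have surf: "(r, s, m * s + r * (4 * r - 1)) \<in> hilbert4_surface \<longleftrightarrow> s = hilbert4_s r m"
  proof -
    have "(r, s, m * s + r * (4 * r - 1)) \<in> hilbert4_surface \<longleftrightarrow>
          s * (s * ?d + r * (8 * m * r + 36 * r - 2 * m - 1)) = 0"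
      unfolding id[symmetric] hilbert4_surface_def by (simp add: eq_neg_iff_add_eq_0)
    also have "\<dots> \<longleftrightarrow> s * ?d = - (r * (8 * m * r + 36 * r - 2 * m - 1))"
      using assms(2) by (simp add: eq_neg_iff_add_eq_0)
    also have "\<dots> \<longleftrightarrow> s = hilbert4_s r m"
      unfolding hilbert4_s_def using assms(1) by (metis eq_divide_eq)
    finally show ?thesis .
  qed
  have z: "m * hilbert4_s r m + r * (4 * r - 1) = hilbert4_z r m"
  proof -
    have "m * hilbert4_s r m + r * (4 * r - 1)
        = (m * - (r * (8 * m * r + 36 * r - 2 * m - 1)) + r * (4 * r - 1) * ?d) / ?d"
      unfolding hilbert4_s_def using assms(1) by (simp add: add_divide_distrib diff_divide_distrib)
    also have "m * - (r * (8 * m * r + 36 * r - 2 * m - 1)) + r * (4 * r - 1) * ?d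
        = r * (108 * r ^ 2 - 4 * m ^ 2 * r - 36 * m * r - 27 * r + m ^ 2 + m)"
      by (simp add: algebra_simps power2_eq_square)
    finally show ?thesis unfolding hilbert4_z_def .
  qed
  show ?thesis using surf z by auto
qed

text \<open>Zariski topology on the \<open>(r, m)\<close>-plane; a \<open>'k poly poly\<close> is a polynomial in \<open>r\<close> and \<open>m\<close>.\<close>

definition zariski_open :: "('k::field \<times> 'k) set \<Rightarrow> bool" where
  "zariski_open U \<longleftrightarrow>
     (\<exists>S :: 'k poly poly set. U = {(r, m). \<exists>P\<in>S. poly (poly P [:m:]) r \<noteq> 0})"

definition zariski_dense :: "('k::field \<times> 'k) set \<Rightarrow> bool" where
  "zariski_dense U \<longleftrightarrow> (\<forall>V. zariski_open V \<and> V \<noteq> {} \<longrightarrow> U \<inter> V \<noteq> {})"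

text \<open>
  \<open>F r m\<close> is the sextic of the curve over the point \<open>(r, m)\<close>, and \<open>U\<close> the open subset, in the
  coordinates \<open>(r, m)\<close>, over which the family lives.
\<close>

definition tautological_family ::
  "('k::field \<times> 'k) set \<Rightarrow> ('k \<Rightarrow> 'k \<Rightarrow> 'k poly) \<Rightarrow> bool" where
  "tautological_family U F \<longleftrightarrow> zariski_open U \<and> zariski_dense U \<and>
     (\<forall>(r, m)\<in>U. genus2_sextic (F r m) \<and>
        has_igusa_clebsch (F r m) (humbert4_point r (hilbert4_s r m)))"


section \<open>Curves, their Jacobians, and (2,2)-splittings\<close>

text \<open>
  Over an algebraically closed field \<open>k\<close>, smooth projective curves are treated through their
  function fields, all of which are realised inside an algebraic closure \<open>\<Omega>\<close> of \<open>k(x)\<close>: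
  points are places, i.e. proper valuation rings containing \<open>k\<close>, and a finite map of curves
  \<open>C \<rightarrow> E\<close> of degree \<open>n\<close> is the inclusion of a copy of \<open>k(E)\<close> as a subfield of index \<open>n\<close>
  in \<open>k(C)\<close>.
\<close>

type_synonym 'k ambient = "'k poly fract alg_closure"

abbreviation ambient_ring :: "'k::field ambient ring" (\<open>\<Omega>\<close>) where
  "\<Omega> \<equiv> ring_of_type_algebra"

definition const_emb :: "'k::field \<Rightarrow> 'k ambient" where
  "const_emb c = to_ac (to_fract [:c:])"

definition coordinate :: "'k::field ambient" where
  "coordinate = to_ac (to_fract [:0, 1:])"

definition eval_at :: "'k::field poly \<Rightarrow> 'k ambient \<Rightarrow> 'k ambient" where
  "eval_at f u = poly (map_poly const_emb f) u"

text \<open>The field \<open>k(x, y)\<close> with \<open>y\<^sup>2 = f(x)\<close>; both choices of \<open>y\<close> generate the same field.\<close>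

definition function_field :: "'k::field poly \<Rightarrow> 'k ambient set" where
  "function_field f =
     generate_field \<Omega> (range const_emb \<union> {coordinate} \<union> {y. y ^ 2 = eval_at f coordinate})"

text \<open>
  \<open>K\<close> is the function field of an elliptic curve \<open>v\<^sup>2 = g(u)\<close>. As \<open>k\<close> is algebraically closed,
  \<open>u \<notin> k\<close> says that \<open>u\<close> is transcendental.
\<close>

definition elliptic_function_field :: "'k::field ambient set \<Rightarrow> bool" where
  "elliptic_function_field K \<longleftrightarrow>
     (\<exists>g u v. Polynomial.degree g = 3 \<and> rsquarefree g \<and> u \<notin> range const_emb \<and>
        v ^ 2 = eval_at g u \<and> K = generate_field \<Omega> (range const_emb \<union> {u, v}))"

definition degree2_elliptic_quotient :: "'k::field ambient set \<Rightarrow> 'k ambient set \<Rightarrow> bool" where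
  "degree2_elliptic_quotient L K \<longleftrightarrow>
     elliptic_function_field K \<and> K \<subseteq> L \<and> ring.dimension \<Omega> 2 K L"

definition places :: "'k::field ambient set \<Rightarrow> 'k ambient set set" where
  "places L = {V. subring V \<Omega> \<and> range const_emb \<subseteq> V \<and> V \<subset> L \<and>
                  (\<forall>z\<in>L. z \<in> V \<or> inverse z \<in> V)}"

definition place_units :: "'k::field ambient set \<Rightarrow> 'k ambient set" where
  "place_units V = {z\<in>V. z \<noteq> 0 \<and> inverse z \<in> V}"

definition ord_at :: "'k::field ambient set \<Rightarrow> 'k ambient \<Rightarrow> int" where
  "ord_at V z = (THE n. \<exists>t w. V - place_units V = (\<lambda>a. t * a) ` V \<and> w \<in> place_units V \<and>
                              z = t powi n * w)"

definition divisor_degree :: "('a \<Rightarrow>\<^sub>0 int) \<Rightarrow> int" where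
  "divisor_degree D = (\<Sum>V\<in>Poly_Mapping.keys D. Poly_Mapping.lookup D V)"

definition degree0_divisors :: "'k::field ambient set \<Rightarrow> ('k ambient set \<Rightarrow>\<^sub>0 int) monoid" where
  "degree0_divisors L = (free_Abelian_group (places L))
     \<lparr>carrier := {D \<in> carrier (free_Abelian_group (places L)). divisor_degree D = 0}\<rparr>"

definition principal_divisors :: "'k::field ambient set \<Rightarrow> ('k ambient set \<Rightarrow>\<^sub>0 int) set" where
  "principal_divisors L =
     {D \<in> carrier (free_Abelian_group (places L)).
        \<exists>z\<in>L. z \<noteq> 0 \<and> (\<forall>V\<in>places L. Poly_Mapping.lookup D V = ord_at V z)}"

text \<open>
  The group of \<open>k\<close>-points of the Jacobian, as the divisor class group of degree 0. For the function
  field of an elliptic curve this is the elliptic curve itself.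
\<close>

definition jacobian :: "'k::field ambient set \<Rightarrow> ('k ambient set \<Rightarrow>\<^sub>0 int) set monoid" where
  "jacobian L = degree0_divisors L Mod principal_divisors L"

text \<open>
  Push-forward along the map of curves given by a subfield \<open>K\<close>: the image of the point \<open>V\<close> is
  the place \<open>V \<inter> K\<close> of \<open>K\<close>.
\<close>

definition divisor_push ::
  "'k::field ambient set \<Rightarrow> ('k ambient set \<Rightarrow>\<^sub>0 int) \<Rightarrow> ('k ambient set \<Rightarrow>\<^sub>0 int)" where
  "divisor_push K D = frag_extend (\<lambda>V. frag_of (V \<inter> K)) D"

text \<open>The union of the classes of the images of all members of the class \<open>\<xi>\<close>.\<close>

definition jacobian_push ::
  "'k::field ambient set \<Rightarrow> ('k ambient set \<Rightarrow>\<^sub>0 int) set \<Rightarrow> ('k ambient set \<Rightarrow>\<^sub>0 int) set" where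
  "jacobian_push K \<xi> =
     (\<Union>D\<in>\<xi>. principal_divisors K #>\<^bsub>degree0_divisors K\<^esub> divisor_push K D)"

text \<open>
  The Jacobian of the curve with function field \<open>L\<close> is (2,2)-reducible: there are degree 2 maps
  \<open>\<phi>\<^sub>1 : C \<rightarrow> E\<^sub>1\<close> and \<open>\<phi>\<^sub>2 : C \<rightarrow> E\<^sub>2\<close> such that the induced homomorphism
  \<open>(\<phi>\<^sub>1, \<phi>\<^sub>2)\<^sub>* : J(C) \<rightarrow> E\<^sub>1 \<times> E\<^sub>2\<close> is surjective with kernel \<open>Z/2 \<times> Z/2\<close>.
\<close>

definition jacobian_22_reducible :: "'k::field ambient set \<Rightarrow> bool" where
  "jacobian_22_reducible L \<longleftrightarrow>
     (\<exists>K1 K2. degree2_elliptic_quotient L K1 \<and> degree2_elliptic_quotient L K2 \<and>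
        (let h = (\<lambda>\<xi>. (jacobian_push K1 \<xi>, jacobian_push K2 \<xi>));
             A = jacobian L;
             B = jacobian K1 \<times>\<times> jacobian K2
         in h \<in> hom A B \<and> h ` carrier A = carrier B \<and>
            A\<lparr>carrier := kernel A B h\<rparr> \<cong> integer_mod_group 2 \<times>\<times> integer_mod_group 2))"

end

theory Submission
  imports Defs
begin

text \<open>
  The sextic is even, \<open>f = g(x\<^sup>2)\<close> with \<open>g = (t - a) (t - b) (t - c)\<close>. The involutions \<open>x \<mapsto> - x\<close>,
  \<open>y \<mapsto> \<plusminus> y\<close> have the quotients \<open>y\<^sup>2 = g(t)\<close> and \<open>w\<^sup>2 = t g(t)\<close> with \<open>w = x y\<close>, both elliptic curves.
  If both push-forwards of a divisor \<open>D\<close> of degree 0 vanish, then adding pull-backs gives \<open>2 D \<sim> 0\<close>, since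
  the product of the two involutions is the hyperelliptic one; this confines the kernel to classes of
  differences of Weierstrass points, and among these exactly the ones of \<open>\<beta> - (- \<beta>)\<close>,
  \<open>\<gamma> - (- \<gamma>)\<close>, \<open>\<delta> - (- \<delta>)\<close> and 0 survive, where \<open>\<beta>\<^sup>2 = a\<close>, \<open>\<gamma>\<^sup>2 = b\<close>, \<open>\<delta>\<^sup>2 = c\<close>. Surjectivity follows from the
  divisibility of the elliptic curves by 2.

  The Igusa--Clebsch invariants are symmetric in \<open>a, b, c\<close>: the orbits of graphs are enumerated, and the elementary
  symmetric functions of \<open>a, b, c\<close> are then the coefficients of \<open>g\<close>. The weighted projective scaling factor is
  \<open>l\<close> with \<open>l\<^sup>2 = 16 (27 r + m\<^sup>2)\<close>, and the discriminant of \<open>g\<close> is \<open>256 r (27 r + m\<^sup>2)\<^sup>2\<close>.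
\<close>

text \<open>The obstacle is that points are valuation rings, so even the existence of orders, the
  finiteness of zeros and poles and the degree 0 of principal divisors have to be earned for
  \<open>k(C)\<close>. They are proved for \<open>k(u)\<close>, where everything is explicit, and
  carried up any quadratic extension \<open>K(s)\<close> (locale \<open>quad_ext\<close>). This
  serves \<open>k(u)\<close> below an elliptic curve, a rational field below \<open>C\<close>, and
  an elliptic curve below \<open>C\<close>. So \<open>k(C)\<close> is a quadratic extension in three
  ways, and its three conjugations are the two involutions and the hyperelliptic one.

  Riemann-Roch is replaced by two elementary facts on a model \<open>v^2 = g(u)\<close> of odd
  degree: a function whose only pole is at infinity, of order less than \<open>degree g\<close>,
  lies in \<open>k(u)\<close>; and for degree 5 the functions \<open>1, u, u^2, v\<close> leave room
  for three vanishing conditions. The first keeps distinct points inequivalent, the second brings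
  every class of degree 0 to the form \<open>P + Q - 2 infty\<close>. Odd degree is reached by
  moving a root to infinity: \<open>\<beta>\<close> for the sextic, \<open>t = 0\<close> for the
  second quotient curve.\<close>

lemma omega_simps [simp]:
  "carrier \<Omega> = UNIV" "monoid.mult \<Omega> = (*)" "one \<Omega> = 1" "ring.zero \<Omega> = 0" "ring.add \<Omega> = (+)"
  by (auto simp: ring_of_type_algebra_def)

lemma omega_field: "field (\<Omega> :: 'k::field ambient ring)"
  by (rule field_from_type_algebra)

lemma omega_ring: "ring (\<Omega> :: 'k::field ambient ring)"
  by (rule ring_from_type_algebra)

lemma omega_a_inv [simp]: "a_inv \<Omega> x = - (x :: 'k::field ambient)"
proof -
  interpret field "\<Omega> :: 'k ambient ring" by (rule omega_field)
  show ?thesis by (rule minus_equality) auto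
qed

lemma omega_m_inv [simp]: "x \<noteq> 0 \<Longrightarrow> m_inv \<Omega> x = inverse (x :: 'k::field ambient)"
proof -
  assume "x \<noteq> 0"
  interpret field "\<Omega> :: 'k ambient ring" by (rule omega_field)
  show ?thesis by (rule comm_inv_char) (use \<open>x \<noteq> 0\<close> in auto)
qed

section \<open>The embedding of the constants into the ambient field\<close>

lemma const_emb_add: "const_emb (a + b) = const_emb a + const_emb b"
  by (simp add: const_emb_def flip: to_fract_add to_ac_add)

lemma const_emb_mult: "const_emb (a * b) = const_emb a * const_emb b"
  by (simp add: const_emb_def flip: to_fract_mult to_ac_mult)

lemma const_emb_0 [simp]: "const_emb 0 = 0"
  by (simp add: const_emb_def)

lemma const_emb_1 [simp]: "const_emb 1 = 1"
  by (simp add: const_emb_def flip: one_pCons)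

lemma const_emb_minus: "const_emb (- a) = - const_emb a"
  using const_emb_add[of a "- a"] by (simp add: eq_neg_iff_add_eq_0 add.commute)

lemma const_emb_diff: "const_emb (a - b) = const_emb a - const_emb b"
  using const_emb_add[of a "- b"] by (simp add: const_emb_minus)

lemma const_emb_eq_0_iff [simp]: "const_emb a = 0 \<longleftrightarrow> a = 0"
proof
  assume "const_emb a = 0"
  then have "const_emb (a * inverse a) = 0" by (simp add: const_emb_mult)
  then show "a = 0" by (cases "a = 0") auto
qed simp

lemma const_emb_eq_iff [simp]: "const_emb a = const_emb b \<longleftrightarrow> a = b"
  using const_emb_eq_0_iff[of "a - b"] by (simp add: const_emb_diff del: const_emb_eq_0_iff)

lemma const_emb_inverse: "const_emb (inverse a) = inverse (const_emb a)"
proof (cases "a = 0")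
  case False
  then have "const_emb a * const_emb (inverse a) = 1" by (simp flip: const_emb_mult)
  then show ?thesis using inverse_unique by metis
qed simp

lemma const_emb_divide: "const_emb (a / b) = const_emb a / const_emb b"
  by (simp add: divide_inverse const_emb_mult const_emb_inverse)

lemma const_emb_power: "const_emb (a ^ n) = const_emb a ^ n"
  by (induction n) (auto simp: const_emb_mult)

lemma const_emb_of_nat: "const_emb (of_nat n) = of_nat n"
  by (induction n) (auto simp: const_emb_add)

lemma const_emb_numeral: "const_emb (numeral n) = numeral n"
  using const_emb_of_nat[of "numeral n"] by simp

lemmas const_emb_hom = const_emb_add const_emb_mult const_emb_minus const_emb_diff
  const_emb_inverse const_emb_divide const_emb_power const_emb_numeral

lemma ambient_2_neq_0: "(2 :: 'k::field_char_0 ambient) \<noteq> 0"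
  using const_emb_eq_0_iff[of "2 :: 'k"] by (simp add: const_emb_numeral del: const_emb_eq_0_iff)

section \<open>Subfields and places\<close>

text \<open>Restates in type-class arithmetic what \<open>generate_field\<close> and
  \<open>subring\<close> express through the ring record \<open>\<Omega>\<close>. Because
  \<open>inverse 0 = 0\<close>, closure under \<open>inverse\<close> needs no case
  distinction.\<close>

locale const_subfield =
  fixes K :: "'k::field ambient set"
  assumes const: "const_emb c \<in> K"
    and add: "a \<in> K \<Longrightarrow> b \<in> K \<Longrightarrow> a + b \<in> K"
    and mult: "a \<in> K \<Longrightarrow> b \<in> K \<Longrightarrow> a * b \<in> K"
    and minus: "a \<in> K \<Longrightarrow> - a \<in> K"
    and inv: "a \<in> K \<Longrightarrow> inverse a \<in> K"
begin

lemma zero: "0 \<in> K" using const[of 0] by simp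

lemma one: "1 \<in> K" using const[of 1] by simp

lemma diff: "a \<in> K \<Longrightarrow> b \<in> K \<Longrightarrow> a - b \<in> K" using add[of a "- b"] minus by simp

lemma div: "a \<in> K \<Longrightarrow> b \<in> K \<Longrightarrow> a / b \<in> K" by (simp add: divide_inverse mult inv)

lemma pow: "a \<in> K \<Longrightarrow> a ^ n \<in> K" by (induction n) (auto simp: one mult)

lemma powi: "a \<in> K \<Longrightarrow> a powi n \<in> K" by (auto simp: power_int_def pow inv)

lemma numeral: "numeral n \<in> K" using const[of "numeral n"] by (simp add: const_emb_numeral)

lemmas closed = const add mult minus inv zero one diff div pow powi numeral

end

lemma const_subfield_generate:
  "const_subfield (generate_field \<Omega> (range const_emb \<union> S :: 'k::field ambient set))"
proof -
  let ?G = "generate_field \<Omega> (range const_emb \<union> S :: 'k ambient set)"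
  have m: "- h \<in> ?G" if "h \<in> ?G" for h using generate_field.a_inv[OF that] by simp
  have i: "inverse h \<in> ?G" if "h \<in> ?G" for h
    using generate_field.m_inv[OF that] that by (cases "h = 0") auto
  show ?thesis
    using generate_field.eng_add[where R = \<Omega> and H = "range const_emb \<union> S"]
      generate_field.eng_mult[where R = \<Omega> and H = "range const_emb \<union> S"] m i
    by unfold_locales (auto intro: generate_field.incl)
qed

text \<open>Serves the inclusions between function fields: it is enough to exhibit the generators in
  the larger field.\<close>

lemma generate_field_least:
  assumes "const_subfield K" "S \<subseteq> K" "z \<in> generate_field \<Omega> (range const_emb \<union> S)"
  shows "z \<in> K"
  using assms(3)
proof induction
  case (m_inv h)
  interpret const_subfield K by fact
  from m_inv show ?case by (auto simp: closed)
next
  interpret const_subfield K by fact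
  case (incl h)
  then show ?case using \<open>S \<subseteq> K\<close> const by auto
qed (use assms(1) in \<open>auto intro: const_subfield.closed\<close>)

lemma subring_omega_iff:
  "subring V \<Omega> \<longleftrightarrow> (1::'k::field ambient) \<in> V \<and> (\<forall>a\<in>V. - a \<in> V) \<and>
     (\<forall>a\<in>V. \<forall>b\<in>V. a + b \<in> V \<and> a * b \<in> V)"
proof -
  interpret ring "\<Omega> :: 'k ambient ring" by (rule omega_ring)
  show ?thesis
    using subringI[of V] subringE[of V \<Omega>] by auto
qed

lemma places_iff:
  "V \<in> places L \<longleftrightarrow> range const_emb \<subseteq> V \<and> (\<forall>a\<in>V. - a \<in> V) \<and>
     (\<forall>a\<in>V. \<forall>b\<in>V. a + b \<in> V \<and> a * b \<in> V) \<and> V \<subset> L \<and> (\<forall>z\<in>L. z \<in> V \<or> inverse z \<in> V)"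
  unfolding places_def subring_omega_iff by (auto simp: image_subset_iff) (metis const_emb_1)

definition max_ideal :: "'k::field ambient set \<Rightarrow> 'k ambient set" where
  "max_ideal V = V - place_units V"

lemma place_units_iff: "z \<in> place_units V \<longleftrightarrow> z \<in> V \<and> z \<noteq> 0 \<and> inverse z \<in> V"
  by (auto simp: place_units_def)

lemma max_ideal_iff: "z \<in> max_ideal V \<longleftrightarrow> z \<in> V \<and> (z = 0 \<or> inverse z \<notin> V)"
  by (auto simp: max_ideal_def place_units_def)

locale place = const_subfield K for K :: "'k::field ambient set" +
  fixes V
  assumes place: "V \<in> places K"
begin

lemma V_const: "const_emb c \<in> V" using place by (auto simp: places_iff)

lemma V_add: "a \<in> V \<Longrightarrow> b \<in> V \<Longrightarrow> a + b \<in> V" using place by (auto simp: places_iff)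

lemma V_mult: "a \<in> V \<Longrightarrow> b \<in> V \<Longrightarrow> a * b \<in> V" using place by (auto simp: places_iff)

lemma V_minus: "a \<in> V \<Longrightarrow> - a \<in> V" using place by (auto simp: places_iff)

lemma V_diff: "a \<in> V \<Longrightarrow> b \<in> V \<Longrightarrow> a - b \<in> V" using V_add[of a "-b"] V_minus by simp

lemma V_0: "0 \<in> V" using V_const[of 0] by simp

lemma V_1: "1 \<in> V" using V_const[of 1] by simp

lemma V_pow: "a \<in> V \<Longrightarrow> a ^ n \<in> V" by (induction n) (auto simp: V_1 V_mult)

lemma V_sub: "a \<in> V \<Longrightarrow> a \<in> K" using place by (auto simp: places_iff)

lemma V_inverse: "a \<in> K \<Longrightarrow> a \<notin> V \<Longrightarrow> inverse a \<in> V" using place by (auto simp: places_iff)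

lemma V_neq: "V \<noteq> K" using place by (auto simp: places_iff)

lemmas V_closed = V_const V_add V_mult V_minus V_diff V_0 V_1 V_pow

lemma ideal_sub: "a \<in> max_ideal V \<Longrightarrow> a \<in> V" by (auto simp: max_ideal_iff)

lemma ideal_0: "0 \<in> max_ideal V" by (simp add: max_ideal_iff V_0)

lemma ideal_mult: "a \<in> max_ideal V \<Longrightarrow> b \<in> V \<Longrightarrow> a * b \<in> max_ideal V"
proof -
  assume a: "a \<in> max_ideal V" and b: "b \<in> V"
  show ?thesis
  proof (cases "a * b = 0")
    case False
    have "inverse (a * b) \<notin> V"
    proof
      assume "inverse (a * b) \<in> V"
      then have "b * inverse (a * b) \<in> V" using b V_mult by blast
      also have "b * inverse (a * b) = inverse a" using False by (simp add: field_simps)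
      finally show False using a False by (auto simp: max_ideal_iff)
    qed
    then show ?thesis using a b by (auto simp: max_ideal_iff V_mult)
  qed (use ideal_0 in auto)
qed

lemma ideal_mult2: "a \<in> V \<Longrightarrow> b \<in> max_ideal V \<Longrightarrow> a * b \<in> max_ideal V"
  using ideal_mult[of b a] by (simp add: mult.commute)

text \<open>In a valuation ring one of \<open>a / b\<close> and \<open>b / a\<close> is integral;
  taking the denominator out of the sum leaves a non-unit times an element of \<open>V\<close>. This
  makes the non-units an ideal.\<close>

lemma ideal_add: "a \<in> max_ideal V \<Longrightarrow> b \<in> max_ideal V \<Longrightarrow> a + b \<in> max_ideal V"
proof -
  have *: "a + b \<in> max_ideal V" if "a \<in> max_ideal V" "b \<in> max_ideal V" "b \<noteq> 0" "a / b \<in> V" for a b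
  proof -
    have "b * (a / b + 1) \<in> max_ideal V" using that by (intro ideal_mult V_closed)
    also have "b * (a / b + 1) = a + b" using that by (simp add: field_simps)
    finally show ?thesis .
  qed
  assume a: "a \<in> max_ideal V" and b: "b \<in> max_ideal V"
  have K: "a / b \<in> K" using a b by (intro closed V_sub ideal_sub)
  show ?thesis
  proof (cases "a = 0 \<or> b = 0")
    case False
    show ?thesis
    proof (cases "a / b \<in> V")
      case True
      then show ?thesis using * a b False by blast
    next
      case nin: False
      then have "b / a \<in> V" using V_inverse[OF K nin] by simp
      then show ?thesis using *[of b a] a b False by (simp add: add.commute)
    qed
  qed (use a b in auto)
qed

lemma ideal_minus: "a \<in> max_ideal V \<Longrightarrow> - a \<in> max_ideal V"
  using ideal_mult[of a "-1"] V_minus V_1 by simp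

lemma ideal_diff: "a \<in> max_ideal V \<Longrightarrow> b \<in> max_ideal V \<Longrightarrow> a - b \<in> max_ideal V"
  using ideal_add[of a "-b"] ideal_minus by simp

lemmas ideal_closed = ideal_0 ideal_mult ideal_mult2 ideal_add ideal_minus ideal_diff

lemma const_not_ideal: "const_emb c \<in> max_ideal V \<longleftrightarrow> c = 0"
  using V_const[of "inverse c"] by (auto simp: max_ideal_iff V_0 V_const const_emb_inverse)

lemma unit_mult: "a \<in> place_units V \<Longrightarrow> b \<in> place_units V \<Longrightarrow> a * b \<in> place_units V"
  by (auto simp: place_units_iff V_mult)

lemma unit_inverse: "a \<in> place_units V \<Longrightarrow> inverse a \<in> place_units V"
  by (auto simp: place_units_iff)

lemma unit_divide: "a \<in> place_units V \<Longrightarrow> b \<in> place_units V \<Longrightarrow> a / b \<in> place_units V"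
  by (simp add: divide_inverse unit_mult unit_inverse)

lemma unit_const: "c \<noteq> 0 \<Longrightarrow> const_emb c \<in> place_units V"
  using V_const[of "inverse c"] by (auto simp: place_units_iff V_const const_emb_inverse)

lemma unit_1: "1 \<in> place_units V" using unit_const[of 1] by simp

lemma unit_pow: "a \<in> place_units V \<Longrightarrow> a ^ n \<in> place_units V"
  by (induction n) (auto simp: unit_1 unit_mult)

lemma unit_powi: "a \<in> place_units V \<Longrightarrow> a powi n \<in> place_units V"
  by (auto simp: power_int_def unit_pow unit_inverse)

lemma unit_sub: "a \<in> place_units V \<Longrightarrow> a \<in> V" by (simp add: place_units_iff)

lemma unit_not_ideal: "a \<in> place_units V \<longleftrightarrow> a \<in> V \<and> a \<notin> max_ideal V"
  by (auto simp: max_ideal_def place_units_iff)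

lemma unit_add_ideal: "a \<in> place_units V \<Longrightarrow> b \<in> max_ideal V \<Longrightarrow> a + b \<in> place_units V"
  using ideal_diff[of "a + b" b] by (auto simp: unit_not_ideal V_add ideal_sub)

lemma ideal_prime: "a \<in> V \<Longrightarrow> b \<in> V \<Longrightarrow> a * b \<in> max_ideal V \<Longrightarrow> a \<in> max_ideal V \<or> b \<in> max_ideal V"
  using unit_mult[of a b] unit_not_ideal by blast

lemma not_V_inverse_ideal: "a \<in> K \<Longrightarrow> a \<notin> V \<Longrightarrow> inverse a \<in> max_ideal V"
  using V_inverse[of a] by (auto simp: max_ideal_iff)

text \<open>Valuation rings are integrally closed; degree 2 suffices for quadratic extensions. If
  \<open>z\<close> were outside, its inverse would be inside, and the equation divided by
  \<open>z\<close> would express \<open>z\<close> through \<open>p\<close>, \<open>q\<close> and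
  that inverse.\<close>

lemma V_integral:
  assumes "z \<in> K" "z ^ 2 - p * z + q = 0" "p \<in> V" "q \<in> V"
  shows "z \<in> V"
proof (rule ccontr)
  assume nin: "z \<notin> V"
  then have z: "z \<noteq> 0" using V_0 by auto
  have i: "inverse z \<in> V" using V_inverse assms(1) nin by blast
  have "z = (p * z - q) * inverse z" using assms(2) z by (simp add: field_simps power2_eq_square)
  also have "\<dots> = p - q * inverse z" using z by (simp add: field_simps)
  also have "\<dots> \<in> V" using assms i by (intro V_closed)
  finally show False using nin by simp
qed

end

section \<open>Discrete valuations and their orders\<close>

text \<open>The first conjunct is a uniformizer for the whole field; the second says that the
  residue field is \<open>k\<close>. The latter is why each place counts with weight one in
  \<open>divisor_degree\<close> and why residues can be treated as constants.\<close>

definition discrete_at :: "'k::field ambient set \<Rightarrow> 'k ambient set \<Rightarrow> bool" where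
  "discrete_at K V \<longleftrightarrow>
     (\<exists>t\<in>max_ideal V. t \<noteq> 0 \<and> (\<forall>z\<in>K. z \<noteq> 0 \<longrightarrow> (\<exists>n::int. \<exists>w\<in>place_units V. z = t powi n * w))) \<and>
     (\<forall>z\<in>V. \<exists>c. z - const_emb c \<in> max_ideal V)"

context place
begin

lemma powi_unit_imp_0:
  assumes t: "t \<in> max_ideal V" "t \<noteq> 0" and u: "t powi n \<in> place_units V"
  shows "n = 0"
proof -
  have *: "m \<le> 0" if "t powi m \<in> place_units V" for m
  proof (rule ccontr)
    assume "\<not> m \<le> 0"
    then obtain j where j: "m = int (Suc j)" by (metis not_le zero_less_imp_eq_int gr0_conv_Suc)
    then have "t powi m = t * t ^ j" by (simp only: power_int_of_nat power_Suc)
    then have "t powi m \<in> max_ideal V" using t by (simp add: ideal_mult V_pow ideal_sub)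
    then show False using that unit_not_ideal by blast
  qed
  have "t powi (- n) \<in> place_units V" using unit_inverse[OF u] by (simp add: power_int_minus)
  then show ?thesis using *[OF u] *[of "- n"] by simp
qed

lemma powi_mem_iff:
  assumes t: "t \<in> max_ideal V" "t \<noteq> 0" and w: "w \<in> place_units V"
  shows "t powi n * w \<in> V \<longleftrightarrow> n \<ge> 0"
proof
  assume n: "t powi n * w \<in> V"
  show "n \<ge> 0"
  proof (rule ccontr)
    assume "\<not> n \<ge> 0"
    then obtain j where j: "- n = int (Suc j)" by (metis neg_0_less_iff_less not_le zero_less_imp_eq_int gr0_conv_Suc)
    have "t powi (- n) = t * t ^ j" unfolding j by (simp only: power_int_of_nat power_Suc)
    then have "(t powi n * w) * t powi (- n) \<in> max_ideal V"
      using t n by (simp add: ideal_mult ideal_mult2 V_pow ideal_sub)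
    moreover have "(t powi n * w) * t powi (- n) = w" using t by (simp add: power_int_minus)
    ultimately show False using w unit_not_ideal by metis
  qed
next
  assume "n \<ge> 0"
  then have "t powi n \<in> V" using t by (simp add: power_int_def V_pow ideal_sub)
  then show "t powi n * w \<in> V" using w unit_sub V_mult by blast
qed

text \<open>\<open>ord_at\<close> is a definite description over all generators of the maximal
  ideal. Any two generators divide each other, hence differ by a unit, and a power of a uniformizer
  is a unit only for exponent 0; so all of them give the same exponent.\<close>

lemma ord_at_eqI:
  assumes t: "t \<in> max_ideal V" "t \<noteq> 0"
    and ex: "\<And>z. z \<in> K \<Longrightarrow> z \<noteq> 0 \<Longrightarrow> \<exists>n::int. \<exists>w\<in>place_units V. z = t powi n * w"
    and w: "w \<in> place_units V"
  shows "ord_at V (t powi n * w) = n"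
proof -
  have gen: "max_ideal V = (\<lambda>a. t * a) ` V"
  proof (intro equalityI subsetI)
    fix z assume z: "z \<in> max_ideal V"
    have "inverse t * z \<in> V"
    proof (cases "z = 0")
      case False
      then obtain i y where y: "y \<in> place_units V" "z = t powi i * y"
        using ex[of z] z V_sub ideal_sub by blast
      have "i > 0"
      proof (rule ccontr)
        assume "\<not> i > 0"
        then have "t powi (- i) \<in> V" by (simp add: power_int_def V_pow ideal_sub t)
        then have "z * t powi (- i) \<in> max_ideal V" using z ideal_mult by blast
        moreover have "z * t powi (- i) = y" using y t by (simp add: power_int_minus field_simps)
        ultimately show False using y(1) unit_not_ideal by metis
      qed
      then obtain j where j: "i = int (Suc j)" by (metis zero_less_imp_eq_int gr0_conv_Suc)
      then have "z = t * (t ^ j * y)" using y(2) by (simp only: power_int_of_nat power_Suc mult_ac)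
      then have "inverse t * z = t ^ j * y" using t by simp
      then show ?thesis using t(1) y(1) by (simp add: V_closed ideal_sub unit_sub)
    qed (simp add: V_0)
    then show "z \<in> (\<lambda>a. t * a) ` V" using t by (intro image_eqI[of _ _ "inverse t * z"]) auto
  qed (use t ideal_mult in auto)
  show ?thesis
    unfolding ord_at_def
  proof (rule the_equality)
    show "\<exists>s y. V - place_units V = (*) s ` V \<and> y \<in> place_units V \<and> t powi n * w = s powi n * y"
      using gen w unfolding max_ideal_def by blast
  next
    fix k assume "\<exists>s y. V - place_units V = (*) s ` V \<and> y \<in> place_units V \<and> t powi n * w = s powi k * y"
    then obtain s y where s: "max_ideal V = (*) s ` V" and y: "y \<in> place_units V"
      and eq: "t powi n * w = s powi k * y" unfolding max_ideal_def by blast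
    have "s \<in> max_ideal V" using V_1 unfolding s by force
    then obtain a where a: "a \<in> V" "s = t * a" unfolding gen by auto
    obtain b where b: "b \<in> V" "t = s * b" using t(1) unfolding s by auto
    have "t * (a * b) = t * 1" using a(2) b(2) by (metis mult.assoc mult.right_neutral)
    then have ab: "a * b = 1" using t(2) mult_cancel_left by blast
    then have ua: "a \<in> place_units V"
      using a b inverse_unique[OF ab] by (auto simp: place_units_iff)
    have "t powi n * w = t powi k * (a powi k * y)"
      using eq by (simp add: a(2) power_int_mult_distrib mult_ac)
    then have "t powi (n - k) = (a powi k * y) / w"
      using t w by (auto simp: power_int_diff field_simps place_units_iff)
    also have "\<dots> \<in> place_units V" by (intro unit_divide unit_mult unit_powi ua y w)
    finally show "k = n" using powi_unit_imp_0[OF t, of "n - k"] by simp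
  qed
qed

end

locale discrete_place = place +
  assumes discrete: "discrete_at K V"
begin

lemma uniformizer_exists:
  obtains t where "t \<in> max_ideal V" "t \<in> K" "t \<noteq> 0"
    "\<forall>z\<in>K. z \<noteq> 0 \<longrightarrow> (\<exists>w\<in>place_units V. z = t powi ord_at V z * w)"
    "\<forall>n. \<forall>w\<in>place_units V. ord_at V (t powi n * w) = n"
proof -
  from discrete obtain t where t: "t \<in> max_ideal V" "t \<noteq> 0"
    and ex: "\<And>z. z \<in> K \<Longrightarrow> z \<noteq> 0 \<Longrightarrow> \<exists>n::int. \<exists>w\<in>place_units V. z = t powi n * w"
    unfolding discrete_at_def by blast
  have o: "ord_at V (t powi n * w) = n" if "w \<in> place_units V" for n w
    by (rule ord_at_eqI[OF t ex that])
  have e: "\<exists>w\<in>place_units V. z = t powi ord_at V z * w" if "z \<in> K" "z \<noteq> 0" for z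
  proof -
    obtain n w where w: "w \<in> place_units V" "z = t powi n * w" using ex \<open>z \<in> K\<close> \<open>z \<noteq> 0\<close> by blast
    then have "ord_at V z = n" using o by simp
    then show ?thesis using w by blast
  qed
  have tK: "t \<in> K" using t V_sub ideal_sub by blast
  show thesis using that[OF t(1) tK t(2)] e o by blast
qed

lemma ord_mult:
  assumes "y \<in> K" "z \<in> K" "y \<noteq> 0" "z \<noteq> 0"
  shows "ord_at V (y * z) = ord_at V y + ord_at V z"
proof -
  obtain t where t: "t \<in> max_ideal V" "t \<in> K" "t \<noteq> 0"
    "\<forall>z\<in>K. z \<noteq> 0 \<longrightarrow> (\<exists>w\<in>place_units V. z = t powi ord_at V z * w)"
    "\<forall>n. \<forall>w\<in>place_units V. ord_at V (t powi n * w) = n"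
    by (rule uniformizer_exists)
  obtain a where a: "a \<in> place_units V" "y = t powi ord_at V y * a" using t(4) assms(1,3) by blast
  obtain b where b: "b \<in> place_units V" "z = t powi ord_at V z * b" using t(4) assms(2,4) by blast
  have "y * z = t powi (ord_at V y + ord_at V z) * (a * b)"
    using t(3) by (subst a(2), subst b(2)) (simp add: power_int_add mult_ac)
  then show ?thesis using t(5) unit_mult[OF a(1) b(1)] by simp
qed

lemma mem_V_iff: "z \<in> K \<Longrightarrow> z \<noteq> 0 \<Longrightarrow> z \<in> V \<longleftrightarrow> ord_at V z \<ge> 0"
  and mem_ideal_iff: "z \<in> K \<Longrightarrow> z \<noteq> 0 \<Longrightarrow> z \<in> max_ideal V \<longleftrightarrow> ord_at V z > 0"
  and mem_units_iff: "z \<in> K \<Longrightarrow> z \<noteq> 0 \<Longrightarrow> z \<in> place_units V \<longleftrightarrow> ord_at V z = 0"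
proof -
  assume z: "z \<in> K" "z \<noteq> 0"
  obtain t where t: "t \<in> max_ideal V" "t \<in> K" "t \<noteq> 0"
    "\<forall>z\<in>K. z \<noteq> 0 \<longrightarrow> (\<exists>w\<in>place_units V. z = t powi ord_at V z * w)"
    "\<forall>n. \<forall>w\<in>place_units V. ord_at V (t powi n * w) = n"
    by (rule uniformizer_exists)
  obtain w where w: "w \<in> place_units V" "z = t powi ord_at V z * w" using t(4) z by blast
  have pos: "t powi n * y \<in> max_ideal V" if n: "n > 0" and y: "y \<in> place_units V" for n y
  proof -
    obtain j where "n = int (Suc j)" using n by (metis zero_less_imp_eq_int gr0_conv_Suc)
    then have "t powi n * y = t * (t ^ j * y)" by (simp only: power_int_of_nat power_Suc mult_ac)
    moreover have "t * (t ^ j * y) \<in> max_ideal V" using t(1) y by (intro ideal_mult V_closed ideal_sub unit_sub)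
    ultimately show ?thesis by (simp only:)
  qed
  have p: "z \<in> max_ideal V" if "ord_at V z > 0" using pos[OF that w(1)] w(2) by metis
  have n: "z \<notin> V" if "ord_at V z < 0"
  proof -
    have "inverse z = t powi (- ord_at V z) * inverse w"
      by (subst w(2)) (simp add: power_int_minus)
    then have "inverse z \<in> max_ideal V" using pos[of "- ord_at V z" "inverse w"] that w(1) unit_inverse by simp
    then show ?thesis using z by (auto simp: max_ideal_iff)
  qed
  have u: "z \<in> place_units V" if "ord_at V z = 0" using w(1) by (subst w(2)) (simp add: that)
  show "z \<in> V \<longleftrightarrow> ord_at V z \<ge> 0" "z \<in> max_ideal V \<longleftrightarrow> ord_at V z > 0"
    "z \<in> place_units V \<longleftrightarrow> ord_at V z = 0"
    using p n u ideal_sub[of z] unit_not_ideal[of z]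
    by (cases "ord_at V z" "0::int" rule: linorder_cases; auto)+
qed

lemma ord_1: "ord_at V 1 = 0"
  using mem_units_iff[of 1] unit_1 one by simp

lemma ord_const: "c \<noteq> 0 \<Longrightarrow> ord_at V (const_emb c) = 0"
  using mem_units_iff unit_const const by simp

lemma ord_inverse: "z \<in> K \<Longrightarrow> z \<noteq> 0 \<Longrightarrow> ord_at V (inverse z) = - ord_at V z"
  using ord_mult[of z "inverse z"] by (simp add: inv ord_1)

lemma ord_divide: "y \<in> K \<Longrightarrow> z \<in> K \<Longrightarrow> y \<noteq> 0 \<Longrightarrow> z \<noteq> 0 \<Longrightarrow> ord_at V (y / z) = ord_at V y - ord_at V z"
  by (simp add: divide_inverse ord_mult inv ord_inverse)

lemma ord_power: "z \<in> K \<Longrightarrow> z \<noteq> 0 \<Longrightarrow> ord_at V (z ^ n) = int n * ord_at V z"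
  by (induction n) (auto simp: ord_1 ord_mult pow algebra_simps)

lemma ord_powi: "z \<in> K \<Longrightarrow> z \<noteq> 0 \<Longrightarrow> ord_at V (z powi n) = n * ord_at V z"
  by (auto simp: power_int_def ord_power ord_inverse inv)

lemma ord_minus: "z \<in> K \<Longrightarrow> z \<noteq> 0 \<Longrightarrow> ord_at V (- z) = ord_at V z"
  using ord_mult[of "const_emb (-1)" z] ord_const[of "-1"] const[of "-1"] by (simp add: const_emb_minus)

text \<open>\<open>ord_at V 0\<close> is an unspecified integer, hence the conditions on vanishing;
  a lower bound \<open>n\<close> in place of a minimum keeps later applications short.\<close>

lemma ord_add_ge:
  assumes "y \<in> K" "z \<in> K" "y \<noteq> 0" "z \<noteq> 0" "y + z \<noteq> 0" "ord_at V y \<ge> n" "ord_at V z \<ge> n"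
  shows "ord_at V (y + z) \<ge> n"
proof -
  have *: "ord_at V (y + z) \<ge> n"
    if "ord_at V y \<ge> n" "ord_at V y \<le> ord_at V z" and a: "y \<in> K" "z \<in> K" "y \<noteq> 0" "z \<noteq> 0" "y + z \<noteq> 0" for y z
  proof -
    have "ord_at V (z / y) \<ge> 0" using that by (simp add: ord_divide)
    then have "z / y \<in> V" using a by (subst mem_V_iff) (auto simp: div)
    then have "1 + z / y \<in> V" by (simp add: V_closed)
    moreover have eq: "y + z = y * (1 + z / y)" and nz: "1 + z / y \<noteq> 0" using a by (auto simp: field_simps)
    ultimately have "ord_at V (1 + z / y) \<ge> 0" using a by (subst (asm) mem_V_iff) (auto simp: closed)
    then show ?thesis using that(1) a nz by (subst eq) (simp add: ord_mult closed)
  qed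
  show ?thesis
    using *[of y z] *[of z y] assms by (cases "ord_at V y \<le> ord_at V z") (auto simp: add.commute)
qed

lemma ord_add_eq:
  assumes "y \<in> K" "z \<in> K" "y \<noteq> 0" "z \<noteq> 0" "ord_at V y < ord_at V z"
  shows "y + z \<noteq> 0" "ord_at V (y + z) = ord_at V y"
proof -
  show nz: "y + z \<noteq> 0"
  proof
    assume "y + z = 0"
    then have "z = - y" by (simp add: eq_neg_iff_add_eq_0 add.commute)
    then show False using assms ord_minus by auto
  qed
  have ge: "ord_at V (y + z) \<ge> ord_at V y" using ord_add_ge[of y z "ord_at V y"] assms nz by simp
  \<comment> \<open>Otherwise \<open>y\<close>, written as \<open>(y + z) + (- z)\<close>, would be
    a sum of two elements of larger order.\<close>
  have "ord_at V y \<ge> ord_at V (y + z)" if "ord_at V (y + z) > ord_at V y"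
    using ord_add_ge[of "y + z" "- z" "min (ord_at V (y + z)) (ord_at V z)"] assms nz that
    by (auto simp: closed ord_minus)
  with ge show "ord_at V (y + z) = ord_at V y" by linarith
qed

lemma ord_1_exists: obtains t where "t \<in> K" "t \<noteq> 0" "ord_at V t = 1"
proof -
  obtain t where t: "t \<in> max_ideal V" "t \<in> K" "t \<noteq> 0"
    "\<forall>z\<in>K. z \<noteq> 0 \<longrightarrow> (\<exists>w\<in>place_units V. z = t powi ord_at V z * w)"
    "\<forall>n. \<forall>w\<in>place_units V. ord_at V (t powi n * w) = n"
    by (rule uniformizer_exists)
  then show thesis using that[of t] t(5)[rule_format, OF unit_1, of 1] by simp
qed

lemma residue: "z \<in> V \<Longrightarrow> \<exists>c. z - const_emb c \<in> max_ideal V"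
  using discrete unfolding discrete_at_def by blast

lemma residue_unit: "z \<in> place_units V \<Longrightarrow> \<exists>c. c \<noteq> 0 \<and> z - const_emb c \<in> max_ideal V"
  using residue[of z] unit_not_ideal[of z] by (metis const_emb_0 diff_zero)

lemma residue_unique:
  assumes "z - const_emb c \<in> max_ideal V" "z - const_emb d \<in> max_ideal V"
  shows "c = d"
proof -
  have "const_emb (d - c) \<in> max_ideal V"
    using ideal_diff[OF assms] by (simp add: const_emb_diff)
  then show ?thesis by (simp only: const_not_ideal) simp
qed

lemma residue_mult:
  assumes "b \<in> V" "a - const_emb c \<in> max_ideal V" "b - const_emb d \<in> max_ideal V"
  shows "a * b - const_emb (c * d) \<in> max_ideal V"
proof -
  have "(a - const_emb c) * b + const_emb c * (b - const_emb d) \<in> max_ideal V"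
    using assms V_const[of c] by (blast intro: ideal_add ideal_mult ideal_mult2)
  then show ?thesis by (simp add: const_emb_mult algebra_simps)
qed

end

definition has_divisor :: "'k::field ambient set \<Rightarrow> 'k ambient \<Rightarrow> ('k ambient set \<Rightarrow>\<^sub>0 int) \<Rightarrow> bool" where
  "has_divisor K z D \<longleftrightarrow> Poly_Mapping.keys D \<subseteq> places K \<and>
     (\<forall>V\<in>places K. Poly_Mapping.lookup D V = ord_at V z)"

locale discrete_field = const_subfield +
  assumes discrete: "V \<in> places K \<Longrightarrow> discrete_at K V"
begin

lemma place: "V \<in> places K \<Longrightarrow> discrete_place K V"
  using const_subfield_axioms
  by (simp add: discrete_place_def place_def place_axioms_def discrete_place_axioms_def discrete)

end

text \<open>Since \<open>D\<close> is finitely supported by its type, the assumption contains the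
  finiteness of zeros and poles as well as the product formula.\<close>

locale curve_field = discrete_field +
  assumes divisor: "z \<in> K \<Longrightarrow> z \<noteq> 0 \<Longrightarrow> \<exists>D. has_divisor K z D \<and> divisor_degree D = 0"

section \<open>Quadratic extensions\<close>

locale quad_ext = discrete_field K for K :: "'k::{alg_closed_field, field_char_0} ambient set" +
  fixes s
  assumes s_notin: "s \<notin> K" and s_sq: "s ^ 2 \<in> K"
begin

definition L where "L = {a + b * s | a b. a \<in> K \<and> b \<in> K}"

lemma L_I: "a \<in> K \<Longrightarrow> b \<in> K \<Longrightarrow> a + b * s \<in> L"
  by (auto simp: L_def)

lemma L_E: assumes "z \<in> L" obtains a b where "a \<in> K" "b \<in> K" "z = a + b * s"
  using assms by (auto simp: L_def)

lemma repr_0: assumes "a \<in> K" "b \<in> K" "a + b * s = 0" shows "a = 0 \<and> b = 0"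
proof -
  have "b = 0"
  proof (rule ccontr)
    assume "b \<noteq> 0"
    then have "s = - a / b" using assms(3) by (simp add: field_simps add_eq_0_iff)
    then have "s \<in> K" using assms by (simp add: closed)
    then show False using s_notin by simp
  qed
  then show ?thesis using assms by simp
qed

lemma repr_unique:
  assumes "a \<in> K" "b \<in> K" "c \<in> K" "d \<in> K" "a + b * s = c + d * s" shows "a = c \<and> b = d"
  using repr_0[of "a - c" "b - d"] assms by (simp add: closed algebra_simps)

definition conj where "conj z = (THE w. \<exists>a\<in>K. \<exists>b\<in>K. z = a + b * s \<and> w = a - b * s)"

lemma conj_eq: "a \<in> K \<Longrightarrow> b \<in> K \<Longrightarrow> conj (a + b * s) = a - b * s"
  unfolding conj_def by (rule the_equality) (use repr_unique in blast)+

lemma K_sub_L: "a \<in> K \<Longrightarrow> a \<in> L" using L_I[of a 0] zero by simp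

lemma s_L: "s \<in> L" using L_I[of 0 1] zero one by simp

lemma conj_K: "a \<in> K \<Longrightarrow> conj a = a" using conj_eq[of a 0] zero by simp

lemma conj_s: "conj s = - s" using conj_eq[of 0 1] zero one by simp

lemma conj_L: "z \<in> L \<Longrightarrow> conj z \<in> L"
  using L_I[of _ "- _"] by (auto elim!: L_E simp: conj_eq minus)

lemma conj_conj: "z \<in> L \<Longrightarrow> conj (conj z) = z"
  using conj_eq[of _ "- _"] by (auto elim!: L_E simp: conj_eq minus)

lemma conj_add: assumes "y \<in> L" "z \<in> L" shows "y + z \<in> L" "conj (y + z) = conj y + conj z"
proof -
  from assms obtain a b c d where [simp]: "a \<in> K" "b \<in> K" "c \<in> K" "d \<in> K"
    and eq: "y = a + b * s" "z = c + d * s" by (elim L_E) blast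
  have yz: "y + z = (a + c) + (b + d) * s" by (simp add: eq algebra_simps)
  show "y + z \<in> L" unfolding yz by (intro L_I closed) auto
  show "conj (y + z) = conj y + conj z" unfolding yz by (subst conj_eq) (auto simp: eq conj_eq closed algebra_simps)
qed

lemma conj_mult: assumes "y \<in> L" "z \<in> L" shows "y * z \<in> L" "conj (y * z) = conj y * conj z"
proof -
  from assms obtain a b c d where [simp]: "a \<in> K" "b \<in> K" "c \<in> K" "d \<in> K"
    and eq: "y = a + b * s" "z = c + d * s" by (elim L_E) blast
  have yz: "y * z = (a * c + b * d * s ^ 2) + (a * d + b * c) * s"
    by (simp add: eq algebra_simps power2_eq_square)
  show "y * z \<in> L" unfolding yz by (intro L_I closed s_sq) auto
  show "conj (y * z) = conj y * conj z" unfolding yz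
    by (subst conj_eq) (auto simp: eq conj_eq closed s_sq, simp add: algebra_simps power2_eq_square)
qed

lemma conj_minus: assumes "z \<in> L" shows "- z \<in> L" "conj (- z) = - conj z"
  using conj_mult[of "-1" z] assms K_sub_L[of "-1"] conj_K[of "-1"] minus[OF one] by auto

definition norm where "norm z = z * conj z"

lemma norm_eq: "a \<in> K \<Longrightarrow> b \<in> K \<Longrightarrow> norm (a + b * s) = a ^ 2 - b ^ 2 * s ^ 2"
  by (simp add: norm_def conj_eq algebra_simps power2_eq_square)

lemma norm_K: "z \<in> L \<Longrightarrow> norm z \<in> K"
  by (auto elim!: L_E simp: norm_eq closed s_sq)

lemma conj_0_iff: "z \<in> L \<Longrightarrow> conj z = 0 \<longleftrightarrow> z = 0"
  using conj_conj[of z] conj_K[OF zero] by auto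

lemma norm_0_iff: "z \<in> L \<Longrightarrow> norm z = 0 \<longleftrightarrow> z = 0"
  by (simp add: norm_def conj_0_iff)

lemma norm_mult: "y \<in> L \<Longrightarrow> z \<in> L \<Longrightarrow> norm (y * z) = norm y * norm z"
  by (simp add: norm_def conj_mult)

lemma inverse_norm: "z \<in> L \<Longrightarrow> inverse z = conj z * inverse (norm z)"
  by (cases "z = 0") (auto simp: norm_def conj_0_iff)

sublocale L: const_subfield L
proof
  show "const_emb c \<in> L" for c by (simp add: K_sub_L const)
  show "inverse a \<in> L" if "a \<in> L" for a
    unfolding inverse_norm[OF that] by (rule conj_mult(1)[OF conj_L[OF that] K_sub_L[OF inv[OF norm_K[OF that]]]])
qed (rule conj_add(1) conj_mult(1) conj_minus(1); assumption)+

lemma conj_diff: "y \<in> L \<Longrightarrow> z \<in> L \<Longrightarrow> conj (y - z) = conj y - conj z"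
  using conj_add(2)[of y "- z"] by (simp add: conj_minus)

lemma conj_inverse: "z \<in> L \<Longrightarrow> conj (inverse z) = inverse (conj z)"
proof (cases "z = 0")
  case False
  assume z: "z \<in> L"
  have "conj z * conj (inverse z) = 1"
    using False conj_mult(2)[of z "inverse z"] z by (simp add: L.inv conj_K one)
  then show ?thesis using inverse_unique by metis
qed (simp add: conj_K zero)

lemma conj_pow: "z \<in> L \<Longrightarrow> conj (z ^ n) = conj z ^ n"
  by (induction n) (auto simp: conj_mult L.pow conj_K one)

lemma conj_powi: "z \<in> L \<Longrightarrow> conj (z powi n) = conj z powi n"
  by (auto simp: power_int_def conj_pow conj_inverse L.inv)

lemma conj_const: "conj (const_emb c) = const_emb c" by (simp add: conj_K const)

lemma norm_inverse: "z \<in> L \<Longrightarrow> norm (inverse z) = inverse (norm z)"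
  by (simp add: norm_def conj_inverse)

subsection \<open>Conjugate places and places of the base\<close>

lemma conj_image_iff: "V \<subseteq> L \<Longrightarrow> z \<in> L \<Longrightarrow> z \<in> conj ` V \<longleftrightarrow> conj z \<in> V"
  using conj_conj[of z] by (auto simp: conj_conj subset_iff image_iff intro!: bexI[of _ "conj z"])

lemma conj_image_conj: "V \<subseteq> L \<Longrightarrow> conj ` conj ` V = V"
proof -
  assume "V \<subseteq> L"
  then have "(\<lambda>z. conj (conj z)) ` V = (\<lambda>z. z) ` V" by (intro image_cong) (auto simp: conj_conj)
  then show ?thesis by (simp add: image_image)
qed

lemma place_sub: "V \<in> places L \<Longrightarrow> V \<subseteq> L" by (auto simp: places_iff)

lemma conj_place: assumes "V \<in> places L" shows "conj ` V \<in> places L"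
proof -
  interpret V: place L V using assms by unfold_locales
  have sub: "V \<subseteq> L" using place_sub assms .
  have sub': "conj ` V \<subseteq> L" using sub conj_L by auto
  note iff = conj_image_iff[OF sub]
  have "conj ` V \<noteq> L"
  proof
    assume "conj ` V = L"
    then have "V = conj ` L" using conj_image_conj[OF sub] by simp
    also have "conj ` L = L" using conj_L conj_conj by (force simp: image_iff)
    finally show False using V.V_neq by simp
  qed
  moreover have "x \<in> conj ` V \<longleftrightarrow> x \<in> L \<and> conj x \<in> V" for x using iff sub' by blast
  moreover have "inverse (conj z) \<in> V" if "z \<in> L" "conj z \<notin> V" for z
    using V.V_inverse[of "conj z"] that conj_L by blast
  ultimately show ?thesis unfolding places_iff
    by (auto simp: L.const L.inv conj_const conj_add conj_mult conj_minus conj_inverse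
        V.V_const V.V_add V.V_mult V.V_minus)
qed

text \<open>The point is that the restriction is proper: a place containing \<open>K\<close> would
  contain \<open>s\<close>, which is integral over \<open>K\<close>, and then all of
  \<open>L\<close>.\<close>

lemma restrict_place: assumes "V \<in> places L" shows "V \<inter> K \<in> places K"
proof -
  interpret V: place L V using assms by unfold_locales
  have "\<not> K \<subseteq> V"
  proof
    assume KV: "K \<subseteq> V"
    have "s \<in> V" by (rule V.V_integral[of s 0 "- (s ^ 2)"]) (use KV minus[OF s_sq] s_L zero in \<open>simp_all add: subsetD\<close>)
    then have "a + b * s \<in> V" if "a \<in> K" "b \<in> K" for a b
      using KV that V.V_add V.V_mult by blast
    then have "L \<subseteq> V" unfolding L_def by blast
    then show False using V.V_neq place_sub[OF assms] by blast
  qed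
  moreover have "inverse z \<in> V" if "z \<in> K" "z \<notin> V" for z using V.V_inverse[of z] that K_sub_L by blast
  ultimately show ?thesis unfolding places_iff
    by (auto simp: V.V_add V.V_mult V.V_minus V.V_const const add mult minus inv)
qed

lemma conj_restrict: "V \<subseteq> L \<Longrightarrow> conj ` V \<inter> K = V \<inter> K"
proof -
  assume "V \<subseteq> L"
  then have "z \<in> conj ` V \<longleftrightarrow> z \<in> V" if "z \<in> K" for z
    using conj_image_iff[of V z] that by (simp add: K_sub_L conj_K)
  then show ?thesis by blast
qed

lemma unit_restrict: "z \<in> place_units (V \<inter> K) \<Longrightarrow> z \<in> place_units V"
  by (auto simp: place_units_iff)

lemma units_conj: "V \<subseteq> L \<Longrightarrow> z \<in> L \<Longrightarrow> z \<in> place_units (conj ` V) \<longleftrightarrow> conj z \<in> place_units V"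
  by (simp add: place_units_iff conj_image_iff L.inv conj_inverse conj_0_iff)

lemma ideal_conj: "V \<subseteq> L \<Longrightarrow> z \<in> L \<Longrightarrow> z \<in> max_ideal (conj ` V) \<longleftrightarrow> conj z \<in> max_ideal V"
  by (simp add: max_ideal_iff conj_image_iff L.inv conj_inverse conj_0_iff)

lemma ideal_restrict: "z \<in> K \<Longrightarrow> z \<in> max_ideal V \<longleftrightarrow> z \<in> max_ideal (V \<inter> K)"
  by (auto simp: max_ideal_iff inv)

text \<open>Transport of structure along the automorphism \<open>conj\<close>: the conjugate of a
  uniformizer is a uniformizer of the conjugate place.\<close>

lemma discrete_conj: assumes V: "V \<in> places L" "discrete_at L V"
  shows "discrete_at L (conj ` V)" "\<And>z. z \<in> L \<Longrightarrow> z \<noteq> 0 \<Longrightarrow> ord_at (conj ` V) z = ord_at V (conj z)"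
proof -
  interpret V: discrete_place L V using V by unfold_locales
  interpret V': place L "conj ` V" using conj_place V by unfold_locales auto
  have sub: "V \<subseteq> L" using place_sub V(1) .
  obtain t where t: "t \<in> max_ideal V" "t \<in> L" "t \<noteq> 0"
    "\<forall>z\<in>L. z \<noteq> 0 \<longrightarrow> (\<exists>w\<in>place_units V. z = t powi ord_at V z * w)"
    "\<forall>n. \<forall>w\<in>place_units V. ord_at V (t powi n * w) = n"
    by (rule V.uniformizer_exists)
  have t': "conj t \<in> max_ideal (conj ` V)" "conj t \<noteq> 0"
    using t(1-3) by (auto simp: ideal_conj sub conj_L conj_conj conj_0_iff)
  have ex: "\<exists>w\<in>place_units (conj ` V). z = conj t powi ord_at V (conj z) * w"
    if z: "z \<in> L" "z \<noteq> 0" for z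
  proof -
    obtain w where w: "w \<in> place_units V" "conj z = t powi ord_at V (conj z) * w"
      using t(4) z conj_L conj_0_iff by blast
    then have wL: "w \<in> L" using V.V_sub V.unit_sub by blast
    have "z = conj (conj z)" using z conj_conj by simp
    also have "\<dots> = conj t powi ord_at V (conj z) * conj w"
      by (subst w(2)) (simp add: conj_mult t wL L.powi conj_powi)
    finally have "z = conj t powi ord_at V (conj z) * conj w" .
    moreover have "conj w \<in> place_units (conj ` V)" using w(1) wL by (simp add: units_conj sub conj_L conj_conj)
    ultimately show ?thesis by (rule bexI)
  qed
  have ex': "\<exists>n::int. \<exists>w\<in>place_units (conj ` V). z = conj t powi n * w" if "z \<in> L" "z \<noteq> 0" for z
    using ex[OF that] by (rule exI)
  show "ord_at (conj ` V) z = ord_at V (conj z)" if z: "z \<in> L" "z \<noteq> 0" for z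
  proof -
    obtain w where w: "w \<in> place_units (conj ` V)" "z = conj t powi ord_at V (conj z) * w"
      using ex[OF z] by (rule bexE)
    have "ord_at (conj ` V) (conj t powi ord_at V (conj z) * w) = ord_at V (conj z)"
      by (rule V'.ord_at_eqI[OF t' ex' w(1)])
    then show ?thesis by (simp only: flip: w(2))
  qed
  show "discrete_at L (conj ` V)"
    unfolding discrete_at_def
  proof (intro conjI ballI)
    show "\<exists>t\<in>max_ideal (conj ` V). t \<noteq> 0 \<and> (\<forall>z\<in>L. z \<noteq> 0 \<longrightarrow> (\<exists>n. \<exists>w\<in>place_units (conj ` V). z = t powi n * w))"
      using t' ex' by blast
    fix z assume z: "z \<in> conj ` V"
    then have zL: "z \<in> L" using V'.V_sub by blast
    have "conj z \<in> V" using z zL sub conj_image_iff by blast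
    then obtain c where c: "conj z - const_emb c \<in> max_ideal V" using V.residue by blast
    then have "conj (z - const_emb c) \<in> max_ideal V" using zL by (simp add: conj_diff conj_const L.const)
    then show "\<exists>c. z - const_emb c \<in> max_ideal (conj ` V)"
      using ideal_conj[OF sub] L.diff[OF zL L.const] by blast
  qed
qed

subsection \<open>Fibres over a place of the base\<close>

text \<open>The decomposition of \<open>W\<close> in a quadratic extension. As the residue field is
  algebraically closed there is no inertia: either one ramified place, which doubles orders, or two
  conjugate places, which keep them. The parity of the order of \<open>s^2\<close> decides.\<close>

definition fibre :: "'k ambient set \<Rightarrow> 'k ambient set \<Rightarrow> bool" where
  "fibre W V \<longleftrightarrow> V \<in> places L \<and> V \<inter> K = W \<and> discrete_at L V \<and>
     {V' \<in> places L. V' \<inter> K = W} = {V, conj ` V} \<and>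
     (conj ` V = V \<and> odd (ord_at W (s ^ 2)) \<and> (\<forall>z\<in>K. z \<noteq> 0 \<longrightarrow> ord_at V z = 2 * ord_at W z) \<or>
      conj ` V \<noteq> V \<and> even (ord_at W (s ^ 2)) \<and> (\<forall>z\<in>K. z \<noteq> 0 \<longrightarrow> ord_at V z = ord_at W z))"

lemma s_neq_0: "s \<noteq> 0" using s_notin zero by auto

end

context quad_ext begin

text \<open>A multiple \<open>q\<close> of \<open>s\<close> by an element of \<open>K\<close> has a
  square of order 1, and \<open>q\<close> is a uniformizer upstairs. Every place above
  \<open>W\<close> has \<open>q\<close> in its maximal ideal, so membership is decided by the
  exponent of \<open>q\<close>, which is the order of the norm; hence the place is unique.\<close>

lemma ramified:
  assumes W: "W \<in> places K" and odd: "odd (ord_at W (s ^ 2))"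
  shows "\<exists>V. fibre W V"
proof -
  interpret W: discrete_place K W using place W .
  obtain t where t: "t \<in> K" "t \<noteq> 0" "ord_at W t = 1" by (rule W.ord_1_exists)
  obtain j where j: "ord_at W (s ^ 2) = 2 * j + 1" using odd by (elim oddE)
  \<comment> \<open>Removes the even part \<open>2 * j\<close> of the order of \<open>s^2\<close>,
    so that \<open>q^2\<close> keeps order exactly 1.\<close>
  define r where "r = t powi (- j)"
  have r: "r \<in> K" "r \<noteq> 0" "ord_at W r = - j" using t by (auto simp: r_def powi W.ord_powi)
  define q where "q = r * s"
  define \<tau> where "\<tau> = q ^ 2"
  have q0: "q \<noteq> 0" using r s_neq_0 by (simp add: q_def)
  have qL: "q \<in> L" using r by (simp add: q_def L.mult K_sub_L s_L)
  have cq: "conj q = - q" using r by (simp add: q_def conj_mult K_sub_L s_L conj_K conj_s)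
  have \<tau>: "\<tau> \<in> K" "\<tau> \<noteq> 0" "ord_at W \<tau> = 1"
    using r s_sq s_neq_0 j
    by (auto simp: \<tau>_def q_def power_mult_distrib closed W.ord_mult W.ord_power)
  have reprq: "\<exists>a\<in>K. \<exists>b\<in>K. z = a + b * q" if z: "z \<in> L" for z
  proof -
    obtain a b where ab: "a \<in> K" "b \<in> K" "z = a + b * s" by (rule L_E[OF z])
    then have "z = a + (b / r) * q" using r by (simp add: q_def)
    then show ?thesis using ab r div by blast
  qed
  have conjq: "conj (a + b * q) = a - b * q" if "a \<in> K" "b \<in> K" for a b
    using that qL by (simp add: conj_add conj_mult K_sub_L L.mult conj_K cq)
  have abL: "a + b * q \<in> L" if "a \<in> K" "b \<in> K" for a b
    using that qL by (simp add: L.add L.mult K_sub_L)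
  have over: "w \<in> place_units V" if "w \<in> place_units W" "V \<inter> K = W" for w V
    using that unit_restrict by blast
  have qV: "q \<in> max_ideal V" if V: "V \<in> places L" "V \<inter> K = W" for V
  proof -
    interpret V: place L V using V by unfold_locales
    have tV: "\<tau> \<in> max_ideal V" using \<tau> ideal_restrict[of \<tau> V] V W.mem_ideal_iff by simp
    have "q \<in> V"
      by (rule V.V_integral[of q 0 "- \<tau>"]) (use qL tV V.ideal_sub V.V_closed in \<open>auto simp: \<tau>_def\<close>)
    then show ?thesis using tV V.ideal_prime[of q q] by (auto simp: \<tau>_def power2_eq_square)
  qed
  have factK: "\<exists>w. a = q powi (2 * ord_at W a) * w \<and> w \<in> place_units W" if "a \<in> K" "a \<noteq> 0" for a
  proof -
    have "a / \<tau> powi ord_at W a \<in> place_units W"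
      using that \<tau> by (subst W.mem_units_iff) (auto simp: closed W.ord_divide W.ord_powi)
    moreover have "q powi (2 * ord_at W a) = \<tau> powi ord_at W a"
      by (simp add: \<tau>_def power_int_mult)
    ultimately show ?thesis using \<tau> by (intro exI[of _ "a / \<tau> powi ord_at W a"]) auto
  qed
  \<comment> \<open>Exponent and cofactor do not depend on the place above \<open>W\<close>, which
    yields uniqueness later. That \<open>conj w\<close> is a unit too makes \<open>norm w\<close> a
    unit of \<open>W\<close>, so the order of \<open>norm z\<close> can be computed.\<close>
  have fact: "\<exists>n w. z = q powi n * w \<and> (\<forall>V\<in>places L. V \<inter> K = W \<longrightarrow> w \<in> place_units V \<and> conj w \<in> place_units V)"
    if z: "z \<in> L" "z \<noteq> 0" for z
  proof -
    obtain a b where ab: "a \<in> K" "b \<in> K" "z = a + b * q" using reprq[OF z(1)] by blast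
    have u: "w \<in> place_units V \<and> conj w \<in> place_units V" if "w \<in> place_units W" "V \<inter> K = W" for w V
      using over[OF that] conj_K[of w] that by (auto simp: place_units_iff)
    consider "a = 0" | "b = 0" | "a \<noteq> 0" "b \<noteq> 0" by blast
    then show ?thesis
    proof cases
      case 1
      then have b: "b \<noteq> 0" using z ab by auto
      obtain w where w: "b = q powi (2 * ord_at W b) * w" "w \<in> place_units W" using factK[OF ab(2) b] by (elim exE conjE)
      have "z = q powi (2 * ord_at W b + 1) * w"
        using q0 by (subst ab(3), subst w(1)) (simp add: 1 power_int_add)
      then show ?thesis using u w(2) by blast
    next
      case 2
      then have a: "a \<noteq> 0" using z ab by auto
      obtain w where w: "a = q powi (2 * ord_at W a) * w" "w \<in> place_units W" using factK[OF ab(1) a] by (elim exE conjE)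
      have "z = a" using ab 2 by simp
      then have "z = q powi (2 * ord_at W a) * w" using w(1) by (rule trans)
      then show ?thesis using u w(2) by blast
    next
      case 3
      obtain v where v: "a = q powi (2 * ord_at W a) * v" "v \<in> place_units W" using factK[OF ab(1) 3(1)] by (elim exE conjE)
      obtain w where w: "b = q powi (2 * ord_at W b) * w" "w \<in> place_units W" using factK[OF ab(2) 3(2)] by (elim exE conjE)
      define i where "i = ord_at W a"
      define k where "k = ord_at W b"
      \<comment> \<open>The two terms have exponents of different parity, so they cannot cancel; the
        term of smaller exponent is taken out.\<close>
      have zz: "z = q powi (2 * i) * v + q powi (2 * k + 1) * w"
        using q0 by (subst ab(3), subst v(1), subst w(1)) (simp add: power_int_add i_def k_def mult_ac)
      have vw: "v \<in> K" "w \<in> K" using v w W.V_sub W.unit_sub by blast+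
      have qn: "q * q ^ n \<in> max_ideal V" if "V \<in> places L" "V \<inter> K = W" for V n
      proof -
        interpret V: place L V using that by unfold_locales
        show ?thesis using qV[OF that] by (intro V.ideal_mult V.V_closed V.ideal_sub)
      qed
      show ?thesis
      proof (cases "i \<le> k")
        case True
        define m where "m = nat (2 * (k - i))"
        have "q powi (2 * k + 1) = q powi (2 * i) * (q * q ^ m)"
        proof -
          have "2 * k + 1 = 2 * i + (1 + int m)" using True by (simp add: m_def)
          then show ?thesis using q0 by (simp only: power_int_add[OF disjI1[OF q0]] power_int_of_nat power_int_1_right)
        qed
        then have "z = q powi (2 * i) * (v + (q * q ^ m) * w)" unfolding zz by (simp add: algebra_simps)
        moreover have "v + (q * q ^ m) * w \<in> place_units V \<and> conj (v + (q * q ^ m) * w) \<in> place_units V"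
          if V: "V \<in> places L" "V \<inter> K = W" for V
        proof -
          interpret V: place L V using V by unfold_locales
          have wV: "w \<in> V" "v \<in> place_units V" using w v over[OF _ V(2)] V.unit_sub by blast+
          have 1: "(q * q ^ m) * w \<in> max_ideal V" using qn[OF V] wV V.ideal_mult by blast
          have "conj ((q * q ^ m) * w) = (-1) ^ Suc m * ((q * q ^ m) * w)"
            using vw qL by (simp add: conj_mult conj_pow cq L.pow K_sub_L L.mult conj_K power_minus[of q])
          then have 2: "conj ((q * q ^ m) * w) \<in> max_ideal V"
            using V.ideal_mult2[OF _ 1, of "(-1) ^ Suc m"] V.V_closed by simp
          have "conj (v + (q * q ^ m) * w) = v + conj ((q * q ^ m) * w)"
            using vw qL by (simp add: conj_add K_sub_L L.mult L.pow conj_K)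
          then show ?thesis using V.unit_add_ideal[OF wV(2)] 1 2 by simp
        qed
        ultimately show ?thesis by blast
      next
        case False
        \<comment> \<open>Here \<open>i > k\<close>, so \<open>2 * i\<close> exceeds
          \<open>2 * k + 1\<close> by \<open>1 + m\<close> with \<open>m\<close> nonnegative. The
          separate factor \<open>q\<close> guarantees that the second term lies in the maximal
          ideal.\<close>
        define m where "m = nat (2 * (i - k) - 2)"
        have "q powi (2 * i) = q powi (2 * k + 1) * (q * q ^ m)"
        proof -
          have "2 * i = (2 * k + 1) + (1 + int m)" using False by (simp add: m_def)
          then show ?thesis using q0 by (simp only: power_int_add[OF disjI1[OF q0]] power_int_of_nat power_int_1_right)
        qed
        then have "z = q powi (2 * k + 1) * (w + (q * q ^ m) * v)" unfolding zz by (simp add: algebra_simps)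
        moreover have "w + (q * q ^ m) * v \<in> place_units V \<and> conj (w + (q * q ^ m) * v) \<in> place_units V"
          if V: "V \<in> places L" "V \<inter> K = W" for V
        proof -
          interpret V: place L V using V by unfold_locales
          have wV: "v \<in> V" "w \<in> place_units V" using w v over[OF _ V(2)] V.unit_sub by blast+
          have 1: "(q * q ^ m) * v \<in> max_ideal V" using qn[OF V] wV V.ideal_mult by blast
          have "conj ((q * q ^ m) * v) = (-1) ^ Suc m * ((q * q ^ m) * v)"
            using vw qL by (simp add: conj_mult conj_pow cq L.pow K_sub_L L.mult conj_K power_minus[of q])
          then have 2: "conj ((q * q ^ m) * v) \<in> max_ideal V"
            using V.ideal_mult2[OF _ 1, of "(-1) ^ Suc m"] V.V_closed by simp
          have "conj (w + (q * q ^ m) * v) = w + conj ((q * q ^ m) * v)"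
            using vw qL by (simp add: conj_add K_sub_L L.mult L.pow conj_K)
          then show ?thesis using V.unit_add_ideal[OF wV(2)] 1 2 by simp
        qed
        ultimately show ?thesis by blast
      qed
    qed
  qed
  \<comment> \<open>As \<open>q\<close> is a root of the Eisenstein polynomial
    \<open>X^2 - \<tau>\<close>, the ring \<open>W[q]\<close> is already the full valuation ring. It
    is recognized through the order of the norm, whose two terms again have orders of different
    parity.\<close>
  define V0 where "V0 = {a + b * q | a b. a \<in> W \<and> b \<in> W}"
  have ordN: "norm (a + b * q) = a ^ 2 - b ^ 2 * \<tau>" if "a \<in> K" "b \<in> K" for a b
    using that by (simp add: norm_def conjq \<tau>_def algebra_simps power2_eq_square)
  have normV0: "z \<in> V0 \<longleftrightarrow> ord_at W (norm z) \<ge> 0" if z: "z \<in> L" "z \<noteq> 0" for z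
  proof -
    have rep: "a = c \<and> b = d" if "a \<in> K" "b \<in> K" "c \<in> K" "d \<in> K" "a + b * q = c + d * q" for a b c d
      using repr_unique[of a "b * r" c "d * r"] that r by (simp add: q_def closed mult_ac)
    obtain a b where ab: "a \<in> K" "b \<in> K" "z = a + b * q" using reprq[OF z(1)] by blast
    have m: "z \<in> V0 \<longleftrightarrow> a \<in> W \<and> b \<in> W"
      using rep[OF ab(1,2)] ab(3) W.V_sub by (auto simp: V0_def)
    have "a \<noteq> 0 \<or> b \<noteq> 0" using z ab by auto
    then consider "a = 0" "b \<noteq> 0" | "b = 0" "a \<noteq> 0" | "a \<noteq> 0" "b \<noteq> 0" by blast
    then show ?thesis
    proof cases
      case 1
      then have "ord_at W (norm z) = 2 * ord_at W b + 1"
        using ab \<tau> ordN[OF ab(1,2)] by (simp add: W.ord_minus W.ord_mult W.ord_power closed)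
      then show ?thesis using m ab 1 W.V_0 W.mem_V_iff[of b] by auto
    next
      case 2
      then have "ord_at W (norm z) = 2 * ord_at W a"
        using ab ordN[OF ab(1,2)] by (simp add: W.ord_power)
      then show ?thesis using m ab 2 W.V_0 W.mem_V_iff[of a] by auto
    next
      case 3
      have o: "ord_at W (a ^ 2) = 2 * ord_at W a" "ord_at W (- (b ^ 2 * \<tau>)) = 2 * ord_at W b + 1"
        using 3 ab \<tau> by (auto simp: W.ord_minus W.ord_mult W.ord_power closed)
      have mem: "a ^ 2 \<in> K" "- (b ^ 2 * \<tau>) \<in> K" "a ^ 2 \<noteq> 0" "- (b ^ 2 * \<tau>) \<noteq> 0"
        using 3 ab \<tau> by (auto simp: closed)
      have n: "norm z = a ^ 2 + - (b ^ 2 * \<tau>)" using ab ordN by simp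
      have "ord_at W (norm z) = min (2 * ord_at W a) (2 * ord_at W b + 1)"
      proof (cases "ord_at W a \<le> ord_at W b")
        case True
        then show ?thesis using W.ord_add_eq(2)[OF mem(1,2,3,4)] o n by simp
      next
        case False
        then show ?thesis using W.ord_add_eq(2)[OF mem(2,1,4,3)] o n by (simp add: add.commute min_def)
      qed
      then show ?thesis using m ab 3 W.mem_V_iff[of a] W.mem_V_iff[of b] by auto
    qed
  qed
  have V0L: "V0 \<subseteq> L" using abL W.V_sub by (auto simp: V0_def)
  have V0K: "V0 \<inter> K = W"
  proof (intro equalityI subsetI)
    fix z assume z: "z \<in> V0 \<inter> K"
    show "z \<in> W"
    proof (cases "z = 0")
      case False
      have "norm z = z ^ 2" using z by (simp add: norm_def conj_K power2_eq_square)
      then show ?thesis using z False normV0[of z] K_sub_L W.mem_V_iff[of z] W.ord_power[of z 2] by auto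
    qed (simp add: W.V_0)
  next
    fix z assume "z \<in> W"
    then have "z = z + 0 * q" "z \<in> W" "z \<in> K" using W.V_sub by auto
    then show "z \<in> V0 \<inter> K" using W.V_0 unfolding V0_def by blast
  qed
  have V0I: "x + y * q \<in> V0" if "x \<in> W" "y \<in> W" for x y using that unfolding V0_def by blast
  have V0p: "V0 \<in> places L"
    unfolding places_iff
  proof (intro conjI ballI)
    show "range const_emb \<subseteq> V0" using V0K W.V_const by blast
    fix a assume a: "a \<in> V0"
    then obtain a1 a2 where a': "a1 \<in> W" "a2 \<in> W" "a = a1 + a2 * q" by (auto simp: V0_def)
    show "- a \<in> V0" using V0I[OF W.V_minus[OF a'(1)] W.V_minus[OF a'(2)]] by (simp add: a'(3))
    fix b assume b: "b \<in> V0"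
    then obtain b1 b2 where b': "b1 \<in> W" "b2 \<in> W" "b = b1 + b2 * q" by (auto simp: V0_def)
    have "(a1 + b1) + (a2 + b2) * q \<in> V0" by (intro V0I W.V_add a' b')
    then show "a + b \<in> V0" by (simp add: a'(3) b'(3) algebra_simps)
    have "\<tau> \<in> W" using \<tau> W.mem_V_iff by simp
    then have "(a1 * b1 + a2 * b2 * \<tau>) + (a1 * b2 + a2 * b1) * q \<in> V0"
      by (intro V0I W.V_add W.V_mult a' b')
    then show "a * b \<in> V0" by (simp add: a'(3) b'(3) algebra_simps power2_eq_square \<tau>_def)
  next
    have "W \<noteq> K" by (rule W.V_neq)
    then show "V0 \<subset> L" using V0L V0K K_sub_L W.V_sub by blast
  next
    fix z assume z: "z \<in> L"
    show "z \<in> V0 \<or> inverse z \<in> V0"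
    proof (cases "z = 0")
      case False
      then show ?thesis using normV0[of z] normV0[of "inverse z"] z
          W.ord_inverse[OF norm_K[OF z]] by (simp add: norm_inverse L.inv norm_0_iff, linarith)
    next
      case True
      then show ?thesis using V0K W.V_0 by blast
    qed
  qed
  have ordV: "ord_at V (q powi n * w) = n"
    if V: "V \<in> places L" "V \<inter> K = W" and w: "w \<in> place_units V" for V n w
  proof -
    interpret V: place L V using V by unfold_locales
    have "\<exists>n::int. \<exists>w\<in>place_units V. z = q powi n * w" if "z \<in> L" "z \<noteq> 0" for z
      using fact[OF that] V by blast
    then show ?thesis by (rule V.ord_at_eqI[OF qV[OF V] q0 _ w])
  qed
  have ordN: "ord_at W (norm z) = ord_at V z" if V: "V \<in> places L" "V \<inter> K = W" and z: "z \<in> L" "z \<noteq> 0" for V z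
  proof -
    interpret V: place L V using V by unfold_locales
    obtain n w where w: "z = q powi n * w" "w \<in> place_units V" "conj w \<in> place_units V"
      using fact[OF z] V by blast
    have wL: "w \<in> L" using w V.V_sub V.unit_sub by blast
    then have wn: "norm w \<in> K" using norm_K by blast
    have "norm w \<in> place_units V" unfolding norm_def using w V.unit_mult by blast
    then have "norm w \<in> place_units W" using V wn inv by (auto simp: place_units_iff)
    then have o: "ord_at W (norm w) = 0" "norm w \<noteq> 0" using wn W.mem_units_iff by (auto simp: place_units_iff)
    have nq: "norm q = - \<tau>" by (simp add: norm_def cq \<tau>_def power2_eq_square)
    have "norm (q powi n) = (- \<tau>) powi n"
      unfolding norm_def using qL by (simp add: conj_powi nq[symmetric] norm_def power_int_mult_distrib)
    then have "norm z = (- \<tau>) powi n * norm w" using w wL qL by (simp add: norm_mult L.powi)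
    then have "ord_at W (norm z) = n" using o wn \<tau> by (simp add: W.ord_mult W.ord_powi W.ord_minus closed)
    moreover have "ord_at V z = n" unfolding w(1) by (rule ordV[OF V w(2)])
    ultimately show ?thesis by simp
  qed
  have memV: "V = V0" if V: "V \<in> places L" "V \<inter> K = W" for V
  proof -
    interpret V: place L V using V by unfold_locales
    have "z \<in> V \<longleftrightarrow> z \<in> V0" if z: "z \<in> L" "z \<noteq> 0" for z
    proof -
      obtain n w where w: "z = q powi n * w" "w \<in> place_units V" using fact[OF z] V by blast
      have "z \<in> V \<longleftrightarrow> n \<ge> 0" unfolding w(1) by (rule V.powi_mem_iff[OF qV[OF V] q0 w(2)])
      moreover have "ord_at V z = n" unfolding w(1) by (rule ordV[OF V w(2)])
      ultimately show ?thesis using normV0[OF z] ordN[OF V z] by simp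
    qed
    moreover have "0 \<in> V" "0 \<in> V0" using V.V_0 V0K W.V_0 by auto
    ultimately show ?thesis using V0L place_sub[OF V(1)] by blast
  qed
  interpret V: place L V0 using V0p by unfold_locales
  have qV0: "q \<in> max_ideal V0" by (rule qV[OF V0p V0K])
  have disc: "discrete_at L V0"
    unfolding discrete_at_def
  proof (intro conjI ballI)
    show "\<exists>t\<in>max_ideal V0. t \<noteq> 0 \<and> (\<forall>z\<in>L. z \<noteq> 0 \<longrightarrow> (\<exists>n. \<exists>w\<in>place_units V0. z = t powi n * w))"
    proof (intro bexI[of _ q] conjI ballI impI q0 qV0)
      show "\<exists>n. \<exists>w\<in>place_units V0. z = q powi n * w" if "z \<in> L" "z \<noteq> 0" for z
        using fact[OF that] V0p V0K by blast
    qed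
    fix z assume "z \<in> V0"
    then obtain a b where ab: "a \<in> W" "b \<in> W" "z = a + b * q" by (auto simp: V0_def)
    obtain c where c: "a - const_emb c \<in> max_ideal W" using W.residue ab by blast
    have "a - const_emb c \<in> max_ideal V0"
      using ideal_restrict[of "a - const_emb c" V0] c V0K W.V_sub ab by (simp add: closed)
    then have "(a - const_emb c) + b * q \<in> max_ideal V0"
      using qV0 ab V0K by (blast intro: V.ideal_add V.ideal_mult2)
    then show "\<exists>c. z - const_emb c \<in> max_ideal V0" using ab by (auto simp: algebra_simps)
  qed
  have c0: "conj ` V0 = V0" by (rule memV) (use conj_place V0p conj_restrict[OF V0L] V0K in auto)
  have "ord_at V0 z = 2 * ord_at W z" if "z \<in> K" "z \<noteq> 0" for z
    using ordN[OF V0p V0K, of z] that K_sub_L W.ord_power[of z 2]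
    by (simp add: norm_def conj_K flip: power2_eq_square)
  moreover have "{V' \<in> places L. V' \<inter> K = W} = {V0}" using memV V0p V0K by blast
  ultimately have "fibre W V0" unfolding fibre_def c0 using V0p V0K disc odd by simp
  then show ?thesis ..
qed

end

context quad_ext begin

text \<open>Now \<open>q\<close> is scaled to a unit whose square has a residue \<open>c0^2\<close>.
  The two places above \<open>W\<close> are the ones at which \<open>q\<close> has the residue
  \<open>c0\<close> or \<open>- c0\<close>; these differ because the characteristic is not 2. The
  predicate \<open>good\<close> selects the first, and \<open>t\<close> remains a uniformizer
  there.\<close>

lemma unramified:
  assumes W: "W \<in> places K" and even: "even (ord_at W (s ^ 2))"
  shows "\<exists>V. fibre W V"
proof -
  interpret W: discrete_place K W using place W .
  obtain t where t: "t \<in> K" "t \<noteq> 0" "ord_at W t = 1" by (rule W.ord_1_exists)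
  obtain j where j: "ord_at W (s ^ 2) = 2 * j" using even by (elim evenE)
  define r where "r = t powi (- j)"
  have r: "r \<in> K" "r \<noteq> 0" "ord_at W r = - j" using t by (auto simp: r_def powi W.ord_powi)
  define q where "q = r * s"
  define \<omega> where "\<omega> = q ^ 2"
  have q0: "q \<noteq> 0" using r s_neq_0 by (simp add: q_def)
  have qL: "q \<in> L" using r by (simp add: q_def L.mult K_sub_L s_L)
  have cq: "conj q = - q" using r by (simp add: q_def conj_mult K_sub_L s_L conj_K conj_s)
  have \<omega>K: "\<omega> \<in> K" "\<omega> \<noteq> 0" "ord_at W \<omega> = 0"
    using r s_sq s_neq_0 j
    by (auto simp: \<omega>_def q_def power_mult_distrib closed W.ord_mult W.ord_power)
  then have \<omega>W: "\<omega> \<in> place_units W" using W.mem_units_iff by simp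
  \<comment> \<open>The residue of \<open>q^2\<close> lies in the algebraically closed field
    \<open>k\<close> and so is a square; this excludes inertia.\<close>
  obtain c0 where c0: "c0 \<noteq> 0" "\<omega> - const_emb (c0 ^ 2) \<in> max_ideal W"
  proof -
    obtain c where c: "c \<noteq> 0" "\<omega> - const_emb c \<in> max_ideal W" using W.residue_unit[OF \<omega>W] by blast
    obtain d where "d ^ 2 = c" using nth_root_exists[of 2 c] by auto
    then show thesis using that[of d] c by auto
  qed
  have reprq: "\<exists>a\<in>K. \<exists>b\<in>K. z = a + b * q" if z: "z \<in> L" for z
  proof -
    obtain a b where ab: "a \<in> K" "b \<in> K" "z = a + b * s" by (rule L_E[OF z])
    then have "z = a + (b / r) * q" using r by (simp add: q_def)
    then show ?thesis using ab r div by blast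
  qed
  have conjq: "conj (a + b * q) = a - b * q" if "a \<in> K" "b \<in> K" for a b
    using that qL by (simp add: conj_add conj_mult K_sub_L L.mult conj_K cq)
  have abL: "a + b * q \<in> L" if "a \<in> K" "b \<in> K" for a b
    using that qL by (simp add: L.add L.mult K_sub_L)
  have rep: "a = c \<and> b = d" if "a \<in> K" "b \<in> K" "c \<in> K" "d \<in> K" "a + b * q = c + d * q" for a b c d
    using repr_unique[of a "b * r" c "d * r"] that r by (simp add: q_def closed mult_ac)
  have tI: "t \<in> max_ideal W" using t W.mem_ideal_iff by simp
  define B where "B = {a + b * q | a b. a \<in> W \<and> b \<in> W}"
  \<comment> \<open>\<open>B\<close> is \<open>W[q]\<close>, and \<open>G\<close> is the complement
    in \<open>B\<close> of the prime ideal of elements that vanish when \<open>q\<close> is replaced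
    by \<open>c0\<close>. The place will be the localization of \<open>B\<close> at this
    ideal.\<close>
  define G where "G = {a + b * q | a b. a \<in> W \<and> b \<in> W \<and> a + b * const_emb c0 \<notin> max_ideal W}"
  define good where "good V \<longleftrightarrow> V \<in> places L \<and> V \<inter> K = W \<and> q - const_emb c0 \<in> max_ideal V" for V
  have GB: "G \<subseteq> B" by (auto simp: G_def B_def)
  have BL: "B \<subseteq> L" using abL W.V_sub by (auto simp: B_def)
  have G0: "0 \<notin> G"
  proof
    assume "0 \<in> G"
    then obtain a b where "a \<in> W" "b \<in> W" "0 = a + b * q" and n: "a + b * const_emb c0 \<notin> max_ideal W"
      by (auto simp: G_def)
    then have "a = 0 \<and> b = 0" using rep[of 0 0 a b] W.V_sub zero by simp
    then show False using n W.ideal_0 by simp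
  qed
  have unitG: "u \<in> G" if "u \<in> place_units W" for u
  proof -
    have "u \<in> W" "u \<notin> max_ideal W" using that W.unit_not_ideal by auto
    moreover have "u = u + 0 * q" "u + 0 * const_emb c0 = u" by auto
    ultimately show ?thesis unfolding G_def using W.V_0 by (intro CollectI exI[of _ u] exI[of _ 0]) auto
  qed
  have resG: "z \<in> V \<and> (\<exists>c. z - const_emb c \<in> max_ideal V) \<and> (z \<in> G \<longrightarrow> z \<in> place_units V)"
    if "good V" "z \<in> B" for V z
  proof -
    have V: "V \<in> places L" "V \<inter> K = W" "q - const_emb c0 \<in> max_ideal V" using that by (auto simp: good_def)
    interpret V: place L V using V by unfold_locales
    have I: "x \<in> max_ideal W \<longleftrightarrow> x \<in> max_ideal V" if "x \<in> K" for x
      using ideal_restrict[OF that, of V] V by simp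
    obtain a b where ab: "a \<in> W" "b \<in> W" "z = a + b * q" using \<open>z \<in> B\<close> by (auto simp: B_def)
    have q: "q \<in> V" using V.V_add[OF V.ideal_sub[OF V(3)] V.V_const[of c0]] by simp
    have abK: "a \<in> V" "b \<in> V" "a \<in> K" "b \<in> K" using ab W.V_sub V(2) by auto
    have zV: "z \<in> V" unfolding ab(3) by (intro V.V_closed abK q)
    have d: "z - (a + b * const_emb c0) \<in> max_ideal V"
      using V.ideal_mult2[OF abK(2) V(3)] by (simp add: ab(3) algebra_simps)
    obtain c where "(a + b * const_emb c0) - const_emb c \<in> max_ideal W"
      using W.residue[of "a + b * const_emb c0"] ab by (auto simp: W.V_closed)
    then have "(a + b * const_emb c0) - const_emb c \<in> max_ideal V" using I abK by (simp add: closed)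
    from V.ideal_add[OF d this] have c: "z - const_emb c \<in> max_ideal V" by simp
    have "z \<in> place_units V" if zG: "z \<in> G"
    proof -
      obtain a' b' where ab': "a' \<in> W" "b' \<in> W" "z = a' + b' * q" "a' + b' * const_emb c0 \<notin> max_ideal W"
        using zG unfolding G_def by blast
      have "a' = a \<and> b' = b"
        by (rule rep[OF W.V_sub[OF ab'(1)] W.V_sub[OF ab'(2)] W.V_sub[OF ab(1)] W.V_sub[OF ab(2)]
              trans[OF ab'(3)[symmetric] ab(3)]])
      then have "a + b * const_emb c0 \<notin> max_ideal W" using ab'(4) by simp
      then have n: "a + b * const_emb c0 \<notin> max_ideal V" using I abK by (simp add: closed)
      have "z \<notin> max_ideal V"
      proof
        assume "z \<in> max_ideal V"
        from V.ideal_diff[OF this d] n show False by simp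
      qed
      then show ?thesis using zV V.unit_not_ideal by blast
    qed
    then show ?thesis using zV c by blast
  qed
  have normB: "(a + b * q) * (a - b * q) = a ^ 2 - b ^ 2 * \<omega>" for a b
    by (simp add: \<omega>_def algebra_simps power2_eq_square)
  have fact: "\<exists>n. \<exists>\<beta>\<in>G. \<exists>\<gamma>\<in>G. z = t powi n * (\<beta> / \<gamma>)" if z: "z \<in> L" "z \<noteq> 0" for z
  proof -
    obtain a b where ab: "a \<in> K" "b \<in> K" "z = a + b * q" using reprq[OF z(1)] by blast
    \<comment> \<open>The smaller order of the two coefficients, a vanishing coefficient being left
      out because it has no order. Dividing by \<open>t powi k\<close> makes both integral and at
      least one of them a unit.\<close>
    define k where "k = (if a = 0 then ord_at W b else if b = 0 then ord_at W a else min (ord_at W a) (ord_at W b))"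
    define a' where "a' = a * t powi (- k)"
    define b' where "b' = b * t powi (- k)"
    have tk: "t powi (- k) \<in> K" "t powi (- k) \<noteq> 0" "ord_at W (t powi (- k)) = - k"
      using t by (auto simp: powi W.ord_powi)
    have aK: "a' \<in> K" "b' \<in> K" using ab tk by (auto simp: a'_def b'_def closed)
    have oa: "ord_at W a' = ord_at W a - k" if "a \<noteq> 0" using that ab tk by (simp add: a'_def W.ord_mult)
    have ob: "ord_at W b' = ord_at W b - k" if "b \<noteq> 0" using that ab tk by (simp add: b'_def W.ord_mult)
    have a'0: "a' = 0 \<longleftrightarrow> a = 0" and b'0: "b' = 0 \<longleftrightarrow> b = 0" using tk by (auto simp: a'_def b'_def)
    have aW: "a' \<in> W" "b' \<in> W"
      using oa ob aK a'0 b'0 W.mem_V_iff[of a'] W.mem_V_iff[of b'] W.V_0 by (auto simp: k_def split: if_splits)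
    have unit: "a' \<notin> max_ideal W \<or> b' \<notin> max_ideal W"
      using oa ob aK a'0 b'0 z ab W.mem_ideal_iff[of a'] W.mem_ideal_iff[of b'] by (auto simp: k_def split: if_splits)
    have zz: "z = t powi k * (a' + b' * q)"
      using t ab by (simp add: a'_def b'_def power_int_minus field_simps)
    show ?thesis
    proof (cases "a' + b' * const_emb c0 \<in> max_ideal W")
      case False
      then have "a' + b' * q \<in> G" using aW by (auto simp: G_def)
      then show ?thesis using unitG[OF W.unit_1] zz by (metis div_by_1)
    next
      case True
      have n: "a' - b' * const_emb c0 \<notin> max_ideal W"
      proof
        assume n: "a' - b' * const_emb c0 \<in> max_ideal W"
        have "(const_emb (1/2) * ((a' + b' * const_emb c0) + (a' - b' * const_emb c0))) \<in> max_ideal W"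
          by (intro W.ideal_mult2 W.ideal_add True n W.V_const)
        moreover have "(const_emb (1/2) * ((a' + b' * const_emb c0) + (a' - b' * const_emb c0))) = a'"
          using ambient_2_neq_0[where 'k = 'k] by (simp add: const_emb_divide const_emb_numeral field_simps)
        ultimately have 1: "a' \<in> max_ideal W" by (simp only:)
        have "(const_emb (1/c0) * ((a' + b' * const_emb c0) - a')) \<in> max_ideal W"
          by (intro W.ideal_mult2 W.ideal_diff True 1 W.V_const)
        moreover have "(const_emb (1/c0) * ((a' + b' * const_emb c0) - a')) = b'"
          using c0 by (simp add: const_emb_divide)
        ultimately have "b' \<in> max_ideal W" by (simp only:)
        then show False using unit 1 by simp
      qed
      \<comment> \<open>If the numerator vanishes at \<open>q = c0\<close>, its conjugate does not:
        otherwise \<open>a'\<close> and \<open>b'\<close> would both lie in the maximal ideal.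
        Multiplying by this conjugate gives the norm \<open>N\<close> in \<open>K\<close>, where
        orders are known.\<close>
      define \<gamma> where "\<gamma> = a' + (- b') * q"
      have \<gamma>G: "\<gamma> \<in> G" unfolding G_def \<gamma>_def using aW n by (intro CollectI exI[of _ a'] exI[of _ "- b'"]) (auto simp: W.V_minus)
      then have \<gamma>0: "\<gamma> \<noteq> 0" using G0 by auto
      define N where "N = a' ^ 2 - b' ^ 2 * \<omega>"
      have NK: "N \<in> K" using aK \<omega>K by (simp add: N_def closed)
      have Neq: "(a' + b' * q) * \<gamma> = N" using normB[of a' b'] by (simp add: \<gamma>_def N_def)
      have N0: "N \<noteq> 0" using z zz \<gamma>0 Neq by auto
      define i where "i = ord_at W N"
      define u where "u = N * t powi (- i)"
      have "u \<in> place_units W"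
        using NK N0 t by (subst W.mem_units_iff) (auto simp: u_def i_def closed W.ord_mult W.ord_powi)
      then have uG: "u \<in> G" using unitG by blast
      have "z = t powi (k + i) * (u / \<gamma>)"
      proof -
        have e: "a' + b' * q = N / \<gamma>" using \<gamma>0 Neq by (simp add: eq_divide_eq)
        show ?thesis unfolding zz e using t by (simp add: u_def power_int_add power_int_minus)
      qed
      then show ?thesis using uG \<gamma>G by blast
    qed
  qed
  have factV: "\<exists>n w. z = t powi n * w \<and> (\<forall>V. good V \<longrightarrow> w \<in> place_units V \<and> (\<exists>c. w - const_emb c \<in> max_ideal V))"
    if z: "z \<in> L" "z \<noteq> 0" for z
  proof -
    obtain n \<beta> \<gamma> where n: "\<beta> \<in> G" "\<gamma> \<in> G" "z = t powi n * (\<beta> / \<gamma>)" using fact[OF z] by blast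
    have "\<beta> / \<gamma> \<in> place_units V \<and> (\<exists>c. \<beta> / \<gamma> - const_emb c \<in> max_ideal V)" if V: "good V" for V
    proof -
      interpret V: place L V using V by unfold_locales (simp add: good_def)
      have u: "\<beta> \<in> place_units V" "\<gamma> \<in> place_units V" using resG[OF V] n GB by auto
      obtain c d where c: "\<beta> - const_emb c \<in> max_ideal V" and d: "\<gamma> - const_emb d \<in> max_ideal V"
        using resG[OF V] n GB by blast
      have d0: "d \<noteq> 0"
      proof
        assume "d = 0"
        then have "\<gamma> \<in> max_ideal V" using d by simp
        then show False using u(2) V.unit_not_ideal by blast
      qed
      have "inverse \<gamma> \<in> V" using u(2) by (simp add: place_units_iff)
      then have i: "inverse \<gamma> * const_emb (inverse d) \<in> V" by (intro V.V_mult V.V_const)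
      have \<gamma>0: "\<gamma> \<noteq> 0" using n G0 by auto
      have "((\<beta> - const_emb c) * const_emb d - const_emb c * (\<gamma> - const_emb d)) * (inverse \<gamma> * const_emb (inverse d)) \<in> max_ideal V"
        by (intro V.ideal_mult V.ideal_diff V.ideal_mult2 c d i V.V_const)
      moreover have "((\<beta> - const_emb c) * const_emb d - const_emb c * (\<gamma> - const_emb d)) * (inverse \<gamma> * const_emb (inverse d))
         = \<beta> / \<gamma> - const_emb (c / d)"
        using d0 \<gamma>0 by (simp add: const_emb_divide const_emb_inverse field_simps)
      ultimately have "\<beta> / \<gamma> - const_emb (c / d) \<in> max_ideal V" by (simp only:)
      then show ?thesis using V.unit_divide[OF u] by blast
    qed
    then show ?thesis using n by blast
  qed
  have tV: "t \<in> max_ideal V" if "good V" for V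
    using that tI t ideal_restrict[of t V] by (simp add: good_def)
  have ordV: "ord_at V (t powi n * w) = n" if V: "good V" and w: "w \<in> place_units V" for V n w
  proof -
    interpret V: place L V using V by unfold_locales (simp add: good_def)
    have "\<exists>n::int. \<exists>w\<in>place_units V. z = t powi n * w" if "z \<in> L" "z \<noteq> 0" for z
      using factV[OF that] V by blast
    then show ?thesis by (rule V.ord_at_eqI[OF tV[OF V] t(2) _ w])
  qed
  have unique: "V = V'" if V: "good V" "good V'" for V V'
  proof -
    interpret V: place L V using V by unfold_locales (simp add: good_def)
    interpret V': place L V' using V by unfold_locales (simp add: good_def)
    have "z \<in> V \<longleftrightarrow> z \<in> V'" if z: "z \<in> L" "z \<noteq> 0" for z
    proof -
      obtain n w where w: "z = t powi n * w" "w \<in> place_units V" "w \<in> place_units V'"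
        using factV[OF z] V by blast
      show ?thesis unfolding w(1)
        using V.powi_mem_iff[OF tV[OF V(1)] t(2) w(2)] V'.powi_mem_iff[OF tV[OF V(2)] t(2) w(3)] by simp
    qed
    then show ?thesis using V.V_0 V'.V_0 V.V_sub V'.V_sub by blast
  qed
  have disc: "discrete_at L V" if V: "good V" for V
    unfolding discrete_at_def
  proof (intro conjI ballI)
    interpret V: place L V using V by unfold_locales (simp add: good_def)
    show "\<exists>t\<in>max_ideal V. t \<noteq> 0 \<and> (\<forall>z\<in>L. z \<noteq> 0 \<longrightarrow> (\<exists>n. \<exists>w\<in>place_units V. z = t powi n * w))"
    proof (intro bexI[of _ t] conjI ballI impI t(2) tV[OF V])
      show "\<exists>n. \<exists>w\<in>place_units V. z = t powi n * w" if "z \<in> L" "z \<noteq> 0" for z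
        using factV[OF that] V by blast
    qed
    fix z assume z: "z \<in> V"
    show "\<exists>c. z - const_emb c \<in> max_ideal V"
    proof (cases "z \<in> max_ideal V")
      case True
      then show ?thesis by (intro exI[of _ 0]) simp
    next
      case False
      then have zu: "z \<in> place_units V" using z V.unit_not_ideal by blast
      then obtain n w where w: "z = t powi n * w" "w \<in> place_units V" "\<exists>c. w - const_emb c \<in> max_ideal V"
        using factV[of z] V V.V_sub[OF z] by (auto simp: place_units_iff)
      have "t powi n = z / w" using w by (auto simp: place_units_iff)
      then have "n = 0" using V.powi_unit_imp_0[OF tV[OF V] t(2)] V.unit_divide[OF zu w(2)] by simp
      then show ?thesis using w by simp
    qed
  qed
  have ordK: "ord_at V z = ord_at W z" if V: "good V" and z: "z \<in> K" "z \<noteq> 0" for V z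
  proof -
    define w where "w = z * t powi (- ord_at W z)"
    have "w \<in> place_units W"
      using z t by (subst W.mem_units_iff) (auto simp: w_def closed W.ord_mult W.ord_powi)
    then have "w \<in> place_units V" using unit_restrict V by (auto simp: good_def)
    moreover have "z = t powi (ord_at W z) * w" using t by (simp add: w_def power_int_minus)
    ultimately show ?thesis using ordV[OF V] by metis
  qed
  have not_conj: "conj ` V \<noteq> V" if V: "good V" for V
  proof
    interpret V: place L V using V by unfold_locales (simp add: good_def)
    assume "conj ` V = V"
    moreover have "q - const_emb c0 \<in> max_ideal V" using V by (simp add: good_def)
    ultimately have "conj (q - const_emb c0) \<in> max_ideal V"
      using ideal_conj[of V "q - const_emb c0"] V place_sub qL by (simp add: good_def L.closed)
    then have "- q - const_emb c0 \<in> max_ideal V" using qL by (simp add: conj_diff cq conj_const L.const)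
    moreover have "q - const_emb c0 \<in> max_ideal V" using V by (simp add: good_def)
    ultimately have "(q - const_emb c0) + (- q - const_emb c0) \<in> max_ideal V" by (intro V.ideal_add)
    moreover have "(q - const_emb c0) + (- q - const_emb c0) = const_emb (- 2 * c0)" by (simp add: const_emb_hom)
    ultimately have "const_emb (- 2 * c0) \<in> max_ideal V" by (simp only:)
    then show False using c0 by (simp only: V.const_not_ideal) simp
  qed
  have over: "good V \<or> good (conj ` V)" if V: "V \<in> places L" "V \<inter> K = W" for V
  proof -
    interpret V: place L V using V by unfold_locales
    have "q \<in> V"
      by (rule V.V_integral[of q 0 "- \<omega>"]) (use qL \<omega>W W.unit_sub V V.V_closed in \<open>auto simp: \<omega>_def\<close>)
    moreover have "\<omega> - const_emb (c0 ^ 2) \<in> max_ideal V"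
      using ideal_restrict[of "\<omega> - const_emb (c0 ^ 2)" V] c0 V \<omega>K by (simp add: closed)
    moreover have "\<omega> - const_emb (c0 ^ 2) = (q - const_emb c0) * (q + const_emb c0)"
      by (simp add: \<omega>_def const_emb_mult algebra_simps power2_eq_square)
    ultimately have "q - const_emb c0 \<in> max_ideal V \<or> q + const_emb c0 \<in> max_ideal V"
      using V.ideal_prime[of "q - const_emb c0" "q + const_emb c0"] by (simp add: V.V_closed)
    then show ?thesis
    proof
      assume "q + const_emb c0 \<in> max_ideal V"
      then have "- (q + const_emb c0) \<in> max_ideal V" by (rule V.ideal_minus)
      then have "conj (q - const_emb c0) \<in> max_ideal V" using qL by (simp add: conj_diff cq conj_const L.const)
      then have "q - const_emb c0 \<in> max_ideal (conj ` V)"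
        using ideal_conj[of V "q - const_emb c0"] V place_sub qL by (simp add: L.closed)
      then show ?thesis using V conj_place conj_restrict[of V] place_sub by (simp add: good_def)
    qed (use V in \<open>simp add: good_def\<close>)
  qed
  have ex: "\<exists>V. good V"
  proof -
    have \<omega>W': "\<omega> \<in> W" using \<omega>W W.unit_sub by blast
    have BI: "x + y * q \<in> B" if "x \<in> W" "y \<in> W" for x y using that unfolding B_def by blast
    have GI: "x + y * q \<in> G" if "x \<in> W" "y \<in> W" "x + y * const_emb c0 \<notin> max_ideal W" for x y
      using that unfolding G_def by blast
    have GE: "x + y * const_emb c0 \<notin> max_ideal W" if G: "x + y * q \<in> G" and xy: "x \<in> W" "y \<in> W" for x y
    proof -
      obtain a b where ab: "a \<in> W" "b \<in> W" "x + y * q = a + b * q" "a + b * const_emb c0 \<notin> max_ideal W"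
        using G unfolding G_def by blast
      have "x = a \<and> y = b"
        by (rule rep[OF W.V_sub[OF xy(1)] W.V_sub[OF xy(2)] W.V_sub[OF ab(1)] W.V_sub[OF ab(2)] ab(3)])
      then show ?thesis using ab by simp
    qed
    have Badd: "x + y \<in> B" if xy: "x \<in> B" "y \<in> B" for x y
    proof -
      obtain a b where 1: "a \<in> W" "b \<in> W" "x = a + b * q" using xy unfolding B_def by blast
      obtain c d where 2: "c \<in> W" "d \<in> W" "y = c + d * q" using xy unfolding B_def by blast
      have "(a + c) + (b + d) * q \<in> B" by (intro BI W.V_add 1 2)
      then show ?thesis by (simp add: 1(3) 2(3) algebra_simps)
    qed
    have Bmult: "x * y \<in> B \<and> (x \<in> G \<longrightarrow> y \<in> G \<longrightarrow> x * y \<in> G)" if xy: "x \<in> B" "y \<in> B" for x y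
    proof -
      obtain a b where 1: "a \<in> W" "b \<in> W" "x = a + b * q" using xy unfolding B_def by blast
      obtain c d where 2: "c \<in> W" "d \<in> W" "y = c + d * q" using xy unfolding B_def by blast
      have eq: "x * y = (a * c + b * d * \<omega>) + (a * d + b * c) * q"
        by (simp add: 1(3) 2(3) algebra_simps power2_eq_square \<omega>_def)
      have W: "a * c + b * d * \<omega> \<in> W" "a * d + b * c \<in> W"
        by (intro W.V_add W.V_mult 1 2 \<omega>W')+
      have "x * y \<in> G" if G: "x \<in> G" "y \<in> G"
      proof -
        have "a + b * const_emb c0 \<notin> max_ideal W" "c + d * const_emb c0 \<notin> max_ideal W"
          using GE[OF _ 1(1,2)] GE[OF _ 2(1,2)] G 1(3) 2(3) by simp_all
        moreover have "a + b * const_emb c0 \<in> W" "c + d * const_emb c0 \<in> W"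
          by (intro W.V_add W.V_mult W.V_const 1 2)+
        ultimately have n: "(a + b * const_emb c0) * (c + d * const_emb c0) \<notin> max_ideal W"
          using W.ideal_prime by blast
        have e: "(a + b * const_emb c0) * (c + d * const_emb c0) =
           (a * c + b * d * \<omega>) + (a * d + b * c) * const_emb c0 - (b * d) * (\<omega> - const_emb (c0 ^ 2))"
          by (simp add: algebra_simps const_emb_mult power2_eq_square)
        have "(b * d) * (\<omega> - const_emb (c0 ^ 2)) \<in> max_ideal W"
          by (intro W.ideal_mult2 c0 W.V_mult 1 2)
        then have "(a * c + b * d * \<omega>) + (a * d + b * c) * const_emb c0 \<notin> max_ideal W"
          using n W.ideal_diff unfolding e by blast
        then show ?thesis unfolding eq by (intro GI W)
      qed
      then show ?thesis using BI[OF W] eq by simp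
    qed
    have Bmin: "- x \<in> B" if xy: "x \<in> B" for x
    proof -
      obtain a b where 1: "a \<in> W" "b \<in> W" "x = a + b * q" using xy unfolding B_def by blast
      then show ?thesis using BI[OF W.V_minus[OF 1(1)] W.V_minus[OF 1(2)]] by simp
    qed
    have WB: "a \<in> B" if "a \<in> W" for a
      using that W.V_0 unfolding B_def by (intro CollectI exI[of _ a] exI[of _ 0]) auto
    have G1: "1 \<in> G" using unitG W.unit_1 by blast
    \<comment> \<open>This prevents denominators from \<open>G\<close> from inverting non-units of
      \<open>W\<close>, so the localization meets \<open>K\<close> in \<open>W\<close> and not in
      more.\<close>
    have IBG: "x * y \<notin> G" if x: "x \<in> max_ideal W" and y: "y \<in> B" for x y
    proof
      assume G: "x * y \<in> G"
      obtain a b where 1: "a \<in> W" "b \<in> W" "y = a + b * q" using y by (auto simp: B_def)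
      have xW: "x \<in> W" using x W.ideal_sub by blast
      have "x * a + x * b * q \<in> G" using G 1(3) by (simp add: algebra_simps)
      then have "x * a + x * b * const_emb c0 \<notin> max_ideal W" by (rule GE) (intro W.V_mult xW 1)+
      moreover have "x * (a + b * const_emb c0) \<in> max_ideal W" by (intro W.ideal_mult x W.V_add W.V_mult W.V_const 1)
      ultimately show False by (simp add: algebra_simps)
    qed
    define V where "V = {\<beta> / \<gamma> | \<beta> \<gamma>. \<beta> \<in> B \<and> \<gamma> \<in> G}"
    have VI: "\<beta> / \<gamma> \<in> V" if "\<beta> \<in> B" "\<gamma> \<in> G" for \<beta> \<gamma> using that by (auto simp: V_def)
    have VE: "\<exists>\<beta>\<in>B. \<exists>\<gamma>\<in>G. \<gamma> \<noteq> 0 \<and> z = \<beta> / \<gamma>" if z: "z \<in> V" for z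
    proof -
      obtain \<beta> \<gamma> where "\<beta> \<in> B" "\<gamma> \<in> G" "z = \<beta> / \<gamma>" using z unfolding V_def by blast
      moreover from this have "\<gamma> \<noteq> 0" using G0 by metis
      ultimately show ?thesis by blast
    qed
    have BV: "x \<in> V" if "x \<in> B" for x using VI[OF that G1] by simp
    have VK: "V \<inter> K = W"
    proof (intro equalityI subsetI)
      fix z assume z: "z \<in> V \<inter> K"
      then obtain \<beta> \<gamma> where 1: "\<beta> \<in> B" "\<gamma> \<in> G" "\<gamma> \<noteq> 0" "z = \<beta> / \<gamma>" using VE by blast
      show "z \<in> W"
      proof (rule ccontr)
        assume n: "z \<notin> W"
        then have i: "inverse z \<in> max_ideal W" using z W.not_V_inverse_ideal by blast
        have "z \<noteq> 0" using n W.V_0 by auto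
        then have "inverse z * \<beta> = \<gamma>" using 1 by auto
        then show False using IBG[OF i 1(1)] 1 by simp
      qed
    qed (use WB BV W.V_sub in auto)
    have VL: "V \<subseteq> L" using BL GB unfolding V_def by (auto intro!: L.div)
    have Vp: "V \<in> places L" unfolding places_iff
    proof (intro conjI ballI)
      show "range const_emb \<subseteq> V" using VK W.V_const by blast
      show "V \<subset> L" using VL VK W.V_neq K_sub_L by blast
      fix x assume x: "x \<in> V"
      then obtain \<beta> \<gamma> where 1: "\<beta> \<in> B" "\<gamma> \<in> G" "\<gamma> \<noteq> 0" "x = \<beta> / \<gamma>" using VE by blast
      show "- x \<in> V" using VI[OF Bmin[OF 1(1)] 1(2)] 1(4) by simp
      fix y assume y: "y \<in> V"
      then obtain \<beta>' \<gamma>' where 2: "\<beta>' \<in> B" "\<gamma>' \<in> G" "\<gamma>' \<noteq> 0" "y = \<beta>' / \<gamma>'" using VE by blast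
      have g: "\<gamma> * \<gamma>' \<in> G" "\<gamma> \<in> B" "\<gamma>' \<in> B" using Bmult[of \<gamma> \<gamma>'] 1 2 GB by auto
      have "x + y = (\<beta> * \<gamma>' + \<beta>' * \<gamma>) / (\<gamma> * \<gamma>')" using 1 2 by (simp add: field_simps)
      moreover have "\<beta> * \<gamma>' + \<beta>' * \<gamma> \<in> B"
        using Badd Bmult[OF 1(1) g(3)] Bmult[OF 2(1) g(2)] by blast
      ultimately show "x + y \<in> V" using VI[OF _ g(1)] by simp
      have "x * y = (\<beta> * \<beta>') / (\<gamma> * \<gamma>')" using 1 2 by simp
      then show "x * y \<in> V" using VI[OF _ g(1)] Bmult[OF 1(1) 2(1)] by simp
    next
      fix z assume z: "z \<in> L"
      have tp: "t ^ n \<in> B" for n using WB W.V_pow[OF W.ideal_sub[OF tI]] by blast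
      have pos: "t ^ n * (\<beta> / \<gamma>) \<in> V" if "\<beta> \<in> G" "\<gamma> \<in> G" for \<beta> \<gamma> n
        using VI[of "t ^ n * \<beta>" \<gamma>] Bmult[OF tp, of \<beta> n] that GB by auto
      show "z \<in> V \<or> inverse z \<in> V"
      proof (cases "z = 0")
        case True
        then show ?thesis using BV WB W.V_0 by blast
      next
        case False
        then obtain n \<beta> \<gamma> where n: "\<beta> \<in> G" "\<gamma> \<in> G" "z = t powi n * (\<beta> / \<gamma>)" using fact z by blast
        show ?thesis
        proof (cases "n \<ge> 0")
          case True
          then show ?thesis using pos[OF n(1,2), of "nat n"] n by (simp add: power_int_def)
        next
          case False
          then have "inverse z = t ^ nat (- n) * (\<gamma> / \<beta>)" using n by (simp add: power_int_def field_simps)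
          then show ?thesis using pos[OF n(2,1)] by metis
        qed
      qed
    qed
    show ?thesis using over[OF Vp VK] by blast
  qed
  then obtain V where V: "good V" by blast
  have set: "{V' \<in> places L. V' \<inter> K = W} = {V, conj ` V}"
  proof (intro equalityI subsetI)
    fix V' assume V': "V' \<in> {V' \<in> places L. V' \<inter> K = W}"
    then consider "good V'" | "good (conj ` V')" using over by blast
    then show "V' \<in> {V, conj ` V}"
    proof cases
      case 2
      then show ?thesis using unique[OF V 2] conj_image_conj[of V'] place_sub V' by auto
    qed (use unique V in auto)
  next
    fix V' assume "V' \<in> {V, conj ` V}"
    then show "V' \<in> {V' \<in> places L. V' \<inter> K = W}"
      using V conj_place[of V] conj_restrict[of V] place_sub[of V] by (auto simp: good_def)
  qed
  have "V \<in> places L" "V \<inter> K = W" using V by (auto simp: good_def)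
  then have "fibre W V" unfolding fibre_def
    using set disc[OF V] not_conj[OF V] even ordK[OF V] by simp
  then show ?thesis ..
qed

end

section \<open>Divisors\<close>

definition divisors :: "'k::field ambient set \<Rightarrow> ('k ambient set \<Rightarrow>\<^sub>0 int) set" where
  "divisors K = {D. Poly_Mapping.keys D \<subseteq> places K}"

lemma divisors_0 [simp]: "0 \<in> divisors K"
  by (simp add: divisors_def)

lemma divisors_add [simp]: "D \<in> divisors K \<Longrightarrow> E \<in> divisors K \<Longrightarrow> D + E \<in> divisors K"
  unfolding divisors_def using keys_add[of D E] by auto

lemma divisors_minus [simp]: "D \<in> divisors K \<Longrightarrow> - D \<in> divisors K"
  unfolding divisors_def by simp

lemma divisors_diff [simp]: "D \<in> divisors K \<Longrightarrow> E \<in> divisors K \<Longrightarrow> D - E \<in> divisors K"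
  using divisors_add[of D K "- E"] divisors_minus[of E K] by simp

lemma divisors_frag_of [simp]: "frag_of V \<in> divisors K \<longleftrightarrow> V \<in> places K"
  by (simp add: divisors_def)

lemma divisors_cmul [simp]: "D \<in> divisors K \<Longrightarrow> frag_cmul n D \<in> divisors K"
  unfolding divisors_def using keys_cmul[of n D] by blast

lemma divisors_lookup: "D \<in> divisors K \<Longrightarrow> V \<notin> places K \<Longrightarrow> Poly_Mapping.lookup D V = 0"
  unfolding divisors_def by (metis (mono_tags, lifting) in_keys_iff mem_Collect_eq subsetD)

lemma divisor_eqI:
  assumes "D \<in> divisors K" "E \<in> divisors K"
    "\<And>V. V \<in> places K \<Longrightarrow> Poly_Mapping.lookup D V = Poly_Mapping.lookup E V"
  shows "D = E"
proof (rule poly_mapping_eqI)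
  show "Poly_Mapping.lookup D V = Poly_Mapping.lookup E V" for V
    using assms divisors_lookup[of D K V] divisors_lookup[of E K V] by (cases "V \<in> places K") auto
qed

lemma divisors_extend:
  assumes "D \<in> divisors L" "\<And>V. V \<in> places L \<Longrightarrow> g V \<in> places K"
  shows "frag_extend (\<lambda>V. frag_of (g V)) D \<in> divisors K"
  using keys_frag_extend[of "\<lambda>V. frag_of (g V)" D] assms by (auto simp: divisors_def)

lemma has_divisor_divisors: "has_divisor K z D \<Longrightarrow> D \<in> divisors K"
  by (simp add: has_divisor_def divisors_def)

lemma has_divisor_unique: "has_divisor K z D \<Longrightarrow> has_divisor K z E \<Longrightarrow> D = E"
  by (rule divisor_eqI[of _ K]) (auto simp: has_divisor_def divisors_def)

lemma divisor_degree_eq_sum: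
  assumes "finite A" "Poly_Mapping.keys D \<subseteq> A"
  shows "divisor_degree D = (\<Sum>V\<in>A. Poly_Mapping.lookup D V)"
  unfolding divisor_degree_def
  by (rule sum.mono_neutral_left) (use assms in \<open>auto simp: in_keys_iff\<close>)

lemma divisor_degree_add [simp]: "divisor_degree (D + E) = divisor_degree D + divisor_degree E"
proof -
  let ?A = "Poly_Mapping.keys D \<union> Poly_Mapping.keys E"
  have "divisor_degree (D + E) = (\<Sum>V\<in>?A. Poly_Mapping.lookup (D + E) V)"
    by (rule divisor_degree_eq_sum) (auto simp: keys_add)
  also have "\<dots> = (\<Sum>V\<in>?A. Poly_Mapping.lookup D V) + (\<Sum>V\<in>?A. Poly_Mapping.lookup E V)"
    by (simp add: lookup_add sum.distrib)
  also have "\<dots> = divisor_degree D + divisor_degree E"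
    using divisor_degree_eq_sum[of ?A D] divisor_degree_eq_sum[of ?A E] by simp
  finally show ?thesis .
qed

lemma divisor_degree_0 [simp]: "divisor_degree 0 = 0"
  by (simp add: divisor_degree_def)

lemma divisor_degree_frag_of [simp]: "divisor_degree (frag_of V) = 1"
  by (simp add: divisor_degree_def)

lemma divisor_degree_minus [simp]: "divisor_degree (- D) = - divisor_degree D"
  using divisor_degree_add[of D "- D"] by simp

lemma divisor_degree_diff [simp]: "divisor_degree (D - E) = divisor_degree D - divisor_degree E"
  using divisor_degree_add[of D "- E"] by simp

lemma divisor_degree_cmul [simp]: "divisor_degree (frag_cmul n D) = n * divisor_degree D"
proof (cases "n = 0")
  case False
  then have "Poly_Mapping.keys (frag_cmul n D) = Poly_Mapping.keys D" by auto
  then show ?thesis by (simp add: divisor_degree_def sum_distrib_left)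
qed simp

lemma divisor_degree_extend [simp]:
  "divisor_degree (frag_extend (\<lambda>V. frag_of (g V)) D) = divisor_degree D"
proof (rule frag_induction[of D UNIV "\<lambda>D. divisor_degree (frag_extend (\<lambda>V. frag_of (g V)) D) = divisor_degree D"])
qed (auto simp: frag_extend_diff)

text \<open>\<open>A\<close> may contain points outside the support of \<open>D\<close>, where the
  coefficient is 0; so it can be taken to be a whole fibre.\<close>

lemma lookup_frag_extend:
  assumes "finite A" "\<And>V. V \<in> Poly_Mapping.keys D \<Longrightarrow> g V = W \<Longrightarrow> V \<in> A" "\<And>V. V \<in> A \<Longrightarrow> g V = W"
  shows "Poly_Mapping.lookup (frag_extend (\<lambda>V. frag_of (g V)) D) W = (\<Sum>V\<in>A. Poly_Mapping.lookup D V)"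
proof -
  have "Poly_Mapping.lookup (frag_extend (\<lambda>V. frag_of (g V)) D) W =
      (\<Sum>V\<in>Poly_Mapping.keys D. if g V = W then Poly_Mapping.lookup D V else 0)"
    unfolding frag_extend_def lookup_sum by (rule sum.cong) (auto simp: lookup_single)
  also have "\<dots> = (\<Sum>V\<in>{V \<in> Poly_Mapping.keys D. g V = W}. Poly_Mapping.lookup D V)"
    by (simp add: sum.If_cases Int_def)
  also have "\<dots> = (\<Sum>V\<in>A. Poly_Mapping.lookup D V)"
    by (rule sum.mono_neutral_left) (use assms in \<open>auto simp: in_keys_iff\<close>)
  finally show ?thesis .
qed

context discrete_field
begin

lemma has_divisor_1: "has_divisor K 1 0"
  using discrete_place.ord_1[OF place] by (auto simp: has_divisor_def)

lemma has_divisor_mult: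
  assumes "y \<in> K" "z \<in> K" "y \<noteq> 0" "z \<noteq> 0" "has_divisor K y D" "has_divisor K z E"
  shows "has_divisor K (y * z) (D + E)"
  using assms discrete_place.ord_mult[OF place] divisors_add[of D K E]
  by (auto simp: has_divisor_def lookup_add divisors_def)

lemma has_divisor_inverse:
  assumes "z \<in> K" "z \<noteq> 0" "has_divisor K z D"
  shows "has_divisor K (inverse z) (- D)"
  using assms discrete_place.ord_inverse[OF place] by (auto simp: has_divisor_def)

lemma has_divisor_const: "c \<noteq> 0 \<Longrightarrow> has_divisor K (const_emb c) 0"
  using discrete_place.ord_const[OF place] by (auto simp: has_divisor_def)

lemma principal_iff: "D \<in> principal_divisors K \<longleftrightarrow> (\<exists>z\<in>K. z \<noteq> 0 \<and> has_divisor K z D)"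
  by (auto simp: principal_divisors_def has_divisor_def)

lemma principal_0: "0 \<in> principal_divisors K"
  unfolding principal_iff using has_divisor_1 one by (intro bexI[of _ 1]) auto

lemma principal_minus: "D \<in> principal_divisors K \<Longrightarrow> - D \<in> principal_divisors K"
  unfolding principal_iff using has_divisor_inverse inv by (metis inverse_nonzero_iff_nonzero)

lemma principal_add: "D \<in> principal_divisors K \<Longrightarrow> E \<in> principal_divisors K \<Longrightarrow> D + E \<in> principal_divisors K"
  unfolding principal_iff using has_divisor_mult mult by (metis mult_eq_0_iff)

lemma principal_diff: "D \<in> principal_divisors K \<Longrightarrow> E \<in> principal_divisors K \<Longrightarrow> D - E \<in> principal_divisors K"
  using principal_add[of D "- E"] principal_minus by simp

lemma principal_cmul: "D \<in> principal_divisors K \<Longrightarrow> frag_cmul n D \<in> principal_divisors K"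
proof -
  assume D: "D \<in> principal_divisors K"
  have *: "frag_cmul (int m) D \<in> principal_divisors K" for m
    by (induction m) (auto simp: principal_0 frag_cmul_distrib D intro: principal_add)
  show ?thesis
    using *[of "nat n"] principal_minus[OF *[of "nat (- n)"]] by (cases "n \<ge> 0") auto
qed

lemma principal_divisors: "D \<in> principal_divisors K \<Longrightarrow> D \<in> divisors K"
  unfolding principal_iff using has_divisor_divisors by blast

end

lemma (in curve_field) principal_degree: "D \<in> principal_divisors K \<Longrightarrow> divisor_degree D = 0"
  unfolding principal_iff using divisor has_divisor_unique by metis

section \<open>Conjugation, push-forward and norms of divisors in a quadratic extension\<close>

context quad_ext
begin

lemma fibre_exists: "W \<in> places K \<Longrightarrow> \<exists>V. fibre W V"
  using ramified unramified by blast

lemma fibre_over: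
  assumes "fibre W V" "V' \<in> places L" "V' \<inter> K = W" shows "V' = V \<or> V' = conj ` V"
  using assms unfolding fibre_def by blast

lemma fibre_conj: assumes "fibre W V" shows "fibre W (conj ` V)"
proof -
  have V: "V \<in> places L" "V \<inter> K = W" "discrete_at L V"
    and set: "{V' \<in> places L. V' \<inter> K = W} = {V, conj ` V}" using assms by (auto simp: fibre_def)
  have cc: "conj ` conj ` V = V" using conj_image_conj place_sub V by blast
  have o: "ord_at (conj ` V) z = ord_at V z" if "z \<in> K" "z \<noteq> 0" for z
    using discrete_conj(2)[OF V(1,3)] that by (simp add: K_sub_L conj_K)
  show ?thesis
    unfolding fibre_def cc
    using assms V discrete_conj(1)[OF V(1,3)] conj_place[OF V(1)] conj_restrict[OF place_sub[OF V(1)]] o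
    unfolding fibre_def by (auto simp: insert_commute)
qed

lemma fibre_self: assumes "V \<in> places L" shows "fibre (V \<inter> K) V"
proof -
  obtain V' where V': "fibre (V \<inter> K) V'" using fibre_exists restrict_place assms by blast
  then show ?thesis using fibre_over[OF V' assms] fibre_conj[OF V'] by auto
qed

sublocale L: discrete_field L
proof
  show "discrete_at L V" if "V \<in> places L" for V
    using fibre_self[OF that] by (simp add: fibre_def)
qed

lemma same_restrict_iff:
  assumes "V \<in> places L" "V' \<in> places L"
  shows "V' \<inter> K = V \<inter> K \<longleftrightarrow> V' = V \<or> V' = conj ` V"
  using fibre_over[OF fibre_self[OF assms(1)]] assms conj_restrict place_sub by blast

lemma ord_conj: "V \<in> places L \<Longrightarrow> z \<in> L \<Longrightarrow> z \<noteq> 0 \<Longrightarrow> ord_at (conj ` V) z = ord_at V (conj z)"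
  using discrete_conj(2) L.discrete by blast

lemma ramified_iff: "V \<in> places L \<Longrightarrow> conj ` V = V \<longleftrightarrow> odd (ord_at (V \<inter> K) (s ^ 2))"
  using fibre_self unfolding fibre_def by blast

lemma ord_restrict: "V \<in> places L \<Longrightarrow> z \<in> K \<Longrightarrow> z \<noteq> 0 \<Longrightarrow>
    ord_at V z = (if conj ` V = V then 2 else 1) * ord_at (V \<inter> K) z"
  using fibre_self unfolding fibre_def by auto

lemma ord_norm:
  assumes V: "V \<in> places L" and z: "z \<in> L" "z \<noteq> 0"
  shows "ord_at (V \<inter> K) (norm z) = (if conj ` V = V then ord_at V z else ord_at V z + ord_at (conj ` V) z)"
proof -
  interpret V: discrete_place L V by (rule L.place[OF V])
  have "ord_at V (norm z) = ord_at V z + ord_at (conj ` V) z"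
    using z V by (simp add: norm_def V.ord_mult conj_L conj_0_iff ord_conj)
  then show ?thesis using ord_restrict[OF V norm_K[OF z(1)]] norm_0_iff z by (auto split: if_splits)
qed

definition conj_div where "conj_div D = frag_extend (\<lambda>V. frag_of (conj ` V)) D"

lemma conj_div_simps [simp]: "conj_div 0 = 0" "conj_div (frag_of V) = frag_of (conj ` V)"
  "conj_div (D + E) = conj_div D + conj_div E" "conj_div (D - E) = conj_div D - conj_div E"
  "conj_div (- D) = - conj_div D" "conj_div (frag_cmul n D) = frag_cmul n (conj_div D)"
  "divisor_degree (conj_div D) = divisor_degree D"
  by (auto simp: conj_div_def frag_extend_add frag_extend_diff frag_extend_minus frag_extend_cmul)

lemma conj_div_divisors: "D \<in> divisors L \<Longrightarrow> conj_div D \<in> divisors L"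
  unfolding conj_div_def by (rule divisors_extend) (auto intro: conj_place)

lemma lookup_conj_div:
  assumes D: "D \<in> divisors L" and V: "V \<in> places L"
  shows "Poly_Mapping.lookup (conj_div D) V = Poly_Mapping.lookup D (conj ` V)"
proof -
  have "V' = conj ` V" if "V' \<in> Poly_Mapping.keys D" "conj ` V' = V" for V'
    using conj_image_conj[of V'] place_sub[of V'] that D by (auto simp: divisors_def)
  then have "Poly_Mapping.lookup (conj_div D) V = (\<Sum>V\<in>{conj ` V}. Poly_Mapping.lookup D V)"
    unfolding conj_div_def by (intro lookup_frag_extend) (use conj_image_conj place_sub V in auto)
  then show ?thesis by simp
qed

lemma push_divisors: "D \<in> divisors L \<Longrightarrow> divisor_push K D \<in> divisors K"
  unfolding divisor_push_def by (rule divisors_extend) (auto intro: restrict_place)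

lemma push_simps [simp]: "divisor_push K 0 = 0" "divisor_push K (frag_of V) = frag_of (V \<inter> K)"
  "divisor_push K (D + E) = divisor_push K D + divisor_push K E"
  "divisor_push K (D - E) = divisor_push K D - divisor_push K E"
  "divisor_push K (- D) = - divisor_push K D"
  "divisor_push K (frag_cmul n D) = frag_cmul n (divisor_push K D)"
  "divisor_degree (divisor_push K D) = divisor_degree D"
  by (auto simp: divisor_push_def frag_extend_add frag_extend_diff frag_extend_minus frag_extend_cmul)

lemma lookup_push:
  assumes D: "D \<in> divisors L" and V: "V \<in> places L"
  shows "Poly_Mapping.lookup (divisor_push K D) (V \<inter> K) =
    (if conj ` V = V then Poly_Mapping.lookup D V
     else Poly_Mapping.lookup D V + Poly_Mapping.lookup D (conj ` V))"
proof -
  have "Poly_Mapping.lookup (divisor_push K D) (V \<inter> K) = (\<Sum>V\<in>{V, conj ` V}. Poly_Mapping.lookup D V)"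
    unfolding divisor_push_def
  proof (rule lookup_frag_extend)
    show "V' \<in> {V, conj ` V}" if "V' \<in> Poly_Mapping.keys D" "V' \<inter> K = V \<inter> K" for V'
      using same_restrict_iff[OF V, of V'] that D by (simp add: divisors_def subset_iff)
    show "V' \<inter> K = V \<inter> K" if "V' \<in> {V, conj ` V}" for V'
      using that conj_restrict[OF place_sub[OF V]] by (elim insertE emptyE) simp_all
  qed simp
  then show ?thesis by (cases "conj ` V = V") simp_all
qed

lemma push_conj_div: "D \<in> divisors L \<Longrightarrow> divisor_push K (conj_div D) = divisor_push K D"
  unfolding divisors_def mem_Collect_eq
  by (induction D rule: frag_induction) (auto simp: conj_restrict place_sub)

lemma has_divisor_conj:
  assumes "z \<in> L" "z \<noteq> 0" "has_divisor L z D"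
  shows "has_divisor L (conj z) (conj_div D)"
  using assms conj_div_divisors[of D] lookup_conj_div[of D] ord_conj conj_place
  by (auto simp: has_divisor_def divisors_def)

lemma place_over: "W \<in> places K \<Longrightarrow> \<exists>V\<in>places L. V \<inter> K = W"
proof -
  assume "W \<in> places K"
  then obtain V where "fibre W V" using fibre_exists by blast
  then have "V \<in> places L" "V \<inter> K = W" by (simp_all add: fibre_def)
  then show ?thesis by blast
qed

text \<open>The norm is the product of the conjugates, so its order at a place of \<open>K\<close>
  adds up the orders over the fibre, just as push-forward adds up coefficients.\<close>

lemma has_divisor_push:
  assumes z: "z \<in> L" "z \<noteq> 0" and D: "has_divisor L z D"
  shows "has_divisor K (norm z) (divisor_push K D)"
  unfolding has_divisor_def
proof (intro conjI ballI)
  have d: "D \<in> divisors L" using D has_divisor_divisors by blast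
  show "Poly_Mapping.keys (divisor_push K D) \<subseteq> places K" using push_divisors[OF d] by (simp add: divisors_def)
  fix W assume "W \<in> places K"
  then obtain V where V: "V \<in> places L" "V \<inter> K = W" using place_over by blast
  have "Poly_Mapping.lookup D V = ord_at V z" "Poly_Mapping.lookup D (conj ` V) = ord_at (conj ` V) z"
    using D V(1) conj_place[OF V(1)] by (simp_all add: has_divisor_def)
  then show "Poly_Mapping.lookup (divisor_push K D) W = ord_at W (norm z)"
    unfolding V(2)[symmetric] ord_norm[OF V(1) z] lookup_push[OF d V(1)] by simp
qed

text \<open>Pull-back is not introduced separately: \<open>D + conj_div D\<close> is the pull-back
  of the push-forward of \<open>D\<close>, with a ramified place counted twice, in accordance with
  the doubling of orders.\<close>

lemma has_divisor_pull:
  assumes z: "z \<in> K" "z \<noteq> 0" and D: "D \<in> divisors L" "has_divisor K z (divisor_push K D)"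
  shows "has_divisor L z (D + conj_div D)"
  unfolding has_divisor_def
proof (intro conjI ballI)
  show "Poly_Mapping.keys (D + conj_div D) \<subseteq> places L"
    using divisors_add[OF D(1) conj_div_divisors[OF D(1)]] by (simp add: divisors_def)
  fix V assume V: "V \<in> places L"
  then have "Poly_Mapping.lookup (divisor_push K D) (V \<inter> K) = ord_at (V \<inter> K) z"
    using D(2) restrict_place by (simp add: has_divisor_def)
  then show "Poly_Mapping.lookup (D + conj_div D) V = ord_at V z"
    unfolding ord_restrict[OF V z] lookup_push[OF D(1) V] lookup_add lookup_conj_div[OF D(1) V]
    by (cases "conj ` V = V") simp_all
qed

lemma principal_push: "D \<in> principal_divisors L \<Longrightarrow> divisor_push K D \<in> principal_divisors K"
  unfolding principal_iff L.principal_iff using has_divisor_push norm_K norm_0_iff by blast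

lemma principal_pull:
  "D \<in> divisors L \<Longrightarrow> divisor_push K D \<in> principal_divisors K \<Longrightarrow> D + conj_div D \<in> principal_divisors L"
  unfolding principal_iff L.principal_iff using has_divisor_pull K_sub_L by blast

lemma principal_conj: "D \<in> principal_divisors L \<Longrightarrow> conj_div D \<in> principal_divisors L"
  unfolding L.principal_iff using has_divisor_conj conj_L conj_0_iff by blast

lemma finite_over: "finite S \<Longrightarrow> S \<subseteq> places K \<Longrightarrow> finite {V \<in> places L. V \<inter> K \<in> S}"
proof -
  assume S: "finite S" "S \<subseteq> places K"
  have "{V \<in> places L. V \<inter> K \<in> S} = (\<Union>W\<in>S. {V \<in> places L. V \<inter> K = W})" by auto
  moreover have "finite {V \<in> places L. V \<inter> K = W}" if WS: "W \<in> S" for W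
  proof -
    obtain V where "fibre W V" using fibre_exists[of W] WS S by blast
    then have "{V \<in> places L. V \<inter> K = W} = {V, conj ` V}" by (simp add: fibre_def)
    then show ?thesis by (simp only: finite.emptyI finite.insertI)
  qed
  ultimately show ?thesis using S by simp
qed

text \<open>\<open>z\<close> and its conjugate are the roots of \<open>X^2 - T X + N\<close>. Above
  a place where \<open>N\<close> has order 0, and \<open>T\<close> has order 0 or vanishes, both
  roots are integral and their orders add up to 0, so both orders are 0.\<close>

lemma finite_support:
  assumes K: "\<And>z. z \<in> K \<Longrightarrow> z \<noteq> 0 \<Longrightarrow> \<exists>D. has_divisor K z D" and z: "z \<in> L" "z \<noteq> 0"
  shows "finite {V \<in> places L. ord_at V z \<noteq> 0}"
proof -
  have finK: "finite {W \<in> places K. ord_at W y \<noteq> 0}" if y: "y \<in> K" "y \<noteq> 0" for y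
  proof -
    obtain D where "has_divisor K y D" using K[OF y] by blast
    then have "{W \<in> places K. ord_at W y \<noteq> 0} \<subseteq> Poly_Mapping.keys D" by (auto simp: has_divisor_def in_keys_iff)
    then show ?thesis using finite_subset finite_keys by blast
  qed
  define N where "N = norm z"
  define T where "T = z + conj z"
  have N: "N \<in> K" "N \<noteq> 0" using z norm_K norm_0_iff by (auto simp: N_def)
  have T: "T \<in> K"
  proof -
    obtain a b where "a \<in> K" "b \<in> K" "z = a + b * s" using L_E[OF z(1)] by blast
    then have "T = a + a" by (simp add: T_def conj_eq)
    then show ?thesis using add[OF \<open>a \<in> K\<close> \<open>a \<in> K\<close>] by (simp only:)
  qed
  \<comment> \<open>The exceptional places. A vanishing trace contributes none of them: it is
    integral everywhere but has no order.\<close>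
  define S where "S = {W \<in> places K. ord_at W N \<noteq> 0} \<union> (if T = 0 then {} else {W \<in> places K. ord_at W T \<noteq> 0})"
  have S: "finite S" "S \<subseteq> places K" using finK N T by (auto simp: S_def)
  have "ord_at V z = 0" if V: "V \<in> places L" "V \<inter> K \<notin> S" for V
  proof -
    interpret V: discrete_place L V by (rule L.place[OF V(1)])
    interpret W: discrete_place K "V \<inter> K" by (rule place[OF restrict_place[OF V(1)]])
    have o: "ord_at (V \<inter> K) N = 0" "T = 0 \<or> ord_at (V \<inter> K) T = 0"
      using V restrict_place[OF V(1)] by (auto simp: S_def split: if_splits)
    have "N \<in> V" using W.mem_V_iff[OF N] o by simp
    moreover have "T \<in> V" using W.mem_V_iff[OF T] o V.V_0 by (cases "T = 0") auto
    moreover have "z ^ 2 - T * z + N = 0" by (simp add: N_def T_def norm_def power2_eq_square algebra_simps)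
    moreover have "(conj z) ^ 2 - T * conj z + N = 0" by (simp add: N_def T_def norm_def power2_eq_square algebra_simps)
    ultimately have "z \<in> V" "conj z \<in> V" using V.V_integral z conj_L by blast+
    then have "ord_at V z \<ge> 0" "ord_at V (conj z) \<ge> 0" using V.mem_V_iff z conj_L conj_0_iff by blast+
    moreover have "ord_at V N = 0" using ord_restrict[OF V(1) N] o by simp
    then have "ord_at V z + ord_at V (conj z) = 0" using V.ord_mult[of z "conj z"] z by (simp add: N_def norm_def conj_L conj_0_iff)
    ultimately show ?thesis by linarith
  qed
  then have "{V \<in> places L. ord_at V z \<noteq> 0} \<subseteq> {V \<in> places L. V \<inter> K \<in> S}" by blast
  then show ?thesis using finite_subset finite_over[OF S] by blast
qed

text \<open>Push-forward preserves degrees and sends the divisor of \<open>z\<close> to the divisor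
  of \<open>norm z\<close>, which has degree 0 by the assumption on \<open>K\<close>.\<close>

lemma curve_field_L:
  assumes "curve_field K" shows "curve_field L"
proof
  interpret curve_field K by fact
  fix z assume z: "z \<in> L" "z \<noteq> 0"
  let ?A = "{V \<in> places L. ord_at V z \<noteq> 0}"
  have fin: "finite ?A" by (rule finite_support) (use divisor z in blast)+
  define D where "D = (\<Sum>V\<in>?A. frag_cmul (ord_at V z) (frag_of V))"
  have lk: "Poly_Mapping.lookup D V = (if V \<in> ?A then ord_at V z else 0)" for V
  proof -
    have "Poly_Mapping.lookup D V = (\<Sum>V'\<in>?A. if V = V' then ord_at V' z else 0)"
      unfolding D_def lookup_sum by (rule sum.cong) (auto simp: lookup_single)
    then show ?thesis using fin by (simp add: sum.delta)
  qed
  then have D: "has_divisor L z D" by (auto simp: has_divisor_def in_keys_iff split: if_splits)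
  have "divisor_push K D \<in> principal_divisors K"
    using has_divisor_push[OF z D] z norm_K norm_0_iff unfolding principal_iff by blast
  then have "divisor_degree (divisor_push K D) = 0" by (rule principal_degree)
  then show "\<exists>D. has_divisor L z D \<and> divisor_degree D = 0" using D by auto
qed

end

section \<open>Rational function fields\<close>

lemma eval_at_0 [simp]: "eval_at 0 u = 0"
  by (simp add: eval_at_def)

lemma eval_at_pCons [simp]: "eval_at (pCons a p) u = const_emb a + u * eval_at p u"
  by (simp add: eval_at_def map_poly_pCons)

lemma eval_at_1 [simp]: "eval_at 1 u = 1"
  by (simp add: one_pCons)

lemma eval_at_add [simp]: "eval_at (p + q) u = eval_at p u + eval_at q u"
  by (induction p q rule: poly_induct2) (auto simp: const_emb_add algebra_simps)

lemma eval_at_smult [simp]: "eval_at (Polynomial.smult c p) u = const_emb c * eval_at p u"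
  by (induction p) (auto simp: const_emb_mult algebra_simps)

lemma eval_at_mult [simp]: "eval_at (p * q) u = eval_at p u * eval_at q u"
  by (induction p) (auto simp: algebra_simps)

lemma eval_at_minus [simp]: "eval_at (- p) u = - eval_at p u"
  using eval_at_smult[of "-1" p u] by (simp add: const_emb_minus)

lemma eval_at_diff [simp]: "eval_at (p - q) u = eval_at p u - eval_at q u"
  using eval_at_add[of p "- q" u] by simp

lemma eval_at_power [simp]: "eval_at (p ^ n) u = eval_at p u ^ n"
  by (induction n) auto

lemma eval_at_closed: "const_subfield K \<Longrightarrow> u \<in> K \<Longrightarrow> eval_at p u \<in> K"
  by (induction p) (auto intro: const_subfield.closed)

lemma poly_factor_induct [consumes 1, case_names const linear]:
  fixes p :: "'k::alg_closed_field poly"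
  assumes "p \<noteq> 0" and const: "\<And>c. c \<noteq> 0 \<Longrightarrow> P [:c:]"
    and linear: "\<And>a q. q \<noteq> 0 \<Longrightarrow> P q \<Longrightarrow> P ([:- a, 1:] * q)"
  shows "P p"
  using assms(1)
proof (induction "Polynomial.degree p" arbitrary: p rule: less_induct)
  case less
  show ?case
  proof (cases "Polynomial.degree p = 0")
    case True
    then obtain c where c: "p = [:c:]" by (rule degree_eq_zeroE)
    then have "c \<noteq> 0" using less.prems by simp
    then show ?thesis unfolding c by (rule const)
  next
    case False
    then obtain a where "poly p a = 0" using alg_closed_imp_poly_has_root[of p] False by auto
    then have "[:- a, 1:] dvd p" by (simp add: poly_eq_0_iff_dvd)
    then obtain q where q: "p = [:- a, 1:] * q" by (rule dvdE)
    have q0: "q \<noteq> 0" using less.prems unfolding q by auto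
    then have "Polynomial.degree p = 1 + Polynomial.degree q" unfolding q by (subst degree_mult_eq) auto
    then have "P q" by (intro less.hyps q0) simp
    then show ?thesis unfolding q by (rule linear[OF q0])
  qed
qed

text \<open>Turns \<open>u \<notin> k\<close> into transcendence: over an algebraically closed field
  the value is a nonzero constant times factors \<open>u - a\<close>, none of which
  vanishes.\<close>

lemma eval_at_nonzero:
  fixes p :: "'k::{alg_closed_field, field_char_0} poly"
  assumes "u \<notin> range const_emb" "p \<noteq> 0"
  shows "eval_at p u \<noteq> 0"
  using assms(2)
proof (induction rule: poly_factor_induct)
  case (linear a q)
  have "u \<noteq> const_emb a" using assms(1) by auto
  then show ?case using linear by (simp add: const_emb_minus)
qed simp

definition rat_field :: "'k::field ambient \<Rightarrow> 'k ambient set" where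
  "rat_field u = {eval_at p u / eval_at q u | p q. q \<noteq> 0}"

definition rat_place :: "'k::field ambient \<Rightarrow> 'k \<Rightarrow> 'k ambient set" where
  "rat_place u a = {eval_at p u / eval_at q u | p q. poly q a \<noteq> 0}"

definition rat_place_inf :: "'k::field ambient \<Rightarrow> 'k ambient set" where
  "rat_place_inf u = rat_place (inverse u) 0"

lemma rat_field_E:
  assumes "z \<in> rat_field u" "z \<noteq> 0"
  obtains p q where "p \<noteq> 0" "q \<noteq> 0" "z = eval_at p u / eval_at q u"
proof -
  obtain p q where "q \<noteq> 0" "z = eval_at p u / eval_at q u" using assms(1) by (auto simp: rat_field_def)
  moreover from this have "p \<noteq> 0" using assms(2) by auto
  ultimately show thesis using that by blast
qed

lemma rat_field_I: "q \<noteq> 0 \<Longrightarrow> eval_at p u / eval_at q u \<in> rat_field u"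
  by (auto simp: rat_field_def)

lemma rat_field_poly: "eval_at p u \<in> rat_field u"
  using rat_field_I[of 1 p u] by simp

lemma rat_field_self: "u \<in> rat_field u"
  using rat_field_poly[of "[:0, 1:]" u] by simp

lemma rat_field_least: "const_subfield K \<Longrightarrow> u \<in> K \<Longrightarrow> rat_field u \<subseteq> K"
  by (auto simp: rat_field_def intro!: const_subfield.div eval_at_closed)

locale rational =
  fixes u :: "'k::{alg_closed_field, field_char_0} ambient"
  assumes transcendental: "u \<notin> range const_emb"
begin

lemma ev0: "eval_at p u = 0 \<longleftrightarrow> p = 0"
  using eval_at_nonzero[OF transcendental] by auto

sublocale const_subfield "rat_field u"
proof
  show "const_emb c \<in> rat_field u" for c using rat_field_poly[of "[:c:]"] by simp
  fix x assume x: "x \<in> rat_field u"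
  then obtain p q where pq: "q \<noteq> 0" "x = eval_at p u / eval_at q u" by (auto simp: rat_field_def)
  show "- x \<in> rat_field u" using rat_field_I[OF pq(1), of "- p"] pq by simp
  show "inverse x \<in> rat_field u"
    using rat_field_I[of p q u] rat_field_poly[of 0 u] pq by (cases "p = 0") auto
  fix y assume y: "y \<in> rat_field u"
  then obtain p' q' where pq': "q' \<noteq> 0" "y = eval_at p' u / eval_at q' u" by (auto simp: rat_field_def)
  have qq: "q * q' \<noteq> 0" using pq(1) pq'(1) by simp
  have e: "x + y = eval_at (p * q' + p' * q) u / eval_at (q * q') u"
    using pq pq' by (simp add: ev0 field_simps)
  show "x + y \<in> rat_field u" unfolding e by (rule rat_field_I[OF qq])
  have e: "x * y = eval_at (p * p') u / eval_at (q * q') u" by (simp add: pq(2) pq'(2))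
  show "x * y \<in> rat_field u" unfolding e by (rule rat_field_I[OF qq])
qed

lemma u_mem: "u \<in> rat_field u" by (rule rat_field_self)

lemma u_minus_neq_0: "u - const_emb a \<noteq> 0"
  using transcendental by auto

lemma factor_at:
  assumes "z \<in> rat_field u" "z \<noteq> 0"
  obtains n p q where "z = (u - const_emb a) powi n * (eval_at p u / eval_at q u)" "poly p a \<noteq> 0" "poly q a \<noteq> 0"
proof -
  have poly: "\<exists>n q. poly q a \<noteq> 0 \<and> eval_at p u = (u - const_emb a) ^ n * eval_at q u" if p0: "p \<noteq> 0" for p
  proof -
    define n where "n = Polynomial.order a p"
    obtain q where q: "p = [:- a, 1:] ^ n * q" "\<not> [:- a, 1:] dvd q"
      using order_decomp[OF p0, of a] unfolding n_def by blast
    have "poly q a \<noteq> 0" using q(2) by (simp add: poly_eq_0_iff_dvd)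
    moreover have "eval_at p u = (u - const_emb a) ^ n * eval_at q u"
      unfolding q(1) by (simp add: const_emb_minus)
    ultimately show ?thesis by blast
  qed
  obtain p q where pq: "p \<noteq> 0" "q \<noteq> 0" "z = eval_at p u / eval_at q u" using rat_field_E[OF assms] .
  obtain n p' where n: "poly p' a \<noteq> 0" "eval_at p u = (u - const_emb a) ^ n * eval_at p' u" using poly[OF pq(1)] by blast
  obtain m q' where m: "poly q' a \<noteq> 0" "eval_at q u = (u - const_emb a) ^ m * eval_at q' u" using poly[OF pq(2)] by blast
  have "z = (u - const_emb a) powi (int n - int m) * (eval_at p' u / eval_at q' u)"
    using u_minus_neq_0 by (simp add: pq(3) n(2) m(2) power_int_diff)
  then show thesis using that n(1) m(1) by blast
qed

lemma residue_poly:
  assumes V: "V \<in> places (rat_field u)" and a: "u - const_emb a \<in> max_ideal V"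
  shows "eval_at p u \<in> V" "eval_at p u - const_emb (poly p a) \<in> max_ideal V"
    "poly p a \<noteq> 0 \<Longrightarrow> eval_at p u \<in> place_units V"
proof -
  interpret V: place "rat_field u" V using V by unfold_locales
  have u: "u \<in> V" using V.V_add[OF V.ideal_sub[OF a] V.V_const[of a]] by simp
  have p: "eval_at p u \<in> V \<and> eval_at p u - const_emb (poly p a) \<in> max_ideal V" for p
  proof (induction p)
    case (pCons c p)
    have "(u - const_emb a) * eval_at p u + const_emb a * (eval_at p u - const_emb (poly p a)) \<in> max_ideal V"
      using pCons a by (blast intro: V.ideal_add V.ideal_mult V.ideal_mult2 V.V_const)
    then show ?case using pCons u by (simp add: const_emb_hom V.V_closed algebra_simps)
  qed (auto simp: V.V_closed V.ideal_0)
  then show "eval_at p u \<in> V" and r: "eval_at p u - const_emb (poly p a) \<in> max_ideal V" by auto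
  assume nz: "poly p a \<noteq> 0"
  have "eval_at p u \<notin> max_ideal V"
  proof
    assume "eval_at p u \<in> max_ideal V"
    from V.ideal_diff[OF this r] have "const_emb (poly p a) \<in> max_ideal V" by simp
    then show False using nz by (simp only: V.const_not_ideal)
  qed
  then show "eval_at p u \<in> place_units V" using p V.unit_not_ideal by blast
qed

lemma rat_place_sub: "rat_place u a \<subseteq> rat_field u"
proof
  fix z assume "z \<in> rat_place u a"
  then obtain p q where pq: "poly q a \<noteq> 0" "z = eval_at p u / eval_at q u" by (auto simp: rat_place_def)
  then have "q \<noteq> 0" by auto
  then show "z \<in> rat_field u" unfolding pq(2) by (rule rat_field_I)
qed

text \<open>By \<open>factor_at\<close>, every nonzero function is a power of \<open>u - a\<close>
  times a quotient of polynomials not vanishing at \<open>a\<close>, and such quotients are units.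
  So \<open>u - a\<close> is a uniformizer and the exponent decides membership in the place.\<close>

lemma place_with:
  assumes V: "V \<in> places (rat_field u)" and a: "u - const_emb a \<in> max_ideal V"
  shows "V = rat_place u a" "discrete_at (rat_field u) V" "ord_at V (u - const_emb a) = 1"
proof -
  interpret V: place "rat_field u" V using V by unfold_locales
  note r = residue_poly[OF V a]
  have f: "\<exists>n p q. z = (u - const_emb a) powi n * (eval_at p u / eval_at q u) \<and> poly p a \<noteq> 0 \<and> poly q a \<noteq> 0"
    if "z \<in> rat_field u" "z \<noteq> 0" for z
    using factor_at[OF that, of a] by metis
  have unit: "eval_at p u / eval_at q u \<in> place_units V" if "poly p a \<noteq> 0" "poly q a \<noteq> 0" for p q
    using r(3)[OF that(1)] r(3)[OF that(2)] V.unit_divide by blast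
  have f': "\<exists>n. \<exists>w\<in>place_units V. z = (u - const_emb a) powi n * w" if "z \<in> rat_field u" "z \<noteq> 0" for z
    using f[OF that] unit by blast
  show "ord_at V (u - const_emb a) = 1"
    using V.ord_at_eqI[OF a u_minus_neq_0 f' V.unit_1, of 1] by simp
  have res: "\<exists>c. eval_at p u / eval_at q u - const_emb c \<in> max_ideal V" if "poly q a \<noteq> 0" for p q
  proof -
    have qi: "inverse (eval_at q u) \<in> V" using r(3)[OF that] by (simp add: place_units_iff)
    have q0: "eval_at q u \<noteq> 0" using that ev0 by auto
    let ?c = "poly p a / poly q a"
    have "((eval_at p u - const_emb (poly p a)) - const_emb ?c * (eval_at q u - const_emb (poly q a))) * inverse (eval_at q u) \<in> max_ideal V"
      by (intro V.ideal_mult V.ideal_diff V.ideal_mult2 r(2) V.V_const qi)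
    moreover have "((eval_at p u - const_emb (poly p a)) - const_emb ?c * (eval_at q u - const_emb (poly q a))) * inverse (eval_at q u)
      = eval_at p u / eval_at q u - const_emb ?c"
      using q0 that by (simp add: const_emb_divide field_simps)
    ultimately show ?thesis by metis
  qed
  have VP: "z \<in> V \<longleftrightarrow> z \<in> rat_place u a" if z: "z \<in> rat_field u" "z \<noteq> 0" for z
  proof
    assume zV: "z \<in> V"
    obtain n p q where n: "z = (u - const_emb a) powi n * (eval_at p u / eval_at q u)" "poly p a \<noteq> 0" "poly q a \<noteq> 0"
      using factor_at[OF z] .
    have "n \<ge> 0" using V.powi_mem_iff[OF a u_minus_neq_0 unit[OF n(2,3)], of n] zV n(1) by simp
    then have "z = eval_at ([:- a, 1:] ^ nat n * p) u / eval_at q u"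
      by (simp add: n(1) power_int_def const_emb_minus)
    then show "z \<in> rat_place u a" using n(3) unfolding rat_place_def by blast
  next
    assume "z \<in> rat_place u a"
    then obtain p q where "poly q a \<noteq> 0" "z = eval_at p u / eval_at q u" by (auto simp: rat_place_def)
    then show "z \<in> V" using r(1)[of p] r(3)[of q] by (auto simp: divide_inverse place_units_iff intro!: V.V_mult)
  qed
  have "0 \<in> rat_place u a"
    unfolding rat_place_def by (rule CollectI, rule exI[of _ 0], rule exI[of _ 1]) simp
  then show eq: "V = rat_place u a" using VP V.V_0 V.V_sub rat_place_sub[of a] by blast
  show "discrete_at (rat_field u) V"
    unfolding discrete_at_def
  proof (intro conjI ballI)
    show "\<exists>t\<in>max_ideal V. t \<noteq> 0 \<and> (\<forall>z\<in>rat_field u. z \<noteq> 0 \<longrightarrow> (\<exists>n. \<exists>w\<in>place_units V. z = t powi n * w))"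
      by (intro bexI[of _ "u - const_emb a"] conjI ballI impI u_minus_neq_0 a f')
    fix z assume "z \<in> V"
    then obtain p q where "poly q a \<noteq> 0" "z = eval_at p u / eval_at q u" unfolding eq by (auto simp: rat_place_def)
    then show "\<exists>c. z - const_emb c \<in> max_ideal V" using res by blast
  qed
qed

lemma rat_place_place: "rat_place u a \<in> places (rat_field u)" "u - const_emb a \<in> max_ideal (rat_place u a)"
proof -
  let ?V = "rat_place u a"
  have I: "eval_at p u / eval_at q u \<in> ?V" if "poly q a \<noteq> 0" for p q using that by (auto simp: rat_place_def)
  have P: "eval_at p u \<in> ?V" for p using I[of 1 p] by simp
  have n: "inverse (u - const_emb a) \<notin> ?V"
  proof
    assume "inverse (u - const_emb a) \<in> ?V"
    then obtain p q where pq: "poly q a \<noteq> 0" "inverse (u - const_emb a) = eval_at p u / eval_at q u" by (auto simp: rat_place_def)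
    then have "eval_at q u \<noteq> 0" using ev0 by auto
    then have "eval_at q u = eval_at ([:- a, 1:] * p) u"
      using pq(2) u_minus_neq_0[of a] by (simp add: field_simps const_emb_minus)
    then have "eval_at (q - [:- a, 1:] * p) u = 0" by (simp only: eval_at_diff) simp
    then have "q = [:- a, 1:] * p" by (simp only: ev0) simp
    then show False using pq(1) by simp
  qed
  show V: "?V \<in> places (rat_field u)"
    unfolding places_iff
  proof (intro conjI ballI)
    show "range const_emb \<subseteq> ?V" using P[of "[:_:]"] by auto
    have "?V \<subseteq> rat_field u" by (rule rat_place_sub)
    moreover have "inverse (u - const_emb a) \<in> rat_field u" by (intro closed u_mem)
    ultimately show "?V \<subset> rat_field u" using n by blast
    fix x assume "x \<in> ?V"
    then obtain p q where pq: "poly q a \<noteq> 0" "x = eval_at p u / eval_at q u" by (auto simp: rat_place_def)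
    show "- x \<in> ?V" using I[OF pq(1), of "- p"] pq by simp
    fix y assume "y \<in> ?V"
    then obtain p' q' where pq': "poly q' a \<noteq> 0" "y = eval_at p' u / eval_at q' u" by (auto simp: rat_place_def)
    have q0: "eval_at q u \<noteq> 0" "eval_at q' u \<noteq> 0" using pq pq' ev0 by auto
    have qq: "poly (q * q') a \<noteq> 0" using pq pq' by simp
    have e: "x + y = eval_at (p * q' + p' * q) u / eval_at (q * q') u" using pq pq' q0 by (simp add: field_simps)
    show "x + y \<in> ?V" unfolding e by (rule I[OF qq])
    have e: "x * y = eval_at (p * p') u / eval_at (q * q') u" by (simp add: pq(2) pq'(2))
    show "x * y \<in> ?V" unfolding e by (rule I[OF qq])
  next
    fix z assume z: "z \<in> rat_field u"
    show "z \<in> ?V \<or> inverse z \<in> ?V"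
    proof (cases "z = 0")
      case True
      then show ?thesis using P[of 0] by simp
    next
      case False
      then obtain n p q where n: "z = (u - const_emb a) powi n * (eval_at p u / eval_at q u)" "poly p a \<noteq> 0" "poly q a \<noteq> 0"
        using factor_at[OF z] by metis
      have pos: "(u - const_emb a) ^ m * (eval_at p u / eval_at q u) \<in> ?V" if "poly q a \<noteq> 0" for m p q
        using I[OF that, of "[:- a, 1:] ^ m * p"] by (simp add: const_emb_minus)
      show ?thesis
      proof (cases "n \<ge> 0")
        case True
        then show ?thesis using pos[OF n(3), of "nat n" p] by (simp add: n(1) power_int_def)
      next
        case False
        then have "inverse z = (u - const_emb a) ^ nat (- n) * (eval_at q u / eval_at p u)"
          by (simp add: n(1) power_int_def field_simps)
        then show ?thesis using pos[OF n(2), of "nat (- n)" q] by simp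
      qed
    qed
  qed
  show "u - const_emb a \<in> max_ideal ?V" using n P[of "[:- a, 1:]"] by (auto simp: max_ideal_iff const_emb_minus)
qed

text \<open>Lets the place at infinity be treated as the place 0 of the coordinate
  \<open>inverse u\<close>.\<close>

lemma inverse_rational: "rational (inverse u)" "rat_field (inverse u) = rat_field u"
proof -
  have "inverse u \<notin> range const_emb"
  proof
    assume "inverse u \<in> range const_emb"
    then obtain c where "inverse u = const_emb c" by auto
    then have "u = const_emb (inverse c)" by (metis const_emb_inverse inverse_inverse_eq)
    then show False using transcendental by auto
  qed
  then show r: "rational (inverse u)" by unfold_locales
  interpret i: rational "inverse u" by (rule r)
  show "rat_field (inverse u) = rat_field u"
    using rat_field_least[OF i.const_subfield_axioms, of u] rat_field_least[OF const_subfield_axioms, of "inverse u"]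
      i.inv[OF i.u_mem] inv[OF u_mem] by auto
qed

lemma u_neq_0: "u \<noteq> 0" using u_minus_neq_0[of 0] by simp

lemma place_inf: "rat_place_inf u \<in> places (rat_field u)" "inverse u \<in> max_ideal (rat_place_inf u)"
  "u \<notin> rat_place_inf u" "ord_at (rat_place_inf u) u = -1" "discrete_at (rat_field u) (rat_place_inf u)"
proof -
  interpret i: rational "inverse u" by (rule inverse_rational)
  note p = i.rat_place_place[of 0, unfolded inverse_rational]
  show V: "rat_place_inf u \<in> places (rat_field u)" "inverse u \<in> max_ideal (rat_place_inf u)"
    using p by (auto simp: rat_place_inf_def)
  then show "u \<notin> rat_place_inf u" using u_neq_0 by (auto simp: max_ideal_iff)
  show d: "discrete_at (rat_field u) (rat_place_inf u)"
    using i.place_with(2)[OF i.rat_place_place] by (simp add: inverse_rational rat_place_inf_def)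
  interpret V: discrete_place "rat_field u" "rat_place_inf u" using V d by unfold_locales
  have "ord_at (rat_place_inf u) (inverse u) = 1"
    using i.place_with(3)[OF i.rat_place_place, of 0] by (simp add: rat_place_inf_def)
  then show "ord_at (rat_place_inf u) u = -1" using V.ord_inverse[OF u_mem u_neq_0] by simp
qed

lemma places_cases:
  assumes V: "V \<in> places (rat_field u)"
  obtains a where "V = rat_place u a" "u - const_emb a \<in> max_ideal V" | "V = rat_place_inf u" "u \<notin> V"
proof -
  interpret V: place "rat_field u" V using V by unfold_locales
  show thesis
  proof (cases "u \<in> V")
    case True
    have "\<exists>a. u - const_emb a \<in> max_ideal V"
    proof (rule ccontr)
      assume n: "\<nexists>a. u - const_emb a \<in> max_ideal V"
      \<comment> \<open>If no \<open>u - a\<close> were a non-unit, every nonzero polynomial, being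
        a product of linear factors, would be a unit, and the place would be the whole
        field.\<close>
      have units: "eval_at p u \<in> place_units V" if "p \<noteq> 0" for p
        using that
      proof (induction rule: poly_factor_induct)
        case (linear a q)
        have "u - const_emb a \<in> place_units V" using n True V.unit_not_ideal V.V_diff V.V_const by blast
        then have "(u - const_emb a) * eval_at q u \<in> place_units V" by (rule V.unit_mult) (rule linear)
        then show ?case by (simp add: const_emb_minus algebra_simps)
      qed (simp add: V.unit_const)
      have "z \<in> V" if z: "z \<in> rat_field u" for z
      proof (cases "z = 0")
        case False
        then obtain p q where "p \<noteq> 0" "q \<noteq> 0" "z = eval_at p u / eval_at q u" using rat_field_E[OF z] by metis
        then show ?thesis using units V.unit_divide V.unit_sub by simp
      qed (simp add: V.V_0)
      then show False using V.V_neq V.V_sub by blast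
    qed
    then show thesis using that(1) place_with(1)[OF V] by blast
  next
    case False
    interpret i: rational "inverse u" by (rule inverse_rational)
    have "inverse u - const_emb 0 \<in> max_ideal V" using V.not_V_inverse_ideal[OF u_mem False] by simp
    then have "V = rat_place (inverse u) 0" using i.place_with(1) V by (simp add: inverse_rational)
    then show thesis using that(2) False by (simp add: rat_place_inf_def)
  qed
qed

sublocale discrete_field "rat_field u"
proof
  show "discrete_at (rat_field u) V" if "V \<in> places (rat_field u)" for V
    using that place_with(2) place_inf(5) by (metis places_cases)
qed

lemma rat_place_inj: "rat_place u a = rat_place u b \<longleftrightarrow> a = b" "rat_place u a \<noteq> rat_place_inf u"
proof -
  interpret V: discrete_place "rat_field u" "rat_place u a" by (rule place[OF rat_place_place(1)])
  show "rat_place u a = rat_place u b \<longleftrightarrow> a = b"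
    using V.residue_unique[of u a b] rat_place_place(2) by metis
  have "u \<in> rat_place u a" using V.V_add[OF V.ideal_sub[OF rat_place_place(2)] V.V_const[of a]] by simp
  then show "rat_place u a \<noteq> rat_place_inf u" using place_inf(3) by blast
qed

lemma ord_poly_at: "p \<noteq> 0 \<Longrightarrow> ord_at (rat_place u a) (eval_at p u) \<ge> 0"
  "poly p a \<noteq> 0 \<Longrightarrow> ord_at (rat_place u a) (eval_at p u) = 0"
  "ord_at (rat_place u a) (u - const_emb a) = 1"
proof -
  interpret V: discrete_place "rat_field u" "rat_place u a" by (rule place[OF rat_place_place(1)])
  note r = residue_poly[OF rat_place_place]
  show "p \<noteq> 0 \<Longrightarrow> ord_at (rat_place u a) (eval_at p u) \<ge> 0"
    using V.mem_V_iff[OF rat_field_poly] r(1) ev0 by blast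
  show "poly p a \<noteq> 0 \<Longrightarrow> ord_at (rat_place u a) (eval_at p u) = 0"
  proof -
    assume nz: "poly p a \<noteq> 0"
    then have "eval_at p u \<noteq> 0" using ev0 by auto
    then show "ord_at (rat_place u a) (eval_at p u) = 0"
      using V.mem_units_iff[OF rat_field_poly] r(3)[OF nz] by blast
  qed
  show "ord_at (rat_place u a) (u - const_emb a) = 1" by (rule place_with[OF rat_place_place])
qed

lemma ord_poly_inf: "p \<noteq> 0 \<Longrightarrow> ord_at (rat_place_inf u) (eval_at p u) = - int (Polynomial.degree p)"
proof (induction p)
  case (pCons c p)
  interpret V: discrete_place "rat_field u" "rat_place_inf u" by (rule place[OF place_inf(1)])
  show ?case
  proof (cases "p = 0")
    case True
    then show ?thesis using pCons V.ord_const by simp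
  next
    case False
    have o: "ord_at (rat_place_inf u) (u * eval_at p u) = - 1 - int (Polynomial.degree p)"
      using pCons False by (simp add: V.ord_mult u_mem rat_field_poly u_neq_0 ev0 place_inf)
    have m: "u * eval_at p u \<in> rat_field u" "u * eval_at p u \<noteq> 0"
      using False by (auto simp: mult u_mem rat_field_poly u_neq_0 ev0)
    show ?thesis
    proof (cases "c = 0")
      case True
      then show ?thesis using o False by simp
    next
      case c: False
      have "ord_at (rat_place_inf u) (u * eval_at p u + const_emb c) = ord_at (rat_place_inf u) (u * eval_at p u)"
        by (rule V.ord_add_eq) (use m c o V.ord_const[OF c] const in auto)
      then show ?thesis using o False by (simp add: add.commute)
    qed
  qed
qed simp

lemma has_divisor_linear: "has_divisor (rat_field u) (u - const_emb a) (frag_of (rat_place u a) - frag_of (rat_place_inf u))"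
proof -
  have "Poly_Mapping.lookup (frag_of (rat_place u a) - frag_of (rat_place_inf u)) V = ord_at V (u - const_emb a)"
    if V: "V \<in> places (rat_field u)" for V
  proof (cases rule: places_cases[OF V])
    case (1 b)
    show ?thesis
    proof (cases "a = b")
      case True
      then show ?thesis using 1 ord_poly_at(3) rat_place_inj by (simp add: lookup_minus)
    next
      case False
      then have "poly [:- a, 1:] b \<noteq> 0" by simp
      then have "ord_at V (u - const_emb a) = 0" using ord_poly_at(2)[of "[:- a, 1:]" b] 1 by (simp add: const_emb_minus)
      then show ?thesis using 1 False rat_place_inj(1)[of b a] rat_place_inj(2)[of b] by (simp add: lookup_minus)
    qed
  next
    case 2
    have "ord_at V (u - const_emb a) = - 1" using ord_poly_inf[of "[:- a, 1:]"] 2 by (simp add: const_emb_minus)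
    then show ?thesis using 2 rat_place_inj(2)[of a] by (simp add: lookup_minus)
  qed
  moreover have "frag_of (rat_place u a) - frag_of (rat_place_inf u) \<in> divisors (rat_field u)"
    by (simp add: rat_place_place place_inf)
  ultimately show ?thesis by (simp add: has_divisor_def divisors_def)
qed

sublocale curve_field "rat_field u"
proof
  have poly: "\<exists>D. has_divisor (rat_field u) (eval_at p u) D \<and> divisor_degree D = 0" if "p \<noteq> 0" for p
    using that
  proof (induction rule: poly_factor_induct)
    fix c :: 'k assume "c \<noteq> 0"
    then show "\<exists>D. has_divisor (rat_field u) (eval_at [:c:] u) D \<and> divisor_degree D = 0"
      using has_divisor_const by (intro exI[of _ 0]) auto
  next
    case (linear a q)
    then obtain D where D: "has_divisor (rat_field u) (eval_at q u) D" "divisor_degree D = 0" by blast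
    have "has_divisor (rat_field u) ((u - const_emb a) * eval_at q u) (frag_of (rat_place u a) - frag_of (rat_place_inf u) + D)"
      by (rule has_divisor_mult[OF diff[OF u_mem const] rat_field_poly u_minus_neq_0 _ has_divisor_linear D(1)])
        (use linear ev0 in simp)
    moreover have "eval_at ([:- a, 1:] * q) u = (u - const_emb a) * eval_at q u"
      by (simp add: const_emb_minus algebra_simps)
    ultimately show ?case using D(2) by (intro exI[of _ "frag_of (rat_place u a) - frag_of (rat_place_inf u) + D"]) simp
  qed
  fix z assume z: "z \<in> rat_field u" "z \<noteq> 0"
  obtain p q where pq: "p \<noteq> 0" "q \<noteq> 0" "z = eval_at p u / eval_at q u" using rat_field_E[OF z] .
  obtain D where D: "has_divisor (rat_field u) (eval_at p u) D" "divisor_degree D = 0" using poly pq by blast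
  obtain E where E: "has_divisor (rat_field u) (eval_at q u) E" "divisor_degree E = 0" using poly pq by blast
  have "has_divisor (rat_field u) (eval_at p u * inverse (eval_at q u)) (D + - E)"
    by (intro has_divisor_mult has_divisor_inverse D E inv rat_field_poly) (use pq ev0 in auto)
  then show "\<exists>D. has_divisor (rat_field u) z D \<and> divisor_degree D = 0"
    using D E pq(3) by (intro exI[of _ "D + - E"]) (simp add: divide_inverse)
qed

lemma degree_0_principal:
  assumes "D \<in> divisors (rat_field u)" "divisor_degree D = 0"
  shows "D \<in> principal_divisors (rat_field u)"
proof -
  \<comment> \<open>The degree is corrected at infinity so that the claim also makes sense for a
    single place and can be proved by induction on formal differences.\<close>
  have "D - frag_cmul (divisor_degree D) (frag_of (rat_place_inf u)) \<in> principal_divisors (rat_field u)"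
    using assms(1) unfolding divisors_def mem_Collect_eq
  proof (induction D rule: frag_induction)
    case zero
    then show ?case using principal_0 by simp
  next
    case (one V)
    show ?case
    proof (cases rule: places_cases[OF one])
      case (1 a)
      have "\<exists>z\<in>rat_field u. z \<noteq> 0 \<and> has_divisor (rat_field u) z (frag_of (rat_place u a) - frag_of (rat_place_inf u))"
        by (intro bexI[of _ "u - const_emb a"] conjI has_divisor_linear u_minus_neq_0 diff u_mem const)
      then show ?thesis by (simp add: 1(1) principal_iff)
    next
      case 2
      then show ?thesis using principal_0 by simp
    qed
  next
    case (diff D E)
    have "(D - frag_cmul (divisor_degree D) (frag_of (rat_place_inf u))) -
       (E - frag_cmul (divisor_degree E) (frag_of (rat_place_inf u))) \<in> principal_divisors (rat_field u)"
      by (rule principal_diff) (use diff in auto)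
    then show ?case by (simp add: frag_cmul_diff_distrib algebra_simps)
  qed
  then show ?thesis using assms(2) by simp
qed

end

section \<open>Effective divisors and Riemann--Roch spaces\<close>

lemma frag_cmul_2: "frag_cmul 2 D = D + D"
  using frag_cmul_distrib[of 1 1 D] by simp

lemma divisor_degree_pos:
  assumes "\<And>V. Poly_Mapping.lookup D V \<ge> 0" "Poly_Mapping.lookup D W > 0"
  shows "divisor_degree D > 0"
  unfolding divisor_degree_def
  by (rule sum_pos2[of _ W]) (use assms in \<open>auto simp: in_keys_iff\<close>)

lemma effective_place:
  assumes "D \<in> divisors K" "\<And>V. Poly_Mapping.lookup D V \<ge> 0" "divisor_degree D > 0"
  obtains A where "A \<in> places K" "\<And>V. Poly_Mapping.lookup (D - frag_of A) V \<ge> 0"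
proof -
  have "\<exists>A\<in>Poly_Mapping.keys D. True"
  proof (rule ccontr)
    assume "\<not> (\<exists>A\<in>Poly_Mapping.keys D. True)"
    then have "Poly_Mapping.keys D = {}" by auto
    then show False using assms(3) by (simp add: divisor_degree_def)
  qed
  then obtain A where A: "A \<in> Poly_Mapping.keys D" by blast
  then have l: "Poly_Mapping.lookup D A \<ge> 1" using assms(2)[of A] by (simp add: in_keys_iff)
  have "Poly_Mapping.lookup (D - frag_of A) V \<ge> 0" for V
    using assms(2)[of V] l by (auto simp: lookup_minus)
  then show thesis using that A assms(1) by (auto simp: divisors_def)
qed

lemma effective_degree_0:
  assumes "\<And>V. Poly_Mapping.lookup D V \<ge> 0" "divisor_degree D = 0"
  shows "D = 0"
proof (rule poly_mapping_eqI)
  show "Poly_Mapping.lookup D V = Poly_Mapping.lookup 0 V" for V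
    using divisor_degree_pos[of D V] assms by (metis lookup_zero less_irrefl order_le_less)
qed

lemma effective_degree_2:
  assumes D: "D \<in> divisors K" "\<And>V. Poly_Mapping.lookup D V \<ge> 0" "divisor_degree D = 2"
  obtains A B where "A \<in> places K" "B \<in> places K" "D = frag_of A + frag_of B"
proof -
  obtain A where A: "A \<in> places K" "\<And>V. Poly_Mapping.lookup (D - frag_of A) V \<ge> 0"
    using effective_place[OF D(1,2)] D(3) by auto
  obtain B where B: "B \<in> places K" "\<And>V. Poly_Mapping.lookup (D - frag_of A - frag_of B) V \<ge> 0"
    using effective_place[of "D - frag_of A" K] A D by auto
  have "D - frag_of A - frag_of B = 0" by (rule effective_degree_0) (use B D in auto)
  then have "D = frag_of A + frag_of B" by (simp add: algebra_simps)
  then show thesis using that A B by blast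
qed

lemma const_emb_sum: "const_emb (sum f A) = (\<Sum>i\<in>A. const_emb (f i))"
  by (induction A rule: infinite_finite_induct) (auto simp: const_emb_add)

definition rr_space :: "'k::field ambient set \<Rightarrow> ('k ambient set \<Rightarrow>\<^sub>0 int) \<Rightarrow> 'k ambient set" where
  "rr_space K D = {z \<in> K. z \<noteq> 0 \<longrightarrow> (\<forall>V\<in>places K. ord_at V z \<ge> - Poly_Mapping.lookup D V)}"

definition const_indep :: "'i set \<Rightarrow> ('i \<Rightarrow> 'k::field ambient) \<Rightarrow> bool" where
  "const_indep I z \<longleftrightarrow> (\<forall>c. (\<Sum>i\<in>I. const_emb (c i) * z i) = 0 \<longrightarrow> (\<forall>i\<in>I. c i = 0))"

context discrete_field
begin

lemma rr_space_lincomb: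
  assumes y: "y \<in> rr_space K D" and z: "z \<in> rr_space K D"
  shows "y + const_emb c * z \<in> rr_space K D"
proof -
  have K: "y \<in> K" "z \<in> K" using y z by (auto simp: rr_space_def)
  have "ord_at V (y + const_emb c * z) \<ge> - Poly_Mapping.lookup D V"
    if V: "V \<in> places K" and nz: "y + const_emb c * z \<noteq> 0" for V
  proof -
    interpret V: discrete_place K V by (rule place[OF V])
    have y': "y \<noteq> 0 \<Longrightarrow> ord_at V y \<ge> - Poly_Mapping.lookup D V" using y V by (auto simp: rr_space_def)
    have z': "const_emb c * z \<noteq> 0 \<Longrightarrow> ord_at V (const_emb c * z) \<ge> - Poly_Mapping.lookup D V"
      using z V by (auto simp: rr_space_def V.ord_mult V.ord_const const)
    show ?thesis
    proof (cases "y = 0 \<or> const_emb c * z = 0")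
      case True
      then show ?thesis using y' z' nz by fastforce
    next
      case False
      then show ?thesis using V.ord_add_ge[of y "const_emb c * z"] y' z' nz K by (simp add: mult const)
    qed
  qed
  then show ?thesis using K by (simp add: rr_space_def add mult const)
qed

text \<open>Passing from \<open>D\<close> to \<open>D - V\<close> imposes a single linear condition,
  the vanishing of the leading coefficient at \<open>V\<close>, because the residue field is
  \<open>k\<close>. One vector is spent on eliminating this coefficient from the others. The
  resulting lower bounds on dimensions are all that is needed of Riemann-Roch.\<close>

lemma rr_space_cut:
  assumes I: "finite I" "card I = Suc n" and ind: "const_indep I z"
    and zD: "\<forall>i\<in>I. z i \<in> rr_space K D" and V: "V \<in> places K"
  shows "\<exists>J y. J \<subseteq> I \<and> card J = n \<and> const_indep J y \<and> (\<forall>i\<in>J. y i \<in> rr_space K (D - frag_of V))"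
proof -
  have z: "z i \<in> rr_space K D" if "i \<in> I" for i using zD that by blast
  interpret V: discrete_place K V by (rule place[OF V])
  obtain t where t: "t \<in> K" "t \<noteq> 0" "ord_at V t = 1" by (rule V.ord_1_exists)
  define r where "r = t powi (Poly_Mapping.lookup D V)"
  have r: "r \<in> K" "r \<noteq> 0" "ord_at V r = Poly_Mapping.lookup D V" using t by (auto simp: r_def powi V.ord_powi)
  have zr: "y * r \<in> V" if "y \<in> rr_space K D" for y
  proof (cases "y = 0")
    case False
    then have "ord_at V y \<ge> - Poly_Mapping.lookup D V" "y \<in> K" using that V by (auto simp: rr_space_def)
    then show ?thesis using r False by (subst V.mem_V_iff) (auto simp: mult V.ord_mult)
  qed (simp add: V.V_0)
  have cut: "y \<in> rr_space K (D - frag_of V)" if y: "y \<in> rr_space K D" "y * r \<in> max_ideal V" for y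
  proof -
    have K: "y \<in> K" using y by (simp add: rr_space_def)
    have "ord_at V' y \<ge> - Poly_Mapping.lookup (D - frag_of V) V'" if V': "V' \<in> places K" "y \<noteq> 0" for V'
    proof (cases "V' = V")
      case True
      have "ord_at V (y * r) > 0" using y(2) V.mem_ideal_iff[of "y * r"] K r V'(2) by (simp add: mult)
      then show ?thesis using True K r V'(2) by (simp add: V.ord_mult lookup_minus)
    next
      case False
      then show ?thesis using y(1) V' by (auto simp: rr_space_def lookup_minus)
    qed
    then show ?thesis using K by (simp add: rr_space_def)
  qed
  have "\<forall>i\<in>I. \<exists>c. z i * r - const_emb c \<in> max_ideal V" using V.residue zr z by blast
  then obtain c where c: "\<And>i. i \<in> I \<Longrightarrow> z i * r - const_emb (c i) \<in> max_ideal V" by metis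
  \<comment> \<open>The pivot has a nonzero leading coefficient if there is one. Otherwise any index
    will do: then \<open>c i / c j\<close> is 0 by convention, and the elimination leaves the
    vectors as they are.\<close>
  have "\<exists>j\<in>I. \<forall>i\<in>I. c i \<noteq> 0 \<longrightarrow> c j \<noteq> 0"
  proof (cases "\<exists>j\<in>I. c j \<noteq> 0")
    case False
    moreover have "I \<noteq> {}" using I by auto
    ultimately show ?thesis by blast
  qed blast
  then obtain j where j: "j \<in> I" "\<And>i. i \<in> I \<Longrightarrow> c i \<noteq> 0 \<Longrightarrow> c j \<noteq> 0" by blast
  define y where "y i = z i + const_emb (- (c i / c j)) * z j" for i
  have "const_indep (I - {j}) y"
    unfolding const_indep_def
  proof (intro allI impI)
    fix a assume a: "(\<Sum>i\<in>I - {j}. const_emb (a i) * y i) = 0"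
    define S where "S = (\<Sum>i\<in>I - {j}. a i * - (c i / c j))"
    have S: "const_emb S = (\<Sum>i\<in>I - {j}. const_emb (a i) * const_emb (- (c i / c j)))"
      unfolding S_def const_emb_sum const_emb_mult ..
    have "(\<Sum>i\<in>I. const_emb ((a(j := S)) i) * z i) = const_emb S * z j + (\<Sum>i\<in>I - {j}. const_emb (a i) * z i)"
      using I(1) j(1) by (subst sum.remove[of I j]) (auto intro!: sum.cong)
    also have "\<dots> = (\<Sum>i\<in>I - {j}. const_emb (a i) * y i)"
      unfolding S y_def by (simp add: sum_distrib_right sum_distrib_left sum.distrib algebra_simps)
    finally have "(\<Sum>i\<in>I. const_emb ((a(j := S)) i) * z i) = 0" using a by (simp only:)
    then have "\<forall>i\<in>I. (a(j := S)) i = 0" using ind unfolding const_indep_def by blast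
    then show "\<forall>i\<in>I - {j}. a i = 0" by (metis DiffE fun_upd_other singletonI)
  qed
  moreover have "y i \<in> rr_space K (D - frag_of V)" if i: "i \<in> I" for i
  proof (rule cut)
    show "y i \<in> rr_space K D" unfolding y_def by (intro rr_space_lincomb z i j)
    have "(z i * r - const_emb (c i)) + const_emb (- (c i / c j)) * (z j * r - const_emb (c j)) \<in> max_ideal V"
      by (intro V.ideal_add V.ideal_mult2 V.V_const c i j)
    moreover have "(z i * r - const_emb (c i)) + const_emb (- (c i / c j)) * (z j * r - const_emb (c j)) = y i * r"
      using j(2)[OF i] unfolding y_def by (cases "c j = 0") (auto simp: const_emb_minus const_emb_divide field_simps)
    ultimately show "y i * r \<in> max_ideal V" by (simp only:)
  qed
  ultimately show ?thesis using I j(1) by (intro exI[of _ "I - {j}"] exI[of _ y]) simp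
qed

end

text \<open>A function without finite poles and with a zero at infinity would have a divisor of
  positive degree.\<close>

lemma (in rational) ord_inf_nonpos:
  assumes z: "z \<in> rat_field u" "z \<noteq> 0" and fin: "\<And>a. ord_at (rat_place u a) z \<ge> 0"
  shows "ord_at (rat_place_inf u) z \<le> 0"
proof (rule ccontr)
  assume pos: "\<not> ord_at (rat_place_inf u) z \<le> 0"
  obtain D where D: "has_divisor (rat_field u) z D" "divisor_degree D = 0" using divisor[OF z] by blast
  have "Poly_Mapping.lookup D V \<ge> 0" for V
  proof (cases "V \<in> places (rat_field u)")
    case True
    then have "ord_at V z \<ge> 0" using fin pos by (cases rule: places_cases) auto
    then show ?thesis using D(1) True by (simp add: has_divisor_def)
  next
    case False
    then show ?thesis using divisors_lookup[OF has_divisor_divisors[OF D(1)]] by simp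
  qed
  moreover have "Poly_Mapping.lookup D (rat_place_inf u) > 0" using D(1) place_inf(1) pos by (simp add: has_divisor_def)
  ultimately show False using divisor_degree_pos[of D] D(2) by simp
qed

section \<open>Hyperelliptic function fields\<close>

text \<open>Odd degree gives \<open>v^2\<close> odd order at infinity. So a single, ramified place
  \<open>infty\<close> lies there; it is fixed by the conjugation and serves as the base
  point.\<close>

locale hyperelliptic = rational u for u :: "'k::{alg_closed_field, field_char_0} ambient" +
  fixes v :: "'k ambient" and g :: "'k poly"
  assumes v_sq: "v ^ 2 = eval_at g u" and squarefree: "rsquarefree g"
    and odd_degree: "odd (Polynomial.degree g)" and degree_ge_3: "Polynomial.degree g \<ge> 3"
begin

lemma g_neq_0: "g \<noteq> 0" using degree_ge_3 by auto

lemma ord_g_inf: "ord_at (rat_place_inf u) (v ^ 2) = - int (Polynomial.degree g)"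
  using ord_poly_inf[OF g_neq_0] v_sq by simp

lemma ord_g: "ord_at (rat_place u a) (v ^ 2) = (if poly g a = 0 then 1 else 0)"
proof (cases "poly g a = 0")
  case True
  then have o: "Polynomial.order a g = 1"
  proof -
    have "Polynomial.order a g \<noteq> 0" using True g_neq_0 order_root[of g a] by simp
    moreover have "Polynomial.order a g = 0 \<or> Polynomial.order a g = 1"
      using squarefree unfolding rsquarefree_def by blast
    ultimately show ?thesis by simp
  qed
  obtain q where q: "g = [:- a, 1:] ^ 1 * q" "\<not> [:- a, 1:] dvd q"
    using order_decomp[OF g_neq_0, of a] unfolding o by blast
  have qa: "poly q a \<noteq> 0" using q(2) by (simp add: poly_eq_0_iff_dvd)
  interpret V: discrete_place "rat_field u" "rat_place u a" by (rule place[OF rat_place_place(1)])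
  have e: "v ^ 2 = (u - const_emb a) * eval_at q u"
    unfolding v_sq q(1) by (simp add: const_emb_minus algebra_simps)
  have q0: "eval_at q u \<noteq> 0" using qa ev0 by auto
  have "ord_at (rat_place u a) (v ^ 2) = ord_at (rat_place u a) (u - const_emb a) + ord_at (rat_place u a) (eval_at q u)"
    unfolding e by (rule V.ord_mult[OF diff[OF u_mem const] rat_field_poly u_minus_neq_0 q0])
  then show ?thesis using True ord_poly_at(2)[OF qa] ord_poly_at(3) by simp
next
  case False
  then show ?thesis using ord_poly_at(2)[OF False] v_sq by simp
qed

text \<open>\<open>v^2\<close> has odd order at infinity, so it is not the square of a function of
  \<open>u\<close>.\<close>

lemma v_notin: "v \<notin> rat_field u"
proof
  assume v: "v \<in> rat_field u"
  interpret V: discrete_place "rat_field u" "rat_place_inf u" by (rule place[OF place_inf(1)])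
  have "v \<noteq> 0"
  proof
    assume "v = 0"
    then have "eval_at g u = 0" using v_sq by simp
    then show False using ev0 g_neq_0 by blast
  qed
  then have "ord_at (rat_place_inf u) (v ^ 2) = 2 * ord_at (rat_place_inf u) v" using V.ord_power[OF v, of 2] by simp
  then have "int (Polynomial.degree g) = 2 * (- ord_at (rat_place_inf u) v)" using ord_g_inf by simp
  then have "even (int (Polynomial.degree g))" by (rule dvdI)
  then show False using odd_degree by simp
qed

sublocale quad_ext "rat_field u" v
  by unfold_locales (use v_notin v_sq rat_field_poly in auto)

lemma curve: "curve_field L"
  by (rule curve_field_L) unfold_locales

sublocale L: curve_field L by (rule curve)

lemma u_L: "u \<in> L" by (rule K_sub_L[OF u_mem])

lemma v_L: "v \<in> L" by (rule s_L)

lemma v_neq_0: "v \<noteq> 0" by (rule s_neq_0)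

definition "infty = (SOME V. V \<in> places L \<and> V \<inter> rat_field u = rat_place_inf u)"

lemma infty: "infty \<in> places L" "infty \<inter> rat_field u = rat_place_inf u"
proof -
  have "\<exists>V. V \<in> places L \<and> V \<inter> rat_field u = rat_place_inf u" using place_over[OF place_inf(1)] by blast
  then have "infty \<in> places L \<and> infty \<inter> rat_field u = rat_place_inf u" unfolding infty_def by (rule someI_ex)
  then show "infty \<in> places L" "infty \<inter> rat_field u = rat_place_inf u" by auto
qed

lemma conj_infty: "conj ` infty = infty"
  using ramified_iff[OF infty(1)] odd_degree by (simp add: infty(2) ord_g_inf)

lemma infty_unique: "V \<in> places L \<Longrightarrow> V \<inter> rat_field u = rat_place_inf u \<Longrightarrow> V = infty"
  using same_restrict_iff[OF infty(1)] infty(2) conj_infty by auto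

lemma conj_neq_infty: "V \<in> places L \<Longrightarrow> V \<noteq> infty \<Longrightarrow> conj ` V \<noteq> infty"
  using conj_image_conj[OF place_sub] conj_infty by metis

lemma finite_place:
  assumes "V \<in> places L" "V \<noteq> infty"
  obtains a where "V \<inter> rat_field u = rat_place u a" "u - const_emb a \<in> max_ideal V"
proof (cases rule: places_cases[OF restrict_place[OF assms(1)]])
  case (1 a)
  have "u - const_emb a \<in> rat_field u" by (intro diff u_mem const)
  then have "u - const_emb a \<in> max_ideal V" using 1(2) ideal_restrict by blast
  then show ?thesis using that 1(1) by blast
next
  case 2
  then show ?thesis using infty_unique assms by blast
qed

lemma ord_infty: "z \<in> rat_field u \<Longrightarrow> z \<noteq> 0 \<Longrightarrow> ord_at infty z = 2 * ord_at (rat_place_inf u) z"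
  using ord_restrict[OF infty(1)] by (simp add: conj_infty infty(2))

lemma ord_infty_v: "ord_at infty v = - int (Polynomial.degree g)"
proof -
  interpret V: discrete_place L infty by (rule L.place[OF infty(1)])
  have "2 * ord_at infty v = ord_at infty (v ^ 2)" using V.ord_power[OF v_L v_neq_0, of 2] by simp
  also have "\<dots> = 2 * - int (Polynomial.degree g)"
    using ord_infty[OF s_sq] v_neq_0 ord_g_inf by simp
  finally show ?thesis by simp
qed

lemma ord_infty_poly: "p \<noteq> 0 \<Longrightarrow> ord_at infty (eval_at p u) = - 2 * int (Polynomial.degree p)"
  using ord_infty[OF rat_field_poly] ev0 ord_poly_inf by simp

lemma ord_finite_poly: "V \<in> places L \<Longrightarrow> V \<noteq> infty \<Longrightarrow> p \<noteq> 0 \<Longrightarrow> ord_at V (eval_at p u) \<ge> 0"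
proof -
  assume V: "V \<in> places L" "V \<noteq> infty" and p: "p \<noteq> 0"
  obtain a where "V \<inter> rat_field u = rat_place u a" by (rule finite_place[OF V])
  then show ?thesis using ord_restrict[OF V(1) rat_field_poly] ev0 p ord_poly_at(1)[OF p, of a] by auto
qed

lemma ord_v:
  assumes V: "V \<in> places L" "V \<noteq> infty"
  shows "ord_at V v = (if conj ` V = V then 1 else 0)"
proof -
  interpret V: discrete_place L V by (rule L.place[OF V(1)])
  obtain a where a: "V \<inter> rat_field u = rat_place u a" by (rule finite_place[OF V])
  have "2 * ord_at V v = ord_at V (v ^ 2)" using V.ord_power[OF v_L v_neq_0, of 2] by simp
  also have "\<dots> = (if conj ` V = V then 2 else 1) * ord_at (rat_place u a) (v ^ 2)"
    using ord_restrict[OF V(1) s_sq] v_neq_0 a by simp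
  finally show ?thesis using ramified_iff[OF V(1)] unfolding a ord_g by (auto split: if_splits)
qed

text \<open>The push-forward to \<open>k(u)\<close> is principal, since it has degree 0. So the
  conjugation acts as inversion on the classes of degree 0.\<close>

lemma degree_0_conj:
  assumes D: "D \<in> divisors L" "divisor_degree D = 0"
  shows "D + conj_div D \<in> principal_divisors L"
  by (rule principal_pull[OF D(1)]) (rule degree_0_principal[OF push_divisors[OF D(1)]], use D in simp)

lemma fibre_principal: "V \<in> places L \<Longrightarrow> frag_of V + frag_of (conj ` V) - frag_cmul 2 (frag_of infty) \<in> principal_divisors L"
proof -
  assume V: "V \<in> places L"
  have "(frag_of V - frag_of infty) + conj_div (frag_of V - frag_of infty) \<in> principal_divisors L"
    by (rule degree_0_conj) (use V infty in auto)
  moreover have "frag_cmul 2 (frag_of infty) = frag_of infty + frag_of infty"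
    using frag_cmul_distrib[of 1 1 "frag_of infty"] by simp
  ultimately show ?thesis by (simp add: conj_infty algebra_simps)
qed

text \<open>Let \<open>z = A + B v\<close>. The difference \<open>z - conj z = 2 B v\<close>
  satisfies the same bounds as \<open>z\<close>, so \<open>B\<close> has no finite poles and hence,
  if nonzero, order at most 0 at infinity. Then \<open>B v\<close> has a pole of order at least
  \<open>degree g\<close> at \<open>infty\<close>, against the assumption.\<close>

lemma regular_in_base:
  assumes z: "z \<in> L" "z \<noteq> 0" and fin: "\<And>V. V \<in> places L \<Longrightarrow> V \<noteq> infty \<Longrightarrow> ord_at V z \<ge> 0"
    and inf: "ord_at infty z > - int (Polynomial.degree g)"
  shows "z \<in> rat_field u"
proof -
  obtain A B where AB: "A \<in> rat_field u" "B \<in> rat_field u" "z = A + B * v" by (rule L_E[OF z(1)])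
  have "B = 0"
  proof (rule ccontr)
    assume B: "B \<noteq> 0"
    have w: "z - conj z = (2 * B) * v" using AB by (simp add: conj_eq)
    have B2: "2 * B \<in> rat_field u" "2 * B \<noteq> 0"
      using AB B ambient_2_neq_0[where 'k = 'k] by (auto simp: mult numeral)
    then have wn: "(2 * B) * v \<noteq> 0" using v_neq_0 by auto
    have ge: "ord_at V ((2 * B) * v) \<ge> n" if V: "V \<in> places L" "ord_at V z \<ge> n" "ord_at (conj ` V) z \<ge> n" for V n
    proof -
      interpret V: discrete_place L V by (rule L.place[OF V(1)])
      have "ord_at V (- conj z) \<ge> n" using V z by (simp add: V.ord_minus conj_L conj_0_iff ord_conj)
      then have "ord_at V (z + - conj z) \<ge> n"
        using V.ord_add_ge[of z "- conj z" n] z V(2) w wn by (simp add: conj_L conj_0_iff conj_minus)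
      then show ?thesis using w by simp
    qed
    have fin': "ord_at (rat_place u a) (2 * B) \<ge> 0" for a
    proof -
      obtain V where V: "V \<in> places L" "V \<inter> rat_field u = rat_place u a" using place_over[OF rat_place_place(1)] by blast
      have ni: "V \<noteq> infty" using V(2) infty(2) rat_place_inj(2) by metis
      interpret V: discrete_place L V by (rule L.place[OF V(1)])
      have "0 \<le> ord_at V ((2 * B) * v)"
        by (rule ge) (use fin conj_place V ni conj_neq_infty in auto)
      also have "\<dots> = ord_at V (2 * B) + ord_at V v" using V.ord_mult[OF K_sub_L[OF B2(1)] v_L B2(2) v_neq_0] .
      \<comment> \<open>At a ramified place \<open>v\<close> has order 1 and the order
        \<open>n\<close> of \<open>2 * B\<close> below is doubled; \<open>2 * n + 1 \<ge> 0\<close>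
        still forces \<open>n \<ge> 0\<close>.\<close>
      finally show ?thesis using ord_v[OF V(1) ni] ord_restrict[OF V(1) B2] V(2) by (auto split: if_splits)
    qed
    interpret V: discrete_place L infty by (rule L.place[OF infty(1)])
    have "- int (Polynomial.degree g) + 1 \<le> ord_at infty ((2 * B) * v)"
      by (rule ge) (use infty conj_infty inf in auto)
    also have "\<dots> = 2 * ord_at (rat_place_inf u) (2 * B) - int (Polynomial.degree g)"
      using V.ord_mult[OF K_sub_L[OF B2(1)] v_L B2(2) v_neq_0] ord_infty[OF B2] ord_infty_v by simp
    finally show False using ord_inf_nonpos[OF B2 fin'] by simp
  qed
  then show ?thesis using AB by simp
qed

text \<open>By \<open>regular_in_base\<close> the function lies in \<open>k(u)\<close>: the
  conjugation fixes it, and its orders at ramified places are doubled orders from below.\<close>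

lemma principal_conj_invariant:
  assumes D: "D \<in> principal_divisors L" and fin: "\<And>V. V \<in> places L \<Longrightarrow> V \<noteq> infty \<Longrightarrow> Poly_Mapping.lookup D V \<ge> 0"
    and inf: "Poly_Mapping.lookup D infty > - int (Polynomial.degree g)"
  shows "conj_div D = D" "V \<in> places L \<Longrightarrow> conj ` V = V \<Longrightarrow> even (Poly_Mapping.lookup D V)"
proof -
  obtain z where z: "z \<in> L" "z \<noteq> 0" "has_divisor L z D" using D L.principal_iff by blast
  have lk: "Poly_Mapping.lookup D V = ord_at V z" if "V \<in> places L" for V using z(3) that by (simp add: has_divisor_def)
  have K: "z \<in> rat_field u"
    by (rule regular_in_base[OF z(1,2)]) (use fin inf lk infty in auto)
  have "has_divisor L (conj z) (conj_div D)" by (rule has_divisor_conj[OF z])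
  then show "conj_div D = D" using has_divisor_unique z(3) conj_K[OF K] by metis
  show "even (Poly_Mapping.lookup D V)" if "V \<in> places L" "conj ` V = V"
    using ord_restrict[OF that(1) K z(2)] that lk by simp
qed

text \<open>A function with one simple pole cannot exist. Moving the pole to infinity gives
  \<open>V + conj V' - 2 infty\<close>, whose pole order 2 is below \<open>degree g\<close>;
  invariance under conjugation makes distinct \<open>V\<close> and \<open>V'\<close> both ramified,
  where the coefficients would have to be even.\<close>

lemma principal_diff_imp_eq:
  assumes V: "V \<in> places L" "V' \<in> places L" and p: "frag_of V - frag_of V' \<in> principal_divisors L"
  shows "V = V'"
proof (rule ccontr)
  assume ne: "V \<noteq> V'"
  define D where "D = frag_of V + frag_of (conj ` V') - frag_cmul 2 (frag_of infty)"
  have "(frag_of V - frag_of V') + (frag_of V' + frag_of (conj ` V') - frag_cmul 2 (frag_of infty)) \<in> principal_divisors L"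
    by (rule L.principal_add[OF p fibre_principal[OF V(2)]])
  then have D: "D \<in> principal_divisors L" by (simp add: D_def algebra_simps)
  have inv: "conj_div D = D" and ev: "\<And>V. V \<in> places L \<Longrightarrow> conj ` V = V \<Longrightarrow> even (Poly_Mapping.lookup D V)"
    using principal_conj_invariant[OF D] degree_ge_3 by (auto simp: D_def lookup_add lookup_minus)
  have cc: "conj ` conj ` V' = V'" using conj_image_conj[OF place_sub[OF V(2)]] .
  have "conj_div D = frag_of (conj ` V) + frag_of V' - frag_cmul 2 (frag_of infty)"
    by (simp add: D_def conj_infty cc)
  then have "frag_of (conj ` V) + frag_of V' - frag_cmul 2 (frag_of infty) = D" using inv by (simp only:)
  then have e: "frag_of V + frag_of (conj ` V') = frag_of (conj ` V) + frag_of V'"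
    unfolding D_def using diff_eq_eq eq_diff_eq by (metis add_diff_cancel_right' diff_add_cancel)
  have "Poly_Mapping.lookup (frag_of V + frag_of (conj ` V')) V = Poly_Mapping.lookup (frag_of (conj ` V) + frag_of V') V"
    using e by simp
  then have 1: "conj ` V = V" using ne by (auto simp: lookup_add split: if_splits)
  have "Poly_Mapping.lookup (frag_of V + frag_of (conj ` V')) V' = Poly_Mapping.lookup (frag_of (conj ` V) + frag_of V') V'"
    using e by simp
  then have 2: "conj ` V' = V'" using ne 1 by (auto simp: lookup_add split: if_splits)
  have "even (Poly_Mapping.lookup D V)" "even (Poly_Mapping.lookup D V')" using ev 1 2 V by auto
  then show False using ne by (auto simp: D_def 2 lookup_add lookup_minus split: if_splits)
qed

definition "weierstrass = {V \<in> places L. conj ` V = V}"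

lemma infty_weierstrass: "infty \<in> weierstrass"
  using infty conj_infty by (simp add: weierstrass_def)

text \<open>All three claims are read off from the divisor of \<open>v\<close>, with simple zeros at
  the finite ramified places and a pole of order \<open>degree g\<close> at \<open>infty\<close>.
  Since \<open>infty\<close> itself is one of the summands, the subtracted multiple is
  \<open>degree g + 1\<close>; degree 0 then counts the places.\<close>

lemma weierstrass_divisor:
  shows "finite weierstrass" "card weierstrass = Polynomial.degree g + 1"
    "(\<Sum>V\<in>weierstrass. frag_of V) - frag_cmul (int (Polynomial.degree g + 1)) (frag_of infty) \<in> principal_divisors L"
proof -
  obtain D where D: "has_divisor L v D" "divisor_degree D = 0" using L.divisor[OF v_L v_neq_0] by blast
  have lk: "Poly_Mapping.lookup D V = (if V = infty then - int (Polynomial.degree g) else if conj ` V = V then 1 else 0)"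
    if "V \<in> places L" for V
    using D(1) that ord_v ord_infty_v by (simp add: has_divisor_def)
  have keys: "Poly_Mapping.keys D = weierstrass"
  proof (intro equalityI subsetI)
    fix V assume V: "V \<in> Poly_Mapping.keys D"
    then have "V \<in> places L" using D by (auto simp: has_divisor_def)
    then show "V \<in> weierstrass"
      using V lk[of V] infty_weierstrass by (auto simp: weierstrass_def in_keys_iff split: if_splits)
  next
    fix V assume "V \<in> weierstrass"
    then show "V \<in> Poly_Mapping.keys D"
      using lk[of V] degree_ge_3 by (auto simp: weierstrass_def in_keys_iff split: if_splits)
  qed
  show fin: "finite weierstrass" using finite_keys[of D] keys by simp
  have D': "D = (\<Sum>V\<in>weierstrass. frag_of V) - frag_cmul (int (Polynomial.degree g + 1)) (frag_of infty)"
  proof (rule poly_mapping_eqI)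
    fix V
    have s: "Poly_Mapping.lookup (\<Sum>V\<in>weierstrass. frag_of V) V = (if V \<in> weierstrass then 1 else 0)"
    proof -
      have "Poly_Mapping.lookup (\<Sum>V\<in>weierstrass. frag_of V) V = (\<Sum>V'\<in>weierstrass. if V = V' then 1 else 0)"
        unfolding lookup_sum by (rule sum.cong) auto
      then show ?thesis using fin by simp
    qed
    show "Poly_Mapping.lookup D V = Poly_Mapping.lookup ((\<Sum>V\<in>weierstrass. frag_of V) - frag_cmul (int (Polynomial.degree g + 1)) (frag_of infty)) V"
    proof (cases "V \<in> places L")
      case True
      then have w: "V \<in> weierstrass \<longleftrightarrow> conj ` V = V" by (simp add: weierstrass_def)
      show ?thesis
        unfolding lookup_minus lookup_frag_cmul lookup_frag_of s w lk[OF True]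
        using conj_infty by (cases "V = infty") simp_all
    next
      case False
      then have "V \<notin> weierstrass" "V \<noteq> infty" using infty by (auto simp: weierstrass_def)
      then show ?thesis using divisors_lookup[OF has_divisor_divisors[OF D(1)] False] by (simp add: lookup_minus s)
    qed
  qed
  have "divisor_degree (\<Sum>V\<in>A. frag_of V) = int (card A)" if "finite A" for A :: "'k ambient set set"
    using that by (induction A) auto
  then show "card weierstrass = Polynomial.degree g + 1" using D(2) fin unfolding D' by simp
  show "(\<Sum>V\<in>weierstrass. frag_of V) - frag_cmul (int (Polynomial.degree g + 1)) (frag_of infty) \<in> principal_divisors L"
    using D(1) v_L v_neq_0 unfolding D' L.principal_iff by blast
qed

lemma weierstrass_double:
  "V \<in> weierstrass \<Longrightarrow> frag_cmul 2 (frag_of V - frag_of infty) \<in> principal_divisors L"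
  using fibre_principal[of V] by (simp add: weierstrass_def frag_cmul_2 algebra_simps)

end

section \<open>Curves of genus 2\<close>

locale genus2 = hyperelliptic +
  assumes degree_5: "Polynomial.degree g = 5"
begin

text \<open>The pole orders at \<open>infty\<close> are 0, 2, 4 and 5. Four functions are what is
  needed for one to survive the three conditions in \<open>three_places\<close>.\<close>

lemma rr_basis:
  "i < 4 \<Longrightarrow> [1, u, u ^ 2, v] ! i \<in> rr_space L (frag_cmul 5 (frag_of infty))"
  "const_indep {..<4} (\<lambda>i. [1, u, u ^ 2, v] ! i)"
proof -
  have p: "eval_at p u \<in> rr_space L (frag_cmul 5 (frag_of infty))" if "p \<noteq> 0" "Polynomial.degree p \<le> 2" for p
  proof -
    have "ord_at V (eval_at p u) \<ge> - Poly_Mapping.lookup (frag_cmul 5 (frag_of infty)) V" if "V \<in> places L" for V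
      using ord_finite_poly[OF that _ \<open>p \<noteq> 0\<close>] ord_infty_poly[OF \<open>p \<noteq> 0\<close>] \<open>Polynomial.degree p \<le> 2\<close>
      by (cases "V = infty") auto
    then show ?thesis by (simp add: rr_space_def K_sub_L rat_field_poly)
  qed
  have v: "v \<in> rr_space L (frag_cmul 5 (frag_of infty))"
  proof -
    have "ord_at V v \<ge> - Poly_Mapping.lookup (frag_cmul 5 (frag_of infty)) V" if "V \<in> places L" for V
      using ord_v[OF that] ord_infty_v degree_5 by (cases "V = infty") auto
    then show ?thesis by (simp add: rr_space_def v_L)
  qed
  have b: "1 \<in> rr_space L (frag_cmul 5 (frag_of infty))" "u \<in> rr_space L (frag_cmul 5 (frag_of infty))"
    "u ^ 2 \<in> rr_space L (frag_cmul 5 (frag_of infty))"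
    using p[of 1] p[of "[:0, 1:]"] p[of "[:0, 0, 1:]"] by (auto simp: power2_eq_square)
  show "[1, u, u ^ 2, v] ! i \<in> rr_space L (frag_cmul 5 (frag_of infty))" if "i < 4"
  proof -
    have "i = 0 \<or> i = 1 \<or> i = 2 \<or> i = 3" using that by linarith
    then show ?thesis using b v by (elim disjE) (simp_all add: eval_nat_numeral)
  qed
  show "const_indep {..<4} (\<lambda>i. [1, u, u ^ 2, v] ! i)"
    unfolding const_indep_def
  proof (intro allI impI)
    fix c :: "nat \<Rightarrow> 'a"
    assume "(\<Sum>i<4. const_emb (c i) * [1, u, u ^ 2, v] ! i) = 0"
    then have s: "eval_at [:c 0, c 1, c 2:] u + const_emb (c 3) * v = 0"
      by (simp add: eval_nat_numeral algebra_simps)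
    have "eval_at [:c 0, c 1, c 2:] u = 0 \<and> const_emb (c 3) = 0"
      by (rule repr_0[OF rat_field_poly const s])
    then have "[:c 0, c 1, c 2:] = 0" "c 3 = 0" using ev0[of "[:c 0, c 1, c 2:]"] by simp_all
    then have c: "c 0 = 0" "c 1 = 0" "c 2 = 0" "c 3 = 0" by auto
    show "\<forall>i\<in>{..<4}. c i = 0"
    proof
      fix i :: nat assume "i \<in> {..<4}"
      then have "i = 0 \<or> i = 1 \<or> i = 2 \<or> i = 3" by auto
      then show "c i = 0" using c by (elim disjE) simp_all
    qed
  qed
qed

text \<open>Three cuts leave a nonzero function in \<open>L(5 infty - P - Q - R)\<close>. Its
  remaining zeros form an effective divisor of degree 2, so \<open>P + Q + R\<close> plus two points
  is equivalent to \<open>5 infty\<close>; conjugating the two points moves them to the other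
  side.\<close>

lemma three_places:
  assumes "P \<in> places L" "Q \<in> places L" "R \<in> places L"
  obtains A B where "A \<in> places L" "B \<in> places L"
    "frag_of P + frag_of Q + frag_of R - (frag_of A + frag_of B + frag_of infty) \<in> principal_divisors L"
proof -
  let ?D = "frag_cmul 5 (frag_of infty)"
  have c4: "card {..<4::nat} = Suc (Suc (Suc (Suc 0)))" by simp
  have m0: "\<forall>i\<in>{..<4}. [1, u, u ^ 2, v] ! i \<in> rr_space L ?D" using rr_basis(1) by simp
  obtain J y where 1: "J \<subseteq> {..<4::nat}" "card J = Suc (Suc (Suc 0))" "const_indep J y"
      "\<forall>i\<in>J. y i \<in> rr_space L (?D - frag_of P)"
    using L.rr_space_cut[OF finite_lessThan c4 rr_basis(2) m0 assms(1)] by (elim exE conjE)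
  have f1: "finite J" using 1(1) by (rule finite_subset) simp
  obtain J' y' where 2: "J' \<subseteq> J" "card J' = Suc (Suc 0)" "const_indep J' y'"
      "\<forall>i\<in>J'. y' i \<in> rr_space L (?D - frag_of P - frag_of Q)"
    using L.rr_space_cut[OF f1 1(2,3) 1(4) assms(2)] by (elim exE conjE)
  have f2: "finite J'" using 2(1) f1 by (rule finite_subset)
  obtain J'' y'' where 30: "J'' \<subseteq> J'" and 3: "card J'' = Suc 0" "const_indep J'' y''"
      "\<forall>i\<in>J''. y'' i \<in> rr_space L (?D - frag_of P - frag_of Q - frag_of R)"
    using L.rr_space_cut[OF f2 2(2,3) 2(4) assms(3)] by (elim exE conjE)
  obtain i where i: "J'' = {i}" using 3(1) by (auto simp: card_Suc_eq)
  define z where "z = y'' i"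
  have zs: "z \<in> rr_space L (?D - frag_of P - frag_of Q - frag_of R)" using 3(3) i by (simp add: z_def)
  have z0: "z \<noteq> 0"
  proof
    assume "z = 0"
    then have "(\<Sum>j\<in>J''. const_emb 1 * y'' j) = 0" by (simp add: i z_def)
    then have "\<forall>j\<in>J''. (1 :: 'a) = 0" using 3(2)[unfolded const_indep_def, rule_format, of "\<lambda>_. 1"] by blast
    then show False using i by simp
  qed
  have zL: "z \<in> L" using zs by (simp add: rr_space_def)
  obtain D where D: "has_divisor L z D" "divisor_degree D = 0" using L.divisor[OF zL z0] by blast
  define E where "E = D + (?D - frag_of P - frag_of Q - frag_of R)"
  have E: "E \<in> divisors L" using has_divisor_divisors[OF D(1)] assms infty by (simp add: E_def)
  have pos: "Poly_Mapping.lookup E V \<ge> 0" for V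
  proof (cases "V \<in> places L")
    case True
    then have "ord_at V z \<ge> - Poly_Mapping.lookup (?D - frag_of P - frag_of Q - frag_of R) V"
      using zs z0 by (simp add: rr_space_def)
    moreover have "Poly_Mapping.lookup D V = ord_at V z" using D(1) True by (simp add: has_divisor_def)
    ultimately show ?thesis unfolding E_def lookup_add by linarith
  next
    case False
    then show ?thesis using divisors_lookup[OF E] by simp
  qed
  have "divisor_degree E = 2" using D(2) by (simp add: E_def)
  then obtain A B where AB: "A \<in> places L" "B \<in> places L" "E = frag_of A + frag_of B"
    using effective_degree_2[OF E pos] by blast
  have "D \<in> principal_divisors L" using D(1) zL z0 L.principal_iff by blast
  then have "(frag_of A + frag_of (conj ` A) - frag_cmul 2 (frag_of infty)) +
     (frag_of B + frag_of (conj ` B) - frag_cmul 2 (frag_of infty)) - D \<in> principal_divisors L"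
    by (intro L.principal_diff L.principal_add fibre_principal AB)
  moreover have "D = frag_of A + frag_of B - (?D - frag_of P - frag_of Q - frag_of R)"
    using AB(3) by (simp add: E_def algebra_simps)
  moreover have "?D = frag_cmul 2 (frag_of infty) + frag_cmul 2 (frag_of infty) + frag_of infty"
    by (rule poly_mapping_eqI) (simp add: lookup_add)
  moreover have "x1 + x2 - t + (y1 + y2 - t) - (x1 + y1 - ((t + t + w) - p - q - r)) = w - (p + q + r) + (x2 + y2)"
    for x1 x2 y1 y2 t w p q r :: "'a ambient set \<Rightarrow>\<^sub>0 int" by (simp add: algebra_simps)
  ultimately have "- (frag_of P + frag_of Q + frag_of R) + frag_of infty + (frag_of (conj ` A) + frag_of (conj ` B)) \<in> principal_divisors L"
    by (simp add: algebra_simps)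
  from L.principal_minus[OF this]
  have "frag_of P + frag_of Q + frag_of R - (frag_of (conj ` A) + frag_of (conj ` B) + frag_of infty) \<in> principal_divisors L"
    by (simp add: algebra_simps)
  then show thesis using that conj_place AB by blast
qed

text \<open>The multiplicity of \<open>infty\<close> is left free, so that the induction over
  divisors need not keep track of degrees; for degree 0 it is forced to be -2.\<close>

definition reducible_to_two where
  "reducible_to_two D \<longleftrightarrow> (\<exists>P\<in>places L. \<exists>Q\<in>places L. \<exists>n.
     D - (frag_of P + frag_of Q + frag_cmul n (frag_of infty)) \<in> principal_divisors L)"

lemma reducible_shift:
  assumes "reducible_to_two D" "E - D - frag_cmul m (frag_of infty) \<in> principal_divisors L"
  shows "reducible_to_two E"
proof -
  obtain P Q n where P: "P \<in> places L" "Q \<in> places L"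
    "D - (frag_of P + frag_of Q + frag_cmul n (frag_of infty)) \<in> principal_divisors L"
    using assms(1) unfolding reducible_to_two_def by blast
  have "E - (frag_of P + frag_of Q + frag_cmul (n + m) (frag_of infty)) \<in> principal_divisors L"
    using L.principal_add[OF P(3) assms(2)] by (simp add: frag_cmul_distrib algebra_simps)
  then show ?thesis using P unfolding reducible_to_two_def by blast
qed

lemma reducible_add:
  assumes D: "reducible_to_two D" and V: "V \<in> places L"
  shows "reducible_to_two (D + frag_of V)"
proof -
  obtain P Q n where P: "P \<in> places L" "Q \<in> places L"
    "D - (frag_of P + frag_of Q + frag_cmul n (frag_of infty)) \<in> principal_divisors L"
    using D unfolding reducible_to_two_def by blast
  obtain A B where A: "A \<in> places L" "B \<in> places L"
    "frag_of P + frag_of Q + frag_of V - (frag_of A + frag_of B + frag_of infty) \<in> principal_divisors L"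
    using three_places[OF P(1,2) V] .
  have "D + frag_of V - (frag_of A + frag_of B + frag_cmul (n + 1) (frag_of infty)) \<in> principal_divisors L"
    using L.principal_add[OF P(3) A(3)] by (simp add: frag_cmul_distrib algebra_simps)
  then show ?thesis using A unfolding reducible_to_two_def by blast
qed

text \<open>Subtracting a place amounts to adding its conjugate, up to
  \<open>2 infty\<close>.\<close>

lemma reducible_minus:
  assumes D: "reducible_to_two D" and V: "V \<in> places L"
  shows "reducible_to_two (D - frag_of V)"
proof (rule reducible_shift)
  show "reducible_to_two (D + frag_of (conj ` V))" by (rule reducible_add[OF D conj_place[OF V]])
  show "D - frag_of V - (D + frag_of (conj ` V)) - frag_cmul (- 2) (frag_of infty) \<in> principal_divisors L"
    using L.principal_minus[OF fibre_principal[OF V]]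
    by (simp add: algebra_simps flip: minus_frag_cmul)
qed

lemma reducible: "D \<in> divisors L \<Longrightarrow> reducible_to_two D"
proof -
  assume "D \<in> divisors L"
  \<comment> \<open>Induction over formal differences requires the claim for both signs and for an
    arbitrary reducible divisor to start from.\<close>
  then have "\<forall>E. reducible_to_two E \<longrightarrow> reducible_to_two (E + D) \<and> reducible_to_two (E - D)"
    unfolding divisors_def mem_Collect_eq
  proof (induction D rule: frag_induction)
    case (diff a b)
    show ?case
    proof (intro allI impI conjI)
      fix E assume E: "reducible_to_two E"
      have "reducible_to_two ((E + a) - b)" "reducible_to_two ((E - a) + b)" using diff E by blast+
      then show "reducible_to_two (E + (a - b))" "reducible_to_two (E - (a - b))" by (simp_all add: algebra_simps)
    qed
  qed (auto intro: reducible_add reducible_minus)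
  moreover have "reducible_to_two 0"
    unfolding reducible_to_two_def
    using infty(1) L.principal_0 frag_cmul_2[of "frag_of infty"]
    by (intro bexI[of _ infty] exI[of _ "-2"]) (simp_all add: frag_cmul_2 flip: minus_frag_cmul)
  ultimately have "reducible_to_two (0 + D)" by blast
  then show ?thesis by simp
qed

text \<open>\<open>D\<close> is equivalent to \<open>F = P + Q - 2 infty\<close>. The double of
  \<open>F\<close> has a pole of order at most 4 at \<open>infty\<close>, below the degree 5, so it
  is invariant under conjugation. Then either \<open>Q\<close> is the conjugate of \<open>P\<close>
  and the class is trivial, or both are Weierstrass places, and the sign at \<open>Q\<close> may be
  changed because \<open>Q - infty\<close> is 2-torsion.\<close>

lemma two_torsion:
  assumes D: "D \<in> divisors L" "divisor_degree D = 0" "frag_cmul 2 D \<in> principal_divisors L"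
  obtains P Q where "P \<in> weierstrass" "Q \<in> weierstrass" "D - (frag_of P - frag_of Q) \<in> principal_divisors L"
proof -
  obtain P Q n where P: "P \<in> places L" "Q \<in> places L"
    "D - (frag_of P + frag_of Q + frag_cmul n (frag_of infty)) \<in> principal_divisors L"
    using reducible[OF D(1)] unfolding reducible_to_two_def by blast
  have n: "n = - 2" using L.principal_degree[OF P(3)] D(2) by simp
  define F where "F = frag_of P + frag_of Q - frag_cmul 2 (frag_of infty)"
  have DF: "D - F \<in> principal_divisors L"
    using P(3) unfolding n F_def by (simp flip: minus_frag_cmul)
  have dF: "frag_cmul 2 F \<in> principal_divisors L"
    using L.principal_diff[OF D(3) L.principal_cmul[OF DF, of 2]] by (simp add: frag_cmul_2 algebra_simps)
  have lk: "Poly_Mapping.lookup (frag_cmul 2 F) V = 2 * (if V = P then 1 else 0) + 2 * (if V = Q then 1 else 0) - 4 * (if V = infty then 1 else 0)" for V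
    by (simp add: F_def lookup_add lookup_minus algebra_simps)
  have inv: "conj_div (frag_cmul 2 F) = frag_cmul 2 F"
  proof (rule principal_conj_invariant(1)[OF dF])
    show "Poly_Mapping.lookup (frag_cmul 2 F) V \<ge> 0" if "V \<in> places L" "V \<noteq> infty" for V
      unfolding lk using that by simp
    show "Poly_Mapping.lookup (frag_cmul 2 F) infty > - int (Polynomial.degree g)"
      unfolding lk degree_5 by simp
  qed
  have e: "frag_of (conj ` P) + frag_of (conj ` Q) = frag_of P + frag_of Q"
  proof (rule poly_mapping_eqI)
    fix V
    have "Poly_Mapping.lookup (conj_div (frag_cmul 2 F)) V = Poly_Mapping.lookup (frag_cmul 2 F) V" using inv by simp
    then show "Poly_Mapping.lookup (frag_of (conj ` P) + frag_of (conj ` Q)) V = Poly_Mapping.lookup (frag_of P + frag_of Q) V"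
      by (simp add: F_def conj_infty lookup_add lookup_minus)
  qed
  have cases: "conj ` P = P \<and> conj ` Q = Q \<or> conj ` P = Q"
  proof (rule ccontr)
    assume n: "\<not> ?thesis"
    have "Poly_Mapping.lookup (frag_of (conj ` P) + frag_of (conj ` Q)) (conj ` P) = Poly_Mapping.lookup (frag_of P + frag_of Q) (conj ` P)"
      using e by simp
    then have P': "conj ` P = P" using n by (auto simp: lookup_add split: if_splits)
    then have "frag_of (conj ` Q) = frag_of Q" using e by simp
    then show False using n P' by (simp add: frag_of_eq)
  qed
  show thesis
  proof (cases "conj ` P = Q")
    case True
    then have "F \<in> principal_divisors L" using fibre_principal[OF P(1)] by (simp add: F_def)
    from L.principal_add[OF DF this] have "D - (frag_of infty - frag_of infty) \<in> principal_divisors L" by simp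
    then show thesis using that infty_weierstrass by blast
  next
    case False
    then have W: "P \<in> weierstrass" "Q \<in> weierstrass" using cases P by (auto simp: weierstrass_def)
    have "F - (frag_of P - frag_of Q) = frag_cmul 2 (frag_of Q - frag_of infty)"
      by (simp add: F_def frag_cmul_2 algebra_simps)
    then have "(D - F) + (F - (frag_of P - frag_of Q)) \<in> principal_divisors L"
      using L.principal_add[OF DF weierstrass_double[OF W(2)]] by (simp only:)
    moreover have "(D - F) + (F - (frag_of P - frag_of Q)) = D - (frag_of P - frag_of Q)" by simp
    ultimately have "D - (frag_of P - frag_of Q) \<in> principal_divisors L" by (simp only:)
    then show thesis by (rule that[OF W])
  qed
qed

end

section \<open>Elliptic curves\<close>

locale elliptic = hyperelliptic +
  fixes e1 e2 e3
  assumes cubic: "g = [:- e1, 1:] * [:- e2, 1:] * [:- e3, 1:]"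
begin

lemma degree_3: "Polynomial.degree g = 3"
  by (simp add: cubic degree_mult_eq)

text \<open>
  With \<open>S\<^sub>i\<^sup>2 = a - e\<^sub>i\<close>, the line of slope \<open>S\<^sub>1 + S\<^sub>2 + S\<^sub>3\<close> through the given point of abscissa \<open>a\<close>
  is tangent to the cubic at a point of abscissa \<open>a + S\<^sub>1S\<^sub>2 + S\<^sub>1S\<^sub>3 + S\<^sub>2S\<^sub>3\<close>.
\<close>

lemma tangent_identity:
  fixes U S1 S2 S3 :: "'b::comm_ring_1"
  shows "((S1 + S2 + S3) * U - S1 * S2 * S3) ^ 2 - (U + S1 ^ 2) * (U + S2 ^ 2) * (U + S3 ^ 2)
     = - (U * (U - (S1 * S2 + S1 * S3 + S2 * S3)) ^ 2)"
  by (simp add: power2_eq_square algebra_simps)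

text \<open>The tangent line \<open>l = v - M\<close> through \<open>V\<close> has the divisor
  \<open>V + 2 R - 3 infty\<close>, and replacing \<open>R\<close> by its conjugate gives a half of
  \<open>V - infty\<close>. The norm of \<open>l\<close> fixes this divisor only up to conjugation
  within fibres; the ambiguity disappears because a line contains no two distinct conjugate
  points.\<close>

lemma divisible_by_2:
  assumes V: "V \<in> places L"
  obtains R where "R \<in> places L" "frag_of V - frag_of infty - frag_cmul 2 (frag_of R - frag_of infty) \<in> principal_divisors L"
proof (cases "V = infty")
  case True
  then show thesis using that[of infty] infty L.principal_0 by simp
next
  case False
  interpret V: discrete_place L V by (rule L.place[OF V])
  obtain a where a: "V \<inter> rat_field u = rat_place u a" "u - const_emb a \<in> max_ideal V" by (rule finite_place[OF V False])
  have vV: "v \<in> V" using ord_v[OF V False] V.mem_V_iff[OF v_L v_neq_0] by simp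
  obtain b where b: "v - const_emb b \<in> max_ideal V" using V.residue[OF vV] by blast
  have b2: "b ^ 2 = poly g a"
  proof (rule V.residue_unique)
    show "v ^ 2 - const_emb (b ^ 2) \<in> max_ideal V"
      using V.residue_mult[OF vV b b] by (simp add: power2_eq_square)
    have "eval_at g u - const_emb (poly g a) \<in> max_ideal (rat_place u a)"
      by (rule residue_poly(2)[OF rat_place_place])
    then have "eval_at g u - const_emb (poly g a) \<in> max_ideal V"
      using ideal_restrict[of "eval_at g u - const_emb (poly g a)" V] a(1) by (simp add: diff rat_field_poly const)
    then show "v ^ 2 - const_emb (poly g a) \<in> max_ideal V" by (simp add: v_sq)
  qed
  \<comment> \<open>The equation of the cubic gives \<open>b^2 = (s1 * s2 * s3)^2\<close>; changing
    the sign of \<open>s1\<close> if necessary yields the sign for which the line of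
    \<open>tangent_identity\<close> takes the value \<open>b\<close> at \<open>a\<close>, that is,
    passes through \<open>V\<close>.\<close>
  obtain s1 s2 s3 where s: "s1 ^ 2 = a - e1" "s2 ^ 2 = a - e2" "s3 ^ 2 = a - e3" "b = - (s1 * s2 * s3)"
  proof -
    obtain s1 s2 s3 where s: "s1 ^ 2 = a - e1" "s2 ^ 2 = a - e2" "s3 ^ 2 = a - e3"
      using nth_root_exists[of 2 "a - e1"] nth_root_exists[of 2 "a - e2"] nth_root_exists[of 2 "a - e3"] by auto
    have "(s1 * s2 * s3) ^ 2 = b ^ 2" unfolding b2 by (simp add: power_mult_distrib s cubic algebra_simps)
    then have "s1 * s2 * s3 = b \<or> s1 * s2 * s3 = - b" by (simp add: power2_eq_iff)
    then show thesis
    proof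
      assume "s1 * s2 * s3 = b"
      then show thesis using that[of "- s1" s2 s3] s by simp
    next
      assume "s1 * s2 * s3 = - b"
      then have "b = - (s1 * s2 * s3)" by simp
      then show thesis by (rule that[OF s])
    qed
  qed
  define \<sigma> where "\<sigma> = s1 * s2 + s1 * s3 + s2 * s3"
  define U where "U = u - const_emb a"
  define M where "M = const_emb (s1 + s2 + s3) * U + const_emb b"
  define l where "l = v - M"
  have UK: "U \<in> rat_field u" unfolding U_def by (intro diff u_mem const)
  have MK: "M \<in> rat_field u" unfolding M_def by (intro add mult const UK)
  have lrep: "l = - M + 1 * v" by (simp add: l_def)
  have lL: "l \<in> L" unfolding lrep by (rule L_I[OF minus[OF MK] one])
  have l0: "l \<noteq> 0"
    using repr_0[OF minus[OF MK] one] lrep by auto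
  have vU: "v ^ 2 = (U + const_emb s1 ^ 2) * (U + const_emb s2 ^ 2) * (U + const_emb s3 ^ 2)"
  proof -
    have le: "eval_at [:- e, 1:] u = U + const_emb s ^ 2" if "s ^ 2 = a - e" for e s
      using that by (simp add: U_def const_emb_minus const_emb_diff flip: const_emb_power)
    show ?thesis unfolding v_sq cubic eval_at_mult le[OF s(1)] le[OF s(2)] le[OF s(3)] ..
  qed
  have nl: "norm l = - ((u - const_emb a) * (u - const_emb (a + \<sigma>)) ^ 2)"
  proof -
    have "norm l = M ^ 2 - v ^ 2"
      unfolding lrep by (subst norm_eq[OF minus[OF MK] one]) simp
    also have "\<dots> = - (U * (U - const_emb \<sigma>) ^ 2)"
      using tangent_identity[of "const_emb s1" "const_emb s2" "const_emb s3" U]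
      unfolding vU M_def s(4) by (simp add: \<sigma>_def const_emb_add const_emb_mult const_emb_minus)
    finally show ?thesis by (simp add: U_def const_emb_add algebra_simps)
  qed
  have div_norm: "has_divisor (rat_field u) (norm l)
     (frag_of (rat_place u a) + frag_cmul 2 (frag_of (rat_place u (a + \<sigma>))) - frag_cmul 3 (frag_of (rat_place_inf u)))"
  proof -
    let ?x = "u - const_emb a" and ?y = "u - const_emb (a + \<sigma>)"
    have K: "?x \<in> rat_field u" "?y \<in> rat_field u" "const_emb (-1) \<in> rat_field u" by (intro diff u_mem const)+
    have "has_divisor (rat_field u) (const_emb (-1) * (?x * (?y * ?y)))
      (0 + ((frag_of (rat_place u a) - frag_of (rat_place_inf u)) +
        ((frag_of (rat_place u (a + \<sigma>)) - frag_of (rat_place_inf u)) + (frag_of (rat_place u (a + \<sigma>)) - frag_of (rat_place_inf u)))))"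
      by (intro has_divisor_mult has_divisor_const has_divisor_linear K mult) (use u_minus_neq_0[of a] u_minus_neq_0[of "a + \<sigma>"] in auto)
    moreover have "const_emb (-1) * (?x * (?y * ?y)) = norm l" by (simp add: nl const_emb_minus power2_eq_square)
    moreover have "0 + ((frag_of (rat_place u a) - frag_of (rat_place_inf u)) +
        ((frag_of (rat_place u (a + \<sigma>)) - frag_of (rat_place_inf u)) + (frag_of (rat_place u (a + \<sigma>)) - frag_of (rat_place_inf u))))
      = frag_of (rat_place u a) + frag_cmul 2 (frag_of (rat_place u (a + \<sigma>))) - frag_cmul 3 (frag_of (rat_place_inf u))"
      by (rule poly_mapping_eqI) (simp add: lookup_add lookup_minus)
    ultimately show ?thesis by (simp only:)
  qed
  obtain E0 where E0: "has_divisor L l E0" using L.divisor[OF lL l0] by blast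
  have E0d: "E0 \<in> divisors L" using E0 has_divisor_divisors by blast
  have lk: "Poly_Mapping.lookup E0 Z = ord_at Z l" if "Z \<in> places L" for Z using E0 that by (simp add: has_divisor_def)
  \<comment> \<open>The zeros of the line alone: \<open>v\<close> has order -3 at
    \<open>infty\<close> and \<open>M\<close>, if nonzero, at least -2, so the added multiple
    exactly cancels the pole.\<close>
  define E where "E = E0 + frag_cmul 3 (frag_of infty)"
  have pushE: "divisor_push (rat_field u) E = frag_of (rat_place u a) + frag_cmul 2 (frag_of (rat_place u (a + \<sigma>)))"
    using has_divisor_unique[OF has_divisor_push[OF lL l0 E0] div_norm] by (simp add: E_def infty)
  have keysE: "Z \<in> places L \<and> Z \<noteq> infty \<and> l \<in> max_ideal Z" if Z: "Z \<in> Poly_Mapping.keys E" for Z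
  proof -
    have XL: "Z \<in> places L" using Z divisors_add[OF E0d divisors_cmul[of "frag_of infty" L 3]] infty
      by (auto simp: E_def divisors_def)
    interpret Z: discrete_place L Z by (rule L.place[OF XL])
    have Mord: "M \<noteq> 0 \<Longrightarrow> Y \<in> places L \<Longrightarrow> Y \<noteq> infty \<Longrightarrow> ord_at Y M \<ge> 0" "M \<noteq> 0 \<Longrightarrow> ord_at infty M \<ge> - 2" for Y
    proof -
      have M: "M = eval_at [:b - (s1 + s2 + s3) * a, s1 + s2 + s3:] u"
        by (simp add: M_def U_def const_emb_hom algebra_simps)
      show "ord_at Y M \<ge> 0" if "M \<noteq> 0" "Y \<in> places L" "Y \<noteq> infty"
        using ord_finite_poly[OF that(2,3)] that(1) ev0 unfolding M by blast
      show "ord_at infty M \<ge> - 2" if "M \<noteq> 0"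
      proof -
        have nz: "[:b - (s1 + s2 + s3) * a, s1 + s2 + s3:] \<noteq> 0" using that ev0 unfolding M by blast
        have "Polynomial.degree [:b - (s1 + s2 + s3) * a, s1 + s2 + s3:] \<le> 1" by simp
        then show ?thesis using ord_infty_poly[OF nz] unfolding M by linarith
      qed
    qed
    have ni: "Z \<noteq> infty"
    proof
      assume Xi: "Z = infty"
      have "ord_at Z l = - 3"
      proof (cases "M = 0")
        case True
        then show ?thesis using ord_infty_v degree_3 Xi by (simp add: l_def)
      next
        case False
        have Mn: "- M \<in> L" "- M \<noteq> 0" using K_sub_L[OF minus[OF MK]] False by auto
        have o: "ord_at Z v = - 3" using ord_infty_v degree_3 Xi by simp
        have "ord_at Z (- M) \<ge> - 2" using Mord(2)[OF False] Z.ord_minus[OF K_sub_L[OF MK] False] Xi by simp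
        then have "ord_at Z v < ord_at Z (- M)" using o by simp
        from Z.ord_add_eq(2)[OF v_L Mn(1) v_neq_0 Mn(2) this] show ?thesis using o by (simp add: l_def)
      qed
      then have "Poly_Mapping.lookup E Z = 0" using lk[OF XL] Xi by (simp add: E_def lookup_add)
      then show False using Z by (simp add: in_keys_iff)
    qed
    have "Poly_Mapping.lookup E Z = ord_at Z l" using lk[OF XL] ni by (simp add: E_def lookup_add)
    then have o: "ord_at Z l \<noteq> 0" using Z by (simp add: in_keys_iff)
    have vX: "v \<in> Z" using ord_v[OF XL ni] Z.mem_V_iff[OF v_L v_neq_0] by simp
    have MX: "M \<in> Z"
    proof (cases "M = 0")
      case False
      then show ?thesis using Mord(1)[OF False XL ni] Z.mem_V_iff[OF K_sub_L[OF MK]] by simp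
    qed (simp add: Z.V_0)
    have "l \<in> Z" unfolding l_def by (intro Z.V_diff vX MX)
    then have "ord_at Z l \<ge> 0" using Z.mem_V_iff[OF lL l0] by simp
    then show ?thesis using XL ni o Z.mem_ideal_iff[OF lL l0] by simp
  qed
  \<comment> \<open>If \<open>l\<close> vanished at two distinct conjugate places, then
    \<open>l - conj l = 2 v\<close> would vanish there as well; but \<open>v\<close> is a unit at
    finite places that are not ramified.\<close>
  have inj: "inj_on (\<lambda>Z. Z \<inter> rat_field u) (Poly_Mapping.keys E)"
  proof (rule inj_onI, rule ccontr)
    fix Z Y assume Z: "Z \<in> Poly_Mapping.keys E" and Y: "Y \<in> Poly_Mapping.keys E"
      and eq: "Z \<inter> rat_field u = Y \<inter> rat_field u" and ne: "Z \<noteq> Y"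
    have XL: "Z \<in> places L" "Z \<noteq> infty" "l \<in> max_ideal Z" using keysE[OF Z] by auto
    have Yc: "Y = conj ` Z" using same_restrict_iff[OF XL(1), of Y] keysE[OF Y] eq ne by auto
    interpret Z: discrete_place L Z by (rule L.place[OF XL(1)])
    have "conj l \<in> max_ideal Z" using keysE[OF Y] ideal_conj[OF place_sub[OF XL(1)] lL] unfolding Yc by blast
    then have "const_emb (1 / 2) * (l - conj l) \<in> max_ideal Z" by (intro Z.ideal_mult2 Z.V_const Z.ideal_diff XL)
    moreover have "const_emb (1 / 2) * (l - conj l) = v"
    proof -
      have "conj l = - M - v" unfolding lrep using conj_eq[OF minus[OF MK] one] by simp
      then have "l - conj l = 2 * v" by (simp add: l_def)
      then show ?thesis using ambient_2_neq_0[where 'k = 'a] by (simp add: const_emb_divide const_emb_numeral)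
    qed
    ultimately have "v \<in> max_ideal Z" by (simp only:)
    then have "ord_at Z v > 0" using Z.mem_ideal_iff[OF v_L v_neq_0] by simp
    then show False using ord_v[OF XL(1,2)] Yc ne by (auto split: if_splits)
  qed
  \<comment> \<open>A section of the restriction to \<open>k(u)\<close> on the support of
    \<open>E\<close>; it recovers \<open>E\<close> from its push-forward, which is known from the
    norm.\<close>
  define r where "r = inv_into (Poly_Mapping.keys E) (\<lambda>Z. Z \<inter> rat_field u)"
  have "frag_extend (\<lambda>W. frag_of (r W)) (divisor_push (rat_field u) E) = E"
  proof -
    have "frag_extend (\<lambda>W. frag_of (r W)) (divisor_push (rat_field u) E)
      = frag_extend (\<lambda>Z. frag_of (r (Z \<inter> rat_field u))) E"
      unfolding divisor_push_def
      using frag_extend_compose[of "\<lambda>W. frag_of (r W)" "\<lambda>Z. Z \<inter> rat_field u" E] by (simp add: comp_def)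
    also have "\<dots> = frag_extend frag_of E"
      by (rule frag_extend_eq) (simp add: r_def inv_into_f_f[OF inj])
    finally show ?thesis using frag_expansion[of E] by simp
  qed
  then have E: "E = frag_of (r (rat_place u a)) + frag_cmul 2 (frag_of (r (rat_place u (a + \<sigma>))))"
    unfolding pushE by (simp add: frag_extend_add frag_extend_cmul)
  have VE: "V \<in> Poly_Mapping.keys E"
  proof -
    have "(v - const_emb b) - const_emb (s1 + s2 + s3) * U \<in> max_ideal V"
      unfolding U_def by (intro V.ideal_diff V.ideal_mult2 V.V_const a(2) b)
    then have "l \<in> max_ideal V" by (simp add: l_def M_def algebra_simps)
    then have "ord_at V l > 0" using V.mem_ideal_iff[OF lL l0] by simp
    then show ?thesis using lk[OF V] False by (simp add: E_def in_keys_iff lookup_add)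
  qed
  have rV: "r (rat_place u a) = V" using inv_into_f_f[OF inj VE] a(1) by (simp add: r_def)
  define R where "R = r (rat_place u (a + \<sigma>))"
  have RL: "R \<in> places L"
  proof -
    have "rat_place u (a + \<sigma>) \<in> Poly_Mapping.keys (divisor_push (rat_field u) E)"
      unfolding pushE by (simp add: in_keys_iff lookup_add)
    then have "rat_place u (a + \<sigma>) \<in> (\<lambda>Z. Z \<inter> rat_field u) ` Poly_Mapping.keys E"
      unfolding divisor_push_def using keys_frag_extend[of "\<lambda>Z. frag_of (Z \<inter> rat_field u)" E] by auto
    then have "R \<in> Poly_Mapping.keys E" unfolding R_def r_def by (rule inv_into_into)
    then show ?thesis using keysE by blast
  qed
  have "E0 \<in> principal_divisors L" using E0 lL l0 L.principal_iff by blast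
  moreover have "E0 = frag_of V + frag_cmul 2 (frag_of R) - frag_cmul 3 (frag_of infty)"
    using E unfolding rV R_def[symmetric] by (simp add: E_def algebra_simps)
  ultimately have "frag_of V + frag_cmul 2 (frag_of R) - frag_cmul 3 (frag_of infty) -
      frag_cmul 2 (frag_of R + frag_of (conj ` R) - frag_cmul 2 (frag_of infty)) \<in> principal_divisors L"
    using L.principal_diff L.principal_cmul fibre_principal[OF RL] by metis
  moreover have "frag_of V + frag_cmul 2 (frag_of R) - frag_cmul 3 (frag_of infty) -
      frag_cmul 2 (frag_of R + frag_of (conj ` R) - frag_cmul 2 (frag_of infty))
     = frag_of V - frag_of infty - frag_cmul 2 (frag_of (conj ` R) - frag_of infty)"
    by (rule poly_mapping_eqI) (simp only: lookup_add lookup_minus lookup_frag_cmul, simp add: algebra_simps)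
  ultimately show thesis using that conj_place[OF RL] by (simp only:)
qed

lemma degree_0_divisible_by_2:
  assumes D: "D \<in> divisors L" "divisor_degree D = 0"
  obtains D' where "D' \<in> divisors L" "divisor_degree D' = 0" "D - frag_cmul 2 D' \<in> principal_divisors L"
proof -
  have "\<exists>D'. D' \<in> divisors L \<and> divisor_degree D' = 0 \<and>
      D - frag_cmul (divisor_degree D) (frag_of infty) - frag_cmul 2 D' \<in> principal_divisors L"
    using D(1) unfolding divisors_def mem_Collect_eq
  proof (induction D rule: frag_induction)
    case zero
    then show ?case using L.principal_0 by (intro exI[of _ 0]) simp
  next
    case (one V)
    obtain R where "R \<in> places L" "frag_of V - frag_of infty - frag_cmul 2 (frag_of R - frag_of infty) \<in> principal_divisors L"
      by (rule divisible_by_2[OF one])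
    then show ?case using infty divisors_diff[of "frag_of R" L "frag_of infty"]
      by (intro exI[of _ "frag_of R - frag_of infty"]) (simp add: divisors_def)
  next
    case (diff A B)
    obtain A' where A': "Poly_Mapping.keys A' \<subseteq> places L" "divisor_degree A' = 0"
      "A - frag_cmul (divisor_degree A) (frag_of infty) - frag_cmul 2 A' \<in> principal_divisors L" using diff(1) by blast
    obtain B' where B': "Poly_Mapping.keys B' \<subseteq> places L" "divisor_degree B' = 0"
      "B - frag_cmul (divisor_degree B) (frag_of infty) - frag_cmul 2 B' \<in> principal_divisors L" using diff(2) by blast
    have "(A - B) - frag_cmul (divisor_degree (A - B)) (frag_of infty) - frag_cmul 2 (A' - B')
      = (A - frag_cmul (divisor_degree A) (frag_of infty) - frag_cmul 2 A') - (B - frag_cmul (divisor_degree B) (frag_of infty) - frag_cmul 2 B')"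
      by (rule poly_mapping_eqI)
        (simp only: lookup_minus lookup_frag_cmul divisor_degree_diff, simp add: algebra_simps)
    then have "(A - B) - frag_cmul (divisor_degree (A - B)) (frag_of infty) - frag_cmul 2 (A' - B') \<in> principal_divisors L"
      using L.principal_diff[OF A'(3) B'(3)] by (simp only:)
    moreover have "Poly_Mapping.keys (A' - B') \<subseteq> places L" using A'(1) B'(1) keys_diff[of A' B'] by blast
    ultimately show ?case using A'(2) B'(2) by (intro exI[of _ "A' - B'"]) simp
  qed
  then show thesis using that D(2) by auto
qed

end

section \<open>Jacobians and push-forward\<close>

definition zero_degree_divisors :: "'k::field ambient set \<Rightarrow> ('k ambient set \<Rightarrow>\<^sub>0 int) set" where
  "zero_degree_divisors L = {D \<in> divisors L. divisor_degree D = 0}"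

definition divisor_class :: "'k::field ambient set \<Rightarrow> ('k ambient set \<Rightarrow>\<^sub>0 int) \<Rightarrow> ('k ambient set \<Rightarrow>\<^sub>0 int) set" where
  "divisor_class L D = (\<lambda>F. F + D) ` principal_divisors L"

lemma zero_degree_divisors_closed [simp]:
  "0 \<in> zero_degree_divisors L"
  "D \<in> zero_degree_divisors L \<Longrightarrow> E \<in> zero_degree_divisors L \<Longrightarrow> D + E \<in> zero_degree_divisors L"
  "D \<in> zero_degree_divisors L \<Longrightarrow> E \<in> zero_degree_divisors L \<Longrightarrow> D - E \<in> zero_degree_divisors L"
  "D \<in> zero_degree_divisors L \<Longrightarrow> frag_cmul n D \<in> zero_degree_divisors L"
  by (auto simp: zero_degree_divisors_def)

lemma degree0_divisors_simps:
  "carrier (degree0_divisors L) = zero_degree_divisors L"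
  "monoid.mult (degree0_divisors L) = (+)" "one (degree0_divisors L) = 0"
  by (auto simp: degree0_divisors_def zero_degree_divisors_def divisors_def free_Abelian_group_def)

lemma r_coset_class: "principal_divisors L #>\<^bsub>degree0_divisors L\<^esub> D = divisor_class L D"
  by (auto simp: r_coset_def degree0_divisors_simps divisor_class_def)

lemma carrier_jacobian: "carrier (jacobian L) = divisor_class L ` zero_degree_divisors L"
  by (auto simp: jacobian_def FactGroup_def RCOSETS_def degree0_divisors_simps r_coset_class)

lemma one_jacobian: "one (jacobian L) = divisor_class L 0"
  by (auto simp: jacobian_def FactGroup_def divisor_class_def)

context discrete_field
begin

lemma mult_jacobian:
  "monoid.mult (jacobian K) (divisor_class K D) (divisor_class K E) = divisor_class K (D + E)"
proof -
  have "monoid.mult (jacobian K) (divisor_class K D) (divisor_class K E) =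
      {x + y | x y. x \<in> divisor_class K D \<and> y \<in> divisor_class K E}"
    by (auto simp: jacobian_def FactGroup_def set_mult_def degree0_divisors_simps)
  also have "\<dots> = divisor_class K (D + E)"
  proof (intro equalityI subsetI)
    fix z assume "z \<in> {x + y | x y. x \<in> divisor_class K D \<and> y \<in> divisor_class K E}"
    then obtain F G where FG: "F \<in> principal_divisors K" "G \<in> principal_divisors K" "z = (F + D) + (G + E)"
      by (auto simp: divisor_class_def)
    then have "z = (F + G) + (D + E)" by (simp add: algebra_simps)
    then show "z \<in> divisor_class K (D + E)"
      using principal_add[OF FG(1,2)] unfolding divisor_class_def by (rule image_eqI)
  next
    fix z assume "z \<in> divisor_class K (D + E)"
    then obtain F where F: "F \<in> principal_divisors K" "z = F + (D + E)" by (auto simp: divisor_class_def)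
    have "F + D \<in> divisor_class K D" "0 + E \<in> divisor_class K E"
      unfolding divisor_class_def using F(1) principal_0 by blast+
    moreover have "z = (F + D) + (0 + E)" using F(2) by (simp add: algebra_simps)
    ultimately show "z \<in> {x + y | x y. x \<in> divisor_class K D \<and> y \<in> divisor_class K E}" by blast
  qed
  finally show ?thesis .
qed

lemma class_eq_iff: "divisor_class K D = divisor_class K E \<longleftrightarrow> D - E \<in> principal_divisors K"
proof
  assume "divisor_class K D = divisor_class K E"
  moreover have "0 + D \<in> divisor_class K D" unfolding divisor_class_def using principal_0 by blast
  ultimately have "D \<in> divisor_class K E" by simp
  then show "D - E \<in> principal_divisors K" by (auto simp: divisor_class_def)
next
  have *: "divisor_class K D \<subseteq> divisor_class K E" if DE: "D - E \<in> principal_divisors K" for D E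
  proof
    fix z assume "z \<in> divisor_class K D"
    then obtain F where F: "F \<in> principal_divisors K" "z = F + D" by (auto simp: divisor_class_def)
    then have "z = (F + (D - E)) + E" by (simp add: algebra_simps)
    then show "z \<in> divisor_class K E" using principal_add[OF F(1) DE] unfolding divisor_class_def by (rule image_eqI)
  qed
  assume "D - E \<in> principal_divisors K"
  moreover from this have "E - D \<in> principal_divisors K" using principal_minus[of "D - E"] by simp
  ultimately show "divisor_class K D = divisor_class K E" using * by blast
qed

lemma class_eq_0_iff: "divisor_class K D = divisor_class K 0 \<longleftrightarrow> D \<in> principal_divisors K"
  using class_eq_iff[of D 0] by simp

end

context quad_ext
begin

text \<open>The union in \<open>jacobian_push\<close> collapses to one class: members of a class
  differ by principal divisors, and these have principal push-forwards.\<close>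

lemma jacobian_push_class: "jacobian_push K (divisor_class L D) = divisor_class K (divisor_push K D)"
proof -
  have "jacobian_push K (divisor_class L D) = (\<Union>F\<in>principal_divisors L. divisor_class K (divisor_push K F + divisor_push K D))"
    unfolding jacobian_push_def r_coset_class divisor_class_def[of L] by simp
  also have "\<dots> = (\<Union>F\<in>principal_divisors L. divisor_class K (divisor_push K D))"
    by (rule SUP_cong) (auto simp: class_eq_iff principal_push)
  also have "\<dots> = divisor_class K (divisor_push K D)" using L.principal_0 by auto
  finally show ?thesis .
qed

lemma push_zero_degree: "D \<in> zero_degree_divisors L \<Longrightarrow> divisor_push K D \<in> zero_degree_divisors K"
  by (simp add: zero_degree_divisors_def push_divisors)

end

text \<open>Removes cosets and group records from the goal. \<open>T1\<close> and \<open>T2\<close>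
  are to generate the kernel; their push-forwards are required to vanish as divisors, which holds
  for differences of two places with the same restrictions.\<close>

lemma jacobian_22_reducibleI:
  fixes K1 K2 F :: "'k::{alg_closed_field, field_char_0} ambient set"
  assumes quad: "quad_ext K1 s1" "quad_ext K2 s2" and F: "quad_ext.L K1 s1 = F" "quad_ext.L K2 s2 = F"
    and ell: "degree2_elliptic_quotient F K1" "degree2_elliptic_quotient F K2"
    and surj: "\<And>E1 E2. E1 \<in> zero_degree_divisors K1 \<Longrightarrow> E2 \<in> zero_degree_divisors K2 \<Longrightarrow>
       \<exists>D\<in>zero_degree_divisors F. divisor_push K1 D - E1 \<in> principal_divisors K1 \<and> divisor_push K2 D - E2 \<in> principal_divisors K2"
    and T: "T1 \<in> zero_degree_divisors F" "T2 \<in> zero_degree_divisors F"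
      "divisor_push K1 T1 = 0" "divisor_push K2 T1 = 0" "divisor_push K1 T2 = 0" "divisor_push K2 T2 = 0"
      "frag_cmul 2 T1 \<in> principal_divisors F" "frag_cmul 2 T2 \<in> principal_divisors F"
      "T1 \<notin> principal_divisors F" "T2 \<notin> principal_divisors F" "T1 + T2 \<notin> principal_divisors F"
    and ker: "\<And>D. D \<in> zero_degree_divisors F \<Longrightarrow> divisor_push K1 D \<in> principal_divisors K1 \<Longrightarrow>
       divisor_push K2 D \<in> principal_divisors K2 \<Longrightarrow>
       D \<in> principal_divisors F \<or> D - T1 \<in> principal_divisors F \<or> D - T2 \<in> principal_divisors F \<or> D - (T1 + T2) \<in> principal_divisors F"
  shows "jacobian_22_reducible F"
proof -
  interpret Q1: quad_ext K1 s1 by fact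
  interpret Q2: quad_ext K2 s2 by fact
  interpret F: discrete_field F using Q1.L.discrete_field_axioms F by simp
  define h where "h \<xi> = (jacobian_push K1 \<xi>, jacobian_push K2 \<xi>)" for \<xi>
  define B where "B = jacobian K1 \<times>\<times> jacobian K2"
  have h: "h (divisor_class F D) = (divisor_class K1 (divisor_push K1 D), divisor_class K2 (divisor_push K2 D))" for D
    using Q1.jacobian_push_class[of D] Q2.jacobian_push_class[of D] F by (simp add: h_def)
  have push: "divisor_push K1 D \<in> zero_degree_divisors K1" "divisor_push K2 D \<in> zero_degree_divisors K2"
    if "D \<in> zero_degree_divisors F" for D
    using Q1.push_zero_degree[of D] Q2.push_zero_degree[of D] F that by auto
  have carB: "carrier B = carrier (jacobian K1) \<times> carrier (jacobian K2)" by (simp add: B_def)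
  have multB: "monoid.mult B (a, b) (c, d) = (monoid.mult (jacobian K1) a c, monoid.mult (jacobian K2) b d)" for a b c d
    by (simp add: B_def)
  have oneB: "one B = (divisor_class K1 0, divisor_class K2 0)" by (simp add: B_def one_jacobian)
  have push_add: "divisor_push K (D + E) = divisor_push K D + divisor_push K E" for D E and K :: "'k ambient set"
    by (simp add: divisor_push_def frag_extend_add)
  have hom: "h \<in> hom (jacobian F) B"
  proof (rule homI)
    fix x assume "x \<in> carrier (jacobian F)"
    then obtain D where "D \<in> zero_degree_divisors F" "x = divisor_class F D" by (auto simp: carrier_jacobian)
    then show "h x \<in> carrier B" using push by (simp add: h carB carrier_jacobian)
    fix y assume "y \<in> carrier (jacobian F)"
    then obtain E where "E \<in> zero_degree_divisors F" "y = divisor_class F E" by (auto simp: carrier_jacobian)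
    then show "h (x \<otimes>\<^bsub>jacobian F\<^esub> y) = h x \<otimes>\<^bsub>B\<^esub> h y"
      using \<open>x = divisor_class F D\<close>
      by (simp add: F.mult_jacobian h multB Q1.mult_jacobian Q2.mult_jacobian push_add)
  qed
  have image: "h ` carrier (jacobian F) = carrier B"
  proof
    show "h ` carrier (jacobian F) \<subseteq> carrier B" using hom by (auto simp: hom_def)
    show "carrier B \<subseteq> h ` carrier (jacobian F)"
    proof
      fix z assume "z \<in> carrier B"
      then obtain E1 E2 where E: "E1 \<in> zero_degree_divisors K1" "E2 \<in> zero_degree_divisors K2"
        "z = (divisor_class K1 E1, divisor_class K2 E2)" by (auto simp: carB carrier_jacobian)
      obtain D where D: "D \<in> zero_degree_divisors F" "divisor_push K1 D - E1 \<in> principal_divisors K1"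
        "divisor_push K2 D - E2 \<in> principal_divisors K2" using surj[OF E(1,2)] by blast
      then have "h (divisor_class F D) = z" using E(3) by (simp add: h Q1.class_eq_iff Q2.class_eq_iff)
      then show "z \<in> h ` carrier (jacobian F)" using D(1) by (auto simp: carrier_jacobian)
    qed
  qed
  define Ker where "Ker = kernel (jacobian F) B h"
  have Ker: "divisor_class F D \<in> Ker \<longleftrightarrow> divisor_push K1 D \<in> principal_divisors K1 \<and> divisor_push K2 D \<in> principal_divisors K2"
    if "D \<in> zero_degree_divisors F" for D
    using that by (auto simp: Ker_def kernel_def carrier_jacobian h oneB Q1.class_eq_0_iff Q2.class_eq_0_iff)
  define \<phi> where "\<phi> = (\<lambda>(i, j). divisor_class F (frag_cmul i T1 + frag_cmul j T2))"
  let ?Z = "integer_mod_group 2"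
  have carZ: "carrier (?Z \<times>\<times> ?Z) = {(0, 0), (1, 0), (0, 1), (1, 1)}"
  proof -
    have "carrier ?Z = {0, 1}" by (auto simp: carrier_integer_mod_group)
    then show ?thesis by auto
  qed
  have deg: "frag_cmul i T1 + frag_cmul j T2 \<in> zero_degree_divisors F" for i j using T by simp
  have even: "frag_cmul i T1 \<in> principal_divisors F" "frag_cmul i T2 \<in> principal_divisors F" if "even i" for i
  proof -
    obtain k where "i = 2 * k" using \<open>even i\<close> by (rule evenE)
    then show "frag_cmul i T1 \<in> principal_divisors F" "frag_cmul i T2 \<in> principal_divisors F"
      using F.principal_cmul[OF T(7), of k] F.principal_cmul[OF T(8), of k] by (simp_all add: mult.commute)
  qed
  \<comment> \<open>\<open>\<phi>\<close> is defined on all pairs of integers and depends only on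
    parities, since \<open>T1\<close> and \<open>T2\<close> are 2-torsion. So addition modulo 2 may
    be replaced by integer addition in checking the homomorphism.\<close>
  have mod: "\<phi> (i mod 2, j mod 2) = \<phi> (i, j)" for i j
  proof -
    have "even (i mod 2 - i)" "even (j mod 2 - j)" by presburger+
    then have "frag_cmul (i mod 2 - i) T1 + frag_cmul (j mod 2 - j) T2 \<in> principal_divisors F"
      using even F.principal_add by blast
    moreover have "frag_cmul (i mod 2 - i) T1 + frag_cmul (j mod 2 - j) T2 =
       (frag_cmul (i mod 2) T1 + frag_cmul (j mod 2) T2) - (frag_cmul i T1 + frag_cmul j T2)"
      by (simp add: frag_cmul_diff_distrib algebra_simps)
    ultimately show ?thesis by (simp add: \<phi>_def F.class_eq_iff)
  qed
  have "\<phi> \<in> iso (?Z \<times>\<times> ?Z) (jacobian F\<lparr>carrier := Ker\<rparr>)"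
    unfolding iso_def
  proof (intro CollectI conjI)
    have push_cmul: "divisor_push K (frag_cmul i D) = frag_cmul i (divisor_push K D)" for i D and K :: "'k ambient set"
      by (simp add: divisor_push_def frag_extend_cmul)
    have in_Ker: "\<phi> z \<in> Ker" for z
      by (cases z) (simp add: \<phi>_def Ker deg push_add push_cmul T Q1.principal_0 Q2.principal_0)
    show "\<phi> \<in> hom (?Z \<times>\<times> ?Z) (jacobian F\<lparr>carrier := Ker\<rparr>)"
    proof (rule homI)
      fix x y :: "int \<times> int"
      obtain i j k l where xy: "x = (i, j)" "y = (k, l)" by (cases x, cases y) blast
      have "\<phi> (x \<otimes>\<^bsub>?Z \<times>\<times> ?Z\<^esub> y) = \<phi> ((i + k) mod 2, (j + l) mod 2)" by (simp add: xy)
      also have "\<dots> = \<phi> (i + k, j + l)" by (rule mod)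
      also have "\<dots> = divisor_class F ((frag_cmul i T1 + frag_cmul j T2) + (frag_cmul k T1 + frag_cmul l T2))"
        by (simp add: \<phi>_def frag_cmul_distrib algebra_simps)
      also have "\<dots> = \<phi> x \<otimes>\<^bsub>jacobian F\<^esub> \<phi> y" by (simp add: xy \<phi>_def F.mult_jacobian)
      finally show "\<phi> (x \<otimes>\<^bsub>?Z \<times>\<times> ?Z\<^esub> y) = \<phi> x \<otimes>\<^bsub>jacobian F\<lparr>carrier := Ker\<rparr>\<^esub> \<phi> y" by simp
    qed (simp add: in_Ker)
    have \<phi>_values: "\<phi> (0, 0) = divisor_class F 0" "\<phi> (1, 0) = divisor_class F T1" "\<phi> (0, 1) = divisor_class F T2"
      "\<phi> (1, 1) = divisor_class F (T1 + T2)" by (auto simp: \<phi>_def)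
    have 1: "T1 - T2 \<notin> principal_divisors F"
    proof
      assume "T1 - T2 \<in> principal_divisors F"
      from F.principal_add[OF this T(8)] show False using T(11) by (simp add: frag_cmul_2)
    qed
    have neg: "- D \<notin> principal_divisors F" if "D \<notin> principal_divisors F" for D
      using F.principal_minus[of "- D"] that by auto
    have 2: "T2 - T1 \<notin> principal_divisors F" "- T1 \<notin> principal_divisors F" "- T2 \<notin> principal_divisors F"
      "- (T1 + T2) \<notin> principal_divisors F"
      using neg[OF 1] neg[OF T(9)] neg[OF T(10)] neg[OF T(11)] by simp_all
    have inj: "inj_on \<phi> {(0, 0), (1, 0), (0, 1), (1, 1)}"
      using 1 2 T(9-11) by (auto simp: inj_on_def \<phi>_values F.class_eq_iff)
    have img: "\<phi> ` {(0, 0), (1, 0), (0, 1), (1, 1)} = Ker"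
    proof
      show "\<phi> ` {(0, 0), (1, 0), (0, 1), (1, 1)} \<subseteq> Ker" using in_Ker by auto
      show "Ker \<subseteq> \<phi> ` {(0, 0), (1, 0), (0, 1), (1, 1)}"
      proof
        fix z assume z: "z \<in> Ker"
        then have "z \<in> carrier (jacobian F)" by (simp add: Ker_def kernel_def)
        then obtain D where D: "D \<in> zero_degree_divisors F" "z = divisor_class F D" by (auto simp: carrier_jacobian)
        have "divisor_push K1 D \<in> principal_divisors K1" "divisor_push K2 D \<in> principal_divisors K2"
          using z Ker[OF D(1)] D(2) by auto
        from ker[OF D(1) this] show "z \<in> \<phi> ` {(0, 0), (1, 0), (0, 1), (1, 1)}"
          by (simp add: \<phi>_values D(2) F.class_eq_iff)
      qed
    qed
    show "bij_betw \<phi> (carrier (?Z \<times>\<times> ?Z)) (carrier (jacobian F\<lparr>carrier := Ker\<rparr>))"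
      unfolding carZ using inj img by (simp add: bij_betw_def)
  qed
  then have "?Z \<times>\<times> ?Z \<cong> jacobian F\<lparr>carrier := Ker\<rparr>" by (auto simp: is_iso_def)
  then have "jacobian F\<lparr>carrier := Ker\<rparr> \<cong> ?Z \<times>\<times> ?Z"
    by (rule group.iso_sym[OF DirProd_group[OF group_integer_mod_group group_integer_mod_group]])
  then show ?thesis
    unfolding jacobian_22_reducible_def Let_def
    using ell hom image unfolding h_def[abs_def] B_def Ker_def by blast
qed

section \<open>Separability of products of linear factors\<close>

text \<open>At the new root the derivative of the product is \<open>d\<close> times the value of
  \<open>p\<close>, hence nonzero. The slope \<open>d\<close> is general because the quintic is a
  product of factors \<open>1 + d w\<close>.\<close>

lemma rsquarefree_linear_mult:
  fixes p :: "'k::field_char_0 poly"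
  assumes "rsquarefree p" "d \<noteq> 0" "poly p (- s / d) \<noteq> 0"
  shows "rsquarefree ([:s, d:] * p)"
  unfolding rsquarefree_roots
proof (intro allI notI)
  fix a assume a: "poly ([:s, d:] * p) a = 0 \<and> poly (pderiv ([:s, d:] * p)) a = 0"
  have l: "poly [:s, d:] a = s + a * d" by simp
  have a1: "(s + a * d) * poly p a = 0" using a unfolding poly_mult l by blast
  have "poly (pderiv ([:s, d:] * p)) a = (s + a * d) * poly (pderiv p) a + d * poly p a"
    unfolding pderiv_mult poly_add poly_mult l by (simp add: pderiv_pCons mult.commute)
  then have a2: "(s + a * d) * poly (pderiv p) a + d * poly p a = 0" using a by metis
  show False
  proof (cases "s + a * d = 0")
    case True
    then have "a * d = - s" by (simp add: eq_neg_iff_add_eq_0 add.commute)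
    have "a = a * d / d" using assms(2) by simp
    then have "a = - s / d" unfolding \<open>a * d = - s\<close> .
    then show False using a2 True assms(2,3) by simp
  next
    case False
    then have p: "poly p a = 0" using a1 by simp
    then have "poly (pderiv p) a = 0" using a2 False by simp
    then show False using p assms(1) unfolding rsquarefree_roots by blast
  qed
qed

lemma degree_linear_mult:
  fixes q :: "'k::field poly"
  shows "d \<noteq> 0 \<Longrightarrow> Polynomial.degree q = n \<and> q \<noteq> 0 \<Longrightarrow>
    Polynomial.degree ([:s, d:] * q) = Suc n \<and> [:s, d:] * q \<noteq> 0"
  using degree_mult_eq[of "[:s, d:]" q] by (simp del: mult_pCons_left)

text \<open>Linear polynomials with the same nonzero constant term and different slopes have no
  common root; this peels off the factors of the quintic one at a time.\<close>

lemma poly_linear_mult_neq_0: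
  fixes q :: "'k::field poly"
  assumes "d \<noteq> 0" "d' \<noteq> d" "poly q (- s / d) \<noteq> 0" "s \<noteq> 0"
  shows "poly ([:s, d':] * q) (- s / d) \<noteq> 0"
proof
  assume "poly ([:s, d':] * q) (- s / d) = 0"
  then have "s + - s / d * d' = 0" using assms(3) unfolding poly_mult by simp
  then have "s * (d - d') = 0" using assms(1) by (simp add: field_simps)
  then show False using assms by simp
qed

lemma rsquarefree_1: "rsquarefree (1 :: 'k::field_char_0 poly)"
  by (simp add: rsquarefree_roots)

section \<open>Automorphisms\<close>

definition field_endo :: "'k::field ambient set \<Rightarrow> ('k ambient \<Rightarrow> 'k ambient) \<Rightarrow> bool" where
  "field_endo F \<phi> \<longleftrightarrow> (\<forall>c. \<phi> (const_emb c) = const_emb c) \<and>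
     (\<forall>a\<in>F. \<phi> a \<in> F \<and> (\<forall>b\<in>F. \<phi> (a + b) = \<phi> a + \<phi> b \<and> \<phi> (a * b) = \<phi> a * \<phi> b))"

lemma field_endo_comp: "field_endo F \<phi> \<Longrightarrow> field_endo F \<psi> \<Longrightarrow> field_endo F (\<lambda>z. \<phi> (\<psi> z))"
  by (auto simp: field_endo_def)

text \<open>The set where two endomorphisms over \<open>k\<close> agree is a subfield, so it is
  everything as soon as it contains the generators.\<close>

lemma field_endo_eq:
  assumes "field_endo F \<phi>" "field_endo F \<psi>" "F = generate_field \<Omega> (range const_emb \<union> S)"
    and eq: "\<And>z. z \<in> S \<Longrightarrow> \<phi> z = \<psi> z" and z: "z \<in> F"
  shows "\<phi> z = \<psi> z"
proof -
  interpret const_subfield F unfolding assms(3) by (rule const_subfield_generate)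
  have c: "\<phi> (const_emb c) = const_emb c" "\<psi> (const_emb c) = const_emb c" for c
    using assms(1,2) by (simp_all add: field_endo_def)
  have add': "\<phi> (a + b) = \<phi> a + \<phi> b" "\<psi> (a + b) = \<psi> a + \<psi> b"
    and mult': "\<phi> (a * b) = \<phi> a * \<phi> b" "\<psi> (a * b) = \<psi> a * \<psi> b" if "a \<in> F" "b \<in> F" for a b
    using assms(1,2) that by (simp_all add: field_endo_def)
  have minus': "\<phi> (- a) = - \<phi> a" "\<psi> (- a) = - \<psi> a" if "a \<in> F" for a
    using mult'[OF const[of "-1"] that] c[of "-1"] by (simp_all add: const_emb_minus)
  have inv': "\<phi> (inverse a) = inverse (\<phi> a)" "\<psi> (inverse a) = inverse (\<psi> a)" if a: "a \<in> F" for a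
  proof -
    have "\<phi> a * \<phi> (inverse a) = 1 \<and> \<psi> a * \<psi> (inverse a) = 1" if "a \<noteq> 0"
      using mult'[OF a inv[OF a]] c[of 1] that by simp
    then show "\<phi> (inverse a) = inverse (\<phi> a)" "\<psi> (inverse a) = inverse (\<psi> a)"
      using inverse_unique[of "\<phi> a" "\<phi> (inverse a)"] inverse_unique[of "\<psi> a" "\<psi> (inverse a)"] c[of 0]
      by (cases "a = 0"; simp)+
  qed
  have "const_subfield {z \<in> F. \<phi> z = \<psi> z}"
    by unfold_locales (auto simp: const c add mult minus inv add' mult' minus' inv')
  moreover have "S \<subseteq> {z \<in> F. \<phi> z = \<psi> z}"
    using eq assms(3) by (auto intro: generate_field.incl)
  ultimately have "z \<in> {z \<in> F. \<phi> z = \<psi> z}"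
    using generate_field_least z assms(3) by blast
  then show ?thesis by simp
qed

context quad_ext
begin

lemma field_endo_conj: "field_endo L conj"
  by (simp add: field_endo_def conj_const conj_L conj_add conj_mult)

lemma L_sub: "const_subfield F \<Longrightarrow> K \<subseteq> F \<Longrightarrow> s \<in> F \<Longrightarrow> L \<subseteq> F"
  unfolding L_def by (auto intro!: const_subfield.add const_subfield.mult)

text \<open>Follows the inductive rules for \<open>dimension\<close>: adjoining 1 to the zero space
  gives \<open>K\<close>, and adjoining \<open>s\<close> to \<open>K\<close> gives
  \<open>L\<close>.\<close>

lemma dimension_L: "ring.dimension \<Omega> 2 K L"
proof -
  interpret R: ring "\<Omega> :: 'k ambient ring" by (rule omega_ring)
  have "R.dimension (Suc 0) K (R.line_extension K 1 {0})"
    using R.Suc_dim[of 1 "{0}" 0 K] R.zero_dim[of K] by simp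
  moreover have "R.line_extension K 1 {0} = K"
    using R.line_extension_mem_iff[of _ K 1 "{0}"] by auto
  ultimately have "R.dimension (Suc (Suc 0)) K (R.line_extension K s K)"
    using R.Suc_dim[of s K "Suc 0" K] s_notin by simp
  moreover have "R.line_extension K s K = L"
    using R.line_extension_mem_iff[of _ K s K] by (auto simp: L_def add.commute)
  ultimately show ?thesis by (simp add: numeral_2_eq_2)
qed

lemma lift_divisor: "D \<in> divisors K \<Longrightarrow> \<exists>E\<in>divisors L. divisor_push K E = D"
  unfolding divisors_def[of K] mem_Collect_eq
proof (induction D rule: frag_induction)
  case (one V)
  then obtain V' where "V' \<in> places L" "V' \<inter> K = V" using place_over by blast
  then show ?case by (intro bexI[of _ "frag_of V'"]) simp_all
next
  case (diff a b)
  then obtain a' b' where "a' \<in> divisors L" "divisor_push K a' = a" "b' \<in> divisors L" "divisor_push K b' = b" by blast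
  then show ?case by (intro bexI[of _ "a' - b'"]) simp_all
qed (intro bexI[of _ 0]; simp)

end

context hyperelliptic
begin

lemma L_generated: "L = generate_field \<Omega> (range const_emb \<union> {u, v})"
proof
  have G: "const_subfield (generate_field \<Omega> (range const_emb \<union> {u, v}))" by (rule const_subfield_generate)
  have m: "u \<in> generate_field \<Omega> (range const_emb \<union> {u, v})" "v \<in> generate_field \<Omega> (range const_emb \<union> {u, v})"
    by (auto intro: generate_field.incl)
  show "L \<subseteq> generate_field \<Omega> (range const_emb \<union> {u, v})"
    by (rule L_sub[OF G rat_field_least[OF G m(1)] m(2)])
  show "generate_field \<Omega> (range const_emb \<union> {u, v}) \<subseteq> L"
    by (rule subsetI, rule generate_field_least[OF L.const_subfield_axioms, where S = "{u, v}"]) (use u_L v_L in auto)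
qed

text \<open>Above \<open>u = 0\<close> the extension is unramified, so \<open>u\<close> keeps order
  1 there and cannot be a square. This makes the genus 2 field a proper extension of both elliptic
  fields.\<close>

lemma sqrt_u_notin:
  assumes g0: "poly g 0 \<noteq> 0" and z: "z ^ 2 = u"
  shows "z \<notin> L"
proof
  assume zL: "z \<in> L"
  obtain V where V: "V \<in> places L" "V \<inter> rat_field u = rat_place u 0" using place_over[OF rat_place_place(1)] by blast
  interpret V: discrete_place L V by (rule L.place[OF V(1)])
  have nr: "conj ` V \<noteq> V" using ramified_iff[OF V(1)] g0 unfolding V(2) ord_g by simp
  have "ord_at V u = 1" using ord_restrict[OF V(1) u_mem u_neq_0] ord_poly_at(3)[of 0] nr V(2) by simp
  moreover have "z \<noteq> 0" using z u_neq_0 by auto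
  then have "ord_at V u = 2 * ord_at V z" using V.ord_power[OF zL, of 2] z by simp
  ultimately have "(1 :: int) = 2 * ord_at V z" by simp
  then have "2 dvd (1 :: int)" by (rule dvdI)
  then show False by simp
qed

end

lemma (in elliptic) elliptic_field: "elliptic_function_field L"
  unfolding elliptic_function_field_def
  by (rule exI[of _ g], rule exI[of _ u], rule exI[of _ v])
    (intro conjI degree_3 squarefree transcendental v_sq L_generated)

section \<open>Genus 2 curves with an extra involution\<close>

locale split_sextic =
  fixes e1 e2 e3 \<beta> \<gamma> \<delta> :: "'k::{alg_closed_field, field_char_0}" and x y :: "'k ambient"
  assumes roots: "\<beta> ^ 2 = e1" "\<gamma> ^ 2 = e2" "\<delta> ^ 2 = e3"
    and distinct: "e1 \<noteq> e2" "e1 \<noteq> e3" "e2 \<noteq> e3" and nonzero: "e1 \<noteq> 0" "e2 \<noteq> 0" "e3 \<noteq> 0"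
    and x_trans: "x \<notin> range const_emb"
    and y_sq: "y ^ 2 = (x ^ 2 - const_emb e1) * (x ^ 2 - const_emb e2) * (x ^ 2 - const_emb e3)"
begin

definition "F = generate_field \<Omega> (range const_emb \<union> {x, y})"

sublocale F: const_subfield F unfolding F_def by (rule const_subfield_generate)

lemma xF: "x \<in> F" and yF: "y \<in> F" by (auto simp: F_def intro: generate_field.incl)

lemma F_least: "const_subfield K \<Longrightarrow> x \<in> K \<Longrightarrow> y \<in> K \<Longrightarrow> F \<subseteq> K"
  using generate_field_least[of K "{x, y}"] by (auto simp: F_def)

lemma x_neq: "x \<noteq> const_emb a" using x_trans by auto

lemma x_neq_0: "x \<noteq> 0" using x_neq[of 0] by simp

lemma x_sq_trans: "x ^ 2 \<notin> range const_emb"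
proof
  assume "x ^ 2 \<in> range const_emb"
  then obtain a where a: "x ^ 2 = const_emb a" by auto
  obtain b where "b ^ 2 = a" using nth_root_exists[of 2 a] by auto
  then have "x ^ 2 = const_emb b ^ 2" using a by (simp flip: const_emb_power)
  then have "x = const_emb b \<or> x = const_emb (- b)" by (simp add: power2_eq_iff const_emb_minus)
  then show False using x_neq by blast
qed

lemma cubic_squarefree:
  fixes a b c :: 'k
  assumes "a \<noteq> b" "a \<noteq> c" "b \<noteq> c"
  shows "rsquarefree ([:- a, 1:] * [:- b, 1:] * [:- c, 1:])"
proof -
  have c: "rsquarefree ([:- c, 1:] * 1)" by (rule rsquarefree_linear_mult[OF rsquarefree_1]) auto
  have "poly ([:- c, 1:] * 1) (- (- b) / 1) \<noteq> 0" unfolding poly_mult using assms by simp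
  from rsquarefree_linear_mult[OF c one_neq_zero this]
  have bc: "rsquarefree ([:- b, 1:] * ([:- c, 1:] * 1))" .
  have "poly ([:- b, 1:] * ([:- c, 1:] * 1)) (- (- a) / 1) \<noteq> 0" unfolding poly_mult using assms by simp
  from rsquarefree_linear_mult[OF bc one_neq_zero this]
  have "rsquarefree ([:- a, 1:] * ([:- b, 1:] * ([:- c, 1:] * 1)))" .
  then show ?thesis by (simp only: mult.assoc mult_1_right)
qed

sublocale E1: elliptic "x ^ 2" y "[:- e1, 1:] * [:- e2, 1:] * [:- e3, 1:]" e1 e2 e3
proof
  show "x ^ 2 \<notin> range const_emb" by (rule x_sq_trans)
  show "y ^ 2 = eval_at ([:- e1, 1:] * [:- e2, 1:] * [:- e3, 1:]) (x ^ 2)"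
    unfolding eval_at_mult y_sq by (simp add: const_emb_minus)
  show "rsquarefree ([:- e1, 1:] * [:- e2, 1:] * [:- e3, 1:])" by (rule cubic_squarefree) (use distinct in auto)
  have "Polynomial.degree ([:- e1, 1:] * [:- e2, 1:] * [:- e3, 1:]) = 3" by (simp add: degree_mult_eq)
  then show "odd (Polynomial.degree ([:- e1, 1:] * [:- e2, 1:] * [:- e3, 1:]))"
    "3 \<le> Polynomial.degree ([:- e1, 1:] * [:- e2, 1:] * [:- e3, 1:])" by simp_all
qed simp

text \<open>A cubic model of the second quotient: inverting \<open>t = x^2\<close> moves the root
  \<open>t = 0\<close> of \<open>t g(t)\<close> to infinity, and the factor
  \<open>- (e1 * e2 * e3)\<close> makes the cubic monic, with roots \<open>- (e2 * e3)\<close>,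
  \<open>- (e1 * e3)\<close>, \<open>- (e1 * e2)\<close>. Accordingly \<open>v2\<close> is a
  constant times \<open>x y / t^2\<close>.\<close>

definition "u2 = const_emb (- (e1 * e2 * e3)) / x ^ 2"

definition "v2 = const_emb (- (e1 * e2 * e3)) * y / x ^ 3"

sublocale E2: elliptic u2 v2 "[:- (- (e2 * e3)), 1:] * [:- (- (e1 * e3)), 1:] * [:- (- (e1 * e2)), 1:]"
  "- (e2 * e3)" "- (e1 * e3)" "- (e1 * e2)"
proof
  let ?g = "[:- (- (e2 * e3)), 1:] * [:- (- (e1 * e3)), 1:] * [:- (- (e1 * e2)), 1:]"
  show "u2 \<notin> range const_emb"
  proof
    assume "u2 \<in> range const_emb"
    then obtain a where "const_emb (- (e1 * e2 * e3)) / x ^ 2 = const_emb a" by (auto simp: u2_def)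
    then have a: "const_emb (- (e1 * e2 * e3)) = const_emb a * x ^ 2" using x_neq_0 by (simp add: divide_eq_eq)
    moreover have "a \<noteq> 0"
    proof
      assume "a = 0"
      then have "const_emb (- (e1 * e2 * e3)) = 0" using a by simp
      then show False using nonzero by (simp only: const_emb_eq_0_iff) simp
    qed
    ultimately have "x ^ 2 = const_emb (- (e1 * e2 * e3) / a)" by (simp only: const_emb_divide) simp
    then show False using x_sq_trans by blast
  qed
  show "v2 ^ 2 = eval_at ?g u2"
  proof -
    have l: "eval_at [:- (- (p * q)), 1:] u2 = const_emb (p * q) * ((x ^ 2 - const_emb r) / x ^ 2)"
      if "p * q * r = e1 * e2 * e3" for p q r
    proof -
      have "u2 = - (const_emb (p * q) * const_emb r / x ^ 2)"
        by (simp add: u2_def const_emb_minus const_emb_mult flip: that)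
      then show ?thesis using x_neq_0 by (simp add: field_simps)
    qed
    have l1: "eval_at [:- (- (e2 * e3)), 1:] u2 = const_emb (e2 * e3) * ((x ^ 2 - const_emb e1) / x ^ 2)"
      by (rule l) (simp add: mult_ac)
    have l2: "eval_at [:- (- (e1 * e3)), 1:] u2 = const_emb (e1 * e3) * ((x ^ 2 - const_emb e2) / x ^ 2)"
      by (rule l) (simp add: mult_ac)
    have l3: "eval_at [:- (- (e1 * e2)), 1:] u2 = const_emb (e1 * e2) * ((x ^ 2 - const_emb e3) / x ^ 2)"
      by (rule l) (simp add: mult_ac)
    have v: "v2 ^ 2 = const_emb (e1 * e2 * e3) ^ 2 * (y ^ 2 / x ^ 6)"
      by (simp add: v2_def const_emb_minus power_divide power_mult_distrib flip: power_mult)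
    have c: "const_emb (e1 * e2 * e3) ^ 2 = const_emb (e2 * e3) * const_emb (e1 * e3) * const_emb (e1 * e2)"
      by (simp add: const_emb_mult power2_eq_square)
    have x6: "x ^ 6 = x ^ 2 * x ^ 2 * x ^ 2" by (simp flip: power_add)
    have "(p * q * r) * ((a * b * c) / (d * d * d)) = (p * (a / d)) * (q * (b / d)) * (r * (c / d))"
      for p q r a b c d :: "'k ambient" by simp
    then show ?thesis unfolding eval_at_mult l1 l2 l3 v c x6 y_sq .
  qed
  show "rsquarefree ?g" by (rule cubic_squarefree) (use distinct nonzero in auto)
  have "Polynomial.degree ?g = 3" by (simp add: degree_mult_eq)
  then show "odd (Polynomial.degree ?g)" "3 \<le> Polynomial.degree ?g" by simp_all
qed simp

sublocale M1: quad_ext E1.L x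
proof
  show "x \<notin> E1.L" by (rule E1.sqrt_u_notin) (use nonzero in auto)
  show "x ^ 2 \<in> E1.L" by (rule E1.u_L)
qed

lemma c_neq_0: "- (e1 * e2 * e3) \<noteq> 0" using nonzero by simp

sublocale M2: quad_ext E2.L x
proof
  have "const_emb (- (e1 * e2 * e3)) \<noteq> 0" unfolding const_emb_eq_0_iff by (rule c_neq_0)
  then have x2: "x ^ 2 = const_emb (- (e1 * e2 * e3)) / u2" using x_neq_0 unfolding u2_def by simp
  show "x ^ 2 \<in> E2.L" unfolding x2 by (intro E2.L.div E2.L.const E2.u_L)
  show "x \<notin> E2.L"
  proof
    assume x: "x \<in> E2.L"
    \<comment> \<open>With this \<open>d\<close>, the quotient \<open>const_emb d / x\<close> is a
      square root of \<open>u2\<close>, so \<open>sqrt_u_notin\<close> applies to it.\<close>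
    obtain d where d: "d ^ 2 = - (e1 * e2 * e3)" using nth_root_exists[of 2 "- (e1 * e2 * e3)"] by auto
    have "(const_emb d / x) ^ 2 = u2" unfolding u2_def d[symmetric] by (simp add: power_divide const_emb_power)
    then have "const_emb d / x \<notin> E2.L" by (rule E2.sqrt_u_notin[rotated]) (use nonzero in simp)
    then show False using x by (simp add: E2.L.div E2.L.const)
  qed
qed

text \<open>The coordinate that sends the branch point \<open>x = \<beta>\<close> to infinity and so
  replaces the sextic by a quintic.\<close>

definition "w = inverse (x - const_emb \<beta>)"

lemma x_w: "x = const_emb \<beta> + inverse w" by (simp add: w_def)

text \<open>For a root \<open>\<rho>\<close> of the sextic,
  \<open>x - \<rho> = (1 + (\<beta> - \<rho>) w) / w\<close>; the factor for
  \<open>\<rho> = \<beta>\<close> becomes 1 and drops out. The nesting ending in 1 suits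
  \<open>rsquarefree_linear_mult\<close>.\<close>

definition "quintic = [:1, 2 * \<beta>:] * ([:1, \<beta> - \<gamma>:] * ([:1, \<beta> + \<gamma>:] * ([:1, \<beta> - \<delta>:] * ([:1, \<beta> + \<delta>:] * 1))))"

lemma root_ineqs: "\<beta> \<noteq> 0" "\<gamma> \<noteq> 0" "\<delta> \<noteq> 0" "\<beta> \<noteq> \<gamma>" "\<beta> \<noteq> - \<gamma>" "\<beta> \<noteq> \<delta>" "\<beta> \<noteq> - \<delta>" "\<gamma> \<noteq> \<delta>" "\<gamma> \<noteq> - \<delta>"
  using distinct nonzero unfolding roots[symmetric] by auto

lemma w_eq: "x * w = 1 + const_emb \<beta> * w" "w \<noteq> 0"
  using x_neq[of \<beta>] by (auto simp: w_def field_simps)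

sublocale G: genus2 w "y * w ^ 3" quintic
proof
  show "w \<notin> range const_emb"
  proof
    assume "w \<in> range const_emb"
    then obtain a where "w = const_emb a" by auto
    then have "x = const_emb (\<beta> + inverse a)" using x_w by (simp add: const_emb_add const_emb_inverse)
    then show False using x_neq by blast
  qed
  have "(x ^ 2 - const_emb (\<rho> ^ 2)) * w ^ 2 = (1 + w * const_emb (\<beta> - \<rho>)) * (1 + w * const_emb (\<beta> + \<rho>))" for \<rho>
  proof -
    have "(x ^ 2 - const_emb (\<rho> ^ 2)) * w ^ 2 = (x * w - const_emb \<rho> * w) * (x * w + const_emb \<rho> * w)"
      by (simp add: const_emb_mult power2_eq_square algebra_simps)
    then show ?thesis unfolding w_eq by (simp add: const_emb_hom algebra_simps)
  qed
  from this[of \<beta>] this[of \<gamma>] this[of \<delta>]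
  have r: "(x ^ 2 - const_emb e1) * w ^ 2 = 1 + w * const_emb (2 * \<beta>)"
    "(x ^ 2 - const_emb e2) * w ^ 2 = (1 + w * const_emb (\<beta> - \<gamma>)) * (1 + w * const_emb (\<beta> + \<gamma>))"
    "(x ^ 2 - const_emb e3) * w ^ 2 = (1 + w * const_emb (\<beta> - \<delta>)) * (1 + w * const_emb (\<beta> + \<delta>))"
    by (simp_all add: roots flip: mult_2)
  have "(y * w ^ 3) ^ 2 = ((x ^ 2 - const_emb e1) * w ^ 2) * (((x ^ 2 - const_emb e2) * w ^ 2) * ((x ^ 2 - const_emb e3) * w ^ 2))"
  proof -
    have w6: "(w ^ 3) ^ 2 = w ^ 2 * (w ^ 2 * w ^ 2)" by (simp flip: power_add power_mult)
    show ?thesis unfolding power_mult_distrib y_sq w6 by (simp only: mult_ac)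
  qed
  also have "\<dots> = eval_at quintic w" unfolding r quintic_def eval_at_mult by (simp add: mult_ac)
  finally show "(y * w ^ 3) ^ 2 = eval_at quintic w" .
  have sums: "\<beta> + \<gamma> \<noteq> 0" "\<beta> + \<delta> \<noteq> 0" "\<gamma> + \<delta> \<noteq> 0" "2 * \<gamma> \<noteq> 0" "2 * \<delta> \<noteq> 0"
    using root_ineqs by (auto simp: eq_neg_iff_add_eq_0)
  have nz: "2 * \<beta> \<noteq> 0" "\<beta> - \<gamma> \<noteq> 0" "\<beta> + \<gamma> \<noteq> 0" "\<beta> - \<delta> \<noteq> 0" "\<beta> + \<delta> \<noteq> 0"
    using root_ineqs sums by auto
  have ne: "p \<noteq> q" if "q - p = r \<or> p - q = r" "r \<noteq> 0" for p q r :: 'k using that by auto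
  have ds: "\<beta> - \<gamma> \<noteq> 2 * \<beta>" "\<beta> + \<gamma> \<noteq> 2 * \<beta>" "\<beta> - \<delta> \<noteq> 2 * \<beta>" "\<beta> + \<delta> \<noteq> 2 * \<beta>"
    "\<beta> + \<gamma> \<noteq> \<beta> - \<gamma>" "\<beta> - \<delta> \<noteq> \<beta> - \<gamma>" "\<beta> + \<delta> \<noteq> \<beta> - \<gamma>"
    "\<beta> - \<delta> \<noteq> \<beta> + \<gamma>" "\<beta> + \<delta> \<noteq> \<beta> + \<gamma>" "\<beta> + \<delta> \<noteq> \<beta> - \<delta>"
    using ne[of "2 * \<beta>" "\<beta> - \<gamma>" "\<beta> + \<gamma>"] ne[of "2 * \<beta>" "\<beta> + \<gamma>" "\<beta> - \<gamma>"]
      ne[of "2 * \<beta>" "\<beta> - \<delta>" "\<beta> + \<delta>"] ne[of "2 * \<beta>" "\<beta> + \<delta>" "\<beta> - \<delta>"]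
      ne[of "\<beta> + \<gamma>" "\<beta> - \<gamma>" "2 * \<gamma>"] ne[of "\<beta> - \<delta>" "\<beta> - \<gamma>" "\<gamma> - \<delta>"]
      ne[of "\<beta> + \<delta>" "\<beta> - \<gamma>" "\<gamma> + \<delta>"] ne[of "\<beta> - \<delta>" "\<beta> + \<gamma>" "\<gamma> + \<delta>"]
      ne[of "\<beta> + \<delta>" "\<beta> + \<gamma>" "\<gamma> - \<delta>"] ne[of "\<beta> + \<delta>" "\<beta> - \<delta>" "2 * \<delta>"] nz sums root_ineqs(8)
    by (simp_all add: algebra_simps)
  show "rsquarefree quintic"
    unfolding quintic_def
    by (intro rsquarefree_linear_mult rsquarefree_1 nz poly_linear_mult_neq_0 ds) simp_all
  have "Polynomial.degree quintic = Suc (Suc (Suc (Suc (Suc 0)))) \<and> quintic \<noteq> 0"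
    unfolding quintic_def by (intro degree_linear_mult nz) simp
  then show d: "Polynomial.degree quintic = 5" by simp
  then show "odd (Polynomial.degree quintic)" "3 \<le> Polynomial.degree quintic" by simp_all
qed

lemma wF: "w \<in> F" unfolding w_def by (intro F.inv F.diff xF F.const)

lemma x_base: "x \<in> rat_field w" by (subst x_w) (intro G.add G.inv G.const G.u_mem)

lemma xG: "x \<in> G.L" by (rule G.K_sub_L[OF x_base])

lemma y_w: "y = y * w ^ 3 * inverse w ^ 3" using w_eq(2) by (simp add: power_inverse)

lemma yG: "y \<in> G.L" by (subst y_w) (rule G.L.mult[OF G.v_L G.L.pow[OF G.L.inv[OF G.u_L]]])

text \<open>Together with \<open>M1_L\<close> and \<open>M2_L\<close> this identifies three
  quadratic extensions, of \<open>k(w)\<close> and of the two elliptic fields, as the same field, so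
  their conjugations can be composed.\<close>

lemma G_L: "G.L = F"
proof
  show "G.L \<subseteq> F"
    by (rule G.L_sub[OF F.const_subfield_axioms rat_field_least[OF F.const_subfield_axioms wF]])
      (intro F.mult F.pow yF wF)
  show "F \<subseteq> G.L" by (rule F_least[OF G.L.const_subfield_axioms xG yG])
qed

lemma E1_sub: "E1.L \<subseteq> F"
  by (rule E1.L_sub[OF F.const_subfield_axioms rat_field_least[OF F.const_subfield_axioms]]) (intro F.pow xF yF)+

lemma M1_L: "M1.L = F"
proof
  show "M1.L \<subseteq> F" by (rule M1.L_sub[OF F.const_subfield_axioms E1_sub xF])
  show "F \<subseteq> M1.L" by (rule F_least[OF M1.L.const_subfield_axioms M1.s_L M1.K_sub_L[OF E1.v_L]])
qed

lemma u2F: "u2 \<in> F" and v2F: "v2 \<in> F"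
  unfolding u2_def v2_def by (intro F.div F.mult F.const F.pow xF yF)+

lemma E2_sub: "E2.L \<subseteq> F"
  by (rule E2.L_sub[OF F.const_subfield_axioms rat_field_least[OF F.const_subfield_axioms u2F] v2F])

lemma y_v2: "y = const_emb (inverse (- (e1 * e2 * e3))) * v2 * x ^ 3"
proof -
  have "const_emb (inverse (- (e1 * e2 * e3))) * const_emb (- (e1 * e2 * e3)) = 1"
    unfolding const_emb_mult[symmetric] left_inverse[OF c_neq_0] by (rule const_emb_1)
  moreover have "p * (q * y / x ^ 3) * x ^ 3 = (p * q) * y" for p q using x_neq_0 by simp
  ultimately show ?thesis unfolding v2_def by simp
qed

lemma M2_L: "M2.L = F"
proof
  show "M2.L \<subseteq> F" by (rule M2.L_sub[OF F.const_subfield_axioms E2_sub xF])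
  have "y \<in> M2.L" by (subst y_v2) (intro M2.L.mult M2.L.const M2.L.pow M2.s_L M2.K_sub_L[OF E2.v_L])
  then show "F \<subseteq> M2.L" by (rule F_least[OF M2.L.const_subfield_axioms M2.s_L])
qed

lemma conj_values:
  "M1.conj x = - x" "M1.conj y = y" "M2.conj x = - x" "M2.conj y = - y" "G.conj x = x" "G.conj y = - y"
proof -
  show "M1.conj x = - x" "M2.conj x = - x" by (rule M1.conj_s, rule M2.conj_s)
  show "M1.conj y = y" by (rule M1.conj_K[OF E1.v_L])
  show "G.conj x = x" by (rule G.conj_K[OF x_base])
  have w3: "inverse w ^ 3 \<in> rat_field w" by (intro G.pow G.inv G.u_mem)
  have "G.conj y = G.conj (y * w ^ 3 * inverse w ^ 3)" by (simp only: flip: y_w)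
  also have "\<dots> = - (y * w ^ 3) * inverse w ^ 3"
    by (simp only: G.conj_mult(2)[OF G.v_L G.K_sub_L[OF w3]] G.conj_s G.conj_K[OF w3])
  also have "\<dots> = - (y * w ^ 3 * inverse w ^ 3)" by (simp only: mult_minus_left)
  finally show "G.conj y = - y" by (simp only: flip: y_w)
  have c: "const_emb (inverse (- (e1 * e2 * e3))) * v2 \<in> E2.L" by (intro E2.L.mult E2.L.const E2.v_L)
  have "M2.conj y = M2.conj (const_emb (inverse (- (e1 * e2 * e3))) * v2 * x ^ 3)" by (simp only: flip: y_v2)
  also have "\<dots> = const_emb (inverse (- (e1 * e2 * e3))) * v2 * (- x) ^ 3"
    by (simp only: M2.conj_mult(2)[OF M2.K_sub_L[OF c] M2.L.pow[OF M2.s_L]] M2.conj_K[OF c] M2.conj_pow[OF M2.s_L] M2.conj_s)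
  also have "\<dots> = - (const_emb (inverse (- (e1 * e2 * e3))) * v2 * x ^ 3)" by simp
  finally show "M2.conj y = - y" by (simp only: flip: y_v2)
qed

lemma endo: "field_endo F M1.conj" "field_endo F M2.conj" "field_endo F G.conj"
  by (rule M1.field_endo_conj[unfolded M1_L], rule M2.field_endo_conj[unfolded M2_L],
      rule G.field_endo_conj[unfolded G_L])

text \<open>The conjugations and the identity form a Klein four-group. Each relation is checked on
  the generators \<open>x\<close> and \<open>y\<close>, where all three conjugations act by
  signs.\<close>

lemma conj_relations:
  assumes "z \<in> F"
  shows "M1.conj (M2.conj z) = G.conj z" "M2.conj (M1.conj z) = G.conj z" "M1.conj (G.conj z) = G.conj (M1.conj z)"
proof -
  have m: "M1.conj (- x) = x" "M1.conj (- y) = - y" "M2.conj (- x) = x" "G.conj (- x) = - x"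
    using M1.conj_minus(2)[of x] M1.conj_minus(2)[of y] M2.conj_minus(2)[of x] G.conj_minus(2)[of x] xF yF
    by (simp_all add: conj_values M1_L M2_L G_L)
  show "M1.conj (M2.conj z) = G.conj z"
    by (rule field_endo_eq[OF field_endo_comp[OF endo(1,2)] endo(3) F_def _ assms]) (auto simp: conj_values m)
  show "M2.conj (M1.conj z) = G.conj z"
    by (rule field_endo_eq[OF field_endo_comp[OF endo(2,1)] endo(3) F_def _ assms]) (auto simp: conj_values m)
  show "M1.conj (G.conj z) = G.conj (M1.conj z)"
    by (rule field_endo_eq[OF field_endo_comp[OF endo(1,3)] field_endo_comp[OF endo(3,1)] F_def _ assms]) (auto simp: conj_values m)
qed

lemma place_sub_F: "V \<in> places F \<Longrightarrow> V \<subseteq> F" by (auto simp: places_iff)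

lemma conj_place_relations:
  assumes "V \<in> places F"
  shows "M1.conj ` M2.conj ` V = G.conj ` V" "M2.conj ` M1.conj ` V = G.conj ` V"
    "M1.conj ` G.conj ` V = G.conj ` M1.conj ` V"
  unfolding image_image by (rule image_cong[OF refl], rule conj_relations, use place_sub_F[OF assms] in blast)+

lemma conj_div_relations:
  assumes "D \<in> divisors F"
  shows "M1.conj_div (M2.conj_div D) = G.conj_div D" "M2.conj_div (M1.conj_div D) = G.conj_div D"
proof -
  have "M1.conj_div (M2.conj_div D) = G.conj_div D \<and> M2.conj_div (M1.conj_div D) = G.conj_div D"
    using assms unfolding divisors_def mem_Collect_eq
    by (induction D rule: frag_induction) (simp_all add: conj_place_relations)
  then show "M1.conj_div (M2.conj_div D) = G.conj_div D" "M2.conj_div (M1.conj_div D) = G.conj_div D" by auto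
qed

end

section \<open>Kernel and image of the map to the two elliptic curves\<close>

context split_sextic
begin

abbreviation "P \<equiv> principal_divisors F"

lemma discrete_F: "discrete_field F"
  using G.L.discrete_field_axioms unfolding G_L .

sublocale F: discrete_field F by (rule discrete_F)

lemma weierstrass_F: "V \<in> G.weierstrass \<longleftrightarrow> V \<in> places F \<and> G.conj ` V = V"
  unfolding G.weierstrass_def G_L by simp

lemma conj1_place: "V \<in> places F \<Longrightarrow> M1.conj ` V \<in> places F"
  using M1.conj_place[of V] unfolding M1_L .

lemma conj1_conj1: "V \<in> places F \<Longrightarrow> M1.conj ` M1.conj ` V = V"
  using M1.conj_image_conj[of V] place_sub_F[of V] unfolding M1_L by simp

lemma conj1_weierstrass: "V \<in> G.weierstrass \<Longrightarrow> M1.conj ` V \<in> G.weierstrass"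
  unfolding weierstrass_F using conj1_place[of V] conj_place_relations(3)[of V] by simp

text \<open>The two involutions compose to the hyperelliptic one, which fixes Weierstrass places; on
  these the involutions therefore agree.\<close>

lemma conj2_weierstrass: assumes "V \<in> G.weierstrass" shows "M2.conj ` V = M1.conj ` V"
proof -
  have V: "V \<in> places F" "G.conj ` V = V" using assms unfolding weierstrass_F by auto
  have V2: "M2.conj ` V \<in> places F" using M2.conj_place[of V] V(1) unfolding M2_L by simp
  have "M1.conj ` M2.conj ` V = V" using conj_place_relations(1)[OF V(1)] V(2) by simp
  then have "M1.conj ` M1.conj ` M2.conj ` V = M1.conj ` V" by simp
  then show ?thesis using conj1_conj1[OF V2] by simp
qed

text \<open>
  A place fixed by all three involutions would lie over \<open>x = 0\<close> or \<open>x = \<infinity>\<close>, where \<open>y\<close> or \<open>y / x\<^sup>3\<close>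
  has a nonzero value that the hyperelliptic involution negates.
\<close>

lemma conj1_no_fixed_point: assumes "V \<in> G.weierstrass" shows "M1.conj ` V \<noteq> V"
proof
  assume f1: "M1.conj ` V = V"
  have V: "V \<in> places F" "G.conj ` V = V" using assms unfolding weierstrass_F by auto
  interpret V: discrete_place F V by (rule F.place[OF V(1)])
  have VL: "V \<subseteq> M1.L" "V \<subseteq> G.L" unfolding M1_L G_L by (rule place_sub_F[OF V(1)])+
  have i1: "M1.conj z \<in> max_ideal V" if "z \<in> max_ideal V" for z
    using M1.ideal_conj[OF VL(1), of z] f1 that V.ideal_sub VL(1) by auto
  have i0: "G.conj z \<in> max_ideal V" if "z \<in> max_ideal V" for z
    using G.ideal_conj[OF VL(2), of z] V(2) that V.ideal_sub VL(2) by auto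
  have neg: "c = 0" if "z - const_emb c \<in> max_ideal V" "- z - const_emb c \<in> max_ideal V" for z c
  proof -
    have "(z - const_emb c) + (- z - const_emb c) \<in> max_ideal V" by (rule V.ideal_add[OF that])
    moreover have "(z - const_emb c) + (- z - const_emb c) = const_emb (- 2 * c)" by (simp add: const_emb_hom)
    ultimately have "const_emb (- 2 * c) \<in> max_ideal V" by (simp only:)
    then have "- 2 * c = 0" by (simp only: V.const_not_ideal)
    then show ?thesis by simp
  qed
  have neg0: "c = 0" if z: "z \<in> F" "G.conj z = - z" "z - const_emb c \<in> max_ideal V" for z c
  proof (rule neg[OF z(3)])
    have "G.conj (z - const_emb c) = - z - const_emb c"
      using G.conj_diff[of z "const_emb c"] z(1,2) F.const unfolding G_L by (simp add: G.conj_const)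
    then show "- z - const_emb c \<in> max_ideal V" using i0[OF z(3)] by simp
  qed
  show False
  proof (cases "x \<in> V")
    case True
    then obtain t where t: "x - const_emb t \<in> max_ideal V" using V.residue by blast
    have "M1.conj (x - const_emb t) = - x - const_emb t"
      using M1.conj_diff[of x "const_emb t"] xF F.const unfolding M1_L by (simp add: M1.conj_const conj_values)
    then have "- x - const_emb t \<in> max_ideal V" using i1[OF t] by simp
    then have "t = 0" by (rule neg[OF t])
    then have xm: "x \<in> max_ideal V" using t by simp
    have r: "x ^ 2 - const_emb a - const_emb (- a) \<in> max_ideal V" for a
      using V.ideal_mult[OF xm True] by (simp add: const_emb_minus power2_eq_square)
    have vs: "x ^ 2 - const_emb a \<in> V" for a by (intro V.V_diff V.V_pow True V.V_const)
    have y2: "y ^ 2 - const_emb (- e1 * - e2 * - e3) \<in> max_ideal V"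
      unfolding y_sq by (intro V.residue_mult r vs V.V_mult)
    have "y ^ 2 \<in> V" unfolding y_sq by (intro V.V_mult vs)
    then have yV: "y \<in> V" using V.V_integral[OF yF, of 0 "- (y ^ 2)"] V.V_0 V.V_minus by simp
    then obtain d where d: "y - const_emb d \<in> max_ideal V" using V.residue by blast
    have "d = 0" by (rule neg0[OF yF conj_values(6) d])
    then have "y * y \<in> max_ideal V" using d V.ideal_mult[of y y] yV by simp
    then have "y ^ 2 - const_emb 0 \<in> max_ideal V" by (simp add: power2_eq_square)
    from V.residue_unique[OF y2 this] show False using nonzero by simp
  next
    case False
    define i where "i = inverse x"
    have im: "i \<in> max_ideal V" unfolding i_def by (rule V.not_V_inverse_ideal[OF xF False])
    then have iV: "i \<in> V" by (rule V.ideal_sub)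
    define p where "p = y * i ^ 3"
    have pF: "p \<in> F" unfolding p_def i_def by (intro F.mult F.pow F.inv yF xF)
    have ib: "i \<in> rat_field w" unfolding i_def by (rule G.inv[OF x_base])
    have pc: "G.conj p = - p"
      unfolding p_def using G.conj_mult(2)[OF yG G.K_sub_L[OF G.pow[OF ib]]] G.conj_K[OF G.pow[OF ib]] conj_values(6) by simp
    have one: "(x ^ 2 - const_emb a) * i ^ 2 = 1 - const_emb a * i ^ 2" for a
      using x_neq_0 by (simp add: i_def field_simps)
    have i6: "(i ^ 3) ^ 2 = i ^ 2 * i ^ 2 * i ^ 2" by (simp flip: power_add power_mult)
    have "p ^ 2 = ((x ^ 2 - const_emb e1) * i ^ 2) * ((x ^ 2 - const_emb e2) * i ^ 2) * ((x ^ 2 - const_emb e3) * i ^ 2)"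
      unfolding p_def power_mult_distrib y_sq i6 by (simp only: mult_ac)
    then have p2: "p ^ 2 = (1 - const_emb e1 * i ^ 2) * (1 - const_emb e2 * i ^ 2) * (1 - const_emb e3 * i ^ 2)"
      unfolding one .
    have r: "1 - const_emb a * i ^ 2 - const_emb 1 \<in> max_ideal V" for a
    proof -
      have "- (const_emb a * (i * i)) \<in> max_ideal V"
        by (intro V.ideal_minus V.ideal_mult2[OF V.V_const] V.ideal_mult[OF im iV])
      then show ?thesis by (simp add: power2_eq_square)
    qed
    have vs: "1 - const_emb a * i ^ 2 \<in> V" for a by (intro V.V_diff V.V_1 V.V_mult V.V_const V.V_pow iV)
    have r2: "p ^ 2 - const_emb (1 * 1 * 1) \<in> max_ideal V"
      unfolding p2 by (intro V.residue_mult r vs V.V_mult)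
    have "p ^ 2 \<in> V" unfolding p2 by (intro V.V_mult vs)
    then have pV: "p \<in> V" using V.V_integral[OF pF, of 0 "- (p ^ 2)"] V.V_0 V.V_minus by simp
    then obtain d where d: "p - const_emb d \<in> max_ideal V" using V.residue by blast
    have "d = 0" by (rule neg0[OF pF pc d])
    then have "p * p \<in> max_ideal V" using d V.ideal_mult[of p p] pV by simp
    then have "p ^ 2 - const_emb 0 \<in> max_ideal V" by (simp add: power2_eq_square)
    from V.residue_unique[OF r2 this] show False by simp
  qed
qed

lemma pull1: "D \<in> divisors F \<Longrightarrow> divisor_push E1.L D \<in> principal_divisors E1.L \<Longrightarrow> D + M1.conj_div D \<in> P"
  using M1.principal_pull[of D] unfolding M1_L .

lemma pull2: "D \<in> divisors F \<Longrightarrow> divisor_push E2.L D \<in> principal_divisors E2.L \<Longrightarrow> D + M2.conj_div D \<in> P"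
  using M2.principal_pull[of D] unfolding M2_L .

lemma pull0: "D \<in> divisors F \<Longrightarrow> divisor_degree D = 0 \<Longrightarrow> D + G.conj_div D \<in> P"
  using G.degree_0_conj[of D] unfolding G_L .

lemma push1: "D \<in> P \<Longrightarrow> divisor_push E1.L D \<in> principal_divisors E1.L"
  using M1.principal_push[of D] unfolding M1_L .

lemma push2: "D \<in> P \<Longrightarrow> divisor_push E2.L D \<in> principal_divisors E2.L"
  using M2.principal_push[of D] unfolding M2_L .

lemma kernel_two_torsion:
  assumes D: "D \<in> zero_degree_divisors F" "divisor_push E1.L D \<in> principal_divisors E1.L"
    "divisor_push E2.L D \<in> principal_divisors E2.L"
  shows "frag_cmul 2 D \<in> P"
proof -
  have d: "D \<in> divisors F" "divisor_degree D = 0" using D(1) by (auto simp: zero_degree_divisors_def)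
  \<comment> \<open>Let \<open>c1\<close>, \<open>c2\<close>, \<open>c0\<close> be the conjugations.
    Applying \<open>c1\<close> to \<open>D + c2 D\<close> gives \<open>c1 D + c0 D\<close>;
    subtracting this from the sum of \<open>D + c1 D\<close> and \<open>D + c0 D\<close> leaves
    \<open>2 D\<close>.\<close>
  have "M1.conj_div (D + M2.conj_div D) \<in> P"
    using M1.principal_conj[of "D + M2.conj_div D"] pull2[OF d(1) D(3)] unfolding M1_L by blast
  then have "M1.conj_div D + G.conj_div D \<in> P" by (simp add: conj_div_relations[OF d(1)])
  from F.principal_diff[OF F.principal_add[OF pull1[OF d(1) D(2)] pull0[OF d]] this]
  show ?thesis by (simp add: frag_cmul_2 algebra_simps)
qed

text \<open>As a 2-torsion class, \<open>D\<close> is a difference \<open>V - W\<close> of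
  Weierstrass places. Its image on the first elliptic curve is trivial, and distinct points there
  are inequivalent; so \<open>V\<close> and \<open>W\<close> have the same restriction, which leaves
  \<open>W = V\<close> or the conjugate of \<open>V\<close>.\<close>

lemma kernel_weierstrass:
  assumes D: "D \<in> zero_degree_divisors F" "divisor_push E1.L D \<in> principal_divisors E1.L"
    "divisor_push E2.L D \<in> principal_divisors E2.L"
  shows "D \<in> P \<or> (\<exists>V\<in>G.weierstrass. D - (frag_of V - frag_of (M1.conj ` V)) \<in> P)"
proof -
  have d: "D \<in> divisors F" "divisor_degree D = 0" using D(1) by (auto simp: zero_degree_divisors_def)
  obtain V W where V: "V \<in> G.weierstrass" "W \<in> G.weierstrass" "D - (frag_of V - frag_of W) \<in> P"
    using G.two_torsion[of D] d kernel_two_torsion[OF D] unfolding G_L by blast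
  have VF: "V \<in> places M1.L" "W \<in> places M1.L" using V(1,2) unfolding weierstrass_F M1_L by auto
  from M1.L.principal_diff[OF _ ] have "divisor_push E1.L D - divisor_push E1.L (D - (frag_of V - frag_of W)) \<in> principal_divisors E1.L"
    using E1.L.principal_diff[OF D(2) push1[OF V(3)]] by blast
  then have "frag_of (V \<inter> E1.L) - frag_of (W \<inter> E1.L) \<in> principal_divisors E1.L" by simp
  then have "V \<inter> E1.L = W \<inter> E1.L"
    by (rule E1.principal_diff_imp_eq[OF M1.restrict_place[OF VF(1)] M1.restrict_place[OF VF(2)]])
  then have "W = V \<or> W = M1.conj ` V" using M1.same_restrict_iff[OF VF] by metis
  then show ?thesis
  proof
    assume "W = V"
    then show ?thesis using V(3) by simp
  next
    assume "W = M1.conj ` V"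
    then show ?thesis using V by blast
  qed
qed

lemma involution_divisor:
  assumes V: "V \<in> G.weierstrass"
  shows "frag_of V - frag_of (M1.conj ` V) \<in> zero_degree_divisors F"
    "divisor_push E1.L (frag_of V - frag_of (M1.conj ` V)) = 0"
    "divisor_push E2.L (frag_of V - frag_of (M1.conj ` V)) = 0"
    "frag_cmul 2 (frag_of V - frag_of (M1.conj ` V)) \<in> P"
    "frag_of V - frag_of (M1.conj ` V) \<notin> P"
proof -
  have VF: "V \<in> places F" "M1.conj ` V \<in> places F" and cW: "M1.conj ` V \<in> G.weierstrass"
    using V conj1_weierstrass[OF V] unfolding weierstrass_F by auto
  show "frag_of V - frag_of (M1.conj ` V) \<in> zero_degree_divisors F"
    using VF by (simp add: zero_degree_divisors_def)
  have VL: "V \<subseteq> M1.L" "V \<subseteq> M2.L" unfolding M1_L M2_L by (rule place_sub_F[OF VF(1)])+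
  show "divisor_push E1.L (frag_of V - frag_of (M1.conj ` V)) = 0"
    using M1.conj_restrict[OF VL(1)] by simp
  show "divisor_push E2.L (frag_of V - frag_of (M1.conj ` V)) = 0"
    using M2.conj_restrict[OF VL(2)] unfolding conj2_weierstrass[OF V] by simp
  have "frag_cmul 2 (frag_of V - frag_of G.infty) - frag_cmul 2 (frag_of (M1.conj ` V) - frag_of G.infty) \<in> P"
    using F.principal_diff G.weierstrass_double[OF V] G.weierstrass_double[OF cW] unfolding G_L by blast
  then show "frag_cmul 2 (frag_of V - frag_of (M1.conj ` V)) \<in> P" by (simp add: frag_cmul_2 algebra_simps)
  show "frag_of V - frag_of (M1.conj ` V) \<notin> P"
    using G.principal_diff_imp_eq[of V "M1.conj ` V"] VF conj1_no_fixed_point[OF V] unfolding G_L by auto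
qed

text \<open>The involution has no fixed point among the six Weierstrass places, so they form three
  pairs. The relation between the three difference classes comes from the divisor of the ordinate
  \<open>y * w ^ 3\<close>; it is why the kernel has order 4 and not 8.\<close>

lemma weierstrass_pairs:
  obtains A B C where "A \<in> G.weierstrass" "B \<in> G.weierstrass" "C \<in> G.weierstrass"
    "G.weierstrass = {A, M1.conj ` A, B, M1.conj ` B, C, M1.conj ` C}"
    "(frag_of A - frag_of (M1.conj ` A)) + (frag_of B - frag_of (M1.conj ` B)) + (frag_of C - frag_of (M1.conj ` C)) \<in> P"
proof -
  have card: "card G.weierstrass = 6" using G.weierstrass_divisor(2) G.degree_5 by simp
  have fin: "finite G.weierstrass" by (rule G.weierstrass_divisor(1))
  have ex: "\<exists>A\<in>G.weierstrass. A \<notin> S" if "finite S" "card S < 6" for S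
  proof (rule ccontr)
    assume "\<not> ?thesis"
    then have "G.weierstrass \<subseteq> S" by blast
    then show False using card_mono[OF that(1)] card that(2) by (metis not_le)
  qed
  have two: "card {a, b} \<le> 2" for a b :: "'k ambient set" by (simp add: card_insert_if)
  have four: "card {a, b, c, d} \<le> 4" for a b c d :: "'k ambient set" by (simp add: card_insert_if)
  let ?C = "G.infty"
  have C: "?C \<in> G.weierstrass" by (rule G.infty_weierstrass)
  have "\<exists>A\<in>G.weierstrass. A \<notin> {?C, M1.conj ` ?C}"
    by (rule ex) (simp, rule le_less_trans[OF two], simp)
  then obtain A where A: "A \<in> G.weierstrass" "A \<notin> {?C, M1.conj ` ?C}" by blast
  have "\<exists>B\<in>G.weierstrass. B \<notin> {A, M1.conj ` A, ?C, M1.conj ` ?C}"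
    by (rule ex) (simp, rule le_less_trans[OF four], simp)
  then obtain B where B: "B \<in> G.weierstrass" "B \<notin> {A, M1.conj ` A, ?C, M1.conj ` ?C}" by blast
  have cc: "M1.conj ` M1.conj ` V = V" if "V \<in> G.weierstrass" for V
    using conj1_conj1[of V] that unfolding weierstrass_F by simp
  note cA = cc[OF A(1)] and cB = cc[OF B(1)] and cC = cc[OF C]
  note nA = conj1_no_fixed_point[OF A(1)] and nB = conj1_no_fixed_point[OF B(1)] and nC = conj1_no_fixed_point[OF C]
  have ne: "M1.conj ` A \<noteq> ?C" "M1.conj ` A \<noteq> M1.conj ` ?C" "M1.conj ` B \<noteq> ?C" "M1.conj ` B \<noteq> M1.conj ` ?C"
    "M1.conj ` B \<noteq> A" "M1.conj ` B \<noteq> M1.conj ` A"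
    using A(2) B(2) cA cB cC by (metis insertCI)+
  have A': "A \<noteq> ?C" "A \<noteq> M1.conj ` ?C" using A(2) by blast+
  have B': "B \<noteq> A" "B \<noteq> M1.conj ` A" "B \<noteq> ?C" "B \<noteq> M1.conj ` ?C" using B(2) by blast+
  have gen: "distinct [a, a', b, b', c, c']"
    if "a \<noteq> a'" "a \<noteq> b" "a \<noteq> b'" "a \<noteq> c" "a \<noteq> c'" "a' \<noteq> b" "a' \<noteq> b'" "a' \<noteq> c" "a' \<noteq> c'"
      "b \<noteq> b'" "b \<noteq> c" "b \<noteq> c'" "b' \<noteq> c" "b' \<noteq> c'" "c \<noteq> c'" for a a' b b' c c' :: "'k ambient set"
    using that by simp
  note dist = gen[OF nA[symmetric] B'(1)[symmetric] ne(5)[symmetric] A' B'(2)[symmetric] ne(6)[symmetric] ne(1,2)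
      nB[symmetric] B'(3,4) ne(3,4) nC[symmetric]]
  have card6: "card {a, a', b, b', c, c'} = 6" if "distinct [a, a', b, b', c, c']" for a a' b b' c c' :: "'k ambient set"
    using distinct_card[OF that] by simp
  have sum6: "(\<Sum>V\<in>{a, a', b, b', c, c'}. frag_of V) = frag_of a + (frag_of a' + (frag_of b + (frag_of b' + (frag_of c + frag_of c'))))"
    if "distinct [a, a', b, b', c, c']" for a a' b b' c c' :: "'k ambient set"
    using sum.distinct_set_conv_list[OF that, of frag_of] by simp
  have sub: "{A, M1.conj ` A, B, M1.conj ` B, ?C, M1.conj ` ?C} \<subseteq> G.weierstrass"
    using A B C conj1_weierstrass by auto
  have "card {A, M1.conj ` A, B, M1.conj ` B, ?C, M1.conj ` ?C} = 6"
    by (rule card6[OF dist])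
  then have eq: "G.weierstrass = {A, M1.conj ` A, B, M1.conj ` B, ?C, M1.conj ` ?C}"
    using card_subset_eq[OF fin sub] card by simp
  have sum: "(\<Sum>V\<in>G.weierstrass. frag_of V) = frag_of A + (frag_of (M1.conj ` A) + (frag_of B + (frag_of (M1.conj ` B) + (frag_of ?C + frag_of (M1.conj ` ?C)))))"
    unfolding eq by (rule sum6[OF dist])
  have p: "(\<Sum>V\<in>G.weierstrass. frag_of V) - frag_cmul 6 (frag_of ?C) \<in> P"
    using G.weierstrass_divisor(3) G.degree_5 unfolding G_L by simp
  have d: "frag_cmul 2 (frag_of (M1.conj ` V) - frag_of ?C) \<in> P" if "V \<in> G.weierstrass" for V
    using G.weierstrass_double[OF conj1_weierstrass[OF that]] unfolding G_L .
  \<comment> \<open>Subtracting twice the 2-torsion divisors \<open>conj V - infty\<close>, one for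
    each pair, turns each \<open>V + conj V\<close> into \<open>V - conj V\<close> and uses up the
    multiple 6 of \<open>infty\<close>.\<close>
  from F.principal_diff[OF F.principal_diff[OF F.principal_diff[OF p d[OF A(1)]] d[OF B(1)]] d[OF C]]
  have "(frag_of A - frag_of (M1.conj ` A)) + (frag_of B - frag_of (M1.conj ` B)) + (frag_of ?C - frag_of (M1.conj ` ?C)) \<in> P"
  proof -
    have "(\<Sum>V\<in>G.weierstrass. frag_of V) - frag_cmul 6 (frag_of ?C) - frag_cmul 2 (frag_of (M1.conj ` A) - frag_of ?C)
      - frag_cmul 2 (frag_of (M1.conj ` B) - frag_of ?C) - frag_cmul 2 (frag_of (M1.conj ` ?C) - frag_of ?C)
      = (frag_of A - frag_of (M1.conj ` A)) + (frag_of B - frag_of (M1.conj ` B)) + (frag_of ?C - frag_of (M1.conj ` ?C))"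
      unfolding sum by (rule poly_mapping_eqI) (simp only: lookup_add lookup_minus lookup_frag_cmul, simp)
    then show ?thesis using F.principal_diff[OF F.principal_diff[OF F.principal_diff[OF p d[OF A(1)]] d[OF B(1)]] d[OF C]] by (simp only:)
  qed
  then show thesis by (rule that[OF A(1) B(1) C eq])
qed

text \<open>Halve the given classes and lift the halves to \<open>X1\<close> and \<open>X2\<close>.
  On the first curve \<open>X1 + conj1 X1\<close> pushes to twice the half. On the second curve
  \<open>conj1 X1\<close> has the same image as the hyperelliptic conjugate of \<open>X1\<close>, so
  the sum becomes principal. The roles are exchanged for \<open>X2\<close>, and the two
  contributions do not disturb each other.\<close>

lemma push_surjective:
  assumes E: "D1 \<in> zero_degree_divisors E1.L" "D2 \<in> zero_degree_divisors E2.L"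
  shows "\<exists>D\<in>zero_degree_divisors F. divisor_push E1.L D - D1 \<in> principal_divisors E1.L \<and>
      divisor_push E2.L D - D2 \<in> principal_divisors E2.L"
proof -
  have d: "D1 \<in> divisors E1.L" "divisor_degree D1 = 0" "D2 \<in> divisors E2.L" "divisor_degree D2 = 0"
    using E by (auto simp: zero_degree_divisors_def)
  obtain H1 where H1: "H1 \<in> divisors E1.L" "divisor_degree H1 = 0" "D1 - frag_cmul 2 H1 \<in> principal_divisors E1.L"
    by (rule E1.degree_0_divisible_by_2[OF d(1,2)])
  obtain H2 where H2: "H2 \<in> divisors E2.L" "divisor_degree H2 = 0" "D2 - frag_cmul 2 H2 \<in> principal_divisors E2.L"
    by (rule E2.degree_0_divisible_by_2[OF d(3,4)])
  obtain X1 where X1: "X1 \<in> divisors F" "divisor_push E1.L X1 = H1" using M1.lift_divisor[OF H1(1)] unfolding M1_L by blast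
  obtain X2 where X2: "X2 \<in> divisors F" "divisor_push E2.L X2 = H2" using M2.lift_divisor[OF H2(1)] unfolding M2_L by blast
  have deg: "divisor_degree X1 = 0" "divisor_degree X2 = 0"
    using M1.push_simps(7)[of X1] M2.push_simps(7)[of X2] X1 X2 H1 H2 by auto
  have cd: "M1.conj_div X1 \<in> divisors F" "M2.conj_div X2 \<in> divisors F"
    using M1.conj_div_divisors[of X1] M2.conj_div_divisors[of X2] X1 X2 unfolding M1_L M2_L by auto
  define D where "D = (X1 + M1.conj_div X1) + (X2 + M2.conj_div X2)"
  have D: "D \<in> zero_degree_divisors F"
    using X1 X2 cd deg by (simp add: D_def zero_degree_divisors_def)
  have a1: "divisor_push E1.L (X1 + M1.conj_div X1) = frag_cmul 2 H1"
    using M1.push_conj_div[of X1] X1 unfolding M1_L by (simp add: frag_cmul_2)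
  have a2: "divisor_push E2.L (X2 + M2.conj_div X2) = frag_cmul 2 H2"
    using M2.push_conj_div[of X2] X2 unfolding M2_L by (simp add: frag_cmul_2)
  have "divisor_push E2.L (M1.conj_div X1) = divisor_push E2.L (G.conj_div X1)"
    using M2.push_conj_div[of "M1.conj_div X1"] cd conj_div_relations(2)[OF X1(1)] unfolding M2_L by simp
  then have b1: "divisor_push E2.L (X1 + M1.conj_div X1) \<in> principal_divisors E2.L"
    using push2[OF pull0[OF X1(1) deg(1)]] by simp
  have "divisor_push E1.L (M2.conj_div X2) = divisor_push E1.L (G.conj_div X2)"
    using M1.push_conj_div[of "M2.conj_div X2"] cd conj_div_relations(1)[OF X2(1)] unfolding M1_L by simp
  then have b2: "divisor_push E1.L (X2 + M2.conj_div X2) \<in> principal_divisors E1.L"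
    using push1[OF pull0[OF X2(1) deg(2)]] by simp
  have "divisor_push E1.L D - D1 = divisor_push E1.L (X2 + M2.conj_div X2) - (D1 - frag_cmul 2 H1)"
    unfolding D_def M1.push_simps(3)[of "X1 + M1.conj_div X1"] a1 by (simp only: algebra_simps)
  then have 1: "divisor_push E1.L D - D1 \<in> principal_divisors E1.L"
    using E1.L.principal_diff[OF b2 H1(3)] by (simp only:)
  have "divisor_push E2.L D - D2 = divisor_push E2.L (X1 + M1.conj_div X1) - (D2 - frag_cmul 2 H2)"
    unfolding D_def M2.push_simps(3)[of "X1 + M1.conj_div X1"] a2 by (simp only: algebra_simps)
  then have "divisor_push E2.L D - D2 \<in> principal_divisors E2.L"
    using E2.L.principal_diff[OF b1 H2(3)] by (simp only:)
  then show ?thesis using 1 D by blast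
qed

theorem reducible: "jacobian_22_reducible F"
proof -
  obtain A B C where ABC: "A \<in> G.weierstrass" "B \<in> G.weierstrass" "C \<in> G.weierstrass"
    and W: "G.weierstrass = {A, M1.conj ` A, B, M1.conj ` B, C, M1.conj ` C}"
    and sum: "(frag_of A - frag_of (M1.conj ` A)) + (frag_of B - frag_of (M1.conj ` B)) + (frag_of C - frag_of (M1.conj ` C)) \<in> P"
    by (rule weierstrass_pairs)
  define T where "T V = frag_of V - frag_of (M1.conj ` V)" for V
  note T = involution_divisor[folded T_def]
  have sum: "T A + T B + T C \<in> P" using sum by (simp only: T_def)
  have TC: "T A + T B \<notin> P"
  proof
    assume "T A + T B \<in> P"
    from F.principal_diff[OF sum this] show False using T(5)[OF ABC(3)] by simp
  qed
  have Tc: "T (M1.conj ` V) = - T V" if "V \<in> G.weierstrass" for V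
    using conj1_conj1[of V] that unfolding weierstrass_F by (simp add: T_def)
  have neg: "D - T V \<in> P" if "D + T V \<in> P" "V \<in> G.weierstrass" for D V
  proof -
    have "D - T V = (D + T V) - frag_cmul 2 (T V)" by (simp add: frag_cmul_2)
    then show ?thesis using F.principal_diff[OF that(1) T(4)[OF that(2)]] by (simp only:)
  qed
  show ?thesis
  proof (rule jacobian_22_reducibleI[OF M1.quad_ext_axioms M2.quad_ext_axioms M1_L M2_L, of "T A" "T B"])
    show "degree2_elliptic_quotient F E1.L" "degree2_elliptic_quotient F E2.L"
      using E1.elliptic_field E2.elliptic_field E1_sub E2_sub M1.dimension_L M2.dimension_L
      unfolding degree2_elliptic_quotient_def M1_L M2_L by blast+
    show "\<exists>D\<in>zero_degree_divisors F. divisor_push E1.L D - D1 \<in> principal_divisors E1.L \<and>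
        divisor_push E2.L D - D2 \<in> principal_divisors E2.L"
      if "D1 \<in> zero_degree_divisors E1.L" "D2 \<in> zero_degree_divisors E2.L" for D1 D2
      by (rule push_surjective[OF that])
    fix D assume D: "D \<in> zero_degree_divisors F" "divisor_push E1.L D \<in> principal_divisors E1.L"
      "divisor_push E2.L D \<in> principal_divisors E2.L"
    have "D \<in> P \<or> (\<exists>V\<in>G.weierstrass. D - T V \<in> P)" unfolding T_def by (rule kernel_weierstrass[OF D])
    then show "D \<in> P \<or> D - T A \<in> P \<or> D - T B \<in> P \<or> D - (T A + T B) \<in> P"
    proof
      assume "\<exists>V\<in>G.weierstrass. D - T V \<in> P"
      then obtain V where V: "V \<in> G.weierstrass" "D - T V \<in> P" by blast
      have c: "D - T Z \<in> P" if ZW: "Z \<in> G.weierstrass" "V = Z \<or> V = M1.conj ` Z" for Z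
        using ZW(2)
      proof
        assume "V = M1.conj ` Z"
        then have "D + T Z \<in> P" using V(2) Tc[OF ZW(1)] by simp
        then show ?thesis using neg ZW(1) by blast
      qed (use V in simp)
      have "(V = A \<or> V = M1.conj ` A) \<or> (V = B \<or> V = M1.conj ` B) \<or> (V = C \<or> V = M1.conj ` C)"
        using V(1) unfolding W insert_iff empty_iff by blast
      then have "D - T A \<in> P \<or> D - T B \<in> P \<or> D - T C \<in> P"
        using c[OF ABC(1)] c[OF ABC(2)] c[OF ABC(3)] by blast
      then consider "D - T A \<in> P" | "D - T B \<in> P" | "D - T C \<in> P" by blast
      then show ?thesis
      proof cases
        case 3
        \<comment> \<open>The third class is the sum of the other two: its sign is changed by
          2-torsion, and then the relation \<open>T A + T B + T C \<in> P\<close> is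
          subtracted.\<close>
        have "D + T C \<in> P"
        proof -
          have "D + T C = (D - T C) + frag_cmul 2 (T C)" by (simp add: frag_cmul_2)
          then show ?thesis using F.principal_add[OF 3 T(4)[OF ABC(3)]] by (simp only:)
        qed
        from F.principal_diff[OF this sum] have "D - (T A + T B) \<in> P" by (simp add: algebra_simps)
        then show ?thesis by blast
      qed blast+
    qed blast
  qed (rule TC T(1)[OF ABC(1)] T(1)[OF ABC(2)] T(2)[OF ABC(1)] T(2)[OF ABC(2)] T(3)[OF ABC(1)] T(3)[OF ABC(2)]
      T(4)[OF ABC(1)] T(4)[OF ABC(2)] T(5)[OF ABC(1)] T(5)[OF ABC(2)])+
qed

end

section \<open>Enumerating the graphs\<close>

text \<open>
  A graph on \<open>{1..6}\<close> is coded by its incidence list with respect to the 15 possible edges.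
\<close>

definition edge_list :: "(nat \<times> nat) list" where
  "edge_list = [(1,2),(1,3),(1,4),(1,5),(1,6),(2,3),(2,4),(2,5),(2,6),(3,4),(3,5),(3,6),(4,5),(4,6),(5,6)]"

definition edge :: "nat \<Rightarrow> nat set" where
  "edge i = {fst (edge_list ! i), snd (edge_list ! i)}"

definition code_graph :: "bool list \<Rightarrow> nat set set" where
  "code_graph l = edge ` {i. i < 15 \<and> l ! i}"

lemma less_15: "(i::nat) < 15 \<longleftrightarrow> i = 0 \<or> i = 1 \<or> i = 2 \<or> i = 3 \<or> i = 4 \<or> i = 5 \<or> i = 6 \<or> i = 7 \<or>
    i = 8 \<or> i = 9 \<or> i = 10 \<or> i = 11 \<or> i = 12 \<or> i = 13 \<or> i = 14"
  by arith

lemma all_less_15: "(\<forall>i<15. Q i) \<longleftrightarrow> Q 0 \<and> Q 1 \<and> Q 2 \<and> Q 3 \<and> Q 4 \<and> Q 5 \<and> Q 6 \<and> Q 7 \<and> Q (8::nat) \<and> Q 9 \<and>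
    Q 10 \<and> Q 11 \<and> Q 12 \<and> Q 13 \<and> Q 14"
  unfolding less_15 by blast

lemma edges: "edge 0 = {1,2}" "edge 1 = {1,3}" "edge 2 = {1,4}" "edge 3 = {1,5}" "edge 4 = {1,6}" "edge 5 = {2,3}"
  "edge 6 = {2,4}" "edge 7 = {2,5}" "edge 8 = {2,6}" "edge 9 = {3,4}" "edge 10 = {3,5}" "edge 11 = {3,6}"
  "edge 12 = {4,5}" "edge 13 = {4,6}" "edge 14 = {5,6}" "edge (Suc 0) = {1,3}"
  by (simp_all add: edge_def edge_list_def)

lemma edge_inj: "inj_on edge {i. i < 15}"
proof (rule inj_onI)
  fix i j assume "i \<in> {i. i < 15}" "j \<in> {i. i < 15}" "edge i = edge j"
  then show "i = j" unfolding mem_Collect_eq less_15 by (elim disjE; simp add: edges doubleton_eq_iff)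
qed

lemma code_graph_inj:
  assumes "length l = 15" "length l' = 15" "code_graph l = code_graph l'" shows "l = l'"
proof (rule nth_equalityI)
  fix i assume "i < length l"
  then have i: "i < 15" using assms by simp
  have "edge i \<in> code_graph l \<longleftrightarrow> l ! i" if "length l = 15" for l
    using inj_onD[OF edge_inj] i unfolding code_graph_def by blast
  from this[OF assms(1)] this[OF assms(2)] show "l ! i = l' ! i" using assms(3) by simp
qed (use assms in simp)

text \<open>Taken literally this is the action of the inverse permutation; \<open>edge_perm\<close>
  restricts to involutions, for which the two coincide.\<close>

definition edge_action :: "nat list \<Rightarrow> bool list \<Rightarrow> bool list" where
  "edge_action \<pi> l = map (\<lambda>i. l ! i) \<pi>"

definition edge_perm :: "nat \<Rightarrow> nat \<Rightarrow> nat list \<Rightarrow> bool" where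
  "edge_perm a b \<pi> \<longleftrightarrow> length \<pi> = 15 \<and> (\<forall>i<15. \<pi> ! i < 15 \<and> \<pi> ! (\<pi> ! i) = i \<and> transpose a b ` edge i = edge (\<pi> ! i))"

lemma code_graph_action:
  assumes "edge_perm a b \<pi>"
  shows "(\<lambda>e. transpose a b ` e) ` code_graph l = code_graph (edge_action \<pi> l)"
proof -
  have p: "\<pi> ! i < 15" "\<pi> ! (\<pi> ! i) = i" "transpose a b ` edge i = edge (\<pi> ! i)" if "i < 15" for i
    using assms that unfolding edge_perm_def by auto
  have len: "length \<pi> = 15" using assms unfolding edge_perm_def by simp
  have n: "edge_action \<pi> l ! i = l ! (\<pi> ! i)" if "i < 15" for i
    using that len by (simp add: edge_action_def)
  show ?thesis
  proof (intro equalityI subsetI)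
    fix e assume "e \<in> (\<lambda>e. transpose a b ` e) ` code_graph l"
    then obtain i where i: "i < 15" "l ! i" "e = transpose a b ` edge i" by (auto simp: code_graph_def)
    have "edge_action \<pi> l ! (\<pi> ! i)" using n[OF p(1)[OF i(1)]] p(2)[OF i(1)] i(2) by simp
    then show "e \<in> code_graph (edge_action \<pi> l)"
      unfolding code_graph_def i(3) p(3)[OF i(1)] using p(1)[OF i(1)] by blast
  next
    fix e assume "e \<in> code_graph (edge_action \<pi> l)"
    then obtain i where i: "i < 15" "edge_action \<pi> l ! i" "e = edge i" by (auto simp: code_graph_def)
    have "l ! (\<pi> ! i)" using n[OF i(1)] i(2) by simp
    then have "edge (\<pi> ! i) \<in> code_graph l" unfolding code_graph_def using p(1)[OF i(1)] by blast
    moreover have "e = transpose a b ` edge (\<pi> ! i)" using p(3)[OF p(1)[OF i(1)]] p(2)[OF i(1)] i(3) by simp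
    ultimately show "e \<in> (\<lambda>e. transpose a b ` e) ` code_graph l" by (rule rev_image_eqI)
  qed
qed

text \<open>For each of the 15 transpositions, the permutation that it induces on the edge numbers
  of \<open>edge_list\<close>.\<close>

definition transposition_table :: "(nat \<times> nat \<times> nat list) list" where
  "transposition_table = [
(1,2,[0,5,6,7,8,1,2,3,4,9,10,11,12,13,14]),
    (1,3,[5,1,9,10,11,0,6,7,8,2,3,4,12,13,14]),
    (1,4,[6,9,2,12,13,5,0,7,8,1,10,11,3,4,14]),
    (1,5,[7,10,12,3,14,5,6,0,8,9,1,11,2,13,4]),
    (1,6,[8,11,13,14,4,5,6,7,0,9,10,1,12,2,3]),
    (2,3,[1,0,2,3,4,5,9,10,11,6,7,8,12,13,14]),
    (2,4,[2,1,0,3,4,9,6,12,13,5,10,11,7,8,14]),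
    (2,5,[3,1,2,0,4,10,12,7,14,9,5,11,6,13,8]),
    (2,6,[4,1,2,3,0,11,13,14,8,9,10,5,12,6,7]),
    (3,4,[0,2,1,3,4,6,5,7,8,9,12,13,10,11,14]),
    (3,5,[0,3,2,1,4,7,6,5,8,12,10,14,9,13,11]),
    (3,6,[0,4,2,3,1,8,6,7,5,13,14,11,12,9,10]),
    (4,5,[0,1,3,2,4,5,7,6,8,10,9,11,12,14,13]),
    (4,6,[0,1,4,3,2,5,8,7,6,11,10,9,14,13,12]),
    (5,6,[0,1,2,4,3,5,6,8,7,9,11,10,13,12,14])
]"

lemma transposition_table: "(a, b, \<pi>) \<in> set transposition_table \<Longrightarrow> edge_perm a b \<pi>"
proof -
  have "\<forall>(a, b, \<pi>)\<in>set transposition_table. edge_perm a b \<pi>"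
    unfolding transposition_table_def edge_perm_def all_less_15
    by (simp add: edges transpose_def doubleton_eq_iff)
  then show "(a, b, \<pi>) \<in> set transposition_table \<Longrightarrow> edge_perm a b \<pi>" by blast
qed

lemma transposition_complete:
  assumes "a \<in> {1..6}" "b \<in> {1..6}" "a \<noteq> (b::nat)"
  shows "\<exists>\<pi>. (a, b, \<pi>) \<in> set transposition_table \<or> (b, a, \<pi>) \<in> set transposition_table"
proof -
  have six: "{1..6::nat} = {1, 2, 3, 4, 5, 6}" by auto
  show ?thesis using assms unfolding six transposition_table_def by (elim insertE emptyE; simp)
qed

lemma permuted_expressions_closed:
  assumes H: "H \<in> permuted_expressions G" and ab: "a \<in> {1..6}" "b \<in> {1..6}"
  shows "(\<lambda>e. transpose a b ` e) ` H \<in> permuted_expressions G"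
proof -
  obtain \<sigma> where s: "\<sigma> permutes {1..6}" "H = (\<lambda>e. \<sigma> ` e) ` G" using H by (auto simp: permuted_expressions_def)
  have "(transpose a b \<circ> \<sigma>) permutes {1..6}" by (rule permutes_compose[OF s(1) permutes_swap_id[OF ab]])
  moreover have "(\<lambda>e. transpose a b ` e) ` H = (\<lambda>e. (transpose a b \<circ> \<sigma>) ` e) ` G" unfolding s(2) by (auto simp: image_comp)
  ultimately show ?thesis unfolding permuted_expressions_def by blast
qed

lemma permuted_expressions_self: "G \<in> permuted_expressions G"
  unfolding permuted_expressions_def by (rule image_eqI[of _ _ id]) (auto simp: permutes_id)

text \<open>A replayable certificate of reachability: \<open>(k, j)\<close> appends the image of the
  \<open>k\<close>-th code listed so far under the \<open>j\<close>-th transposition, both counted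
  from 0.\<close>

fun orbit_search :: "bool list list \<Rightarrow> (nat \<times> nat) list \<Rightarrow> bool list list" where
  "orbit_search ls [] = ls"
| "orbit_search ls ((k, j) # ps) = orbit_search (ls @ [edge_action (snd (snd (transposition_table ! j))) (ls ! k)]) ps"

fun valid_search :: "nat \<Rightarrow> (nat \<times> nat) list \<Rightarrow> bool" where
  "valid_search n [] \<longleftrightarrow> True"
| "valid_search n ((k, j) # ps) \<longleftrightarrow> k < n \<and> j < 15 \<and> valid_search (Suc n) ps"

lemma table_range: "(a, b, \<pi>) \<in> set transposition_table \<Longrightarrow> a \<in> {1..6} \<and> b \<in> {1..6}"
  unfolding transposition_table_def by (simp, elim disjE; simp)

lemma orbit_search_sound:
  assumes "valid_search (length ls) ps" "\<forall>l\<in>set ls. code_graph l \<in> permuted_expressions G"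
  shows "\<forall>l\<in>set (orbit_search ls ps). code_graph l \<in> permuted_expressions G"
  using assms
proof (induction ps arbitrary: ls)
  case (Cons x ps)
  obtain k j where x: "x = (k, j)" by (cases x)
  obtain a b \<pi> where t: "transposition_table ! j = (a, b, \<pi>)" by (cases "transposition_table ! j") auto
  have v: "k < length ls" "j < 15" "valid_search (Suc (length ls)) ps" using Cons.prems(1) x by auto
  have "length transposition_table = 15" by (simp add: transposition_table_def)
  then have T: "(a, b, \<pi>) \<in> set transposition_table" using v(2) t nth_mem by metis
  have "code_graph (ls ! k) \<in> permuted_expressions G" using Cons.prems(2) v(1) by simp
  then have "(\<lambda>e. transpose a b ` e) ` code_graph (ls ! k) \<in> permuted_expressions G"
    using table_range[OF T] by (intro permuted_expressions_closed) auto
  then have n: "code_graph (edge_action \<pi> (ls ! k)) \<in> permuted_expressions G"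
    using code_graph_action[OF transposition_table[OF T]] by simp
  have "\<forall>l\<in>set (orbit_search (ls @ [edge_action \<pi> (ls ! k)]) ps). code_graph l \<in> permuted_expressions G"
    by (rule Cons.IH) (use v Cons.prems(2) n in auto)
  then show ?case by (simp add: x t)
qed simp

text \<open>Avoids running through all 720 permutations. The certificate shows that each listed code
  is in the orbit; closure under the transpositions, which generate the symmetric group, shows that
  the orbit contains nothing else.\<close>

lemma permuted_expressions_eq:
  assumes G: "G = code_graph l" and Ls: "orbit_search [l] ps = Ls" "valid_search 1 ps" "l \<in> set Ls"
    and closed: "\<forall>(a, b, \<pi>)\<in>set transposition_table. \<forall>l\<in>set Ls. edge_action \<pi> l \<in> set Ls"
  shows "permuted_expressions G = code_graph ` set Ls"
proof
  have step: "(\<lambda>e. transpose a b ` e) ` H \<in> code_graph ` set Ls"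
    if H: "H \<in> code_graph ` set Ls" and ab: "a \<in> {1..6}" "b \<in> {1..6}" for H a b
  proof (cases "a = b")
    case True
    then show ?thesis using H by simp
  next
    case False
    obtain l where l: "l \<in> set Ls" "H = code_graph l" using H by blast
    obtain \<pi> where "(a, b, \<pi>) \<in> set transposition_table \<or> (b, a, \<pi>) \<in> set transposition_table"
      using transposition_complete[OF ab False] by blast
    then have "\<exists>c d. (c, d, \<pi>) \<in> set transposition_table \<and> transpose a b = transpose c d"
    proof
      assume "(b, a, \<pi>) \<in> set transposition_table"
      then show ?thesis using transpose_commute[of a b] by blast
    qed blast
    then obtain c d where cd: "(c, d, \<pi>) \<in> set transposition_table" "transpose a b = transpose c d" by blast
    have m: "edge_action \<pi> l \<in> set Ls" using bspec[OF closed cd(1)] l(1) by simp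
    have "(\<lambda>e. transpose a b ` e) ` H = code_graph (edge_action \<pi> l)"
      unfolding l(2) cd(2) by (rule code_graph_action[OF transposition_table[OF cd(1)]])
    then show ?thesis using m by blast
  qed
  show "permuted_expressions G \<subseteq> code_graph ` set Ls"
  proof
    fix H assume "H \<in> permuted_expressions G"
    then obtain \<sigma> where s: "\<sigma> permutes {1..6}" "H = (\<lambda>e. \<sigma> ` e) ` G" by (auto simp: permuted_expressions_def)
    have "finite {1..6::nat}" by simp
    have "(\<lambda>e. \<sigma> ` e) ` G \<in> code_graph ` set Ls"
      using s(1) \<open>finite {1..6::nat}\<close>
    proof (induction rule: permutes_induct)
      case id
      then show ?case using G Ls(3) by simp
    next
      case (swap a b p)
      have e: "(\<lambda>e. (transpose a b \<circ> p) ` e) ` G = (\<lambda>e. transpose a b ` e) ` ((\<lambda>e. p ` e) ` G)"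
        by (simp add: image_comp comp_def)
      show ?case unfolding e by (rule step) (fact swap)+
    qed
    then show "H \<in> code_graph ` set Ls" using s(2) by simp
  qed
  show "code_graph ` set Ls \<subseteq> permuted_expressions G"
  proof -
    have "\<forall>m\<in>set (orbit_search [l] ps). code_graph m \<in> permuted_expressions G"
      by (rule orbit_search_sound) (use Ls(2) permuted_expressions_self[of G] G in simp_all)
    then show ?thesis unfolding Ls(1) by blast
  qed
qed

lemma expression_value_code:
  "expression_value \<alpha> (code_graph l) = (\<Prod>i<15. if l ! i then (\<alpha> (Min (edge i)) - \<alpha> (Max (edge i)))\<^sup>2 else 1)"
proof -
  have "inj_on edge {i. i < 15 \<and> l ! i}" using edge_inj by (rule inj_on_subset) auto
  then have "expression_value \<alpha> (code_graph l) = (\<Prod>i\<in>{i. i < 15 \<and> l ! i}. (\<alpha> (Min (edge i)) - \<alpha> (Max (edge i)))\<^sup>2)"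
    unfolding expression_value_def code_graph_def by (simp add: prod.reindex)
  also have "{i. i < 15 \<and> l ! i} = {i \<in> {..<15}. l ! i}" by auto
  also have "(\<Prod>i\<in>{i \<in> {..<15}. l ! i}. (\<alpha> (Min (edge i)) - \<alpha> (Max (edge i)))\<^sup>2) =
      (\<Prod>i<15. if l ! i then (\<alpha> (Min (edge i)) - \<alpha> (Max (edge i)))\<^sup>2 else 1)"
    by (rule prod.inter_filter) simp
  finally show ?thesis .
qed

definition edge_product :: "(nat \<Rightarrow> 'a::comm_ring_1) \<Rightarrow> bool list \<Rightarrow> 'a" where
  "edge_product d l = prod_list (map (\<lambda>(x, i). if x then d i else 1) (zip l [0..<15]))"

lemma expression_value_edge_product:
  assumes "length l = 15"
  shows "expression_value \<alpha> (code_graph l) = edge_product (\<lambda>i. (\<alpha> (Min (edge i)) - \<alpha> (Max (edge i)))\<^sup>2) l"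
proof -
  let ?f = "\<lambda>(x, i). if x then (\<alpha> (Min (edge i)) - \<alpha> (Max (edge i)))\<^sup>2 else 1"
  have "edge_product (\<lambda>i. (\<alpha> (Min (edge i)) - \<alpha> (Max (edge i)))\<^sup>2) l = (\<Prod>i<15. ?f (zip l [0..<15] ! i))"
    unfolding edge_product_def using assms by (subst prod.list_conv_set_nth) (simp add: atLeast0LessThan)
  also have "\<dots> = (\<Prod>i<15. if l ! i then (\<alpha> (Min (edge i)) - \<alpha> (Max (edge i)))\<^sup>2 else 1)"
    using assms by (intro prod.cong) auto
  finally show ?thesis by (simp add: expression_value_code)
qed

text \<open>Distinct codes of length 15 stand for distinct graphs, so the sum over the set of
  distinct expressions becomes a sum over an explicit list, which can be unfolded by
  simplification.\<close>

lemma orbit_sum_code: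
  assumes "permuted_expressions G = code_graph ` set Ls" "distinct Ls" "\<forall>l\<in>set Ls. length l = 15"
  shows "orbit_sum \<alpha> G = sum_list (map (edge_product (\<lambda>i. (\<alpha> (Min (edge i)) - \<alpha> (Max (edge i)))\<^sup>2)) Ls)"
proof -
  have "inj_on code_graph (set Ls)" using assms(3) code_graph_inj by (auto simp: inj_on_def)
  then have "orbit_sum \<alpha> G = (\<Sum>l\<in>set Ls. expression_value \<alpha> (code_graph l))"
    unfolding orbit_sum_def assms(1) by (simp add: sum.reindex)
  also have "\<dots> = (\<Sum>l\<in>set Ls. edge_product (\<lambda>i. (\<alpha> (Min (edge i)) - \<alpha> (Max (edge i)))\<^sup>2) l)"
    by (rule sum.cong) (use assms(3) expression_value_edge_product in auto)
  also have "\<dots> = sum_list (map (edge_product (\<lambda>i. (\<alpha> (Min (edge i)) - \<alpha> (Max (edge i)))\<^sup>2)) Ls)"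
    by (rule sum.distinct_set_conv_list[OF assms(2)])
  finally show ?thesis .
qed

lemma upt_15: "[0..<15::nat] = [0,1,2,3,4,5,6,7,8,9,10,11,12,13,14]"
  by code_simp

lemma code_graph_filter: "code_graph l = edge ` set (filter (\<lambda>i. l ! i) [0..<15])"
  by (auto simp: code_graph_def)

lemma edge_product_list:
  "edge_product d [x0,x1,x2,x3,x4,x5,x6,x7,x8,x9,x10,x11,x12,x13,x14] = (if x0 then d 0 else 1) * (if x1 then d 1 else 1) * (if x2 then d 2 else 1) * (if x3 then d 3 else 1) * (if x4 then d 4 else 1) * (if x5 then d 5 else 1) * (if x6 then d 6 else 1) * (if x7 then d 7 else 1) * (if x8 then d 8 else 1) * (if x9 then d 9 else 1) * (if x10 then d 10 else 1) * (if x11 then d 11 else 1) * (if x12 then d 12 else 1) * (if x13 then d 13 else 1) * (if x14 then d 14 else 1)"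
  unfolding edge_product_def upt_15 by (simp add: mult.assoc del: One_nat_def split del: if_split)

text \<open>The 15 perfect matchings of the complete graph on six vertices.\<close>

definition matching_codes :: "bool list list" where
  "matching_codes = [
    [True,False,False,False,False,False,False,False,False,True,False,False,False,False,True],
    [False,False,True,False,False,True,False,False,False,False,False,False,False,False,True],
    [False,True,False,False,False,False,True,False,False,False,False,False,False,False,True],
    [False,False,False,False,True,False,False,True,False,True,False,False,False,False,False],
    [False,False,False,True,False,False,False,False,True,True,False,False,False,False,False],
    [True,False,False,False,False,False,False,False,False,False,False,True,True,False,False],
    [True,False,False,False,False,False,False,False,False,False,True,False,False,True,False],
    [False,False,False,False,True,True,False,False,False,False,False,False,True,False,False],
    [False,False,False,True,False,True,False,False,False,False,False,False,False,True,False],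
    [False,False,True,False,False,False,False,False,True,False,True,False,False,False,False],
    [False,False,True,False,False,False,False,True,False,False,False,True,False,False,False],
    [False,False,False,False,True,False,True,False,False,False,True,False,False,False,False],
    [False,False,False,True,False,False,True,False,False,False,False,True,False,False,False],
    [False,True,False,False,False,False,False,False,True,False,False,False,True,False,False],
    [False,True,False,False,False,False,False,True,False,False,False,False,False,True,False]]"

lemma matching_graph: "{{1,2}, {3,4}, {5,6}} = code_graph [True,False,False,False,False,False,False,False,False,True,False,False,False,False,True]"
  unfolding code_graph_filter upt_15 by (simp add: edges insert_commute)

lemma matching_orbit: "permuted_expressions {{1,2}, {3,4}, {5,6}} = code_graph ` set matching_codes"
proof (rule permuted_expressions_eq[OF matching_graph])
  show "orbit_search [[True,False,False,False,False,False,False,False,False,True,False,False,False,False,True]] [(0,1),(0,2),(0,3),(0,4),(0,10),(0,11),(1,3),(1,4),(1,7),(1,8),(2,3),(2,4),(2,7),(2,8)] = matching_codes"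
    by code_simp
  show "valid_search 1 [(0,1),(0,2),(0,3),(0,4),(0,10),(0,11),(1,3),(1,4),(1,7),(1,8),(2,3),(2,4),(2,7),(2,8)]" by simp
  show "[True,False,False,False,False,False,False,False,False,True,False,False,False,False,True] \<in> set matching_codes" by (simp add: matching_codes_def)
  show "\<forall>(a, b, \<pi>)\<in>set transposition_table. \<forall>l\<in>set matching_codes. edge_action \<pi> l \<in> set matching_codes"
    by code_simp
qed

text \<open>The hypotheses describe roots in opposite pairs \<open>1, 2\<close>, then
  \<open>3, 4\<close>, then \<open>5, 6\<close>. The 15 squared differences then take only nine
  values: \<open>A\<close>, \<open>B\<close>, \<open>C\<close> within the pairs and two values for
  each two pairs. Working with these nine variables keeps the expansion small.\<close>

lemma matching_sum:
  fixes \<alpha> :: "nat \<Rightarrow> 'a::comm_ring_1"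
  assumes "(\<alpha> 1 - \<alpha> 2)\<^sup>2 = A" "(\<alpha> 1 - \<alpha> 3)\<^sup>2 = p" "(\<alpha> 1 - \<alpha> 4)\<^sup>2 = q" "(\<alpha> 1 - \<alpha> 5)\<^sup>2 = r" "(\<alpha> 1 - \<alpha> 6)\<^sup>2 = s" "(\<alpha> 2 - \<alpha> 3)\<^sup>2 = q" "(\<alpha> 2 - \<alpha> 4)\<^sup>2 = p" "(\<alpha> 2 - \<alpha> 5)\<^sup>2 = s" "(\<alpha> 2 - \<alpha> 6)\<^sup>2 = r" "(\<alpha> 3 - \<alpha> 4)\<^sup>2 = B" "(\<alpha> 3 - \<alpha> 5)\<^sup>2 = t" "(\<alpha> 3 - \<alpha> 6)\<^sup>2 = u" "(\<alpha> 4 - \<alpha> 5)\<^sup>2 = u" "(\<alpha> 4 - \<alpha> 6)\<^sup>2 = t" "(\<alpha> 5 - \<alpha> 6)\<^sup>2 = C"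
  shows "orbit_sum \<alpha> {{1,2}, {3,4}, {5,6}} = 2 * (q * s * u + q * r * t + p * s * t + p * r * u) + A * (t^2 + u^2) + B * (r^2 + s^2) + C * (p^2 + q^2) + A * B * C"
proof -
  define d where "d i = (\<alpha> (Min (edge i)) - \<alpha> (Max (edge i)))\<^sup>2" for i
  have d: "d 0 = A" "d 1 = p" "d 2 = q" "d 3 = r" "d 4 = s" "d 5 = q" "d 6 = p" "d 7 = s" "d 8 = r" "d 9 = B" "d 10 = t" "d 11 = u" "d 12 = u" "d 13 = t" "d 14 = C"
    using assms by (simp_all add: d_def edges del: One_nat_def)
  have "orbit_sum \<alpha> {{1,2}, {3,4}, {5,6}} = sum_list (map (edge_product d) matching_codes)"
    unfolding d_def by (rule orbit_sum_code[OF matching_orbit]) (simp_all add: matching_codes_def)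
  also have "\<dots> = 2 * (q * s * u + q * r * t + p * s * t + p * r * u) + A * (t^2 + u^2) + B * (r^2 + s^2) + C * (p^2 + q^2) + A * B * C"
    unfolding matching_codes_def by (simp add: edge_product_list d d[unfolded One_nat_def] del: One_nat_def, simp add: power2_eq_square algebra_simps)
  finally show ?thesis .
qed

text \<open>The 10 ways of splitting six vertices into two triangles.\<close>

definition triangles_codes :: "bool list list" where
  "triangles_codes = [
    [True,True,False,False,False,True,False,False,False,False,False,False,True,True,True],
    [False,False,False,True,True,True,True,False,False,True,False,False,False,False,True],
    [False,False,True,False,True,True,False,True,False,False,True,False,False,True,False],
    [False,False,True,True,False,True,False,False,True,False,False,True,True,False,False],
    [False,True,True,False,False,False,False,True,True,True,False,False,False,False,True],
    [False,True,False,True,False,False,True,False,True,False,True,False,False,True,False],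
    [False,True,False,False,True,False,True,True,False,False,False,True,True,False,False],
    [True,False,True,False,False,False,True,False,False,False,True,True,False,False,True],
    [True,False,False,True,False,False,False,True,False,True,False,True,False,True,False],
    [True,False,False,False,True,False,False,False,True,True,True,False,True,False,False]]"

lemma triangles_graph: "{{1,2}, {2,3}, {3,1}, {4,5}, {5,6}, {6,4}} = code_graph [True,True,False,False,False,True,False,False,False,False,False,False,True,True,True]"
  unfolding code_graph_filter upt_15 by (simp add: edges insert_commute)

lemma triangles_orbit: "permuted_expressions {{1,2}, {2,3}, {3,1}, {4,5}, {5,6}, {6,4}} = code_graph ` set triangles_codes"
proof (rule permuted_expressions_eq[OF triangles_graph])
  show "orbit_search [[True,True,False,False,False,True,False,False,False,False,False,False,True,True,True]] [(0,2),(0,3),(0,4),(0,6),(0,7),(0,8),(0,9),(0,10),(0,11)] = triangles_codes"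
    by code_simp
  show "valid_search 1 [(0,2),(0,3),(0,4),(0,6),(0,7),(0,8),(0,9),(0,10),(0,11)]" by simp
  show "[True,True,False,False,False,True,False,False,False,False,False,False,True,True,True] \<in> set triangles_codes" by (simp add: triangles_codes_def)
  show "\<forall>(a, b, \<pi>)\<in>set transposition_table. \<forall>l\<in>set triangles_codes. edge_action \<pi> l \<in> set triangles_codes"
    by code_simp
qed

lemma triangles_sum:
  fixes \<alpha> :: "nat \<Rightarrow> 'a::comm_ring_1"
  assumes "(\<alpha> 1 - \<alpha> 2)\<^sup>2 = A" "(\<alpha> 1 - \<alpha> 3)\<^sup>2 = p" "(\<alpha> 1 - \<alpha> 4)\<^sup>2 = q" "(\<alpha> 1 - \<alpha> 5)\<^sup>2 = r" "(\<alpha> 1 - \<alpha> 6)\<^sup>2 = s" "(\<alpha> 2 - \<alpha> 3)\<^sup>2 = q" "(\<alpha> 2 - \<alpha> 4)\<^sup>2 = p" "(\<alpha> 2 - \<alpha> 5)\<^sup>2 = s" "(\<alpha> 2 - \<alpha> 6)\<^sup>2 = r" "(\<alpha> 3 - \<alpha> 4)\<^sup>2 = B" "(\<alpha> 3 - \<alpha> 5)\<^sup>2 = t" "(\<alpha> 3 - \<alpha> 6)\<^sup>2 = u" "(\<alpha> 4 - \<alpha> 5)\<^sup>2 = u" "(\<alpha> 4 - \<alpha> 6)\<^sup>2 = t" "(\<alpha> 5 - \<alpha> 6)\<^sup>2 = C"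
  shows "orbit_sum \<alpha> {{1,2}, {2,3}, {3,1}, {4,5}, {5,6}, {6,4}} = (q * s * t)^2 + (q * r * u)^2 + (p * r * t)^2 + (p * s * u)^2 + 2 * (A * B * (t*u) * (r*s) + A * C * (t*u) * (p*q) + B * C * (r*s) * (p*q))"
proof -
  define d where "d i = (\<alpha> (Min (edge i)) - \<alpha> (Max (edge i)))\<^sup>2" for i
  have d: "d 0 = A" "d 1 = p" "d 2 = q" "d 3 = r" "d 4 = s" "d 5 = q" "d 6 = p" "d 7 = s" "d 8 = r" "d 9 = B" "d 10 = t" "d 11 = u" "d 12 = u" "d 13 = t" "d 14 = C"
    using assms by (simp_all add: d_def edges del: One_nat_def)
  have "orbit_sum \<alpha> {{1,2}, {2,3}, {3,1}, {4,5}, {5,6}, {6,4}} = sum_list (map (edge_product d) triangles_codes)"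
    unfolding d_def by (rule orbit_sum_code[OF triangles_orbit]) (simp_all add: triangles_codes_def)
  also have "\<dots> = (q * s * t)^2 + (q * r * u)^2 + (p * r * t)^2 + (p * s * u)^2 + 2 * (A * B * (t*u) * (r*s) + A * C * (t*u) * (p*q) + B * C * (r*s) * (p*q))"
    unfolding triangles_codes_def by (simp add: edge_product_list d d[unfolded One_nat_def] del: One_nat_def, simp add: power2_eq_square algebra_simps)
  finally show ?thesis .
qed

text \<open>The 60 triangular prisms: one of 10 splittings into two triangles, together with one of
  the 6 matchings between them.\<close>

definition prism_codes :: "bool list list" where
  "prism_codes = [
    [True,True,True,False,False,True,False,True,False,False,False,True,True,True,True],
    [True,True,False,True,False,True,True,False,False,False,False,True,True,True,True],
    [True,True,False,False,True,True,False,True,False,True,False,False,True,True,True],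
    [False,False,True,True,True,True,True,True,False,True,False,True,False,False,True],
    [True,False,True,False,True,True,False,True,False,False,True,True,True,True,False],
    [False,True,True,True,False,True,False,True,True,False,False,True,True,True,False],
    [True,True,True,False,False,True,False,False,True,False,True,False,True,True,True],
    [True,True,True,False,False,False,False,True,True,True,False,True,True,False,True],
    [False,True,True,True,False,False,True,True,True,False,True,True,False,True,False],
    [False,True,True,False,True,True,True,True,False,False,False,True,True,False,True],
    [True,True,True,False,False,False,True,True,False,False,True,True,False,True,True],
    [True,False,True,True,False,True,False,True,False,True,False,True,False,True,True],
    [True,False,True,False,True,False,False,True,True,True,True,True,True,False,False],
    [True,True,False,False,True,True,True,False,False,False,True,False,True,True,True],
    [True,False,False,True,True,True,True,False,False,True,False,True,True,False,True],
    [False,False,True,True,True,True,True,True,False,False,True,True,False,True,False],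
    [False,True,True,True,False,True,True,False,True,False,False,True,True,False,True],
    [True,True,False,True,False,True,False,False,True,True,False,False,True,True,True],
    [False,True,True,True,False,False,True,True,True,True,False,True,False,False,True],
    [True,True,False,True,False,False,True,False,True,False,True,True,True,True,False],
    [False,True,False,True,True,True,True,True,False,False,False,True,True,True,False],
    [True,False,True,True,False,True,True,False,False,False,True,True,False,True,True],
    [True,True,False,True,False,False,True,True,False,True,False,True,False,True,True],
    [True,False,False,True,True,False,True,False,True,True,True,True,True,False,False],
    [False,True,False,True,True,True,True,True,False,True,False,False,False,True,True],
    [True,False,True,False,True,True,False,True,False,True,True,False,False,True,True],
    [False,False,True,True,True,True,False,True,True,True,False,True,True,False,False],
    [False,True,True,False,True,True,False,True,True,True,False,False,True,False,True],
    [False,True,False,True,True,False,True,True,True,True,True,False,False,True,False],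
    [True,True,False,False,True,False,True,True,False,True,False,True,True,False,True],
    [True,False,True,False,True,False,True,True,False,True,True,True,False,False,True],
    [True,False,False,True,True,True,False,True,False,True,False,True,True,True,False],
    [True,True,False,False,True,False,False,True,True,True,True,False,True,True,False],
    [False,False,True,True,True,True,True,False,True,True,True,False,False,False,True],
    [False,True,True,False,True,True,False,True,True,False,True,False,True,True,False],
    [True,False,True,False,True,True,True,False,False,False,True,True,True,False,True],
    [True,True,False,False,True,False,True,True,False,False,True,True,True,True,False],
    [True,False,True,True,False,True,False,False,True,False,True,True,True,True,False],
    [True,True,False,True,False,False,False,True,True,True,False,True,True,True,False],
    [False,True,True,True,False,True,False,True,True,True,False,False,False,True,True],
    [True,True,True,False,False,False,False,True,True,True,True,False,False,True,True],
    [False,True,True,True,False,True,True,False,True,False,True,False,False,True,True],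
    [False,True,True,False,True,False,True,True,True,False,True,True,True,False,False],
    [True,True,True,False,False,False,True,False,True,False,True,True,True,False,True],
    [True,False,True,True,False,False,False,True,True,True,True,True,False,True,False],
    [True,False,True,False,True,True,False,False,True,True,True,False,True,False,True],
    [True,False,True,True,False,True,False,False,True,True,False,True,True,False,True],
    [False,True,True,False,True,True,True,True,False,False,True,False,False,True,True],
    [True,False,False,True,True,True,True,False,False,True,True,False,False,True,True],
    [False,False,True,True,True,True,True,False,True,False,True,True,True,False,False],
    [False,True,True,False,True,False,True,True,True,True,True,False,False,False,True],
    [False,True,False,True,True,True,True,False,True,False,True,False,True,True,False],
    [True,False,False,True,True,False,True,True,False,True,True,True,False,True,False],
    [True,True,False,False,True,False,True,False,True,True,True,False,True,False,True],
    [False,True,False,True,True,True,True,False,True,True,False,False,True,False,True],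
    [False,False,True,True,True,True,False,True,True,True,True,False,False,True,False],
    [True,True,False,True,False,False,True,False,True,True,True,False,False,True,True],
    [False,True,False,True,True,False,True,True,True,True,False,True,True,False,False],
    [True,False,True,True,False,False,True,False,True,True,True,True,False,False,True],
    [True,False,False,True,True,True,False,False,True,True,True,False,True,True,False]]"

lemma prism_graph: "{{1,2}, {2,3}, {3,1}, {4,5}, {5,6}, {6,4}, {1,4}, {2,5}, {3,6}} = code_graph [True,True,True,False,False,True,False,True,False,False,False,True,True,True,True]"
  unfolding code_graph_filter upt_15 by (simp add: edges insert_commute)

lemma prism_orbit: "permuted_expressions {{1,2}, {2,3}, {3,1}, {4,5}, {5,6}, {6,4}, {1,4}, {2,5}, {3,6}} = code_graph ` set prism_codes"
proof (rule permuted_expressions_eq[OF prism_graph])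
  show "orbit_search [[True,True,True,False,False,True,False,True,False,False,False,True,True,True,True]] [(0,0),(0,1),(0,2),(0,3),(0,4),(0,5),(0,6),(0,7),(0,8),(0,9),(0,10),(0,11),(1,1),(1,2),(1,3),(1,4),(1,5),(1,6),(1,7),(1,8),(1,9),(1,10),(1,11),(2,2),(2,3),(2,4),(2,6),(2,7),(2,8),(2,9),(2,10),(2,11),(3,5),(4,4),(4,8),(4,9),(4,14),(5,6),(5,10),(6,6),(6,7),(6,8),(6,9),(6,10),(6,11),(7,10),(9,9),(13,2),(13,4),(13,6),(13,7),(13,10),(13,11),(14,4),(15,5),(17,7),(17,8),(17,9),(17,11)] = prism_codes"
    by code_simp
  show "valid_search 1 [(0,0),(0,1),(0,2),(0,3),(0,4),(0,5),(0,6),(0,7),(0,8),(0,9),(0,10),(0,11),(1,1),(1,2),(1,3),(1,4),(1,5),(1,6),(1,7),(1,8),(1,9),(1,10),(1,11),(2,2),(2,3),(2,4),(2,6),(2,7),(2,8),(2,9),(2,10),(2,11),(3,5),(4,4),(4,8),(4,9),(4,14),(5,6),(5,10),(6,6),(6,7),(6,8),(6,9),(6,10),(6,11),(7,10),(9,9),(13,2),(13,4),(13,6),(13,7),(13,10),(13,11),(14,4),(15,5),(17,7),(17,8),(17,9),(17,11)]" by simp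
  show "[True,True,True,False,False,True,False,True,False,False,False,True,True,True,True] \<in> set prism_codes" by (simp add: prism_codes_def)
  show "\<forall>(a, b, \<pi>)\<in>set transposition_table. \<forall>l\<in>set prism_codes. edge_action \<pi> l \<in> set prism_codes"
    by code_simp
qed

text \<open>The 60 products are grouped into the combinations of \<open>p, q, r, s, t, u\<close>
  that are polynomials in the squares of the roots, namely the products and square sums of each pair
  and the symmetric sums of triples.\<close>

lemma prism_sum:
  fixes \<alpha> :: "nat \<Rightarrow> 'a::comm_ring_1"
  assumes "(\<alpha> 1 - \<alpha> 2)\<^sup>2 = A" "(\<alpha> 1 - \<alpha> 3)\<^sup>2 = p" "(\<alpha> 1 - \<alpha> 4)\<^sup>2 = q" "(\<alpha> 1 - \<alpha> 5)\<^sup>2 = r" "(\<alpha> 1 - \<alpha> 6)\<^sup>2 = s" "(\<alpha> 2 - \<alpha> 3)\<^sup>2 = q" "(\<alpha> 2 - \<alpha> 4)\<^sup>2 = p" "(\<alpha> 2 - \<alpha> 5)\<^sup>2 = s" "(\<alpha> 2 - \<alpha> 6)\<^sup>2 = r" "(\<alpha> 3 - \<alpha> 4)\<^sup>2 = B" "(\<alpha> 3 - \<alpha> 5)\<^sup>2 = t" "(\<alpha> 3 - \<alpha> 6)\<^sup>2 = u" "(\<alpha> 4 - \<alpha> 5)\<^sup>2 = u" "(\<alpha> 4 - \<alpha> 6)\<^sup>2 = t" "(\<alpha> 5 - \<alpha> 6)\<^sup>2 = C"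
  shows "orbit_sum \<alpha> {{1,2}, {2,3}, {3,1}, {4,5}, {5,6}, {6,4}, {1,4}, {2,5}, {3,6}} = A * B * C * ((q * s * t)^2 + (q * r * u)^2 + (p * r * t)^2 + (p * s * u)^2)
     + 2 * (A * B * C) * ((t*u) * (r*s) * (p^2 + q^2) + (t*u) * (p*q) * (r^2 + s^2) + (r*s) * (p*q) * (t^2 + u^2))
     + 2 * (q * s * u + q * r * t + p * s * t + p * r * u) * (A * B * (t*u) * (r*s) + A * C * (t*u) * (p*q) + B * C * (r*s) * (p*q))
     + A * (t*u)^2 * (p^2 + q^2) * (r^2 + s^2) + B * (r*s)^2 * (p^2 + q^2) * (t^2 + u^2) + C * (p*q)^2 * (r^2 + s^2) * (t^2 + u^2)
     + 2 * ((t*u) * (r*s) * (p*q)) * (q * r * u + p * r * t + q * s * t + p * s * u)"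
proof -
  define d where "d i = (\<alpha> (Min (edge i)) - \<alpha> (Max (edge i)))\<^sup>2" for i
  have d: "d 0 = A" "d 1 = p" "d 2 = q" "d 3 = r" "d 4 = s" "d 5 = q" "d 6 = p" "d 7 = s" "d 8 = r" "d 9 = B" "d 10 = t" "d 11 = u" "d 12 = u" "d 13 = t" "d 14 = C"
    using assms by (simp_all add: d_def edges del: One_nat_def)
  have "orbit_sum \<alpha> {{1,2}, {2,3}, {3,1}, {4,5}, {5,6}, {6,4}, {1,4}, {2,5}, {3,6}} = sum_list (map (edge_product d) prism_codes)"
    unfolding d_def by (rule orbit_sum_code[OF prism_orbit]) (simp_all add: prism_codes_def)
  also have "\<dots> = A * B * C * ((q * s * t)^2 + (q * r * u)^2 + (p * r * t)^2 + (p * s * u)^2)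
     + 2 * (A * B * C) * ((t*u) * (r*s) * (p^2 + q^2) + (t*u) * (p*q) * (r^2 + s^2) + (r*s) * (p*q) * (t^2 + u^2))
     + 2 * (q * s * u + q * r * t + p * s * t + p * r * u) * (A * B * (t*u) * (r*s) + A * C * (t*u) * (p*q) + B * C * (r*s) * (p*q))
     + A * (t*u)^2 * (p^2 + q^2) * (r^2 + s^2) + B * (r*s)^2 * (p^2 + q^2) * (t^2 + u^2) + C * (p*q)^2 * (r^2 + s^2) * (t^2 + u^2)
     + 2 * ((t*u) * (r*s) * (p*q)) * (q * r * u + p * r * t + q * s * t + p * s * u)"
    unfolding prism_codes_def by (simp add: edge_product_list d d[unfolded One_nat_def] del: One_nat_def, simp add: power2_eq_square algebra_simps)
  finally show ?thesis .
qed

section \<open>The open dense locus over which the family lives\<close>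

lemma zariski_open_locus:
  "zariski_open {(r, m). r \<noteq> 0 \<and> 27 * r + m ^ 2 \<noteq> 0 \<and> 8 * m * r + 36 * r - 2 * m - 1 \<noteq> (0::'k::field_char_0)}"
proof -
  \<comment> \<open>The outer variable is \<open>m\<close>; the coefficients are polynomials in
    \<open>r\<close>.\<close>
  define P :: "'k poly poly" where
    "P = [:[:0, 1:]:] * [:[:0, 27:], 0, 1:] * [:[:-1, 36:], [:-2, 8:]:]"
  have "poly (poly P [:m:]) r = r * (27 * r + m ^ 2) * (8 * m * r + 36 * r - 2 * m - 1)" for r m
    by (simp add: P_def algebra_simps power2_eq_square)
  then show ?thesis unfolding zariski_open_def by (intro exI[of _ "{P}"]) auto
qed

text \<open>A product of two nonzero polynomials in two variables does not vanish identically on the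
  plane over an infinite field: a suitable \<open>m\<close> is chosen first, which leaves a nonzero
  polynomial in \<open>r\<close>.\<close>

lemma zariski_dense_nonvanishing:
  fixes P :: "'k::field_char_0 poly poly"
  assumes "P \<noteq> 0"
  shows "zariski_dense {(r, m). poly (poly P [:m:]) r \<noteq> 0}"
  unfolding zariski_dense_def
proof (intro allI impI)
  fix V :: "('k \<times> 'k) set" assume "zariski_open V \<and> V \<noteq> {}"
  then obtain S r0 m0 where V: "V = {(r, m). \<exists>Q\<in>S. poly (poly Q [:m:]) r \<noteq> 0}" and "(r0, m0) \<in> V"
    unfolding zariski_open_def by auto
  then obtain Q where Q: "Q \<in> S" "poly (poly Q [:m0:]) r0 \<noteq> 0" by auto
  then have "Q * P \<noteq> 0" using assms by auto
  have inj: "inj (\<lambda>m::'k. [:m:])" by (auto simp: inj_def)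
  have "finite ((\<lambda>m. [:m:]) -` {x. poly (Q * P) x = 0})"
    by (rule finite_vimageI[OF poly_roots_finite[OF \<open>Q * P \<noteq> 0\<close>] inj])
  then have "(\<lambda>m::'k. [:m:]) -` {x. poly (Q * P) x = 0} \<noteq> UNIV" using infinite_UNIV_char_0 by metis
  then obtain m where m: "poly (Q * P) [:m:] \<noteq> 0" by auto
  have "{r. poly (poly (Q * P) [:m:]) r = 0} \<noteq> UNIV" using poly_roots_finite[OF m] infinite_UNIV_char_0 by metis
  then obtain r where "poly (poly (Q * P) [:m:]) r \<noteq> 0" by auto
  then have "(r, m) \<in> {(r, m). poly (poly P [:m:]) r \<noteq> 0} \<inter> V" using Q(1) unfolding V by auto
  then show "{(r, m). poly (poly P [:m:]) r \<noteq> 0} \<inter> V \<noteq> {}" by blast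
qed

lemma zariski_dense_locus:
  "zariski_dense {(r, m). r \<noteq> 0 \<and> 27 * r + m ^ 2 \<noteq> 0 \<and> 8 * m * r + 36 * r - 2 * m - 1 \<noteq> (0::'k::field_char_0)}"
proof -
  define P :: "'k poly poly" where
    "P = [:[:0, 1:]:] * [:[:0, 27:], 0, 1:] * [:[:-1, 36:], [:-2, 8:]:]"
  have "poly (poly P [:m:]) r = r * (27 * r + m ^ 2) * (8 * m * r + 36 * r - 2 * m - 1)" for r m
    by (simp add: P_def algebra_simps power2_eq_square)
  then have "{(r, m). r \<noteq> 0 \<and> 27 * r + m ^ 2 \<noteq> 0 \<and> 8 * m * r + 36 * r - 2 * m - 1 \<noteq> 0} = {(r, m). poly (poly P [:m:]) r \<noteq> 0}"
    by auto
  moreover have "P \<noteq> 0" by (simp add: P_def)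
  ultimately show ?thesis using zariski_dense_nonvanishing[of P] by simp
qed

section \<open>Igusa--Clebsch invariants of even sextics\<close>

text \<open>Opposite roots carry consecutive numbers \<open>1, 2\<close>, then \<open>3, 4\<close>,
  then \<open>5, 6\<close>, which is the pattern assumed in \<open>matching_sum\<close>,
  \<open>triangles_sum\<close> and \<open>prism_sum\<close>.\<close>

definition signed_roots :: "'a::comm_ring_1 \<Rightarrow> 'a \<Rightarrow> 'a \<Rightarrow> nat \<Rightarrow> 'a" where
  "signed_roots \<beta> \<gamma> \<delta> i = [0, \<beta>, - \<beta>, \<gamma>, - \<gamma>, \<delta>, - \<delta>] ! i"

lemma signed_roots_simps:
  "signed_roots \<beta> \<gamma> \<delta> 1 = \<beta>" "signed_roots \<beta> \<gamma> \<delta> (Suc 0) = \<beta>" "signed_roots \<beta> \<gamma> \<delta> 2 = - \<beta>" "signed_roots \<beta> \<gamma> \<delta> 3 = \<gamma>"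
  "signed_roots \<beta> \<gamma> \<delta> 4 = - \<gamma>" "signed_roots \<beta> \<gamma> \<delta> 5 = \<delta>" "signed_roots \<beta> \<gamma> \<delta> 6 = - \<delta>"
  by (simp_all add: signed_roots_def)

lemma atLeastAtMost_1_6: "{1..6::nat} = {1,2,3,4,5,6}" by auto

lemma prod_signed_roots:
  "(\<Prod>i\<in>{1..6}. [:- signed_roots \<beta> \<gamma> \<delta> i, 1:]) = [:- \<beta>\<^sup>2, 0, 1:] * [:- \<gamma>\<^sup>2, 0, 1:] * [:- \<delta>\<^sup>2, 0, 1:]"
proof -
  have "[:- c, 1:] * [:c, 1:] = [:- c\<^sup>2, 0, 1:]" for c :: 'a by (simp add: power2_eq_square)
  then have "[:- c, 1:] * ([:c, 1:] * q) = [:- c\<^sup>2, 0, 1:] * q" for c :: 'a and q by (metis mult.assoc)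
  note e = this
  have "(\<Prod>i\<in>{1..6}. [:- signed_roots \<beta> \<gamma> \<delta> i, 1:]) =
      [:- \<beta>, 1:] * ([:\<beta>, 1:] * ([:- \<gamma>, 1:] * ([:\<gamma>, 1:] * ([:- \<delta>, 1:] * ([:\<delta>, 1:] * 1)))))"
    unfolding atLeastAtMost_1_6 by (simp add: signed_roots_simps del: mult_pCons_left mult_pCons_right)
  also have "\<dots> = [:- \<beta>\<^sup>2, 0, 1:] * ([:- \<gamma>\<^sup>2, 0, 1:] * ([:- \<delta>\<^sup>2, 0, 1:] * 1))" unfolding e ..
  finally show ?thesis by (simp only: mult_1_right mult.assoc)
qed

text \<open>The discriminant of \<open>g(x^2)\<close> in terms of that of \<open>g\<close>: the
  opposite pairs contribute \<open>4^3 = 64\<close> times the product of the squares, and the four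
  mixed differences of two pairs combine to the fourth power of a difference of squares.\<close>

lemma prod_differences_signed_roots:
  fixes \<beta> :: "'a::comm_ring_1"
  shows "(\<Prod>i\<in>{1..6}. \<Prod>j\<in>{i<..6}. (signed_roots \<beta> \<gamma> \<delta> i - signed_roots \<beta> \<gamma> \<delta> j)\<^sup>2) =
    64 * (\<beta>\<^sup>2 * \<gamma>\<^sup>2 * \<delta>\<^sup>2) * (((\<beta>\<^sup>2 - \<gamma>\<^sup>2) * (\<beta>\<^sup>2 - \<delta>\<^sup>2) * (\<gamma>\<^sup>2 - \<delta>\<^sup>2))\<^sup>2)\<^sup>2"
proof -
  have "{1<..6::nat} = {2,3,4,5,6}" "{2<..6::nat} = {3,4,5,6}" "{3<..6::nat} = {4,5,6}" "{4<..6::nat} = {5,6}"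
    "{5<..6::nat} = {6}" "{6<..6::nat} = {}" by auto
  note sets = this this(1)[unfolded One_nat_def]
  have q: "(u - v)\<^sup>2 * ((u - - v)\<^sup>2 * x) = (u\<^sup>2 - v\<^sup>2)\<^sup>2 * x" "(- u - v)\<^sup>2 * ((- u - - v)\<^sup>2 * x) = (u\<^sup>2 - v\<^sup>2)\<^sup>2 * x"
    "(u - - u)\<^sup>2 = 4 * u\<^sup>2" for u v x :: 'a
    by (simp_all add: power2_eq_square algebra_simps)
  have "(\<Prod>i\<in>{1..6}. \<Prod>j\<in>{i<..6}. (signed_roots \<beta> \<gamma> \<delta> i - signed_roots \<beta> \<gamma> \<delta> j)\<^sup>2) =
    (\<beta> - - \<beta>)\<^sup>2 * ((\<beta> - \<gamma>)\<^sup>2 * ((\<beta> - - \<gamma>)\<^sup>2 * ((\<beta> - \<delta>)\<^sup>2 * ((\<beta> - - \<delta>)\<^sup>2 * 1)))) *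
    (((- \<beta> - \<gamma>)\<^sup>2 * ((- \<beta> - - \<gamma>)\<^sup>2 * ((- \<beta> - \<delta>)\<^sup>2 * ((- \<beta> - - \<delta>)\<^sup>2 * 1)))) *
    (((\<gamma> - - \<gamma>)\<^sup>2 * ((\<gamma> - \<delta>)\<^sup>2 * ((\<gamma> - - \<delta>)\<^sup>2 * 1))) * (((- \<gamma> - \<delta>)\<^sup>2 * ((- \<gamma> - - \<delta>)\<^sup>2 * 1)) *
    ((\<delta> - - \<delta>)\<^sup>2))))"
    unfolding atLeastAtMost_1_6
    by (simp add: sets signed_roots_simps mult.assoc del: diff_minus_eq_add minus_diff_minus)
  also have "\<dots> = 64 * (\<beta>\<^sup>2 * \<gamma>\<^sup>2 * \<delta>\<^sup>2) * (((\<beta>\<^sup>2 - \<gamma>\<^sup>2) * (\<beta>\<^sup>2 - \<delta>\<^sup>2) * (\<gamma>\<^sup>2 - \<delta>\<^sup>2))\<^sup>2)\<^sup>2"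
    unfolding q by (simp add: power_mult_distrib power2_eq_square[of "(_ - _)\<^sup>2"] mult_ac)
  finally show ?thesis .
qed

lemma signed_roots_squares:
  fixes \<beta> \<gamma> \<delta> :: "'a::comm_ring_1"
  defines "\<alpha> \<equiv> signed_roots \<beta> \<gamma> \<delta>"
  shows "(\<alpha> 1 - \<alpha> 2)\<^sup>2 = 4 * \<beta>\<^sup>2" "(\<alpha> 1 - \<alpha> 3)\<^sup>2 = \<beta>\<^sup>2 + \<gamma>\<^sup>2 - 2 * (\<beta> * \<gamma>)" "(\<alpha> 1 - \<alpha> 4)\<^sup>2 = \<beta>\<^sup>2 + \<gamma>\<^sup>2 + 2 * (\<beta> * \<gamma>)"
    "(\<alpha> 1 - \<alpha> 5)\<^sup>2 = \<beta>\<^sup>2 + \<delta>\<^sup>2 - 2 * (\<beta> * \<delta>)" "(\<alpha> 1 - \<alpha> 6)\<^sup>2 = \<beta>\<^sup>2 + \<delta>\<^sup>2 + 2 * (\<beta> * \<delta>)"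
    "(\<alpha> 2 - \<alpha> 3)\<^sup>2 = \<beta>\<^sup>2 + \<gamma>\<^sup>2 + 2 * (\<beta> * \<gamma>)" "(\<alpha> 2 - \<alpha> 4)\<^sup>2 = \<beta>\<^sup>2 + \<gamma>\<^sup>2 - 2 * (\<beta> * \<gamma>)"
    "(\<alpha> 2 - \<alpha> 5)\<^sup>2 = \<beta>\<^sup>2 + \<delta>\<^sup>2 + 2 * (\<beta> * \<delta>)" "(\<alpha> 2 - \<alpha> 6)\<^sup>2 = \<beta>\<^sup>2 + \<delta>\<^sup>2 - 2 * (\<beta> * \<delta>)"
    "(\<alpha> 3 - \<alpha> 4)\<^sup>2 = 4 * \<gamma>\<^sup>2" "(\<alpha> 3 - \<alpha> 5)\<^sup>2 = \<gamma>\<^sup>2 + \<delta>\<^sup>2 - 2 * (\<gamma> * \<delta>)" "(\<alpha> 3 - \<alpha> 6)\<^sup>2 = \<gamma>\<^sup>2 + \<delta>\<^sup>2 + 2 * (\<gamma> * \<delta>)"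
    "(\<alpha> 4 - \<alpha> 5)\<^sup>2 = \<gamma>\<^sup>2 + \<delta>\<^sup>2 + 2 * (\<gamma> * \<delta>)" "(\<alpha> 4 - \<alpha> 6)\<^sup>2 = \<gamma>\<^sup>2 + \<delta>\<^sup>2 - 2 * (\<gamma> * \<delta>)" "(\<alpha> 5 - \<alpha> 6)\<^sup>2 = 4 * \<delta>\<^sup>2"
  unfolding \<alpha>_def signed_roots_simps by (simp_all add: power2_eq_square algebra_simps)

text \<open>\<open>\<xi>\<close>, \<open>\<eta>\<close>, \<open>\<zeta>\<close> stand for the
  products of two of the roots \<open>\<beta>\<close>, \<open>\<gamma>\<close>,
  \<open>\<delta>\<close>. The combinations of \<open>p, ..., u\<close> that occur involve them only
  through their squares and their triple product, so the four equations \<open>prods\<close>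
  eliminate them altogether.\<close>

context
  fixes a b c P R T \<xi> \<eta> \<zeta> p q r s t u :: "'a::field_char_0"
  assumes defs: "P = a + b" "R = a + c" "T = b + c"
    and prods: "\<xi>\<^sup>2 = a * b" "\<eta>\<^sup>2 = a * c" "\<zeta>\<^sup>2 = b * c" "\<xi> * \<eta> * \<zeta> = a * b * c"
    and pqrstu: "p = P - 2 * \<xi>" "q = P + 2 * \<xi>" "r = R - 2 * \<eta>" "s = R + 2 * \<eta>" "t = T - 2 * \<zeta>" "u = T + 2 * \<zeta>"
begin

lemma root_products: "p * q = (a - b)\<^sup>2" "r * s = (a - c)\<^sup>2" "t * u = (b - c)\<^sup>2"
proof -
  have e: "(v - 2 * w) * (v + 2 * w) = v\<^sup>2 - 4 * w\<^sup>2" for v w :: 'a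
    by (simp add: power2_eq_square algebra_simps)
  show "p * q = (a - b)\<^sup>2" "r * s = (a - c)\<^sup>2" "t * u = (b - c)\<^sup>2"
    unfolding pqrstu e prods defs by (simp_all add: power2_eq_square algebra_simps)
qed

lemma root_square_sums: "p\<^sup>2 + q\<^sup>2 = 2 * ((a + b)\<^sup>2 + 4 * (a * b))" "r\<^sup>2 + s\<^sup>2 = 2 * ((a + c)\<^sup>2 + 4 * (a * c))"
  "t\<^sup>2 + u\<^sup>2 = 2 * ((b + c)\<^sup>2 + 4 * (b * c))"
proof -
  have e: "(v - 2 * w)\<^sup>2 + (v + 2 * w)\<^sup>2 = 2 * (v\<^sup>2 + 4 * w\<^sup>2)" for v w :: 'a
    by (simp add: power2_eq_square algebra_simps)
  show "p\<^sup>2 + q\<^sup>2 = 2 * ((a + b)\<^sup>2 + 4 * (a * b))" "r\<^sup>2 + s\<^sup>2 = 2 * ((a + c)\<^sup>2 + 4 * (a * c))"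
    "t\<^sup>2 + u\<^sup>2 = 2 * ((b + c)\<^sup>2 + 4 * (b * c))"
    unfolding pqrstu e prods defs by simp_all
qed

text \<open>The summands run through the sign patterns of \<open>P \<plusminus> 2 \<xi>\<close>,
  \<open>R \<plusminus> 2 \<eta>\<close>, \<open>T \<plusminus> 2 \<zeta>\<close> whose signs
  multiply to 1, respectively to -1. Summing over such patterns cancels every mixed term except the
  triple product.\<close>

lemma root_triples:
  "q * s * u + q * r * t + p * s * t + p * r * u = 4 * ((a + b) * (a + c) * (b + c) + 8 * (a * b * c))"
  "q * r * u + p * r * t + q * s * t + p * s * u = 4 * ((a + b) * (a + c) * (b + c) - 8 * (a * b * c))"
proof -
  have "q * s * u + q * r * t + p * s * t + p * r * u = 4 * (P * R * T + 8 * (\<xi> * \<eta> * \<zeta>))"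
    "q * r * u + p * r * t + q * s * t + p * s * u = 4 * (P * R * T - 8 * (\<xi> * \<eta> * \<zeta>))"
    unfolding pqrstu by (simp_all add: algebra_simps)
  then show "q * s * u + q * r * t + p * s * t + p * r * u = 4 * ((a + b) * (a + c) * (b + c) + 8 * (a * b * c))"
    "q * r * u + p * r * t + q * s * t + p * s * u = 4 * ((a + b) * (a + c) * (b + c) - 8 * (a * b * c))"
    unfolding prods defs by simp_all
qed

lemma root_triple_squares:
  "(q * s * t)\<^sup>2 + (q * r * u)\<^sup>2 + (p * r * t)\<^sup>2 + (p * s * u)\<^sup>2 =
    4 * (((a + b)\<^sup>2 + 4 * (a * b)) * ((a + c)\<^sup>2 + 4 * (a * c)) * ((b + c)\<^sup>2 + 4 * (b * c))) -
    256 * ((a + b) * (a + c) * (b + c) * (a * b * c))"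
proof -
  have sq: "q\<^sup>2 = (P\<^sup>2 + 4 * \<xi>\<^sup>2) + 4 * (P * \<xi>)" "p\<^sup>2 = (P\<^sup>2 + 4 * \<xi>\<^sup>2) - 4 * (P * \<xi>)"
    "s\<^sup>2 = (R\<^sup>2 + 4 * \<eta>\<^sup>2) + 4 * (R * \<eta>)" "r\<^sup>2 = (R\<^sup>2 + 4 * \<eta>\<^sup>2) - 4 * (R * \<eta>)"
    "u\<^sup>2 = (T\<^sup>2 + 4 * \<zeta>\<^sup>2) + 4 * (T * \<zeta>)" "t\<^sup>2 = (T\<^sup>2 + 4 * \<zeta>\<^sup>2) - 4 * (T * \<zeta>)"
    unfolding pqrstu by (simp_all add: power2_eq_square algebra_simps)
  have e: "(f + f') * (g + g') * (h - h') + (f + f') * (g - g') * (h + h') + (f - f') * (g - g') * (h - h') +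
      (f - f') * (g + g') * (h + h') = 4 * (f * g * h) - 4 * (f' * g' * h')" for f f' g g' h h' :: 'a
    by (simp add: algebra_simps)
  have k: "4 * (P * \<xi>) * (4 * (R * \<eta>)) * (4 * (T * \<zeta>)) = 64 * (P * R * T * (\<xi> * \<eta> * \<zeta>))"
    by (simp add: algebra_simps)
  show ?thesis unfolding power_mult_distrib sq e k unfolding prods defs by simp
qed

lemma igusa_2_symmetric:
  "2 * (q * s * u + q * r * t + p * s * t + p * r * u) + (4 * a) * (t\<^sup>2 + u\<^sup>2) + (4 * b) * (r\<^sup>2 + s\<^sup>2) + (4 * c) * (p\<^sup>2 + q\<^sup>2)
     + (4 * a) * (4 * b) * (4 * c) =
   16 * ((a + b + c) * (a * b + a * c + b * c)) + 240 * (a * b * c)"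
  unfolding root_triples root_square_sums by Groebner_Basis.algebra

lemma igusa_4_symmetric:
  "(q * s * t)\<^sup>2 + (q * r * u)\<^sup>2 + (p * r * t)\<^sup>2 + (p * s * u)\<^sup>2 +
     2 * ((4 * a) * (4 * b) * (t * u) * (r * s) + (4 * a) * (4 * c) * (t * u) * (p * q) + (4 * b) * (4 * c) * (r * s) * (p * q)) =
   4 * ((a + b + c)\<^sup>2 * (a * b + a * c + b * c)\<^sup>2) + 48 * (a * b + a * c + b * c) ^ 3 + 48 * ((a + b + c) ^ 3 * (a * b * c))
     - 504 * ((a + b + c) * (a * b + a * c + b * c) * (a * b * c)) + 1620 * (a * b * c)\<^sup>2"
  unfolding root_triple_squares root_products by Groebner_Basis.algebra

lemma igusa_6_symmetric:
  "(4 * a) * (4 * b) * (4 * c) * ((q * s * t)\<^sup>2 + (q * r * u)\<^sup>2 + (p * r * t)\<^sup>2 + (p * s * u)\<^sup>2)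
     + 2 * ((4 * a) * (4 * b) * (4 * c)) * ((t * u) * (r * s) * (p\<^sup>2 + q\<^sup>2) + (t * u) * (p * q) * (r\<^sup>2 + s\<^sup>2) + (r * s) * (p * q) * (t\<^sup>2 + u\<^sup>2))
     + 2 * (q * s * u + q * r * t + p * s * t + p * r * u) *
       ((4 * a) * (4 * b) * (t * u) * (r * s) + (4 * a) * (4 * c) * (t * u) * (p * q) + (4 * b) * (4 * c) * (r * s) * (p * q))
     + (4 * a) * (t * u)\<^sup>2 * (p\<^sup>2 + q\<^sup>2) * (r\<^sup>2 + s\<^sup>2) + (4 * b) * (r * s)\<^sup>2 * (p\<^sup>2 + q\<^sup>2) * (t\<^sup>2 + u\<^sup>2)
     + (4 * c) * (p * q)\<^sup>2 * (r\<^sup>2 + s\<^sup>2) * (t\<^sup>2 + u\<^sup>2)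
     + 2 * ((t * u) * (r * s) * (p * q)) * (q * r * u + p * r * t + q * s * t + p * s * u) =
   24 * ((a + b + c) ^ 3 * (a * b + a * c + b * c) ^ 3) + 160 * ((a + b + c) * (a * b + a * c + b * c) ^ 4)
     + 160 * ((a + b + c) ^ 4 * (a * b + a * c + b * c) * (a * b * c))
     - 424 * ((a + b + c)\<^sup>2 * (a * b + a * c + b * c)\<^sup>2 * (a * b * c)) + 96 * ((a * b + a * c + b * c) ^ 3 * (a * b * c))
     + 96 * ((a + b + c) ^ 3 * (a * b * c)\<^sup>2)
     - 20664 * ((a + b + c) * (a * b + a * c + b * c) * (a * b * c)\<^sup>2) + 119880 * (a * b * c) ^ 3"
  unfolding root_triples root_triple_squares root_square_sums root_products by Groebner_Basis.algebra

end

lemma igusa_clebsch_signed_roots: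
  fixes a b c \<beta> \<gamma> \<delta> :: "'a::field_char_0"
  assumes "\<beta>\<^sup>2 = a" "\<gamma>\<^sup>2 = b" "\<delta>\<^sup>2 = c"
  shows "igusa_clebsch 1 (signed_roots \<beta> \<gamma> \<delta>) =
    (16 * ((a + b + c) * (a * b + a * c + b * c)) + 240 * (a * b * c),
     4 * ((a + b + c)\<^sup>2 * (a * b + a * c + b * c)\<^sup>2) + 48 * (a * b + a * c + b * c) ^ 3 + 48 * ((a + b + c) ^ 3 * (a * b * c))
       - 504 * ((a + b + c) * (a * b + a * c + b * c) * (a * b * c)) + 1620 * (a * b * c)\<^sup>2,
     24 * ((a + b + c) ^ 3 * (a * b + a * c + b * c) ^ 3) + 160 * ((a + b + c) * (a * b + a * c + b * c) ^ 4)
       + 160 * ((a + b + c) ^ 4 * (a * b + a * c + b * c) * (a * b * c))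
       - 424 * ((a + b + c)\<^sup>2 * (a * b + a * c + b * c)\<^sup>2 * (a * b * c)) + 96 * ((a * b + a * c + b * c) ^ 3 * (a * b * c))
       + 96 * ((a + b + c) ^ 3 * (a * b * c)\<^sup>2)
       - 20664 * ((a + b + c) * (a * b + a * c + b * c) * (a * b * c)\<^sup>2) + 119880 * (a * b * c) ^ 3,
     64 * (a * b * c) * (((a - b) * (a - c) * (b - c))\<^sup>2)\<^sup>2)"
proof -
  note sq = signed_roots_squares[of \<beta> \<gamma> \<delta>, unfolded assms]
  have pr: "(\<beta> * \<gamma>)\<^sup>2 = a * b" "(\<beta> * \<delta>)\<^sup>2 = a * c" "(\<gamma> * \<delta>)\<^sup>2 = b * c" "\<beta> * \<gamma> * (\<beta> * \<delta>) * (\<gamma> * \<delta>) = a * b * c"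
    by (simp_all add: assms[symmetric] power2_eq_square mult_ac)
  note hyps = refl refl refl pr refl refl refl refl refl refl
  show ?thesis
    unfolding igusa_clebsch_def prod.inject matching_sum[OF sq] triangles_sum[OF sq] prism_sum[OF sq]
      prod_differences_signed_roots assms power_one mult_1_left
    by (intro conjI igusa_2_symmetric[OF hyps] igusa_4_symmetric[OF hyps] igusa_6_symmetric[OF hyps] refl)
qed

lemma weighted_proj_eqI:
  "l \<noteq> 0 \<Longrightarrow> a2 = l ^ 2 * b2 \<Longrightarrow> a4 = l ^ 4 * b4 \<Longrightarrow> a6 = l ^ 6 * b6 \<Longrightarrow> a10 = l ^ 10 * b10 \<Longrightarrow> a10 \<noteq> 0 \<Longrightarrow>
    weighted_proj_eq (a2, a4, a6, a10) (b2, b4, b6, b10)"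
  by auto

text \<open>With \<open>C = - (a * b * c)\<close> and \<open>s * D = - (r * C)\<close>, the
  invariants become polynomials in \<open>r\<close>, \<open>C\<close>, \<open>D\<close>. The scaling
  can be read off from the last one: the two values of \<open>I10\<close> differ by the factor
  \<open>1048576 * D ^ 5 = (16 * D) ^ 5\<close>, which suggests \<open>l^2 = 16 * D\<close>, and the
  other three agree with it.\<close>

lemma igusa_clebsch_family:
  fixes a b c r m \<beta> \<gamma> \<delta> :: "'k::{alg_closed_field, field_char_0}"
  assumes sq: "\<beta>\<^sup>2 = a" "\<gamma>\<^sup>2 = b" "\<delta>\<^sup>2 = c"
    and sym: "a + b + c = 2 * m + 3" "a * b + a * c + b * c = - (36 * r - 4 * m - 3)"
      "a * b * c = - (8 * m * r + 36 * r - 2 * m - 1)"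
    and nz: "r \<noteq> 0" "27 * r + m\<^sup>2 \<noteq> 0" "8 * m * r + 36 * r - 2 * m - 1 \<noteq> 0"
  shows "a \<noteq> b" "a \<noteq> c" "b \<noteq> c"
    and "weighted_proj_eq (igusa_clebsch 1 (signed_roots \<beta> \<gamma> \<delta>)) (humbert4_point r (hilbert4_s r m))"
proof -
  define D where "D = 27 * r + m\<^sup>2"
  define C where "C = 8 * m * r + 36 * r - 2 * m - 1"
  have D: "D \<noteq> 0" and C: "C \<noteq> 0" using nz by (simp_all add: D_def C_def)
  have "((a - b) * (a - c) * (b - c))\<^sup>2 = (a + b + c)\<^sup>2 * (a * b + a * c + b * c)\<^sup>2 - 4 * (a * b + a * c + b * c) ^ 3
      - 4 * ((a + b + c) ^ 3 * (a * b * c)) + 18 * ((a + b + c) * (a * b + a * c + b * c) * (a * b * c)) - 27 * (a * b * c)\<^sup>2"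
    by Groebner_Basis.algebra
  also have "\<dots> = 256 * r * D\<^sup>2" unfolding sym D_def by Groebner_Basis.algebra
  finally have disc: "((a - b) * (a - c) * (b - c))\<^sup>2 = 256 * r * D\<^sup>2" .
  have "256 * r * D\<^sup>2 \<noteq> 0" using D nz(1) by simp
  then have "(a - b) * (a - c) * (b - c) \<noteq> 0" unfolding disc[symmetric] by simp
  then show "a \<noteq> b" "a \<noteq> c" "b \<noteq> c" by auto
  obtain l where l: "l\<^sup>2 = 16 * D" using nth_root_exists[of 2 "16 * D"] by auto
  have "l ^ 4 = (l\<^sup>2)\<^sup>2" "l ^ 6 = (l\<^sup>2) ^ 3" "l ^ 10 = (l\<^sup>2) ^ 5" by (simp_all flip: power_mult)
  then have l': "l ^ 4 = 256 * D\<^sup>2" "l ^ 6 = 4096 * D ^ 3" "l ^ 10 = 1048576 * D ^ 5"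
    by (simp_all add: l power_mult_distrib)
  have l0: "l \<noteq> 0" using l D by auto
  define s where "s = hilbert4_s r m"
  have s: "s = - (r * C) / D" by (simp add: s_def hilbert4_s_def C_def D_def)
  have sD: "s * D = - (r * C)" using D by (simp add: s)
  have I: "igusa_clebsch 1 (signed_roots \<beta> \<gamma> \<delta>) =
    (128 * (D - 3 * C), - 1024 * D\<^sup>2 * (3 * r - 1), - 16384 * D\<^sup>2 * (8 * C - 6 * r * C + (5 * r - 2) * D),
     - 64 * C * (256 * r * D\<^sup>2)\<^sup>2)"
    unfolding igusa_clebsch_signed_roots[OF sq] disc sym prod.inject
    by (intro conjI; (unfold C_def D_def)?; Groebner_Basis.algebra)
  have h2: "128 * (D - 3 * C) = 16 * D * (8 * (3 * s + r) / r)"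
  proof -
    have "16 * D * (8 * (3 * s + r) / r) = 128 * (3 * (s * D) + r * D) / r" by (simp add: algebra_simps)
    then show ?thesis unfolding sD using nz(1) by (simp add: field_simps)
  qed
  have h6: "- 16384 * D\<^sup>2 * (8 * C - 6 * r * C + (5 * r - 2) * D) =
      4096 * D ^ 3 * (- 4 * (6 * r * s - 8 * s + 5 * r\<^sup>2 - 2 * r) / r)"
  proof -
    have "4096 * D ^ 3 * (- 4 * (6 * r * s - 8 * s + 5 * r\<^sup>2 - 2 * r) / r) =
        - 16384 * D\<^sup>2 * ((6 * r - 8) * (s * D) + (5 * r\<^sup>2 - 2 * r) * D) / r"
      by (simp add: algebra_simps power2_eq_square power3_eq_cube)
    also have "(6 * r - 8) * (s * D) + (5 * r\<^sup>2 - 2 * r) * D = r * (8 * C - 6 * r * C + (5 * r - 2) * D)"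
      unfolding sD by (simp add: algebra_simps power2_eq_square)
    finally show ?thesis using nz(1) by simp
  qed
  have h10: "- 64 * C * (256 * r * D\<^sup>2)\<^sup>2 = 1048576 * D ^ 5 * (4 * r * s)"
  proof -
    have "1048576 * D ^ 5 * (4 * r * s) = 4194304 * r * D ^ 4 * (s * D)" by (simp add: eval_nat_numeral mult_ac)
    then show ?thesis unfolding sD by (simp add: eval_nat_numeral mult_ac)
  qed
  have h4: "- 1024 * D\<^sup>2 * (3 * r - 1) = 256 * D\<^sup>2 * (- 4 * (3 * r - 1))" by (simp add: algebra_simps)
  have "- 64 * C * (256 * r * D\<^sup>2)\<^sup>2 \<noteq> 0" using C D nz(1) by simp
  then show "weighted_proj_eq (igusa_clebsch 1 (signed_roots \<beta> \<gamma> \<delta>)) (humbert4_point r (hilbert4_s r m))"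
    unfolding I humbert4_point_def s_def[symmetric]
    by (rule weighted_proj_eqI[OF l0 h2[folded l] h4[folded l'] h6[folded l'] h10[folded l']])
qed

section \<open>The sextic of the family and its function field\<close>

lemma even_sextic_factorization:
  fixes a b c :: "'a::comm_ring_1"
  shows "[:- a, 0, 1:] * [:- b, 0, 1:] * [:- c, 0, 1:] =
    [:- (a * b * c), 0, a * b + a * c + b * c, 0, - (a + b + c), 0, 1:]"
  by (simp add: algebra_simps)

lemma cubic_roots_exist:
  fixes p q n :: "'k::alg_closed_field"
  obtains a b c where "a + b + c = - p" "a * b + a * c + b * c = q" "a * b * c = - n"
proof -
  obtain a where "poly [:n, q, p, 1:] a = 0"
    using alg_closed_imp_poly_has_root[of "[:n, q, p, 1:]"] by auto
  then have a: "n + a * (q + a * (p + a)) = 0" by simp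
  \<comment> \<open>This quadratic polynomial is the quotient of the cubic by
    \<open>X - a\<close>.\<close>
  obtain b where "poly [:a * a + p * a + q, a + p, 1:] b = 0"
    using alg_closed_imp_poly_has_root[of "[:a * a + p * a + q, a + p, 1:]"] by auto
  then have b: "a * a + p * a + q + b * (a + p + b) = 0" by simp
  define c where "c = - (a + p) - b"
  show thesis
  proof (rule that)
    show "a + b + c = - p" by (simp add: c_def)
    show "a * b + a * c + b * c = q" unfolding c_def using b by Groebner_Basis.algebra
    show "a * b * c = - n" unfolding c_def using a b by Groebner_Basis.algebra
  qed
qed

lemma genus2_sextic_even:
  fixes a b c \<beta> \<gamma> \<delta> :: "'k::field_char_0"
  assumes sq: "\<beta>\<^sup>2 = a" "\<gamma>\<^sup>2 = b" "\<delta>\<^sup>2 = c" and "a \<noteq> b" "a \<noteq> c" "b \<noteq> c" "a \<noteq> 0" "b \<noteq> 0" "c \<noteq> 0"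
  shows "genus2_sextic ([:- a, 0, 1:] * [:- b, 0, 1:] * [:- c, 0, 1:])"
proof -
  have ne: "\<beta> + \<beta> \<noteq> 0" "\<gamma> + \<gamma> \<noteq> 0" "\<delta> + \<delta> \<noteq> 0" using assms by auto
  have sum: "v + u \<noteq> 0" "- v + u \<noteq> 0" "v + - u \<noteq> 0" "- v + - u \<noteq> 0" if "u\<^sup>2 \<noteq> v\<^sup>2" for u v :: 'k
  proof -
    have "(v + u) * (- v + u) \<noteq> 0" using that by (simp add: power2_eq_square algebra_simps)
    then have "v + u \<noteq> 0" "- v + u \<noteq> 0" by auto
    moreover from this have "- (v + u) \<noteq> 0" "- (- v + u) \<noteq> 0" by (simp_all only: neg_equal_0_iff_equal not_False_eq_True)
    ultimately show "v + u \<noteq> 0" "- v + u \<noteq> 0" "v + - u \<noteq> 0" "- v + - u \<noteq> 0" by (simp_all add: add.commute)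
  qed
  have lin: "poly ([:s, 1:] * q) z \<noteq> 0 \<longleftrightarrow> s + z \<noteq> 0 \<and> poly q z \<noteq> 0" for s z :: 'k and q
    unfolding poly_mult by simp
  have ne': "\<beta>\<^sup>2 \<noteq> \<gamma>\<^sup>2" "\<beta>\<^sup>2 \<noteq> \<delta>\<^sup>2" "\<gamma>\<^sup>2 \<noteq> \<delta>\<^sup>2" using assms by simp_all
  define f where "f = [:- \<beta>, 1:] * ([:\<beta>, 1:] * ([:- \<gamma>, 1:] * ([:\<gamma>, 1:] * ([:- \<delta>, 1:] * ([:\<delta>, 1:] * 1)))))"
  have e: "[:- u, 1:] * ([:u, 1:] * q) = [:- u\<^sup>2, 0, 1:] * q" for u :: 'k and q
    unfolding mult.assoc[symmetric] by (rule arg_cong[where f = "\<lambda>p. p * q"]) (simp add: power2_eq_square)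
  have "f = [:- a, 0, 1:] * [:- b, 0, 1:] * [:- c, 0, 1:]"
    unfolding f_def e sq by (simp only: mult_1_right mult.assoc)
  moreover have "rsquarefree f"
    unfolding f_def
    by (intro rsquarefree_linear_mult rsquarefree_1)
      (simp_all only: lin div_by_1 minus_minus poly_1 one_neq_zero not_False_eq_True simp_thms
        ne sum[OF ne'(1)] sum[OF ne'(2)] sum[OF ne'(3)])
  moreover have "Polynomial.degree f = Suc (Suc (Suc (Suc (Suc (Suc 0))))) \<and> f \<noteq> 0"
    unfolding f_def by (intro degree_linear_mult) simp_all
  ultimately show ?thesis unfolding genus2_sextic_def by simp
qed

lemma coordinate_not_const: "(coordinate :: 'k::field ambient) \<notin> range const_emb"
  by (auto simp: coordinate_def const_emb_def)

lemma function_field_eq: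
  assumes "y\<^sup>2 = eval_at f coordinate"
  shows "function_field f = generate_field \<Omega> (range const_emb \<union> {coordinate, y})"
proof -
  have "{y'. y'\<^sup>2 = eval_at f coordinate} = {y, - y}"
    unfolding assms[symmetric] by (auto simp: power2_eq_iff)
  then have f: "function_field f = generate_field \<Omega> (range const_emb \<union> {coordinate, y, - y})"
    unfolding function_field_def by (simp only: Un_assoc Un_insert_left Un_empty_left)
  let ?K = "generate_field \<Omega> (range const_emb \<union> {coordinate, y})"
  let ?L = "generate_field \<Omega> (range const_emb \<union> {coordinate, y, - y})"
  have y: "y \<in> ?K" "coordinate \<in> ?K" by (auto intro: generate_field.incl)
  have "- y \<in> ?K" using generate_field.a_inv[OF y(1)] by simp
  then have "z \<in> ?K" if "z \<in> ?L" for z using y by (intro generate_field_least[OF const_subfield_generate _ that]) auto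
  moreover have "z \<in> ?L" if "z \<in> ?K" for z
    by (intro generate_field_least[OF const_subfield_generate _ that]) (auto intro: generate_field.incl)
  ultimately show ?thesis unfolding f by blast
qed

theorem theorem8:
  fixes F :: "'k::{alg_closed_field, field_char_0} \<Rightarrow> 'k \<Rightarrow> 'k poly"
    and U :: "('k \<times> 'k) set"
  assumes "F = (\<lambda>r m. [:4 * (2 * m + 9) * r - 2 * m - 1, 0, - (36 * r - 4 * m - 3), 0,
                         - (2 * m + 3), 0, 1:])"
    and "U = {(r, m). r \<noteq> 0 \<and> 27 * r + m ^ 2 \<noteq> 0 \<and> 8 * m * r + 36 * r - 2 * m - 1 \<noteq> 0}"
  shows "tautological_family U F \<and>
         (\<forall>(r, m)\<in>U. jacobian_22_reducible (function_field (F r m)))"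
proof -
  have main: "genus2_sextic (F r m) \<and> has_igusa_clebsch (F r m) (humbert4_point r (hilbert4_s r m)) \<and>
      jacobian_22_reducible (function_field (F r m))" if "(r, m) \<in> U" for r m
  proof -
    \<comment> \<open>The discriminant of the sextic is a nonzero constant times
      \<open>(8 * m * r + 36 * r - 2 * m - 1) * r^2 * (27 * r + m^2)^4\<close>, so these three
      conditions say exactly that the sextic is separable.\<close>
    have nz: "r \<noteq> 0" "27 * r + m\<^sup>2 \<noteq> 0" "8 * m * r + 36 * r - 2 * m - 1 \<noteq> 0" using that assms(2) by auto
    obtain a b c where abc: "a + b + c = - (- (2 * m + 3))" "a * b + a * c + b * c = - (36 * r - 4 * m - 3)"
      "a * b * c = - (8 * m * r + 36 * r - 2 * m - 1)"
      by (rule cubic_roots_exist)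
    note sym = abc(1)[unfolded minus_minus] abc(2,3)
    obtain \<beta> \<gamma> \<delta> where sq: "\<beta>\<^sup>2 = a" "\<gamma>\<^sup>2 = b" "\<delta>\<^sup>2 = c"
      using nth_root_exists[of 2 a] nth_root_exists[of 2 b] nth_root_exists[of 2 c] by auto
    have "a * b * c \<noteq> 0" unfolding sym using nz(3) by simp
    then have abc0: "a \<noteq> 0" "b \<noteq> 0" "c \<noteq> 0" by auto
    note fam = igusa_clebsch_family[OF sq sym nz]
    have Ff: "F r m = [:- a, 0, 1:] * [:- b, 0, 1:] * [:- c, 0, 1:]"
      unfolding even_sextic_factorization sym by (simp add: assms(1) algebra_simps)
    have g: "genus2_sextic (F r m)"
      unfolding Ff by (rule genus2_sextic_even[OF sq fam(1,2,3) abc0])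
    have lc: "lead_coeff (F r m) = 1" by (simp add: assms(1))
    have i: "has_igusa_clebsch (F r m) (humbert4_point r (hilbert4_s r m))"
      unfolding has_igusa_clebsch_def lc
      by (rule exI[of _ "signed_roots \<beta> \<gamma> \<delta>"]) (simp only: prod_signed_roots sq Ff smult_1_left fam(4) simp_thms)
    obtain y where y: "y\<^sup>2 = eval_at (F r m) coordinate"
      using nth_root_exists[of 2 "eval_at (F r m) coordinate"] by auto
    have ev: "eval_at [:- u, 0, 1:] coordinate = coordinate\<^sup>2 - const_emb u" for u :: 'k
      by (simp add: const_emb_minus power2_eq_square)
    interpret split_sextic a b c \<beta> \<gamma> \<delta> coordinate y
      by unfold_locales
        (fact sq fam(1,2,3) abc0 coordinate_not_const | simp only: y Ff eval_at_mult ev)+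
    have "jacobian_22_reducible (function_field (F r m))"
      using reducible unfolding function_field_eq[OF y] local.F_def .
    then show ?thesis using g i by blast
  qed
  have "zariski_open U" "zariski_dense U"
    unfolding assms(2) by (rule zariski_open_locus, rule zariski_dense_locus)
  then show ?thesis unfolding tautological_family_def using main by blast
qed

end
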